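(* Let $\alpha>0$, let $n\ge 2$ be an integer, let $X_1,\dots,X_n$ be i.i.d. random variables with gamma density $\Gamma(\alpha)^{-1}x^{\alpha-1}e^{-x}$, $x>0$, and let $U=\left(\sum_{i=1}^n X_i^2\right)^{1/2}\big/\sum_{i=1}^n X_i$ with cumulative distribution function $F_U$. Put $\gamma_{\alpha n+j}=E\left(C^{\alpha n+j}\right)$ with $C=1/(\sqrt n\,U)$. (a) If $n>\max\left(2,\,1+\frac{1}{2\alpha}\right)$, then $$F_U(u)=\sum_{k=0}^\infty(-1)^k(\alpha n+k)\binom{\alpha n+2k}{k}\left(\sum_{j=0}^k(-1)^j\frac{(\alpha n+j)_k}{j!\,(k-j)!}\,\frac{\gamma_{\alpha n+j}}{\alpha n+j}\right)G_k\left(\alpha n,\alpha n;\,n^{-1/2}u^{-1}\right),$$ and the series is uniformly and absolutely convergent (in $u$) on every compact interval $[a,b]\subset(1/\sqrt n,\,1)$. (b) If $n>\max\left(2,\,1+\frac{1}{2\alpha},\,\frac{3}{2\alpha}\right)$, then for $n^{-1/2}\le u\le 1$ $$F_U(u)=\left(n^{1/2}u\right)^{\alpha n-1}\sum_{k=0}^\infty(-1)^k(2k+1)\left(\sum_{j=0}^k(-1)^j\frac{(k-j+1)_{2j}}{j!\,j!}\,\frac{\gamma_{\alpha n+j}}{\alpha n+j}\right)P_k^\ast\left(n^{-1/2}u^{-1}\right),$$ and the series is uniformly and absolutely convergent.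
   Context: Pochhammer symbol: $(c)_k=\prod_{i=0}^{k-1}(c+i)$, $(c)_0=1$. For real $a$, $\binom{a}{k}=\frac{a(a-1)\cdots(a-k+1)}{k!}$. $G_k(p,q;x)$ denotes the (monic) Jacobi polynomial of Abramowitz–Stegun 22.3.3, $$G_k(p,q;x)=\frac{\Gamma(q+k)}{\Gamma(p+2k)}\sum_{m=0}^k(-1)^m\binom{k}{m}\frac{\Gamma(p+2k-m)}{\Gamma(q+k-m)}x^{k-m};$$ the polynomials $G_k(\alpha n,\alpha n;x)$ are orthogonal on $(0,1]$ with respect to the weight $x^{\alpha n-1}$. $P_k^\ast(x)=P_k(2x-1)$ is the shifted Legendre polynomial, where $P_k$ is the Legendre polynomial. The random variable $U$ takes values in $[n^{-1/2},1]$, so $C$ takes values in $[n^{-1/2},1]$. *)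

theory Defs
  imports "HOL-Probability.Probability"
begin

definition gamma_density :: "real \<Rightarrow> real \<Rightarrow> real" where
  "gamma_density \<alpha> x = (if x > 0 then x powr (\<alpha> - 1) * exp (- x) / Gamma \<alpha> else 0)"

(* Jacobi polynomial in the normalisation of Abramowitz-Stegun 22.3.3 (monic, orthogonal on (0,1)
   with respect to (1 - x) powr (p - q) * x powr (q - 1)). *)
definition jacobi_G :: "nat \<Rightarrow> real \<Rightarrow> real \<Rightarrow> real \<Rightarrow> real" where
  "jacobi_G k p q x =
     Gamma (q + real k) / Gamma (p + 2 * real k) *
     (\<Sum>m=0..k. (-1) ^ m * real (k choose m) *
        (Gamma (p + 2 * real k - real m) / Gamma (q + real k - real m)) * x ^ (k - m))"

(* Rodrigues' formula. *)
definition legendre_poly :: "nat \<Rightarrow> real poly" where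
  "legendre_poly k = smult (1 / (2 ^ k * fact k)) ((pderiv ^^ k) ([:-1, 0, 1:] ^ k))"

definition shifted_legendre :: "nat \<Rightarrow> real \<Rightarrow> real" where
  "shifted_legendre k x = poly (legendre_poly k) (2 * x - 1)"

(* In the next two definitions p stands for alpha n, and g j for the moment of order p + j. *)
definition jacobi_coeff :: "real \<Rightarrow> (nat \<Rightarrow> real) \<Rightarrow> nat \<Rightarrow> real" where
  "jacobi_coeff p g k =
     (-1) ^ k * (p + real k) * ((p + 2 * real k) gchoose k) *
     (\<Sum>j=0..k. (-1) ^ j * (pochhammer (p + real j) k / (fact j * fact (k - j))) *
        (g j / (p + real j)))"

definition legendre_coeff :: "real \<Rightarrow> (nat \<Rightarrow> real) \<Rightarrow> nat \<Rightarrow> real" where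
  "legendre_coeff p g k =
     (-1) ^ k * (2 * real k + 1) *
     (\<Sum>j=0..k. (-1) ^ j * (pochhammer (real k - real j + 1) (2 * j) / (fact j * fact j)) *
        (g j / (p + real j)))"

definition series_unif_abs_convergent_on :: "real set \<Rightarrow> (nat \<Rightarrow> real \<Rightarrow> real) \<Rightarrow> bool" where
  "series_unif_abs_convergent_on S f \<longleftrightarrow>
     uniformly_convergent_on S (\<lambda>N u. \<Sum>k<N. f k u) \<and>
     (\<forall>u\<in>S. summable (\<lambda>k. \<bar>f k u\<bar>))"

end

theory Submission
  imports Defs
begin

text \<open>
  Write \<open>p = \<alpha>n\<close>, let \<open>C = 1 / (\<surd>n U)\<close>, which lies in \<open>[1/\<surd>n, 1]\<close>, and let \<open>H x = P(C \<ge> x)\<close>. Since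
  \<open>U \<le> u\<close> means \<open>C \<ge> 1 / (\<surd>n u)\<close>, the distribution function is \<open>F u = H (1 / (\<surd>n u))\<close>, and Fubini gives
  \<open>\<gamma>\<^sub>p\<^sub>+\<^sub>j / (p + j) = \<integral>\<^sub>0\<^sup>1 x powr (p + j - 1) * H x dx\<close>. The inner sum of the first series is therefore the scalar
  product of \<open>H\<close> with a multiple \<open>R\<^sub>k\<close> of the Jacobi polynomial \<open>G\<^sub>k\<close> for the weight \<open>x powr (p - 1)\<close>, and the
  first series is the orthogonal expansion of \<open>H\<close>. In the same way the second series is the Legendre expansion of
  \<open>x powr (p - 1) * H x\<close>. A uniformly convergent orthogonal expansion of a continuous function converges to this
  function (\<open>jacobi_expansion_converges_to_function\<close>, from the Weierstrass approximation theorem), so the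
  matter is the size of the coefficients, that is, the regularity of the law of \<open>C\<close>.

  To understand the law of \<open>C\<close>, split the sample space by the indices \<open>i\<close> and \<open>j\<close> of the largest and the second largest
  observation, and put \<open>x\<^sub>i = a\<close>, \<open>x\<^sub>j = a t\<close>, \<open>x\<^sub>k = a t w\<^sub>k\<close> for the others. The ratio \<open>\<surd>n C\<close> does not depend on \<open>a\<close>, which
  is integrated out (\<open>nn_integral_sector\<close>); what remains is the density
  \<open>\<Prod> w\<^sub>k powr (\<alpha> - 1) * t powr (\<beta> - 1) * (1 + t L) powr (-p)\<close>, up to a constant, with \<open>\<beta> = (n - 1)\<alpha>\<close>,
  \<open>L = 1 + \<Sum> w\<^sub>k\<close>, \<open>N = 1 + \<Sum> w\<^sub>k\<^sup>2\<close>, and \<open>\<surd>n C = (1 + t L) / \<surd>(1 + t\<^sup>2 N)\<close>. For fixed \<open>w\<close> the ratio increases with \<open>t\<close> at a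
  speed comparable to \<open>L - t N = \<Sum> w\<^sub>k (1 - w\<^sub>k) + (1 - t) N\<close>. With \<open>n \<ge> 3\<close> there is at least one \<open>w\<^sub>k\<close>, and this keeps the
  reciprocal of the speed integrable; \<open>\<beta> > 1/2\<close> makes \<open>t powr (2\<beta> - 2)\<close> integrable at \<open>0\<close>. A Young inequality then
  yields \<open>E \<phi>(C) \<le> const * (\<integral>\<phi>\<^sup>2) powr (1/2)\<close> for \<open>\<phi> \<ge> 0\<close> (\<open>norm_ratio_law_L2_bound\<close>): the law of \<open>C\<close> has a square
  integrable density, and \<open>H\<close> is continuous.

  For the Jacobi series, with the eigenvalue \<open>\<lambda>\<^sub>k = k (k + p)\<close> of the Jacobi equation, the scalar product of \<open>H\<close> with \<open>R\<^sub>k\<close> is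
  \<open>- m\<^sub>k / \<lambda>\<^sub>k\<close>, where \<open>m\<^sub>k = E[C\<^sup>p (1 - C) R\<^sub>k'(C)]\<close>. The derivatives \<open>R\<^sub>k'\<close> are orthogonal for the weight \<open>x\<^sup>p (1 - x)\<close>, so
  Bessel's inequality and square integrability give \<open>\<Sum> (p + 2k) / \<lambda>\<^sub>k * m\<^sub>k\<^sup>2 < \<infinity>\<close> (\<open>jacobi_moment_bessel\<close>). On compact
  subintervals of \<open>(0,1)\<close> Sonin's function shows \<open>(p + 2k) R\<^sub>k\<^sup>2 \<le> const\<close> (\<open>jacobi_poly_locally_bounded\<close>). Hence the \<open>k\<close>-th
  term is at most \<open>(p + 2k) / \<lambda>\<^sub>k * m\<^sub>k\<^sup>2 + const / \<lambda>\<^sub>k\<close>, which is summable (\<open>jacobi_series_majorant\<close>).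

  For the Legendre series, up to and including the endpoint \<open>1\<close>, only \<open>\<bar>R\<^sub>k\<bar> \<le> 1\<close> is available
  (\<open>jacobi_poly_one_bounded\<close>), so the coefficients \<open>c\<^sub>k\<close> of the \<open>R\<^sub>k\<close> have to be summable themselves. Square
  integrability only bounds the sum of \<open>\<bar>c\<^sub>k\<bar>\<close> over each dyadic block \<open>K \<le> k < 2K\<close> by a constant. With the signs
  \<open>s\<^sub>k = sgn c\<^sub>k\<close> the block sum is \<open>E[C powr (p - 1) * G(C)] - (p - 1) E[\<integral>\<^sub>0\<^sup>C x powr (p - 2) * G x dx]\<close>, where
  \<open>G' = \<Sum> s\<^sub>k (2k + 1) R\<^sub>k\<close>; this \<open>G\<close> has \<open>\<integral>G\<^sup>2 \<le> 2\<close> and a primitive of size \<open>O(K powr (-1/2))\<close> (\<open>block_bounds\<close>,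
  \<open>block_primitive_bound\<close>). In a sector, integration by parts in \<open>t\<close> on \<open>(\<tau>, 1 - \<tau>)\<close> exploits the small primitive at the
  price of a power of \<open>1/\<tau>\<close>, and the two ends contribute a positive power of \<open>\<tau>\<close> by the Young inequality
  (\<open>norm_ratio_law_oscillation\<close>). The integral in the second expectation is split at \<open>\<tau>\<close> in the same way; square
  integrability of \<open>x powr (p - 2)\<close> near \<open>0\<close> is the condition \<open>p > 3/2\<close>. Choosing \<open>\<tau>\<close> as a small negative power
  of \<open>K\<close> gives \<open>O(K powr (-\<eta>))\<close> for the block (\<open>optimize_block_bound\<close>), and the dyadic blocks sum up
  (\<open>summable_legendre_coefficients\<close>).
\<close>

section \<open>Jacobi polynomials on the unit interval\<close>

text \<open>The coefficients are those of the inner sum of the series. In this normalisation the value at \<open>1\<close> is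
  \<open>\<plusminus>1\<close> and the squared norm for the weight \<open>x powr (p - 1)\<close> is \<open>1 / (p + 2k)\<close>; the case \<open>p = 1\<close> gives the
  Legendre polynomials of \<open>1 - 2x\<close>.\<close>

definition jacobi_poly :: "real \<Rightarrow> nat \<Rightarrow> real poly" where
  "jacobi_poly p k =
     (\<Sum>j\<le>k. monom ((-1) ^ j * pochhammer (p + real j) k / (fact j * fact (k - j))) j)"

lemma coeff_jacobi_poly:
  "coeff (jacobi_poly p k) j =
     (if j \<le> k then (-1) ^ j * pochhammer (p + real j) k / (fact j * fact (k - j)) else 0)"
  unfolding jacobi_poly_def by (simp add: coeff_sum coeff_monom)

lemma degree_jacobi_poly_le: "degree (jacobi_poly p k) \<le> k"
  by (rule degree_le) (simp add: coeff_jacobi_poly)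

lemma pochhammer_shift:
  fixes a :: real
  shows "pochhammer (a + 1) k * a = pochhammer a k * (a + real k)"
  by (metis pochhammer_rec pochhammer_rec' mult.commute)

text \<open>The two-term recursion of a hypergeometric polynomial. Both the differential equation and the formula for
  the primitive below are this recursion read off coefficient by coefficient.\<close>

lemma coeff_jacobi_poly_rec:
  assumes "p > 0"
  shows "real (Suc j) * (p + real j) * coeff (jacobi_poly p k) (Suc j) =
         - (real k - real j) * (real k + real j + p) * coeff (jacobi_poly p k) j"
proof (cases "Suc j \<le> k")
  case True
  then obtain d where d: "k = Suc (j + d)" by (metis le_Suc_ex add_Suc)
  have *: "pochhammer (p + real (Suc j)) k * (p + real j) = pochhammer (p + real j) k * (p + real j + real k)"
    using pochhammer_shift[of "p + real j" k] by (simp add: add_ac)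
  have f1: "fact (Suc j) = real (Suc j) * (fact j :: real)" by simp
  have f2: "fact (k - j) = (real k - real j) * (fact (k - Suc j) :: real)"
    using d by (simp add: algebra_simps)
  have nz: "real k - real j \<noteq> 0" using d by simp
  have "real (Suc j) * (p + real j) * coeff (jacobi_poly p k) (Suc j) =
      (-1) ^ Suc j * (pochhammer (p + real (Suc j)) k * (p + real j)) / (fact j * fact (k - Suc j))"
    using True unfolding coeff_jacobi_poly f1 by (simp add: field_simps del: of_nat_Suc)
  also have "\<dots> = - (real k - real j) * (real k + real j + p) * coeff (jacobi_poly p k) j"
    using True nz unfolding coeff_jacobi_poly f2 * by (simp add: field_simps)
  finally show ?thesis .
next
  case False
  then show ?thesis by (cases "j = k") (auto simp: coeff_jacobi_poly)
qed

definition jacobi_eigenvalue :: "real \<Rightarrow> nat \<Rightarrow> real" where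
  "jacobi_eigenvalue p k = real k * (real k + p)"

lemma jacobi_eigenvalue_pos: "p > 0 \<Longrightarrow> k > 0 \<Longrightarrow> jacobi_eigenvalue p k > 0"
  by (simp add: jacobi_eigenvalue_def)

lemma jacobi_poly_ode:
  assumes "p > 0"
  shows "[:0, 1, -1:] * pderiv (pderiv (jacobi_poly p k)) + [:p, -(p + 1):] * pderiv (jacobi_poly p k)
         = - smult (jacobi_eigenvalue p k) (jacobi_poly p k)"
proof (rule poly_eqI)
  fix j
  let ?c = "coeff (jacobi_poly p k)"
  have "coeff ([:0, 1, -1:] * pderiv (pderiv (jacobi_poly p k)) +
      [:p, -(p + 1):] * pderiv (jacobi_poly p k)) j
     = real (Suc j) * (p + real j) * ?c (Suc j) - real j * (real j + p) * ?c j"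
    by (cases j; cases "j - 1") (auto simp: coeff_pderiv algebra_simps)
  also have "\<dots> = - (real k * (real k + p)) * ?c j"
    unfolding coeff_jacobi_poly_rec[OF assms] by (simp add: algebra_simps)
  finally show "coeff ([:0, 1, -1:] * pderiv (pderiv (jacobi_poly p k)) +
      [:p, -(p + 1):] * pderiv (jacobi_poly p k)) j
      = coeff (- smult (jacobi_eigenvalue p k) (jacobi_poly p k)) j"
    by (simp add: jacobi_eigenvalue_def)
qed

lemma poly_jacobi_ode:
  assumes "p > 0"
  shows "x * (1 - x) * poly (pderiv (pderiv (jacobi_poly p k))) x
         + (p - (p + 1) * x) * poly (pderiv (jacobi_poly p k)) x
         = - jacobi_eigenvalue p k * poly (jacobi_poly p k) x"
  using arg_cong[OF jacobi_poly_ode[OF assms, of k], of "\<lambda>P. poly P x"]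
  by (simp add: algebra_simps)

lemma sum_poly_jacobi: "poly (jacobi_poly p k) x = (\<Sum>j\<le>k. coeff (jacobi_poly p k) j * x ^ j)"
  unfolding jacobi_poly_def by (simp add: poly_sum poly_monom coeff_sum coeff_monom)

text \<open>The sum is \<open>x powr (- p)\<close> times the integral of \<open>y powr (p - 1) * R\<^sub>k y\<close> over \<open>[0, x]\<close>, so this is the first integral
  of the Sturm-Liouville form \<open>(x powr p * (1 - x) * R\<^sub>k')' = - \<lambda>\<^sub>k * x powr (p - 1) * R\<^sub>k\<close>. It will turn scalar products of \<open>R\<^sub>k\<close>
  with the tail function into expectations of \<open>R\<^sub>k'\<close>.\<close>

lemma jacobi_poly_primitive:
  assumes "p > 0"
  shows "jacobi_eigenvalue p k * (\<Sum>j\<le>k. coeff (jacobi_poly p k) j * x ^ j / (p + real j))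
         = - (1 - x) * poly (pderiv (jacobi_poly p k)) x"
proof -
  let ?c = "coeff (jacobi_poly p k)"
  define A where "A = (\<Sum>j\<le>k. monom (?c j / (p + real j)) j)"
  have cA: "coeff A j = ?c j / (p + real j)" for j
    unfolding A_def by (auto simp: coeff_sum coeff_monom coeff_jacobi_poly)
  have "smult (jacobi_eigenvalue p k) A = - [:1, -1:] * pderiv (jacobi_poly p k)"
  proof (rule poly_eqI)
    fix j
    have pos: "p + real j > 0" using assms by simp
    have "coeff (- [:1, -1:] * pderiv (jacobi_poly p k)) j = - real (Suc j) * ?c (Suc j) + real j * ?c j"
      by (cases j) (auto simp: coeff_pderiv algebra_simps)
    also have "real (Suc j) * ?c (Suc j) = - (real k - real j) * (real k + real j + p) * ?c j / (p + real j)"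
      using coeff_jacobi_poly_rec[OF assms, of j k] pos
      by (simp add: field_simps del: of_nat_Suc)
    hence "- real (Suc j) * ?c (Suc j) + real j * ?c j = jacobi_eigenvalue p k * (?c j / (p + real j))"
      using pos by (simp add: field_simps jacobi_eigenvalue_def del: of_nat_Suc)
    finally show "coeff (smult (jacobi_eigenvalue p k) A) j = coeff (- [:1, -1:] * pderiv (jacobi_poly p k)) j"
      by (simp add: cA)
  qed
  from arg_cong[OF this, of "\<lambda>P. poly P x"] show ?thesis
    by (simp add: A_def poly_sum poly_monom algebra_simps)
qed

text \<open>The alternating sum is, up to sign, the \<open>k\<close>-th difference of \<open>a \<mapsto> a gchoose m\<close>, and each difference lowers the
  order by one by Pascal's rule.\<close>

lemma alternating_binomial_sum:
  fixes a :: real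
  assumes "k \<le> m"
  shows "(\<Sum>j\<le>k. (-1) ^ j * real (k choose j) * ((a + real j) gchoose m)) = (-1) ^ k * (a gchoose (m - k))"
  using assms
proof (induction k arbitrary: a m)
  case 0
  then show ?case by simp
next
  case (Suc k)
  let ?g = "\<lambda>a. \<Sum>j\<le>k. (-1) ^ j * real (k choose j) * ((a + real j) gchoose m)"
  have "(\<Sum>j\<le>Suc k. (-1) ^ j * real (Suc k choose j) * ((a + real j) gchoose m))
      = (a gchoose m) + (\<Sum>j\<le>k. (-1) ^ Suc j * real (Suc k choose Suc j) * ((a + real (Suc j)) gchoose m))"
    by (subst sum.atMost_Suc_shift) simp
  also have "(\<Sum>j\<le>k. (-1) ^ Suc j * real (Suc k choose Suc j) * ((a + real (Suc j)) gchoose m))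
      = - ?g (a + 1) + (\<Sum>j\<le>k. (-1) ^ Suc j * real (k choose Suc j) * ((a + real (Suc j)) gchoose m))"
    by (simp add: sum.distrib[symmetric] sum_negf[symmetric] algebra_simps)
  also have "(a gchoose m) + (- ?g (a + 1) + (\<Sum>j\<le>k. (-1) ^ Suc j * real (k choose Suc j) * ((a + real (Suc j)) gchoose m)))
     = - ?g (a + 1) + (\<Sum>j\<le>Suc k. (-1) ^ j * real (k choose j) * ((a + real j) gchoose m))"
    by (simp add: sum.atMost_Suc_shift del: sum.atMost_Suc)
  also have "(\<Sum>j\<le>Suc k. (-1) ^ j * real (k choose j) * ((a + real j) gchoose m)) = ?g a"
    by simp
  also have "?g (a + 1) = (-1) ^ k * ((a + 1) gchoose (m - k))"
    using Suc by simp
  also have "?g a = (-1) ^ k * (a gchoose (m - k))"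
    using Suc by simp
  finally have *: "(\<Sum>j\<le>Suc k. (-1) ^ j * real (Suc k choose j) * ((a + real j) gchoose m))
      = - ((-1) ^ k * ((a + 1) gchoose (m - k))) + (-1) ^ k * (a gchoose (m - k))" .
  have "m - k = Suc (m - Suc k)" using Suc.prems by simp
  hence "(a + 1) gchoose (m - k) = (a gchoose (m - Suc k)) + (a gchoose (m - k))"
    by (simp add: gbinomial_Suc_Suc)
  thus ?case unfolding * by (simp add: algebra_simps)
qed

text \<open>At \<open>1\<close> the coefficients add up to the \<open>k\<close>-th difference of a polynomial of degree \<open>k\<close> in \<open>j\<close>.\<close>

lemma poly_jacobi_poly_1: "poly (jacobi_poly p k) 1 = (-1) ^ k"
proof -
  have g: "((p + real k - 1) + real j) gchoose k = pochhammer (p + real j) k / fact k" for j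
    by (subst gbinomial_pochhammer') (simp add: algebra_simps)
  have "poly (jacobi_poly p k) 1 = (\<Sum>j\<le>k. coeff (jacobi_poly p k) j)"
    by (simp add: sum_poly_jacobi)
  also have "\<dots> = (\<Sum>j\<le>k. (-1) ^ j * real (k choose j) * (((p + real k - 1) + real j) gchoose k))"
    by (intro sum.cong refl) (simp add: coeff_jacobi_poly g binomial_fact)
  also have "\<dots> = (-1) ^ k"
    by (subst alternating_binomial_sum) auto
  finally show ?thesis .
qed

section \<open>Orthogonality\<close>

text \<open>The value of \<open>\<integral>\<^sub>0\<^sup>1 x powr (p - 1) * P x dx\<close>, as an algebraic expression: orthogonality and norms can then be
  derived by polynomial identities alone.\<close>

definition jint :: "real \<Rightarrow> real poly \<Rightarrow> real" where
  "jint p P = (\<Sum>i\<le>degree P. coeff P i / (p + real i))"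

lemma jint_altdef: "degree P \<le> n \<Longrightarrow> jint p P = (\<Sum>i\<le>n. coeff P i / (p + real i))"
  unfolding jint_def by (rule sum.mono_neutral_left) (auto simp: coeff_eq_0)

lemma jint_add: "jint p (P + Q) = jint p P + jint p Q"
proof -
  let ?n = "max (degree P) (degree Q)"
  show ?thesis
    using jint_altdef[of P ?n p] jint_altdef[of Q ?n p] jint_altdef[of "P + Q" ?n p] degree_add_le_max[of P Q]
    by (simp add: sum.distrib add_divide_distrib)
qed

lemma jint_smult: "jint p (smult c P) = c * jint p P"
  using jint_altdef[of "smult c P" "degree P" p] by (simp add: jint_def sum_distrib_left)

lemma jint_0 [simp]: "jint p 0 = 0"
  by (simp add: jint_def)

lemma jint_minus: "jint p (- P) = - jint p P"
  using jint_smult[of p "-1" P] by simp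

lemma jint_sum: "jint p (sum f A) = (\<Sum>a\<in>A. jint p (f a))"
  by (induction A rule: infinite_finite_induct) (auto simp: jint_add)

text \<open>The fundamental theorem of calculus for \<open>(x\<^sup>p P)' = x powr (p - 1) * (p P + x P')\<close>.\<close>

lemma jint_by_parts:
  assumes "p > 0"
  shows "p * jint p P + jint p ([:0, 1:] * pderiv P) = poly P 1"
proof -
  have "p * jint p P + jint p ([:0, 1:] * pderiv P) = jint p (smult p P + [:0, 1:] * pderiv P)"
    by (simp add: jint_add jint_smult)
  also have "\<dots> = (\<Sum>i\<le>degree P. coeff (smult p P + [:0, 1:] * pderiv P) i / (p + real i))"
    by (rule jint_altdef, rule degree_le) (auto simp: coeff_eq_0 coeff_pderiv coeff_pCons split: nat.splits)
  also have "\<dots> = (\<Sum>i\<le>degree P. coeff P i)"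
  proof (intro sum.cong refl)
    fix i
    have "coeff (smult p P + [:0, 1:] * pderiv P) i = (p + real i) * coeff P i"
      by (cases i) (auto simp: coeff_pderiv algebra_simps)
    moreover have "p + real i \<noteq> 0"
      using assms by (metis add_pos_nonneg less_irrefl of_nat_0_le_iff)
    ultimately show "coeff (smult p P + [:0, 1:] * pderiv P) i / (p + real i) = coeff P i"
      by simp
  qed
  also have "\<dots> = poly P 1" by (simp add: poly_altdef)
  finally show ?thesis .
qed

text \<open>Integration by parts of \<open>(x\<^sup>p (1 - x) R\<^sub>k')' v\<close>; the boundary term vanishes because of the factor \<open>1 - x\<close>.\<close>

lemma jint_sturm_liouville:
  assumes "p > 0"
  shows "jacobi_eigenvalue p k * jint p (jacobi_poly p k * v) =
         jint p ([:0, 1, -1:] * pderiv (jacobi_poly p k) * pderiv v)"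
proof -
  let ?u = "jacobi_poly p k"
  have "0 = p * jint p ([:1, -1:] * pderiv ?u * v) + jint p ([:0, 1:] * pderiv ([:1, -1:] * pderiv ?u * v))"
    using jint_by_parts[OF assms, of "[:1, -1:] * pderiv ?u * v"] by simp
  also have "\<dots> = jint p (smult p ([:1, -1:] * pderiv ?u * v) + [:0, 1:] * pderiv ([:1, -1:] * pderiv ?u * v))"
    by (simp only: jint_add jint_smult)
  also have "smult p ([:1, -1:] * pderiv ?u * v) + [:0, 1:] * pderiv ([:1, -1:] * pderiv ?u * v)
     = ([:0, 1, -1:] * pderiv (pderiv ?u) + [:p, -(p + 1):] * pderiv ?u) * v + [:0, 1, -1:] * pderiv ?u * pderiv v"
    unfolding pderiv_mult pderiv_pCons
    by (rule poly_eq_poly_eq_iff[THEN iffD1], rule ext) (simp add: algebra_simps)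
  also have "\<dots> = - smult (jacobi_eigenvalue p k) (?u * v) + [:0, 1, -1:] * pderiv ?u * pderiv v"
    unfolding jacobi_poly_ode[OF assms] by simp
  finally show ?thesis unfolding jint_add jint_minus jint_smult by linarith
qed

text \<open>The right-hand side of the previous identity is symmetric when \<open>v\<close> is another Jacobi polynomial, and the
  eigenvalues are distinct.\<close>

lemma jacobi_poly_orthogonal:
  assumes "p > 0" "k \<noteq> l"
  shows "jint p (jacobi_poly p k * jacobi_poly p l) = 0"
proof -
  have "jacobi_eigenvalue p k * jint p (jacobi_poly p k * jacobi_poly p l) =
        jacobi_eigenvalue p l * jint p (jacobi_poly p k * jacobi_poly p l)"
    using jint_sturm_liouville[OF assms(1), of k "jacobi_poly p l"]
          jint_sturm_liouville[OF assms(1), of l "jacobi_poly p k"]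
    by (simp only: mult_ac)
  moreover have "jacobi_eigenvalue p k - jacobi_eigenvalue p l = (real k - real l) * (real k + real l + p)"
    by (simp add: jacobi_eigenvalue_def algebra_simps)
  hence "jacobi_eigenvalue p k \<noteq> jacobi_eigenvalue p l"
    using assms by (smt (verit) mult_eq_0_iff of_nat_0_le_iff of_nat_eq_iff)
  ultimately show ?thesis by simp
qed

lemma coeff_jacobi_poly_degree_nonzero:
  assumes "p > 0" shows "coeff (jacobi_poly p k) k \<noteq> 0"
  using assms by (simp add: coeff_jacobi_poly pochhammer_pos less_imp_neq[THEN not_sym] add_pos_nonneg)

lemma poly_in_span_jacobi:
  assumes "p > 0" "degree P < n \<or> P = 0"
  shows "\<exists>c. P = (\<Sum>k<n. smult (c k) (jacobi_poly p k))"
  using assms(2)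
proof (induction n arbitrary: P)
  case 0
  then show ?case by simp
next
  case (Suc n)
  let ?R = "jacobi_poly p n"
  define d where "d = coeff P n / coeff ?R n"
  have "coeff (P - smult d ?R) i = 0" if "i \<ge> n" for i
  proof (cases "i = n")
    case True
    then show ?thesis
      using coeff_jacobi_poly_degree_nonzero[OF assms(1), of n] by (simp add: d_def)
  next
    case False
    with that Suc.prems have "coeff P i = 0" by (auto intro: coeff_eq_0)
    with False that show ?thesis by (simp add: coeff_jacobi_poly)
  qed
  hence "degree (P - smult d ?R) < n \<or> P - smult d ?R = 0"
    by (metis coeff_eq_0 degree_0 leading_coeff_0_iff not_le)
  from Suc.IH[OF this] obtain c where c: "P - smult d ?R = (\<Sum>k<n. smult (c k) (jacobi_poly p k))"
    by blast
  have "P = (\<Sum>k<Suc n. smult ((c(n := d)) k) (jacobi_poly p k))"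
    using c by (simp add: algebra_simps)
  then show ?case by blast
qed

lemma jint_jacobi_poly_lower:
  assumes "p > 0" "degree P < k \<or> P = 0"
  shows "jint p (jacobi_poly p k * P) = 0"
proof -
  obtain c where c: "P = (\<Sum>l<k. smult (c l) (jacobi_poly p l))"
    using poly_in_span_jacobi[OF assms] by blast
  show ?thesis
    unfolding c by (simp add: sum_distrib_left jint_sum jint_smult jacobi_poly_orthogonal[OF assms(1)])
qed

text \<open>Integrate \<open>(x\<^sup>p R\<^sub>k\<^sup>2)'\<close>. Since \<open>x R\<^sub>k' - k R\<^sub>k\<close> has degree below \<open>k\<close>, it is orthogonal to \<open>R\<^sub>k\<close>, so the integral is
  \<open>(p + 2k)\<close> times the squared norm, while the boundary value is \<open>R\<^sub>k(1)\<^sup>2 = 1\<close>.\<close>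

lemma jint_jacobi_poly_square:
  assumes "p > 0"
  shows "jint p (jacobi_poly p k * jacobi_poly p k) = 1 / (p + 2 * real k)"
proof -
  let ?R = "jacobi_poly p k"
  let ?Q = "[:0, 1:] * pderiv ?R - smult (real k) ?R"
  have cQ: "coeff ?Q i = (real i - real k) * coeff ?R i" for i
    by (cases i) (auto simp: coeff_pderiv algebra_simps)
  have "coeff ?Q i = 0" if "i \<ge> k" for i
    unfolding cQ using that by (cases "i = k") (auto simp: coeff_jacobi_poly)
  hence deg: "degree ?Q < k \<or> ?Q = 0"
    by (metis coeff_eq_0 degree_0 leading_coeff_0_iff not_le)
  have "1 = poly (?R * ?R) 1"
    by (simp add: poly_jacobi_poly_1 power_mult_distrib[symmetric])
  also have "\<dots> = p * jint p (?R * ?R) + jint p ([:0, 1:] * pderiv (?R * ?R))"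
    by (rule jint_by_parts[OF assms, symmetric])
  also have "[:0, 1:] * pderiv (?R * ?R) = smult (2 * real k) (?R * ?R) + smult 2 (?R * ?Q)"
    by (rule poly_eq_poly_eq_iff[THEN iffD1], rule ext) (simp add: pderiv_mult algebra_simps)
  also have "jint p \<dots> = 2 * real k * jint p (?R * ?R)"
    unfolding jint_add jint_smult jint_jacobi_poly_lower[OF assms deg] by simp
  finally have "(p + 2 * real k) * jint p (?R * ?R) = 1" by (simp add: algebra_simps)
  thus ?thesis using assms by (simp add: field_simps)
qed

lemma jint_jacobi_poly_mult:
  assumes "p > 0"
  shows "jint p (jacobi_poly p k * jacobi_poly p l) = (if k = l then 1 / (p + 2 * real k) else 0)"
  using jacobi_poly_orthogonal[OF assms] jint_jacobi_poly_square[OF assms] by auto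

lemma jint_jacobi_pderiv_mult:
  assumes "p > 0"
  shows "jint p ([:0, 1, -1:] * pderiv (jacobi_poly p k) * pderiv (jacobi_poly p l)) =
         (if k = l then jacobi_eigenvalue p k / (p + 2 * real k) else 0)"
  unfolding jint_sturm_liouville[OF assms, symmetric] jint_jacobi_poly_mult[OF assms] by simp

lemma smult_sum_right: "smult c (sum f A) = (\<Sum>a\<in>A. smult c (f a))"
  by (induction A rule: infinite_finite_induct) (auto simp: smult_add_right)

text \<open>Pythagoras for a system \<open>f\<close> that is orthogonal for the weight \<open>X\<close>.\<close>

lemma jint_bilinear_diagonal:
  assumes fin: "finite A" and B: "\<And>k l. k \<in> A \<Longrightarrow> l \<in> A \<Longrightarrow> jint p (X * f k * f l) = (if k = l then d k else 0)"
  shows "jint p (X * (\<Sum>k\<in>A. smult (v k) (f k)) * (\<Sum>k\<in>A. smult (v k) (f k))) = (\<Sum>k\<in>A. (v k)\<^sup>2 * d k)"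
proof -
  have "X * (\<Sum>k\<in>A. smult (v k) (f k)) * (\<Sum>k\<in>A. smult (v k) (f k)) = (\<Sum>k\<in>A. \<Sum>l\<in>A. smult (v k * v l) (X * f k * f l))"
    by (simp only: sum_distrib_left sum_distrib_right mult_smult_left mult_smult_right smult_smult smult_sum_right mult_ac)
  hence "jint p (X * (\<Sum>k\<in>A. smult (v k) (f k)) * (\<Sum>k\<in>A. smult (v k) (f k))) = (\<Sum>k\<in>A. \<Sum>l\<in>A. v k * v l * jint p (X * f k * f l))"
    by (simp only: jint_sum jint_smult)
  also have "\<dots> = (\<Sum>k\<in>A. (v k)\<^sup>2 * d k)"
  proof (intro sum.cong refl)
    fix k assume k: "k \<in> A"
    have "(\<Sum>l\<in>A. v k * v l * jint p (X * f k * f l)) = (\<Sum>l\<in>A. if l = k then (v k)\<^sup>2 * d k else 0)"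
      by (intro sum.cong refl) (auto simp: B k power2_eq_square)
    thus "(\<Sum>l\<in>A. v k * v l * jint p (X * f k * f l)) = (v k)\<^sup>2 * d k" using fin k by simp
  qed
  finally show ?thesis .
qed

lemma borel_measurable_poly [measurable (raw)]:
  fixes P :: "real poly"
  assumes "f \<in> borel_measurable M"
  shows "(\<lambda>x. poly P (f x)) \<in> borel_measurable M"
proof -
  have "poly P \<in> borel_measurable borel"
    by (intro borel_measurable_continuous_onI continuous_intros)
  from measurable_compose[OF assms this] show ?thesis .
qed

lemma has_bochner_integral_jint:
  assumes "p > 0"
  shows "has_bochner_integral lborel (\<lambda>x. indicator {0..1} x * (x powr (p - 1) * poly P x)) (jint p P)"
proof -
  have m: "has_bochner_integral lborel (\<lambda>x. indicator {0..1} x * x powr (p - 1 + real i)) (1 / (p + real i))" for i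
  proof -
    have "((\<lambda>x. x powr (p - 1 + real i)) has_integral (1 powr (p - 1 + real i + 1) / (p - 1 + real i + 1))) {0..1}"
      using assms by (intro has_integral_powr_from_0) auto
    hence "((\<lambda>x. x powr (p - 1 + real i)) has_integral 1 / (p + real i)) {0..1}" by simp
    from nn_integral_has_integral_lebesgue[OF _ this] have "integral\<^sup>N lborel (\<lambda>x. ennreal (indicator {0..1} x * x powr (p - 1 + real i))) = ennreal (1 / (p + real i))"
      by (simp add: ennreal_mult' ennreal_indicator indicator_def if_distrib cong: if_cong)
    thus ?thesis
      using assms by (intro has_bochner_integral_nn_integral) auto
  qed
  have "has_bochner_integral lborel (\<lambda>x. \<Sum>i\<le>degree P. coeff P i * (indicator {0..1} x * x powr (p - 1 + real i)))
     (\<Sum>i\<le>degree P. coeff P i * (1 / (p + real i)))"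
    by (intro has_bochner_integral_sum has_bochner_integral_mult_right m)
  also have "(\<Sum>i\<le>degree P. coeff P i * (1 / (p + real i))) = jint p P"
    by (simp add: jint_def)
  finally have *: "has_bochner_integral lborel (\<lambda>x. \<Sum>i\<le>degree P. coeff P i * (indicator {0..1} x * x powr (p - 1 + real i))) (jint p P)" .
  have ae: "AE x in lborel. (\<Sum>i\<le>degree P. coeff P i * (indicator {0..1} x * x powr (p - 1 + real i)))
      = indicator {0..1} x * (x powr (p - 1) * poly P x)"
    using AE_lborel_singleton[of 0]
  proof eventually_elim
    case (elim x)
    show ?case
    proof (cases "x > 0")
      case True
      hence "x powr (p - 1 + real i) = x powr (p - 1) * x ^ i" for i
        by (simp add: powr_add powr_realpow)
      thus ?thesis by (simp add: poly_altdef sum_distrib_left mult_ac)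
    next
      case False
      with elim show ?thesis by (auto simp: indicator_def)
    qed
  qed
  show ?thesis
    by (rule has_bochner_integralI_AE[OF * _ ae]) measurable
qed

section \<open>Sonin's function and bounds for Jacobi polynomials\<close>

definition wint :: "real \<Rightarrow> (real \<Rightarrow> real) \<Rightarrow> real" where
  "wint p g = (\<integral>x. indicator {0..1} x * (x powr (p - 1) * g x) \<partial>lborel)"

lemma integrable_wint:
  fixes p :: real and g :: "real \<Rightarrow> real"
  assumes "p > 0" "continuous_on {0..1} g"
  shows "integrable lborel (\<lambda>x. indicator {0..1} x * (x powr (p - 1) * g x))"
proof -
  have "bounded (g ` {0..1})"
    by (intro compact_imp_bounded compact_continuous_image compact_Icc assms(2))
  then obtain B where "\<forall>x\<in>{0..1}. \<bar>g x\<bar> \<le> B"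
    by (auto simp: bounded_iff)
  hence B: "\<And>x. x \<in> {0..1} \<Longrightarrow> \<bar>g x\<bar> \<le> B" by blast
  have [measurable]: "(\<lambda>x. indicator {0..1} x * g x) \<in> borel_measurable borel"
    using borel_measurable_continuous_on_indicator[OF _ assms(2)] by simp
  have "integrable lborel (\<lambda>x. B * (indicator {0..1} x * (x powr (p - 1) * poly 1 x)))"
    using has_bochner_integral_jint[OF assms(1), of 1]
    by (intro integrable_mult_right) (rule integrable.intros)
  thus ?thesis
  proof (rule Bochner_Integration.integrable_bound)
    have "(\<lambda>x. x powr (p - 1) * (indicator {0..1} x * g x)) \<in> borel_measurable lborel"
      by measurable
    thus "(\<lambda>x. indicator {0..1} x * (x powr (p - 1) * g x)) \<in> borel_measurable lborel"
      by (simp add: mult_ac)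
    show "AE x in lborel. norm (indicator {0..1} x * (x powr (p - 1) * g x)) \<le>
        norm (B * (indicator {0..1} x * (x powr (p - 1) * poly 1 x)))"
    proof (intro AE_I2)
      fix x :: real
      show "norm (indicator {0..1} x * (x powr (p - 1) * g x)) \<le>
        norm (B * (indicator {0..1} x * (x powr (p - 1) * poly 1 x)))"
      proof (cases "x \<in> {0..1}")
        case True
        hence "\<bar>g x\<bar> \<le> \<bar>B\<bar>" using B[OF True] by simp
        thus ?thesis using True by (simp add: abs_mult mult.commute mult_right_mono)
      qed simp
    qed
  qed
qed

lemma wint_add:
  assumes "p > 0" "continuous_on {0..1} f" "continuous_on {0..1} g"
  shows "wint p (\<lambda>x. f x + g x) = wint p f + wint p g"
  unfolding wint_def using integrable_wint[OF assms(1,2)] integrable_wint[OF assms(1,3)]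
  by (simp add: algebra_simps)

lemma wint_cmult: "wint p (\<lambda>x. c * f x) = c * wint p f"
proof -
  have "wint p (\<lambda>x. c * f x) = (\<integral>x. c * (indicator {0..1} x * (x powr (p - 1) * f x)) \<partial>lborel)"
    unfolding wint_def by (simp add: mult_ac)
  thus ?thesis by (simp add: wint_def)
qed

lemma wint_sum:
  assumes "p > 0" "\<And>i. i \<in> A \<Longrightarrow> continuous_on {0..1} (f i)"
  shows "wint p (\<lambda>x. \<Sum>i\<in>A. f i x) = (\<Sum>i\<in>A. wint p (f i))"
  using assms(2)
proof (induction A rule: infinite_finite_induct)
  case (insert i A)
  thus ?case using wint_add[OF assms(1), of "f i" "\<lambda>x. \<Sum>i\<in>A. f i x"] by (auto intro!: continuous_intros)
qed (auto simp: wint_def)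

lemma wint_mono:
  assumes "p > 0" "continuous_on {0..1} f" "continuous_on {0..1} g" "\<And>x. x \<in> {0..1} \<Longrightarrow> f x \<le> g x"
  shows "wint p f \<le> wint p g"
  unfolding wint_def
  using integrable_wint[OF assms(1,2)] integrable_wint[OF assms(1,3)]
  by (intro integral_mono) (auto simp: indicator_def intro!: mult_left_mono assms(4))

lemma wint_poly: "p > 0 \<Longrightarrow> wint p (poly P) = jint p P"
  unfolding wint_def by (rule has_bochner_integral_integral_eq[OF has_bochner_integral_jint])

lemma wint_const: "p > 0 \<Longrightarrow> wint p (\<lambda>x. c) = c / p"
proof -
  assume "p > 0"
  have "(\<lambda>x. c) = poly [:c:]" by (simp add: fun_eq_iff)
  thus ?thesis using wint_poly[OF \<open>p > 0\<close>, of "[:c:]"] by (simp only: jint_def) simp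
qed

text \<open>The weight \<open>x powr (p - 1)\<close> is monotone, so on \<open>[a, b]\<close> it is at least its smaller boundary value.\<close>

lemma wint_lower_bound:
  assumes p: "p > 0" and g: "continuous_on {0..1} g" and nn: "\<And>x. x \<in> {0..1} \<Longrightarrow> g x \<ge> 0"
    and ab: "0 < a" "a < b" "b \<le> 1" and ge: "\<And>x. x \<in> {a..b} \<Longrightarrow> g x \<ge> e" and e: "e \<ge> 0"
  shows "min (a powr (p - 1)) (b powr (p - 1)) * e * (b - a) \<le> wint p g"
proof -
  define m where "m = min (a powr (p - 1)) (b powr (p - 1))"
  have m: "m > 0" using ab by (simp add: m_def)
  have m_le: "m \<le> y powr (p - 1)" if "y \<in> {a..b}" for y
  proof (cases "p \<ge> 1")
    case True
    hence "a powr (p - 1) \<le> y powr (p - 1)" using that ab by (intro powr_mono2) auto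
    thus ?thesis by (simp add: m_def)
  next
    case False
    hence "b powr (p - 1) \<le> y powr (p - 1)" using that ab by (intro powr_mono2') auto
    thus ?thesis by (simp add: m_def)
  qed
  have "m * e * (b - a) = (\<integral>y. indicator {a..b} y * (m * e) \<partial>lborel)"
    using ab by simp
  also have "\<dots> \<le> wint p g"
    unfolding wint_def
  proof (rule integral_mono)
    show "integrable lborel (\<lambda>y. indicator {a..b} y * (m * e))"
      by (intro integrable_mult_left integrable_real_indicator) (auto simp: emeasure_lborel_Icc_eq)
    show "integrable lborel (\<lambda>y. indicator {0..1} y * (y powr (p - 1) * g y))"
      by (rule integrable_wint[OF p g])
    fix y
    show "indicator {a..b} y * (m * e) \<le> indicator {0..1} y * (y powr (p - 1) * g y)"
    proof (cases "y \<in> {a..b}")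
      case True
      hence "m * e \<le> y powr (p - 1) * g y"
        using m_le[OF True] m e ge by (intro mult_mono) auto
      thus ?thesis using True ab by (simp add: indicator_def)
    next
      case False
      thus ?thesis using nn[of y] by (cases "y \<in> {0..1}") auto
    qed
  qed
  finally show ?thesis by (simp add: m_def)
qed

text \<open>Sonin's function \<open>S = R\<^sup>2 + x (1 - x) R'\<^sup>2 / \<lambda>\<close>, the energy of the oscillation that the Jacobi equation
  describes.\<close>

definition jacobi_sonin :: "real \<Rightarrow> nat \<Rightarrow> real poly" where
  "jacobi_sonin p k = jacobi_poly p k * jacobi_poly p k +
     smult (1 / jacobi_eigenvalue p k) ([:0, 1, -1:] * pderiv (jacobi_poly p k) * pderiv (jacobi_poly p k))"

lemma poly_jacobi_sonin:
  "poly (jacobi_sonin p k) x = (poly (jacobi_poly p k) x)\<^sup>2 +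
     x * (1 - x) / jacobi_eigenvalue p k * (poly (pderiv (jacobi_poly p k)) x)\<^sup>2"
  by (simp add: jacobi_sonin_def power2_eq_square algebra_simps diff_divide_distrib)

lemma jacobi_sonin_nonneg:
  assumes "p > 0" "x \<in> {0..1}"
  shows "0 \<le> x * (1 - x) / jacobi_eigenvalue p k * (poly (pderiv (jacobi_poly p k)) x)\<^sup>2"
  using assms by (intro mult_nonneg_nonneg divide_nonneg_nonneg) (auto simp: jacobi_eigenvalue_def)

lemma jacobi_poly_square_le_sonin:
  assumes "p > 0" "x \<in> {0..1}"
  shows "(poly (jacobi_poly p k) x)\<^sup>2 \<le> poly (jacobi_sonin p k) x"
  using jacobi_sonin_nonneg[OF assms, of k] by (simp add: poly_jacobi_sonin)

text \<open>The second derivative is eliminated by the differential equation, and then \<open>S'\<close> contains only \<open>R'\<^sup>2\<close> with a linear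
  factor.\<close>

lemma jacobi_sonin_deriv:
  assumes "p > 0" "k > 0"
  shows "(poly (jacobi_sonin p k) has_real_derivative
           (poly (pderiv (jacobi_poly p k)) x)\<^sup>2 * (1 - 2 * p + 2 * p * x) / jacobi_eigenvalue p k) (at x)"
proof -
  define u where "u = poly (jacobi_poly p k)"
  define u' where "u' = poly (pderiv (jacobi_poly p k))"
  define u'' where "u'' = poly (pderiv (pderiv (jacobi_poly p k)))"
  define l where "l = jacobi_eigenvalue p k"
  have l [simp]: "l \<noteq> 0" using jacobi_eigenvalue_pos[OF assms] by (simp add: l_def)
  have d: "(u has_real_derivative u' x) (at x)" "(u' has_real_derivative u'' x) (at x)" for x
    by (auto simp: u_def u'_def u''_def intro: poly_DERIV)
  have ode: "x * (1 - x) * u'' x + (p - (p + 1) * x) * u' x = - l * u x"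
    using poly_jacobi_ode[OF assms(1), of x k] by (simp add: u_def u'_def u''_def l_def)
  have "((\<lambda>x. (u x)\<^sup>2 + x * (1 - x) / l * (u' x)\<^sup>2) has_real_derivative
      (2 * u x * u' x + ((1 - 2 * x) / l * (u' x)\<^sup>2 + x * (1 - x) / l * (2 * u' x * u'' x)))) (at x)"
    by (auto intro!: derivative_eq_intros d simp: power2_eq_square algebra_simps diff_divide_distrib add_divide_distrib)
  also have "2 * u x * u' x + ((1 - 2 * x) / l * (u' x)\<^sup>2 + x * (1 - x) / l * (2 * u' x * u'' x)) =
     2 * u' x / l * (l * u x + x * (1 - x) * u'' x) + (1 - 2 * x) / l * (u' x)\<^sup>2"
    using l by (simp add: field_simps power2_eq_square)
  also have "l * u x + x * (1 - x) * u'' x = - (p - (p + 1) * x) * u' x"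
    using ode by (simp add: algebra_simps)
  also have "2 * u' x / l * (- (p - (p + 1) * x) * u' x) + (1 - 2 * x) / l * (u' x)\<^sup>2 =
      (u' x)\<^sup>2 * (1 - 2 * p + 2 * p * x) / l"
    using l by (simp add: field_simps power2_eq_square)
  moreover have "poly (jacobi_sonin p k) = (\<lambda>x. (u x)\<^sup>2 + x * (1 - x) / l * (u' x)\<^sup>2)"
    by (simp add: fun_eq_iff poly_jacobi_sonin u_def u'_def l_def)
  ultimately show ?thesis by (simp only: u'_def l_def)
qed

lemma poly_jacobi_poly_one_0: "poly (jacobi_poly 1 k) 0 = 1"
  by (simp add: poly_0_coeff_0 coeff_jacobi_poly pochhammer_fact[symmetric])

text \<open>For \<open>p = 1\<close> the derivative of Sonin's function has the sign of \<open>2x - 1\<close>. So \<open>S\<close> is largest at the two endpoints,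
  where it equals \<open>R\<^sub>k\<^sup>2 = 1\<close>.\<close>

lemma jacobi_poly_one_bounded:
  assumes x: "x \<in> {0..1}"
  shows "\<bar>poly (jacobi_poly 1 k) x\<bar> \<le> 1"
proof (cases "k = 0")
  case True
  then show ?thesis by (simp add: jacobi_poly_def)
next
  case False
  let ?S = "poly (jacobi_sonin 1 k)"
  let ?d = "\<lambda>x. (poly (pderiv (jacobi_poly 1 k)) x)\<^sup>2 * (1 - 2 * 1 + 2 * 1 * x) / jacobi_eigenvalue 1 k"
  have D: "(?S has_real_derivative ?d x) (at x)" for x
    by (rule jacobi_sonin_deriv) (use False in auto)
  have l: "jacobi_eigenvalue 1 k > 0" using False by (simp add: jacobi_eigenvalue_pos)
  have ends: "?S 0 = 1" "?S 1 = 1"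
    by (simp_all add: poly_jacobi_sonin poly_jacobi_poly_one_0 poly_jacobi_poly_1 flip: power_mult)
  have "?S x \<le> 1"
  proof (cases "x \<le> 1/2")
    case True
    have "?S x \<le> ?S 0"
    proof (rule DERIV_nonpos_imp_nonincreasing[where f = ?S and a = 0 and b = x])
      fix y assume "0 \<le> y" "y \<le> x"
      hence "?d y \<le> 0" using True l by (intro divide_nonpos_nonneg mult_nonneg_nonpos) auto
      thus "\<exists>z. (?S has_real_derivative z) (at y) \<and> z \<le> 0" using D by blast
    qed (use x in auto)
    thus ?thesis by (simp add: ends)
  next
    case False
    have "?S x \<le> ?S 1"
    proof (rule DERIV_nonneg_imp_nondecreasing[where f = ?S and a = x and b = 1])
      fix y assume "x \<le> y" "y \<le> 1"
      hence "?d y \<ge> 0" using False l by (intro divide_nonneg_nonneg mult_nonneg_nonneg) auto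
      thus "\<exists>z. (?S has_real_derivative z) (at y) \<and> z \<ge> 0" using D by blast
    qed (use x in auto)
    thus ?thesis by (simp add: ends)
  qed
  with jacobi_poly_square_le_sonin[of 1 x k] x have "(poly (jacobi_poly 1 k) x)\<^sup>2 \<le> 1"
    by simp
  thus ?thesis by (simp add: abs_square_le_1)
qed

text \<open>By Sturm-Liouville both summands of Sonin's function have the integral \<open>1 / (p + 2k)\<close>.\<close>

lemma jint_jacobi_sonin:
  assumes "p > 0" "k > 0"
  shows "jint p (jacobi_sonin p k) = 2 / (p + 2 * real k)"
  using jacobi_eigenvalue_pos[OF assms]
  unfolding jacobi_sonin_def jint_add jint_smult jint_jacobi_pderiv_mult[OF assms(1)] jint_jacobi_poly_mult[OF assms(1)]
  by simp

text \<open>Away from the endpoints \<open>\<bar>S'\<bar> \<le> M S\<close> with \<open>M\<close> independent of \<open>k\<close>, so by Gronwall the values of \<open>S\<close> on \<open>[a, b]\<close> differ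
  by at most a factor \<open>exp M\<close>. Each of them is therefore at most a constant times the weighted integral \<open>2 / (p + 2k)\<close>
  of \<open>S\<close>.\<close>

lemma jacobi_poly_locally_bounded:
  fixes p a b :: real
  assumes p: "p > 0" and ab: "0 < a" "a < b" "b < 1"
  shows "\<exists>C\<ge>0. \<forall>k. \<forall>x\<in>{a..b}. (p + 2 * real k) * (poly (jacobi_poly p k) x)\<^sup>2 \<le> C"
proof -
  define M where "M = (1 + 2 * p) / (a * (1 - b))"
  define m where "m = min (a powr (p - 1)) (b powr (p - 1))"
  have m: "m > 0" using ab by (simp add: m_def)
  have M: "M > 0" using ab p by (auto simp: M_def intro!: divide_pos_pos mult_pos_pos)
  define C where "C = max p (2 * exp M / (m * (b - a)))"
  have main: "(p + 2 * real k) * (poly (jacobi_poly p k) x)\<^sup>2 \<le> C" if x: "x \<in> {a..b}" for k x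
  proof (cases "k = 0")
    case True
    thus ?thesis by (simp add: jacobi_poly_def C_def)
  next
    case False
    hence k: "k > 0" by simp
    define S where "S = poly (jacobi_sonin p k)"
    let ?S = S
    define d where "d = (\<lambda>x. (poly (pderiv (jacobi_poly p k)) x)\<^sup>2 * (1 - 2 * p + 2 * p * x) / jacobi_eigenvalue p k)"
    have D: "(?S has_real_derivative d y) (at y)" for y
      unfolding d_def S_def by (rule jacobi_sonin_deriv) (use k p in auto)
    have l: "jacobi_eigenvalue p k > 0" using k p by (simp add: jacobi_eigenvalue_pos)
    have d: "\<bar>d y\<bar> \<le> M * ?S y" if y: "y \<in> {a..b}" for y
    proof -
      let ?e = "(poly (pderiv (jacobi_poly p k)) y)\<^sup>2 / jacobi_eigenvalue p k"
      have e: "?e \<ge> 0" using l by simp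
      have yp: "y * (1 - y) \<ge> a * (1 - b)" using y ab by (intro mult_mono) auto
      have abp: "a * (1 - b) > 0" using ab by simp
      have "\<bar>1 - 2 * p + 2 * p * y\<bar> \<le> 1 + 2 * p"
      proof -
        have "1 - 2 * p + 2 * p * y = 1 - 2 * p * (1 - y)" by (simp add: algebra_simps)
        moreover have "0 \<le> 2 * p * (1 - y)" "2 * p * (1 - y) \<le> 2 * p"
          using y ab p by (auto intro!: mult_left_le)
        ultimately show ?thesis by linarith
      qed
      hence "\<bar>d y\<bar> \<le> ?e * (1 + 2 * p)"
        using e l by (simp add: d_def abs_mult divide_right_mono mult_left_mono)
      also have "\<dots> = M * (a * (1 - b) * ?e)" using abp ab by (simp add: M_def)
      also have "\<dots> \<le> M * (y * (1 - y) * ?e)"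
        using yp e M by (intro mult_left_mono mult_right_mono) auto
      also have "\<dots> \<le> M * ?S y"
        using M by (intro mult_left_mono) (auto simp: S_def poly_jacobi_sonin)
      finally show ?thesis .
    qed
    have Spos: "?S y \<ge> 0" if "y \<in> {a..b}" for y
    proof -
      have "0 \<le> (poly (jacobi_poly p k) y)\<^sup>2" by simp
      also have "\<dots> \<le> ?S y" unfolding S_def by (rule jacobi_poly_square_le_sonin[OF p]) (use that ab in auto)
      finally show ?thesis .
    qed
    have compare: "?S x \<le> exp M * ?S y" if y: "y \<in> {a..b}" for y
    proof -
      have "?S x \<le> exp (M * \<bar>x - y\<bar>) * ?S y"
      proof (cases "x \<le> y")
        case True
        (* Gronwall: exp (M z) * S z is increasing and exp (- M z) * S z is decreasing. *)
        have "exp (M * x) * ?S x \<le> exp (M * y) * ?S y"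
        proof (rule DERIV_nonneg_imp_nondecreasing[OF True])
          fix z assume "x \<le> z" "z \<le> y"
          hence "z \<in> {a..b}" using x y by auto
          hence "M * ?S z + d z \<ge> 0" using d[of z] by linarith
          hence "exp (M * z) * (M * ?S z + d z) \<ge> 0" by simp
          moreover have "((\<lambda>z. exp (M * z) * ?S z) has_real_derivative exp (M * z) * (M * ?S z + d z)) (at z)"
            by (auto intro!: derivative_eq_intros D simp: algebra_simps)
          ultimately show "\<exists>t. ((\<lambda>z. exp (M * z) * ?S z) has_real_derivative t) (at z) \<and> 0 \<le> t" by blast
        qed
        thus ?thesis using True by (simp add: exp_diff exp_minus algebra_simps divide_simps)
      next
        case False
        hence yx: "y \<le> x" by simp
        have "exp (- M * x) * ?S x \<le> exp (- M * y) * ?S y"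
        proof (rule DERIV_nonpos_imp_nonincreasing[OF yx])
          fix z assume "y \<le> z" "z \<le> x"
          hence "z \<in> {a..b}" using x y by auto
          hence "- M * ?S z + d z \<le> 0" using d[of z] by linarith
          hence "exp (- M * z) * (- M * ?S z + d z) \<le> 0" by (simp add: mult_nonneg_nonpos)
          moreover have "((\<lambda>z. exp (- M * z) * ?S z) has_real_derivative exp (- M * z) * (- M * ?S z + d z)) (at z)"
            by (auto intro!: derivative_eq_intros D simp: algebra_simps)
          ultimately show "\<exists>t. ((\<lambda>z. exp (- M * z) * ?S z) has_real_derivative t) (at z) \<and> t \<le> 0" by blast
        qed
        thus ?thesis using False by (simp add: exp_diff exp_minus algebra_simps divide_simps)
      qed
      also have "\<dots> \<le> exp M * ?S y"
      proof (rule mult_right_mono)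
        have "\<bar>x - y\<bar> \<le> 1" using x y ab by auto
        hence "M * \<bar>x - y\<bar> \<le> M * 1" using M by (intro mult_left_mono) auto
        thus "exp (M * \<bar>x - y\<bar>) \<le> exp M" by simp
      qed (use Spos y in auto)
      finally show ?thesis .
    qed
    (* The smallest possible value of S on [a, b] bounds its mean from below. *)
    have *: "m * (?S x * exp (-M)) * (b - a) \<le> 2 / (p + 2 * real k)"
    proof -
      have "m * (?S x * exp (-M)) * (b - a) \<le> wint p ?S"
        unfolding m_def
      proof (rule wint_lower_bound[OF p])
        fix y :: real assume "y \<in> {0..1}"
        thus "?S y \<ge> 0" unfolding S_def
          using jacobi_poly_square_le_sonin[OF p, of y k] zero_le_power2 order_trans by blast
      next
        fix y assume "y \<in> {a..b}"
        thus "?S x * exp (-M) \<le> ?S y" using compare[of y] by (simp add: exp_minus field_simps)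
      qed (use ab x Spos in \<open>auto simp: S_def intro!: continuous_intros\<close>)
      also have "\<dots> = 2 / (p + 2 * real k)"
        by (simp add: S_def wint_poly[OF p] jint_jacobi_sonin[OF p k])
      finally show ?thesis .
    qed
    have pk: "p + 2 * real k > 0" using p by simp
    have "(p + 2 * real k) * ?S x \<le> 2 * exp M / (m * (b - a))"
      using * pk m ab by (simp add: exp_minus field_simps)
    moreover have "(p + 2 * real k) * (poly (jacobi_poly p k) x)\<^sup>2 \<le> (p + 2 * real k) * ?S x"
      unfolding S_def using pk jacobi_poly_square_le_sonin[OF p, of x k] x ab by (intro mult_left_mono) auto
    ultimately show ?thesis by (simp add: C_def)
  qed
  have "C \<ge> 0" using p by (simp add: C_def)
  with main show ?thesis by blast
qed

section \<open>Convergence of Jacobi expansions to the expanded function\<close>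

lemma polynomial_approximation:
  fixes f :: "real \<Rightarrow> real"
  assumes "continuous_on {0..1} f" "e > 0"
  shows "\<exists>P. \<forall>x\<in>{0..1}. \<bar>f x - poly P x\<bar> < e"
proof -
  obtain g where g: "real_polynomial_function g" "\<And>x. x \<in> {0..1} \<Longrightarrow> \<bar>f x - g x\<bar> < e"
    using Stone_Weierstrass_real_polynomial_function[OF _ assms(1) assms(2)] by auto
  obtain a n where "g = (\<lambda>x. \<Sum>i\<le>n. a i * x ^ i)"
    using g(1) unfolding real_polynomial_function_iff_sum by blast
  hence "g x = poly (\<Sum>i\<le>n. monom (a i) i) x" for x
    by (simp add: poly_sum poly_monom)
  with g(2) show ?thesis by (intro exI[of _ "\<Sum>i\<le>n. monom (a i) i"]) auto
qed

definition jacobi_partial_sum :: "real \<Rightarrow> (real \<Rightarrow> real) \<Rightarrow> nat \<Rightarrow> real \<Rightarrow> real" where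
  "jacobi_partial_sum p f N x =
     (\<Sum>k<N. (p + 2 * real k) * wint p (\<lambda>y. poly (jacobi_poly p k) y * f y) * poly (jacobi_poly p k) x)"

lemma continuous_on_jacobi_partial_sum [continuous_intros]:
  "continuous_on A (jacobi_partial_sum p f N)"
  unfolding jacobi_partial_sum_def[abs_def] by (intro continuous_intros)

lemma jacobi_partial_sum_orthogonal:
  assumes p: "p > 0" and f: "continuous_on {0..1} f" and k: "k < N"
  shows "wint p (\<lambda>x. (f x - jacobi_partial_sum p f N x) * poly (jacobi_poly p k) x) = 0"
proof -
  let ?R = "\<lambda>k. poly (jacobi_poly p k)"
  let ?c = "\<lambda>k. (p + 2 * real k) * wint p (\<lambda>y. ?R k y * f y)"
  have eq: "(\<lambda>x. (f x - jacobi_partial_sum p f N x) * ?R k x) =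
    (\<lambda>x. ?R k x * f x + (\<Sum>l<N. (- ?c l) * poly (jacobi_poly p l * jacobi_poly p k) x))"
    by (simp add: fun_eq_iff jacobi_partial_sum_def left_diff_distrib right_diff_distrib sum_distrib_left sum_distrib_right sum_negf mult_ac)
  have o: "wint p (\<lambda>x. (- ?c l) * poly (jacobi_poly p l * jacobi_poly p k) x) =
     (if l = k then - wint p (\<lambda>y. ?R k y * f y) else 0)" for l
    using p unfolding wint_cmult wint_poly[OF p] jint_jacobi_poly_mult[OF p]
    by (auto simp: add_pos_nonneg less_imp_neq[THEN not_sym])
  have "wint p (\<lambda>x. (f x - jacobi_partial_sum p f N x) * ?R k x) =
     wint p (\<lambda>x. ?R k x * f x) + (\<Sum>l<N. wint p (\<lambda>x. (- ?c l) * poly (jacobi_poly p l * jacobi_poly p k) x))"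
    unfolding eq
    by (subst wint_sum[OF p, symmetric])
       (intro continuous_intros f p wint_add[OF p, of "\<lambda>x. ?R k x * f x" "\<lambda>x. \<Sum>l<N. (- ?c l) * poly (jacobi_poly p l * jacobi_poly p k) x"])+
  also have "\<dots> = 0" unfolding o using k by simp
  finally show ?thesis .
qed

text \<open>The partial sum is the best approximation in the mean among polynomials of degree below \<open>N\<close>, hence at least as good
  as a uniform approximation given by Weierstrass.\<close>

lemma jacobi_partial_sum_L2:
  assumes p: "p > 0" and f: "continuous_on {0..1} f" and e: "e > 0"
  shows "\<exists>N0. \<forall>N\<ge>N0. wint p (\<lambda>x. (f x - jacobi_partial_sum p f N x)\<^sup>2) \<le> e"
proof -
  (* The weight has total mass 1 / p, so an error d everywhere has mean square d^2 / p = e. *)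
  define d where "d = sqrt (e * p)"
  have d: "d > 0" "d\<^sup>2 = e * p" using e p by (auto simp: d_def)
  obtain P where P: "\<And>x. x \<in> {0..1} \<Longrightarrow> \<bar>f x - poly P x\<bar> < d"
    using polynomial_approximation[OF f d(1)] by blast
  have "wint p (\<lambda>x. (f x - jacobi_partial_sum p f N x)\<^sup>2) \<le> e" if N: "N \<ge> Suc (degree P)" for N
  proof -
    let ?S = "jacobi_partial_sum p f N"
    let ?R = "\<lambda>k. poly (jacobi_poly p k)"
    obtain c where c: "P = (\<Sum>k<N. smult (c k) (jacobi_poly p k))"
      using poly_in_span_jacobi[OF p, of P N] N by auto
    define a where "a = (\<lambda>k. (p + 2 * real k) * wint p (\<lambda>y. ?R k y * f y) - c k)"
    have diff: "?S x - poly P x = (\<Sum>k<N. a k * ?R k x)" for x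
      unfolding c jacobi_partial_sum_def a_def
      by (simp add: poly_sum sum_subtractf algebra_simps)
    have cross: "wint p (\<lambda>x. 2 * ((f x - ?S x) * (?S x - poly P x))) = 0"
    proof -
      have "wint p (\<lambda>x. (f x - ?S x) * (?S x - poly P x)) =
        wint p (\<lambda>x. \<Sum>k<N. a k * ((f x - ?S x) * ?R k x))"
        unfolding diff by (simp add: sum_distrib_left mult_ac)
      also have "\<dots> = (\<Sum>k<N. wint p (\<lambda>x. a k * ((f x - ?S x) * ?R k x)))"
        by (intro wint_sum[OF p] continuous_intros f)
      also have "\<dots> = 0"
        by (intro sum.neutral) (auto simp: wint_cmult jacobi_partial_sum_orthogonal[OF p f])
      finally show ?thesis by (simp only: wint_cmult)
    qed
    have "wint p (\<lambda>x. (f x - ?S x)\<^sup>2) =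
        wint p (\<lambda>x. (f x - ?S x)\<^sup>2) + wint p (\<lambda>x. 2 * ((f x - ?S x) * (?S x - poly P x)))"
      using cross by simp
    also have "\<dots> = wint p (\<lambda>x. (f x - ?S x)\<^sup>2 + 2 * ((f x - ?S x) * (?S x - poly P x)))"
      by (intro wint_add[symmetric] p continuous_intros f)
    also have "\<dots> \<le> wint p (\<lambda>x. d\<^sup>2)"
    proof (intro wint_mono p continuous_intros f)
      fix x :: real assume x: "x \<in> {0..1}"
      (* Pythagoras; the cross term integrates to zero. *)
      have "(f x - ?S x)\<^sup>2 + 2 * ((f x - ?S x) * (?S x - poly P x)) =
         (f x - poly P x)\<^sup>2 - (?S x - poly P x)\<^sup>2"
        by (simp add: power2_eq_square algebra_simps)
      also have "\<dots> \<le> (f x - poly P x)\<^sup>2" by simp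
      also have "\<dots> \<le> d\<^sup>2" using P[OF x] d by (intro abs_le_square_iff[THEN iffD1]) auto
      finally show "(f x - ?S x)\<^sup>2 + 2 * ((f x - ?S x) * (?S x - poly P x)) \<le> d\<^sup>2" .
    qed
    also have "\<dots> = e" using p d by (simp add: wint_const)
    finally show ?thesis .
  qed
  thus ?thesis by blast
qed

text \<open>If the uniform limit \<open>s\<close> differed from \<open>f\<close> at one point, it would, both being continuous, differ from \<open>f\<close> on a whole
  interval, and convergence in the mean would fail.\<close>

theorem jacobi_expansion_converges_to_function:
  assumes p: "p > 0" and f: "continuous_on {0..1} f"
    and ab: "0 < a" "a < b" "b \<le> 1"
    and conv: "uniform_limit {a..b} (jacobi_partial_sum p f) s sequentially"
    and x0: "x0 \<in> {a..b}"
  shows "s x0 = f x0"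
proof (rule ccontr)
  assume neq: "s x0 \<noteq> f x0"
  define e where "e = \<bar>f x0 - s x0\<bar>"
  have e: "e > 0" using neq by (simp add: e_def)
  have cs: "continuous_on {a..b} s"
    by (rule uniform_limit_theorem[OF _ conv]) (auto intro!: always_eventually continuous_intros)
  have cf: "continuous_on {a..b} f" using f by (rule continuous_on_subset) (use ab in auto)
  have "continuous_on {a..b} (\<lambda>x. \<bar>f x - s x\<bar>)" by (intro continuous_intros cf cs)
  then obtain d where d: "d > 0" "\<And>x. x \<in> {a..b} \<Longrightarrow> dist x x0 < d \<Longrightarrow> dist \<bar>f x - s x\<bar> e < e / 2"
    using x0 e unfolding continuous_on_iff e_def by (metis half_gt_zero)
  define a' where "a' = max a (x0 - d / 2)"
  define b' where "b' = min b (x0 + d / 2)"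
  have ab': "0 < a'" "a' < b'" "b' \<le> 1" "{a'..b'} \<subseteq> {a..b}"
    using x0 d ab by (auto simp: a'_def b'_def)
  have big: "\<bar>f x - s x\<bar> > e / 2" if "x \<in> {a'..b'}" for x
  proof -
    have "dist x x0 < d" using that d x0 by (auto simp: a'_def b'_def dist_real_def abs_if)
    hence "dist \<bar>f x - s x\<bar> e < e / 2" using that ab' d by blast
    thus ?thesis by (simp add: dist_real_def abs_if split: if_splits)
  qed
  (* A lower bound for the mean square distance to a partial sum that differs from f by e / 4 on [a', b']. *)
  let ?m = "min (a' powr (p - 1)) (b' powr (p - 1)) * (e / 4)\<^sup>2 * (b' - a')"
  have m: "?m > 0" using ab' e by (auto intro!: mult_pos_pos)
  obtain N0 where N0: "\<And>N. N \<ge> N0 \<Longrightarrow> wint p (\<lambda>x. (f x - jacobi_partial_sum p f N x)\<^sup>2) \<le> ?m / 2"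
    using jacobi_partial_sum_L2[OF p f, of "?m / 2"] m by auto
  have "\<forall>\<^sub>F N in sequentially. \<forall>x\<in>{a..b}. dist (jacobi_partial_sum p f N x) (s x) < e / 4"
    using uniform_limitD[OF conv, of "e / 4"] e by simp
  then obtain N1 where N1: "\<And>N x. N \<ge> N1 \<Longrightarrow> x \<in> {a..b} \<Longrightarrow> dist (jacobi_partial_sum p f N x) (s x) < e / 4"
    unfolding eventually_sequentially by blast
  let ?N = "max N0 N1"
  have "?m \<le> wint p (\<lambda>x. (f x - jacobi_partial_sum p f ?N x)\<^sup>2)"
  proof (rule wint_lower_bound[OF p _ _ ab'(1-3)])
    show "continuous_on {0..1} (\<lambda>x. (f x - jacobi_partial_sum p f ?N x)\<^sup>2)"
      by (intro continuous_intros f)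
    fix x assume x: "x \<in> {a'..b'}"
    hence "dist (jacobi_partial_sum p f ?N x) (s x) < e / 4" using ab' by (intro N1) auto
    with big[OF x] have "e / 4 \<le> \<bar>f x - jacobi_partial_sum p f ?N x\<bar>"
      by (simp add: dist_real_def abs_if split: if_splits)
    thus "(e / 4)\<^sup>2 \<le> (f x - jacobi_partial_sum p f ?N x)\<^sup>2"
      using e by (intro abs_le_square_iff[THEN iffD1]) auto
  qed auto
  with N0[of ?N] m show False by simp
qed

section \<open>A gamma sample, seen from its two largest entries\<close>

lemma gamma_density_nonneg: "\<alpha> > 0 \<Longrightarrow> 0 \<le> gamma_density \<alpha> x"
  by (simp add: gamma_density_def Gamma_real_pos less_imp_le)

lemma borel_measurable_gamma_density [measurable]: "gamma_density \<alpha> \<in> borel_measurable borel"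
  unfolding gamma_density_def[abs_def] by measurable

definition gamma_measure :: "real \<Rightarrow> real measure" where
  "gamma_measure \<alpha> = density lborel (\<lambda>x. ennreal (gamma_density \<alpha> x))"

lemma sets_gamma_measure [measurable_cong, simp]: "sets (gamma_measure \<alpha>) = sets borel"
  by (simp add: gamma_measure_def)

lemma space_gamma_measure [simp]: "space (gamma_measure \<alpha>) = UNIV"
  by (simp add: gamma_measure_def)

lemma nn_integral_gamma_measure_scale:
  fixes F :: "real \<Rightarrow> ennreal"
  assumes [measurable]: "F \<in> borel_measurable borel" and r: "r > 0"
  shows "(\<integral>\<^sup>+x. F x \<partial>gamma_measure \<alpha>) =
         (\<integral>\<^sup>+y. ennreal (r * gamma_density \<alpha> (r * y)) * F (r * y) \<partial>lborel)"
proof -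
  have "(\<integral>\<^sup>+x. F x \<partial>gamma_measure \<alpha>) = (\<integral>\<^sup>+x. ennreal (gamma_density \<alpha> x) * F x \<partial>lborel)"
    unfolding gamma_measure_def by (subst nn_integral_density) auto
  also have "\<dots> = ennreal r * (\<integral>\<^sup>+y. ennreal (gamma_density \<alpha> (r * y)) * F (r * y) \<partial>lborel)"
    using r by (subst nn_integral_real_affine[where c = r and t = 0]) auto
  also have "\<dots> = (\<integral>\<^sup>+y. ennreal (r * gamma_density \<alpha> (r * y)) * F (r * y) \<partial>lborel)"
    using r by (subst nn_integral_cmult[symmetric]) (auto simp: ennreal_mult' mult.assoc)
  finally show ?thesis .
qed

lemma sigma_finite_gamma_measure: "\<alpha> > 0 \<Longrightarrow> sigma_finite_measure (gamma_measure \<alpha>)"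
  unfolding gamma_measure_def
  by (subst sigma_finite_measure.sigma_finite_iff_density_finite[OF lborel.sigma_finite_measure_axioms]) auto

text \<open>The substitution \<open>z\<^sub>k = r w\<^sub>k\<close> in all coordinates at once, by induction on their number.\<close>

lemma nn_integral_PiM_gamma_scale:
  fixes F :: "('i \<Rightarrow> real) \<Rightarrow> ennreal"
  assumes "finite J" and F: "F \<in> borel_measurable (PiM J (\<lambda>_. borel))" and r: "r > 0" and \<alpha>: "\<alpha> > 0"
  shows "(\<integral>\<^sup>+z. F z \<partial>PiM J (\<lambda>_. gamma_measure \<alpha>)) =
         (\<integral>\<^sup>+w. (\<Prod>k\<in>J. ennreal (r * gamma_density \<alpha> (r * w k))) * F (\<lambda>k\<in>J. r * w k) \<partial>PiM J (\<lambda>_. lborel))"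
  using assms(1) F
proof (induction J arbitrary: F rule: finite_induct)
  case empty
  show ?case by (simp add: PiM_empty nn_integral_count_space_finite)
next
  case (insert i J)
  note [measurable] = insert.prems
  interpret G: product_sigma_finite "\<lambda>_. gamma_measure \<alpha>"
    using sigma_finite_gamma_measure[OF \<alpha>] by (intro product_sigma_finite.intro)
  interpret L: product_sigma_finite "\<lambda>_. lborel :: real measure" ..
  have sG: "sets (PiM K (\<lambda>_. gamma_measure \<alpha>)) = sets (PiM K (\<lambda>_. borel))" for K :: "'i set"
    by (intro sets_PiM_cong) auto
  have mG: "F \<in> borel_measurable (PiM (insert i J) (\<lambda>_. gamma_measure \<alpha>))"
    using insert.prems by (simp cong: measurable_cong_sets add: sG)
  have upd [measurable]: "(\<lambda>(y, x). F (x(i := f y))) \<in> borel_measurable (borel \<Otimes>\<^sub>M PiM J (\<lambda>_. borel))"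
    if [measurable]: "f \<in> borel_measurable borel" for f
  proof -
    have "(\<lambda>(y, x). x(i := f y)) \<in> borel \<Otimes>\<^sub>M PiM J (\<lambda>_. borel) \<rightarrow>\<^sub>M PiM (insert i J) (\<lambda>_. borel)"
      unfolding case_prod_unfold by (rule measurable_fun_upd[where J = J]) auto
    from measurable_compose[OF this insert.prems] show ?thesis by (simp add: case_prod_unfold)
  qed
  have "(\<integral>\<^sup>+z. F z \<partial>PiM (insert i J) (\<lambda>_. gamma_measure \<alpha>)) =
        (\<integral>\<^sup>+y. \<integral>\<^sup>+x. F (x(i := y)) \<partial>PiM J (\<lambda>_. gamma_measure \<alpha>) \<partial>gamma_measure \<alpha>)"
    by (rule G.product_nn_integral_insert_rev[OF insert.hyps mG])
  also have "\<dots> = (\<integral>\<^sup>+y. ennreal (r * gamma_density \<alpha> (r * y)) *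
        (\<integral>\<^sup>+x. F (x(i := r * y)) \<partial>PiM J (\<lambda>_. gamma_measure \<alpha>)) \<partial>lborel)"
  proof (rule nn_integral_gamma_measure_scale[OF _ r])
    have [measurable_cong]: "sets (PiM J (\<lambda>_. gamma_measure \<alpha>)) = sets (PiM J (\<lambda>_. borel))" by (rule sG)
    interpret sigma_finite_measure "PiM J (\<lambda>_. gamma_measure \<alpha>)"
      by (rule G.sigma_finite) fact
    show "(\<lambda>y. \<integral>\<^sup>+x. F (x(i := y)) \<partial>PiM J (\<lambda>_. gamma_measure \<alpha>)) \<in> borel_measurable borel"
      using upd[of "\<lambda>y. y"] by (intro borel_measurable_nn_integral) (simp cong: measurable_cong_sets add: sG)
  qed
  also have "\<dots> = (\<integral>\<^sup>+y. \<integral>\<^sup>+x. (\<Prod>k\<in>insert i J. ennreal (r * gamma_density \<alpha> (r * (x(i := y)) k))) *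
        F (\<lambda>k\<in>insert i J. r * (x(i := y)) k) \<partial>PiM J (\<lambda>_. lborel) \<partial>lborel)"
  proof (intro nn_integral_cong)
    fix y :: real
    have m1: "(\<lambda>x. F (x(i := r * y))) \<in> borel_measurable (PiM J (\<lambda>_. borel))"
      using measurable_compose[OF _ upd[of "\<lambda>_. r * y"], of "\<lambda>x. (0, x)" "PiM J (\<lambda>_. borel)"] by simp
    have "(\<integral>\<^sup>+x. F (x(i := r * y)) \<partial>PiM J (\<lambda>_. gamma_measure \<alpha>)) =
       (\<integral>\<^sup>+x. (\<Prod>k\<in>J. ennreal (r * gamma_density \<alpha> (r * x k))) * F ((\<lambda>k\<in>J. r * x k)(i := r * y)) \<partial>PiM J (\<lambda>_. lborel))"
      by (rule insert.IH[OF m1])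
    hence "ennreal (r * gamma_density \<alpha> (r * y)) * (\<integral>\<^sup>+x. F (x(i := r * y)) \<partial>PiM J (\<lambda>_. gamma_measure \<alpha>)) =
       (\<integral>\<^sup>+x. ennreal (r * gamma_density \<alpha> (r * y)) *
         ((\<Prod>k\<in>J. ennreal (r * gamma_density \<alpha> (r * x k))) * F ((\<lambda>k\<in>J. r * x k)(i := r * y))) \<partial>PiM J (\<lambda>_. lborel))"
    proof (simp only:, subst nn_integral_cmult)
      have "(\<lambda>x. (\<lambda>k\<in>J. r * x k)) \<in> PiM J (\<lambda>_. lborel) \<rightarrow>\<^sub>M PiM J (\<lambda>_. borel)"
        by measurable
      from measurable_compose[OF this m1]
      have [measurable]: "(\<lambda>x. F ((\<lambda>k\<in>J. r * x k)(i := r * y))) \<in> borel_measurable (PiM J (\<lambda>_. lborel))" .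
      show "(\<lambda>x. (\<Prod>k\<in>J. ennreal (r * gamma_density \<alpha> (r * x k))) * F ((\<lambda>k\<in>J. r * x k)(i := r * y)))
          \<in> borel_measurable (PiM J (\<lambda>_. lborel))"
        by measurable
    qed simp
    also have "\<dots> = (\<integral>\<^sup>+x. (\<Prod>k\<in>insert i J. ennreal (r * gamma_density \<alpha> (r * (x(i := y)) k))) *
        F (\<lambda>k\<in>insert i J. r * (x(i := y)) k) \<partial>PiM J (\<lambda>_. lborel))"
    proof (intro nn_integral_cong)
      fix x :: "'i \<Rightarrow> real"
      have "(\<lambda>k\<in>J. r * x k)(i := r * y) = (\<lambda>k\<in>insert i J. r * (x(i := y)) k)"
        using insert.hyps by (auto simp: fun_eq_iff)
      moreover have "(\<Prod>k\<in>insert i J. ennreal (r * gamma_density \<alpha> (r * (x(i := y)) k))) =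
          ennreal (r * gamma_density \<alpha> (r * y)) * (\<Prod>k\<in>J. ennreal (r * gamma_density \<alpha> (r * x k)))"
        using insert.hyps by (subst prod.insert) (auto intro!: arg_cong2[where f = "(*)"] prod.cong)
      ultimately show "ennreal (r * gamma_density \<alpha> (r * y)) *
         ((\<Prod>k\<in>J. ennreal (r * gamma_density \<alpha> (r * x k))) * F ((\<lambda>k\<in>J. r * x k)(i := r * y))) =
         (\<Prod>k\<in>insert i J. ennreal (r * gamma_density \<alpha> (r * (x(i := y)) k))) *
        F (\<lambda>k\<in>insert i J. r * (x(i := y)) k)"
        by (simp add: mult.assoc)
    qed
    finally show "ennreal (r * gamma_density \<alpha> (r * y)) * (\<integral>\<^sup>+x. F (x(i := r * y)) \<partial>PiM J (\<lambda>_. gamma_measure \<alpha>)) =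
       (\<integral>\<^sup>+x. (\<Prod>k\<in>insert i J. ennreal (r * gamma_density \<alpha> (r * (x(i := y)) k))) *
        F (\<lambda>k\<in>insert i J. r * (x(i := y)) k) \<partial>PiM J (\<lambda>_. lborel))" .
  qed
  also have "\<dots> = (\<integral>\<^sup>+w. (\<Prod>k\<in>insert i J. ennreal (r * gamma_density \<alpha> (r * w k))) * F (\<lambda>k\<in>insert i J. r * w k)
      \<partial>PiM (insert i J) (\<lambda>_. lborel))"
  proof (rule L.product_nn_integral_insert_rev[OF insert.hyps, symmetric])
    have "(\<lambda>x. (\<lambda>k\<in>insert i J. r * x k)) \<in> PiM (insert i J) (\<lambda>_. lborel) \<rightarrow>\<^sub>M PiM (insert i J) (\<lambda>_. borel)"
      by measurable
    from measurable_compose[OF this insert.prems]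
    have [measurable]: "(\<lambda>x. F (\<lambda>k\<in>insert i J. r * x k)) \<in> borel_measurable (PiM (insert i J) (\<lambda>_. lborel))" .
    show "(\<lambda>w. (\<Prod>k\<in>insert i J. ennreal (r * gamma_density \<alpha> (r * w k))) * F (\<lambda>k\<in>insert i J. r * w k))
      \<in> borel_measurable (PiM (insert i J) (\<lambda>_. lborel))"
      by measurable
  qed
  finally show ?case .
qed

text \<open>Euler's integral after the substitution \<open>t = s a\<close>.\<close>

lemma nn_integral_powr_exp:
  assumes p: "p > 0" and s: "s > 0"
  shows "(\<integral>\<^sup>+a. indicator {0<..} a * ennreal (a powr (p - 1) * exp (- (a * s))) \<partial>lborel) = ennreal (Gamma p * s powr (- p))"
proof -
  have "ennreal (Gamma p) = (\<integral>\<^sup>+t. ennreal (indicator {0..} t * t powr (p - 1) / exp t) \<partial>lborel)"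
    by (rule Gamma_conv_nn_integral_real[OF p])
  also have "\<dots> = (\<integral>\<^sup>+t. indicator {0<..} t * ennreal (t powr (p - 1) * exp (- t)) \<partial>lborel)"
    by (rule nn_integral_cong_AE, rule AE_mp[OF AE_lborel_singleton[of 0]])
       (auto simp: indicator_def exp_minus divide_inverse)
  also have "\<dots> = ennreal s * (\<integral>\<^sup>+a. indicator {0<..} (s * a) * ennreal ((s * a) powr (p - 1) * exp (- (s * a))) \<partial>lborel)"
    using s by (subst nn_integral_real_affine[where c = s and t = 0]) auto
  also have "\<dots> = (\<integral>\<^sup>+a. ennreal (s powr p) * (indicator {0<..} a * ennreal (a powr (p - 1) * exp (- (a * s)))) \<partial>lborel)"
  proof (subst nn_integral_cmult[symmetric])
    show "(\<integral>\<^sup>+a. ennreal s * (indicator {0<..} (s * a) * ennreal ((s * a) powr (p - 1) * exp (- (s * a)))) \<partial>lborel) =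
       (\<integral>\<^sup>+a. ennreal (s powr p) * (indicator {0<..} a * ennreal (a powr (p - 1) * exp (- (a * s)))) \<partial>lborel)"
    proof (intro nn_integral_cong)
      fix a :: real
      show "ennreal s * (indicator {0<..} (s * a) * ennreal ((s * a) powr (p - 1) * exp (- (s * a)))) =
        ennreal (s powr p) * (indicator {0<..} a * ennreal (a powr (p - 1) * exp (- (a * s))))"
      proof (cases "a > 0")
        case True
        have "s * (s * a) powr (p - 1) = s powr p * a powr (p - 1)"
          using s True by (simp add: powr_mult powr_diff)
        hence "s * ((s * a) powr (p - 1) * exp (- (s * a))) = s powr p * (a powr (p - 1) * exp (- (a * s)))"
          by (simp add: mult_ac)
        thus ?thesis using True s by (simp add: ennreal_mult'[symmetric])
      next
        case False
        hence "\<not> s * a > 0" using s by (simp add: mult_le_0_iff not_less)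
        thus ?thesis using False by simp
      qed
    qed
  qed auto
  also have "\<dots> = ennreal (s powr p) * (\<integral>\<^sup>+a. indicator {0<..} a * ennreal (a powr (p - 1) * exp (- (a * s))) \<partial>lborel)"
    by (subst nn_integral_cmult) auto
  finally have "ennreal (s powr (- p)) * ennreal (Gamma p) =
     ennreal (s powr (- p) * s powr p) * (\<integral>\<^sup>+a. indicator {0<..} a * ennreal (a powr (p - 1) * exp (- (a * s))) \<partial>lborel)"
    by (simp add: ennreal_mult' mult.assoc)
  also have "s powr (- p) * s powr p = 1" using s by (simp flip: powr_add)
  finally show ?thesis using p by (simp add: ennreal_mult'[symmetric] mult.commute)
qed

lemma nn_integral_rotate3:
  assumes sf: "sigma_finite_measure A" "sigma_finite_measure B" "sigma_finite_measure C"
  assumes K [measurable]: "(\<lambda>(a, t, w). K a t w) \<in> borel_measurable (A \<Otimes>\<^sub>M (B \<Otimes>\<^sub>M C))"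
  shows "(\<integral>\<^sup>+a. \<integral>\<^sup>+t. \<integral>\<^sup>+w. K a t w \<partial>C \<partial>B \<partial>A) = (\<integral>\<^sup>+w. \<integral>\<^sup>+t. \<integral>\<^sup>+a. (K a t w :: ennreal) \<partial>A \<partial>B \<partial>C)"
proof -
  interpret A: sigma_finite_measure A by fact
  interpret B: sigma_finite_measure B by fact
  interpret C: sigma_finite_measure C by fact
  interpret AB: pair_sigma_finite A B ..
  interpret AC: pair_sigma_finite A C ..
  interpret BC: pair_sigma_finite B C ..
  have [measurable (raw)]: "(\<lambda>x. K (f x) (g x) (h x)) \<in> borel_measurable N"
    if [measurable]: "f \<in> N \<rightarrow>\<^sub>M A" "g \<in> N \<rightarrow>\<^sub>M B" "h \<in> N \<rightarrow>\<^sub>M C" for f g h and N :: "'z measure"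
    using measurable_compose[OF _ K, of "\<lambda>x. (f x, g x, h x)" N] by simp
  have "(\<integral>\<^sup>+a. \<integral>\<^sup>+t. \<integral>\<^sup>+w. K a t w \<partial>C \<partial>B \<partial>A) = (\<integral>\<^sup>+a. \<integral>\<^sup>+w. \<integral>\<^sup>+t. K a t w \<partial>B \<partial>C \<partial>A)"
    by (intro nn_integral_cong BC.Fubini'[symmetric]) measurable
  also have "\<dots> = (\<integral>\<^sup>+w. \<integral>\<^sup>+a. \<integral>\<^sup>+t. K a t w \<partial>B \<partial>A \<partial>C)"
    by (rule AC.Fubini'[symmetric]) measurable
  also have "\<dots> = (\<integral>\<^sup>+w. \<integral>\<^sup>+t. \<integral>\<^sup>+a. K a t w \<partial>A \<partial>B \<partial>C)"
    by (intro nn_integral_cong AB.Fubini'[symmetric]) measurable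
  finally show ?thesis .
qed

text \<open>The quotient of the \<open>l\<^sub>1\<close> norm and the \<open>l\<^sub>2\<close> norm of a positive vector: \<open>1 / U\<close>, or \<open>\<surd>n C\<close>.\<close>

definition norm_ratio :: "'i set \<Rightarrow> ('i \<Rightarrow> real) \<Rightarrow> real" where
  "norm_ratio I x = (\<Sum>k\<in>I. x k) / sqrt (\<Sum>k\<in>I. (x k)\<^sup>2)"

text \<open>With \<open>i\<close> and \<open>j\<close> running over the pairs of distinct indices and \<open>J\<close> being the set of the remaining ones, these sets partition
  the positive vectors up to ties: \<open>i\<close> is the index of the largest entry and \<open>j\<close> that of the second largest.\<close>

definition sector :: "'i \<Rightarrow> 'i \<Rightarrow> 'i set \<Rightarrow> ('i \<Rightarrow> real) set" where
  "sector i j J = {x. 0 < x j \<and> x j < x i \<and> (\<forall>k\<in>J. 0 < x k \<and> x k < x j)}"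

text \<open>The norm ratio of a vector with entries \<open>a\<close>, \<open>a t\<close> and \<open>a t w\<^sub>k\<close>, where \<open>L = 1 + \<Sum> w\<^sub>k\<close> and \<open>N = 1 + \<Sum> w\<^sub>k\<^sup>2\<close> are the two
  quantities defined next.\<close>

definition sector_ratio :: "real \<Rightarrow> real \<Rightarrow> real \<Rightarrow> real" where
  "sector_ratio L N t = (1 + t * L) / sqrt (1 + t\<^sup>2 * N)"

definition sum1 :: "'i set \<Rightarrow> ('i \<Rightarrow> real) \<Rightarrow> real" where
  "sum1 J w = 1 + (\<Sum>k\<in>J. w k)"

definition sumsq1 :: "'i set \<Rightarrow> ('i \<Rightarrow> real) \<Rightarrow> real" where
  "sumsq1 J w = 1 + (\<Sum>k\<in>J. (w k)\<^sup>2)"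

lemma norm_ratio_sector:
  assumes "finite J" "i \<noteq> j" "i \<notin> J" "j \<notin> J" "a > 0"
  shows "norm_ratio (insert i (insert j J)) ((\<lambda>k\<in>J. (a * t) * w k)(j := a * t, i := a))
       = sector_ratio (sum1 J w) (sumsq1 J w) t"
proof -
  let ?x = "(\<lambda>k\<in>J. (a * t) * w k)(j := a * t, i := a)"
  have "(\<Sum>k\<in>J. ?x k) = (\<Sum>k\<in>J. a * t * w k)" using assms by (intro sum.cong) auto
  hence s: "(\<Sum>k\<in>insert i (insert j J). ?x k) = a * (1 + t * sum1 J w)"
    using assms by (simp add: sum1_def algebra_simps sum_distrib_left)
  have "(\<Sum>k\<in>J. (?x k)\<^sup>2) = (\<Sum>k\<in>J. (a * t * w k)\<^sup>2)" using assms by (intro sum.cong) auto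
  hence q: "(\<Sum>k\<in>insert i (insert j J). (?x k)\<^sup>2) = a\<^sup>2 * (1 + t\<^sup>2 * sumsq1 J w)"
    using assms by (simp add: sumsq1_def algebra_simps sum_distrib_left power_mult_distrib)
  show ?thesis using assms(5)
    unfolding norm_ratio_def s q sector_ratio_def by (simp add: real_sqrt_mult)
qed

lemma sector_scaled_iff:
  assumes "i \<noteq> j" "i \<notin> J" "j \<notin> J" "a > 0"
  shows "((\<lambda>k\<in>J. (a * t) * w k)(j := a * t, i := a)) \<in> sector i j J \<longleftrightarrow>
         0 < t \<and> t < 1 \<and> (\<forall>k\<in>J. 0 < w k \<and> w k < 1)"
proof -
  have "((\<lambda>k\<in>J. (a * t) * w k)(j := a * t, i := a)) k = a * t * w k" if "k \<in> J" for k
    using that assms by auto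
  hence "((\<lambda>k\<in>J. (a * t) * w k)(j := a * t, i := a)) \<in> sector i j J \<longleftrightarrow>
     0 < a * t \<and> a * t < a \<and> (\<forall>k\<in>J. 0 < a * t * w k \<and> a * t * w k < a * t)"
    using assms by (simp add: sector_def)
  also have "\<dots> \<longleftrightarrow> 0 < t \<and> t < 1 \<and> (\<forall>k\<in>J. 0 < w k \<and> w k < 1)"
  proof (cases "t > 0")
    case True
    hence at: "a * t > 0" using assms by simp
    have "a * t < a \<longleftrightarrow> t < 1" using mult_less_cancel_left_pos[OF \<open>a > 0\<close>, of t 1] by simp
    moreover have "0 < a * t * y \<longleftrightarrow> 0 < y" for y using at zero_less_mult_pos[of "a * t" y] mult_pos_pos[of "a * t" y] by blast
    moreover have "a * t * y < a * t \<longleftrightarrow> y < 1" for y using mult_less_cancel_left_pos[OF at, of y 1] by simp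
    ultimately show ?thesis using True at by simp
  next
    case False
    thus ?thesis using assms by (simp add: zero_less_mult_iff)
  qed
  finally show ?thesis .
qed

text \<open>The factors \<open>a\<close> and \<open>a t\<close> are the Jacobian of \<open>(a, t, w) \<mapsto> (a, a t, a t w)\<close>. The powers of \<open>a\<close> and \<open>t\<close> collect to
  \<open>\<alpha>n - 1\<close> and \<open>\<alpha>(n - 1) - 1\<close>, where \<open>n = card J + 2\<close>.\<close>

lemma sector_density_identity:
  assumes \<alpha>: "\<alpha> > 0" and a: "a > 0" and t: "t > 0" and w: "\<And>k. k \<in> J \<Longrightarrow> w k > 0" and fin: "finite J"
  shows "gamma_density \<alpha> a * (a * gamma_density \<alpha> (a * t)) * (\<Prod>k\<in>J. a * t * gamma_density \<alpha> (a * t * w k)) =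
    (\<Prod>k\<in>J. w k powr (\<alpha> - 1)) * t powr (\<alpha> * real (card J + 1) - 1) *
     ((1 / Gamma \<alpha> ^ (card J + 2)) * (a powr (\<alpha> * real (card J + 2) - 1) * exp (- (a * (1 + t * sum1 J w)))))"
proof -
  let ?m = "card J"
  have P: "(\<Prod>k\<in>J. a * t * gamma_density \<alpha> (a * t * w k)) =
     (\<Prod>k\<in>J. w k powr (\<alpha> - 1)) * (a powr (\<alpha> * ?m) * t powr (\<alpha> * ?m)) * exp (- (a * t * (\<Sum>k\<in>J. w k))) / Gamma \<alpha> ^ ?m"
  proof -
    have "a * t * gamma_density \<alpha> (a * t * w k) =
      w k powr (\<alpha> - 1) * (a powr \<alpha> * t powr \<alpha>) * exp (- (a * t * w k)) / Gamma \<alpha>" if "k \<in> J" for k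
      using a t w[OF that] by (simp add: gamma_density_def powr_mult powr_diff)
    hence "(\<Prod>k\<in>J. a * t * gamma_density \<alpha> (a * t * w k)) =
      (\<Prod>k\<in>J. w k powr (\<alpha> - 1) * (a powr \<alpha> * t powr \<alpha>) * exp (- (a * t * w k)) / Gamma \<alpha>)"
      by (rule prod.cong[OF refl])
    also have "\<dots> = (\<Prod>k\<in>J. w k powr (\<alpha> - 1)) * (a powr \<alpha> * t powr \<alpha>) ^ ?m * exp (- (a * t * (\<Sum>k\<in>J. w k))) / Gamma \<alpha> ^ ?m"
      using fin by (simp add: prod_dividef prod.distrib exp_sum[symmetric] sum_distrib_left sum_negf)
    also have "(a powr \<alpha> * t powr \<alpha>) ^ ?m = a powr (\<alpha> * ?m) * t powr (\<alpha> * ?m)"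
      using a t by (simp add: power_mult_distrib powr_powr[symmetric] powr_realpow)
    finally show ?thesis .
  qed
  have ea: "a powr (\<alpha> * real (?m + 2) - 1) = a powr (\<alpha> - 1) * a powr \<alpha> * a powr (\<alpha> * ?m)"
    by (simp add: algebra_simps flip: powr_add)
  have et: "t powr (\<alpha> * real (?m + 1) - 1) = t powr (\<alpha> - 1) * t powr (\<alpha> * ?m)"
    by (simp add: algebra_simps flip: powr_add)
  have ex: "exp (- (a * (1 + t * sum1 J w))) = exp (- a) * exp (- (a * t)) * exp (- (a * t * (\<Sum>k\<in>J. w k)))"
    by (simp add: sum1_def algebra_simps flip: exp_add)
  have g1: "gamma_density \<alpha> a = a powr (\<alpha> - 1) * exp (- a) / Gamma \<alpha>"
    using a by (simp add: gamma_density_def)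
  have g2: "a * gamma_density \<alpha> (a * t) = a powr \<alpha> * t powr (\<alpha> - 1) * exp (- (a * t)) / Gamma \<alpha>"
    using a t by (simp add: gamma_density_def powr_mult powr_diff)
  show ?thesis unfolding P ea et ex g1 g2 by (simp add: field_simps power_add power2_eq_square)
qed

lemma measurable_sector [measurable]:
  assumes "finite J" "i \<in> I" "j \<in> I" "J \<subseteq> I"
  shows "Measurable.pred (PiM I (\<lambda>_. borel)) (\<lambda>x. x \<in> sector i j J)"
proof -
  have [measurable]: "(\<lambda>x. x k) \<in> borel_measurable (PiM I (\<lambda>_. borel :: real measure))" if "k \<in> I" for k
    using that by measurable
  have 1: "Measurable.pred (PiM I (\<lambda>_. borel)) (\<lambda>x. x k < (x l :: real))" if "k \<in> I" "l \<in> I" for k l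
    using that by measurable
  have 2: "Measurable.pred (PiM I (\<lambda>_. borel)) (\<lambda>x. 0 < (x k :: real))" if "k \<in> I" for k
    using that by measurable
  have "Measurable.pred (PiM I (\<lambda>_. borel)) (\<lambda>x::'a \<Rightarrow> real. 0 < x j \<and> x j < x i \<and> (\<forall>k\<in>J. 0 < x k \<and> x k < x j))"
    using assms by (intro pred_intros_logic(3) pred_intros_finite(3) 1 2) auto
  thus ?thesis by (simp add: sector_def)
qed

lemma measurable_norm_ratio [measurable]:
  "norm_ratio I \<in> borel_measurable (PiM I (\<lambda>_. borel))"
  unfolding norm_ratio_def[abs_def] by measurable

lemma measurable_sum1 [measurable]:
  "sum1 J \<in> borel_measurable (PiM J (\<lambda>_. borel))" "sumsq1 J \<in> borel_measurable (PiM J (\<lambda>_. borel))"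
  unfolding sum1_def[abs_def] sumsq1_def[abs_def] by measurable

lemma measurable_sector_ratio [measurable (raw)]:
  assumes [measurable]: "f \<in> borel_measurable M" "g \<in> borel_measurable M" "h \<in> borel_measurable M"
  shows "(\<lambda>x. sector_ratio (f x) (g x) (h x)) \<in> borel_measurable M"
  unfolding sector_ratio_def by measurable

text \<open>Homogeneity: neither the ratio nor the quotient of the two largest entries depends on the scale \<open>a\<close>, so \<open>a\<close> occurs
  only in \<open>a powr (p - 1) * exp (- a (1 + t L))\<close> and can be integrated out. The set \<open>T\<close> restricts \<open>t = x\<^sub>j / x\<^sub>i\<close>.\<close>

theorem nn_integral_sector:
  fixes J :: "'i set" and \<phi> :: "real \<Rightarrow> ennreal"
  assumes fin: "finite J" and ij: "i \<noteq> j" "i \<notin> J" "j \<notin> J" and \<alpha>: "\<alpha> > 0"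
    and [measurable]: "\<phi> \<in> borel_measurable borel" "T \<in> sets borel"
  defines "p \<equiv> \<alpha> * real (card J + 2)" and "\<beta> \<equiv> \<alpha> * real (card J + 1)"
  shows "(\<integral>\<^sup>+x. indicator (sector i j J) x * (indicator T (x j / x i) * \<phi> (norm_ratio (insert i (insert j J)) x))
            \<partial>PiM (insert i (insert j J)) (\<lambda>_. gamma_measure \<alpha>)) =
    (\<integral>\<^sup>+w. (\<Prod>k\<in>J. indicator {0<..<1} (w k) * ennreal (w k powr (\<alpha> - 1))) *
       (\<integral>\<^sup>+t. indicator ({0<..<1} \<inter> T) t * \<phi> (sector_ratio (sum1 J w) (sumsq1 J w) t) *
          ennreal (Gamma p / Gamma \<alpha> ^ (card J + 2) * (t powr (\<beta> - 1) * (1 + t * sum1 J w) powr (- p))) \<partial>lborel)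
      \<partial>PiM J (\<lambda>_. lborel))"
proof -
  let ?I = "insert i (insert j J)"
  interpret G: product_sigma_finite "\<lambda>_. gamma_measure \<alpha>"
    using sigma_finite_gamma_measure[OF \<alpha>] by (intro product_sigma_finite.intro)
  interpret L: product_sigma_finite "\<lambda>_. lborel :: real measure" ..
  have sG [measurable_cong]: "sets (PiM K (\<lambda>_. gamma_measure \<alpha>)) = sets (PiM K (\<lambda>_. borel))" for K :: "'i set"
    by (intro sets_PiM_cong) auto
  have sL [measurable_cong]: "sets (PiM K (\<lambda>_. lborel :: real measure)) = sets (PiM K (\<lambda>_. borel))" for K :: "'i set"
    by (intro sets_PiM_cong) auto
  have p: "p > 0" using \<alpha> by (simp add: p_def)
  have G0: "Gamma \<alpha> > 0" using \<alpha> by (simp add: Gamma_real_pos)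
  define F where "F = (\<lambda>x. indicator (sector i j J) x * (indicator T (x j / x i) * \<phi> (norm_ratio ?I x)))"
  have mS: "Measurable.pred (PiM ?I (\<lambda>_. borel)) (\<lambda>x. x \<in> sector i j J)"
    by (rule measurable_sector) (use fin in auto)
  have mF [measurable]: "F \<in> borel_measurable (PiM ?I (\<lambda>_. borel))"
  proof -
    have [measurable]: "(\<lambda>x. indicator (sector i j J) x :: ennreal) \<in> borel_measurable (PiM ?I (\<lambda>_. borel))"
      using mS by (intro borel_measurable_indicator') (auto simp: pred_def)
    have [measurable]: "(\<lambda>x. x i) \<in> borel_measurable (PiM ?I (\<lambda>_. borel :: real measure))"
         "(\<lambda>x. x j) \<in> borel_measurable (PiM ?I (\<lambda>_. borel :: real measure))"
      by measurable
    show ?thesis unfolding F_def by measurable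
  qed
  (* The integrand in the coordinates (a, t, w), with the factor depending on a put last. *)
  define K where "K = (\<lambda>a t w.
     (\<Prod>k\<in>J. indicator {0<..<1} (w k) * ennreal (w k powr (\<alpha> - 1))) *
       ((indicator ({0<..<1} \<inter> T) t * \<phi> (sector_ratio (sum1 J w) (sumsq1 J w) t) *
          ennreal (t powr (\<beta> - 1) / Gamma \<alpha> ^ (card J + 2))) *
        (indicator {0<..} a * ennreal (a powr (p - 1) * exp (- (a * (1 + t * sum1 J w)))))))"
  have mK [measurable]: "(\<lambda>(a, t, w). K a t w) \<in> borel_measurable (lborel \<Otimes>\<^sub>M (lborel \<Otimes>\<^sub>M PiM J (\<lambda>_. lborel)))"
    unfolding K_def by measurable
  have upd: "(\<lambda>y. F ((fst (h y))(j := f y, i := g y))) \<in> borel_measurable M'"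
    if [measurable]: "h \<in> M' \<rightarrow>\<^sub>M (PiM J (\<lambda>_. borel) \<Otimes>\<^sub>M borel)" "f \<in> borel_measurable M'" "g \<in> borel_measurable M'"
    for M' :: "'z measure" and f g and h :: "'z \<Rightarrow> ('i \<Rightarrow> real) \<times> real"
  proof -
    have 1: "(\<lambda>y. fst (h y)) \<in> M' \<rightarrow>\<^sub>M PiM J (\<lambda>_. borel)" by measurable
    have 2: "(\<lambda>y. (fst (h y))(j := f y)) \<in> M' \<rightarrow>\<^sub>M PiM (insert j J) (\<lambda>_. borel)"
      by (rule measurable_fun_upd[where J = J]) (use 1 in auto)
    have 3: "(\<lambda>y. (fst (h y))(j := f y, i := g y)) \<in> M' \<rightarrow>\<^sub>M PiM ?I (\<lambda>_. borel)"
      by (rule measurable_fun_upd[where J = "insert j J"]) (use 2 in auto)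
    from measurable_compose[OF 3 mF] show ?thesis .
  qed
  have m2: "(\<lambda>z. F (z(j := b, i := a))) \<in> borel_measurable (PiM J (\<lambda>_. borel))" for a b
    using upd[of "\<lambda>z. (z, 0)" "PiM J (\<lambda>_. borel)" "\<lambda>_. b" "\<lambda>_. a"] by simp
  have m1: "(\<lambda>x. F (x(i := a))) \<in> borel_measurable (PiM (insert j J) (\<lambda>_. borel))" for a
  proof -
    have "(\<lambda>x. x(i := a)) \<in> PiM (insert j J) (\<lambda>_. borel) \<rightarrow>\<^sub>M PiM ?I (\<lambda>_. borel)"
      by (rule measurable_fun_upd[where J = "insert j J"]) auto
    from measurable_compose[OF this mF] show ?thesis .
  qed
  have sfJ: "sigma_finite_measure (PiM J (\<lambda>_. gamma_measure \<alpha>))" by (rule G.sigma_finite) fact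
  have sfJ1: "sigma_finite_measure (PiM (insert j J) (\<lambda>_. gamma_measure \<alpha>))" by (rule G.sigma_finite) (use fin in simp)
  have m3: "(\<lambda>b. \<integral>\<^sup>+z. F (z(j := b, i := a)) \<partial>PiM J (\<lambda>_. gamma_measure \<alpha>)) \<in> borel_measurable borel" for a
  proof -
    interpret sigma_finite_measure "PiM J (\<lambda>_. gamma_measure \<alpha>)" by fact
    have "(\<lambda>y. F ((snd y)(j := fst y, i := a))) \<in> borel_measurable (borel \<Otimes>\<^sub>M PiM J (\<lambda>_. gamma_measure \<alpha>))"
      using upd[of "\<lambda>y. (snd y, fst y)" "borel \<Otimes>\<^sub>M PiM J (\<lambda>_. gamma_measure \<alpha>)" fst "\<lambda>_. a"] by simp
    thus ?thesis by (intro borel_measurable_nn_integral) (simp add: case_prod_unfold)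
  qed
  have m4: "(\<lambda>a. \<integral>\<^sup>+x. F (x(i := a)) \<partial>PiM (insert j J) (\<lambda>_. gamma_measure \<alpha>)) \<in> borel_measurable borel"
  proof -
    interpret sigma_finite_measure "PiM (insert j J) (\<lambda>_. gamma_measure \<alpha>)" by fact
    have "(\<lambda>y. (snd y)(i := fst y)) \<in> borel \<Otimes>\<^sub>M PiM (insert j J) (\<lambda>_. gamma_measure \<alpha>) \<rightarrow>\<^sub>M PiM ?I (\<lambda>_. borel)"
      by (rule measurable_fun_upd[where J = "insert j J"]) auto
    from measurable_compose[OF this mF]
    have "(\<lambda>y. F ((snd y)(i := fst y))) \<in> borel_measurable (borel \<Otimes>\<^sub>M PiM (insert j J) (\<lambda>_. gamma_measure \<alpha>))" .
    thus ?thesis by (intro borel_measurable_nn_integral) (simp add: case_prod_unfold)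
  qed
  (* The three gamma densities and the Jacobian of the substitutions multiply to K. *)
  have point: "ennreal (gamma_density \<alpha> a) * (ennreal (a * gamma_density \<alpha> (a * t)) *
       ((\<Prod>k\<in>J. ennreal ((a * t) * gamma_density \<alpha> ((a * t) * w k))) * F ((\<lambda>k\<in>J. (a * t) * w k)(j := a * t, i := a)))) = K a t w"
    if a: "a > 0" and t: "t > 0" for a t w
  proof (cases "t < 1 \<and> (\<forall>k\<in>J. 0 < w k \<and> w k < 1) \<and> t \<in> T")
    case True
    let ?x = "(\<lambda>k\<in>J. (a * t) * w k)(j := a * t, i := a)"
    have Fx: "F ?x = \<phi> (sector_ratio (sum1 J w) (sumsq1 J w) t)"
      using True t a ij sector_scaled_iff[OF ij a, of t w] norm_ratio_sector[OF fin ij a, of t w]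
      by (simp add: F_def)
    have gd: "0 \<le> gamma_density \<alpha> x" for x by (rule gamma_density_nonneg[OF \<alpha>])
    have P1: "(\<Prod>k\<in>J. ennreal ((a * t) * gamma_density \<alpha> ((a * t) * w k))) = ennreal (\<Prod>k\<in>J. (a * t) * gamma_density \<alpha> ((a * t) * w k))"
      using a t gd by (intro prod_ennreal) auto
    have P2: "(\<Prod>k\<in>J. indicator {0<..<1} (w k) * ennreal (w k powr (\<alpha> - 1))) = ennreal (\<Prod>k\<in>J. w k powr (\<alpha> - 1))"
    proof -
      have "(\<Prod>k\<in>J. indicator {0<..<1} (w k) * ennreal (w k powr (\<alpha> - 1))) = (\<Prod>k\<in>J. ennreal (w k powr (\<alpha> - 1)))"
        using True by (intro prod.cong) auto
      thus ?thesis by (simp add: prod_ennreal)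
    qed
    have "ennreal (gamma_density \<alpha> a) * (ennreal (a * gamma_density \<alpha> (a * t)) *
       ((\<Prod>k\<in>J. ennreal ((a * t) * gamma_density \<alpha> ((a * t) * w k))) * F ?x)) =
       \<phi> (sector_ratio (sum1 J w) (sumsq1 J w) t) *
       ennreal (gamma_density \<alpha> a * (a * gamma_density \<alpha> (a * t)) * (\<Prod>k\<in>J. (a * t) * gamma_density \<alpha> ((a * t) * w k)))"
      unfolding P1 Fx using a gd by (simp add: ennreal_mult' mult_ac)
    also have "gamma_density \<alpha> a * (a * gamma_density \<alpha> (a * t)) * (\<Prod>k\<in>J. (a * t) * gamma_density \<alpha> ((a * t) * w k)) =
      (\<Prod>k\<in>J. w k powr (\<alpha> - 1)) * ((t powr (\<beta> - 1) / Gamma \<alpha> ^ (card J + 2)) *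
        (a powr (p - 1) * exp (- (a * (1 + t * sum1 J w)))))"
      using sector_density_identity[OF \<alpha> a t, of J w] True fin by (simp add: p_def \<beta>_def)
    also have "ennreal \<dots> = ennreal (\<Prod>k\<in>J. w k powr (\<alpha> - 1)) * (ennreal (t powr (\<beta> - 1) / Gamma \<alpha> ^ (card J + 2)) *
        ennreal (a powr (p - 1) * exp (- (a * (1 + t * sum1 J w)))))"
    proof -
      have em: "ennreal (u * (v * z)) = ennreal u * (ennreal v * ennreal z)" if "u \<ge> 0" "v \<ge> 0" "z \<ge> 0" for u v z
        using that by (simp add: ennreal_mult)
      show ?thesis by (rule em) (use G0 in \<open>auto simp: prod_nonneg\<close>)
    qed
    also have "\<phi> (sector_ratio (sum1 J w) (sumsq1 J w) t) * \<dots> = K a t w"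
      unfolding K_def P2 using True a t by (simp add: mult_ac)
    finally show ?thesis .
  next
    case False
    have "F ((\<lambda>k\<in>J. (a * t) * w k)(j := a * t, i := a)) = 0"
      using False t a ij sector_scaled_iff[OF ij a, of t w] by (auto simp: F_def indicator_def)
    moreover have "K a t w = 0"
    proof (cases "t < 1 \<and> t \<in> T")
      case True
      with False obtain k where "k \<in> J" "\<not> (0 < w k \<and> w k < 1)" by blast
      hence "(\<Prod>k\<in>J. indicator {0<..<1} (w k) * ennreal (w k powr (\<alpha> - 1))) = 0"
        using fin by (intro prod_zero[OF _ bexI[of _ k]]) auto
      thus ?thesis by (simp add: K_def)
    qed (auto simp: K_def)
    ultimately show ?thesis by simp
  qed
  have "(\<integral>\<^sup>+x. F x \<partial>PiM ?I (\<lambda>_. gamma_measure \<alpha>)) =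
     (\<integral>\<^sup>+a. \<integral>\<^sup>+x. F (x(i := a)) \<partial>PiM (insert j J) (\<lambda>_. gamma_measure \<alpha>) \<partial>gamma_measure \<alpha>)"
    by (rule G.product_nn_integral_insert_rev) (use fin ij in \<open>auto simp: mF cong: measurable_cong_sets\<close>)
  also have "\<dots> = (\<integral>\<^sup>+a. ennreal (1 * gamma_density \<alpha> (1 * a)) *
      (\<integral>\<^sup>+x. F (x(i := 1 * a)) \<partial>PiM (insert j J) (\<lambda>_. gamma_measure \<alpha>)) \<partial>lborel)"
    by (rule nn_integral_gamma_measure_scale[OF m4]) simp
  also have "\<dots> = (\<integral>\<^sup>+a. \<integral>\<^sup>+t. \<integral>\<^sup>+w. K a t w \<partial>PiM J (\<lambda>_. lborel) \<partial>lborel \<partial>lborel)"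
  proof (intro nn_integral_cong)
    fix a :: real
    show "ennreal (1 * gamma_density \<alpha> (1 * a)) * (\<integral>\<^sup>+x. F (x(i := 1 * a)) \<partial>PiM (insert j J) (\<lambda>_. gamma_measure \<alpha>)) =
       (\<integral>\<^sup>+t. \<integral>\<^sup>+w. K a t w \<partial>PiM J (\<lambda>_. lborel) \<partial>lborel)"
    proof (cases "a > 0")
      case False
      thus ?thesis by (simp add: gamma_density_def K_def)
    next
      case a: True
      have "(\<integral>\<^sup>+x. F (x(i := a)) \<partial>PiM (insert j J) (\<lambda>_. gamma_measure \<alpha>)) =
        (\<integral>\<^sup>+b. \<integral>\<^sup>+z. F (z(j := b, i := a)) \<partial>PiM J (\<lambda>_. gamma_measure \<alpha>) \<partial>gamma_measure \<alpha>)"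
        using G.product_nn_integral_insert_rev[OF fin ij(3), of "\<lambda>x. F (x(i := a))"] m1[of a]
        by (simp cong: measurable_cong_sets)
      also have "\<dots> = (\<integral>\<^sup>+t. ennreal (a * gamma_density \<alpha> (a * t)) *
           (\<integral>\<^sup>+z. F (z(j := a * t, i := a)) \<partial>PiM J (\<lambda>_. gamma_measure \<alpha>)) \<partial>lborel)"
        by (rule nn_integral_gamma_measure_scale[OF m3 a])
      finally have eq: "(\<integral>\<^sup>+x. F (x(i := a)) \<partial>PiM (insert j J) (\<lambda>_. gamma_measure \<alpha>)) = \<dots>" .
      have "ennreal (gamma_density \<alpha> a) * (\<integral>\<^sup>+x. F (x(i := a)) \<partial>PiM (insert j J) (\<lambda>_. gamma_measure \<alpha>)) =
         (\<integral>\<^sup>+t. ennreal (gamma_density \<alpha> a) * (ennreal (a * gamma_density \<alpha> (a * t)) *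
           (\<integral>\<^sup>+z. F (z(j := a * t, i := a)) \<partial>PiM J (\<lambda>_. gamma_measure \<alpha>))) \<partial>lborel)"
        unfolding eq
      proof (subst nn_integral_cmult)
        note [measurable] = measurable_compose[OF _ m3[of a]]
        show "(\<lambda>t. ennreal (a * gamma_density \<alpha> (a * t)) *
           (\<integral>\<^sup>+z. F (z(j := a * t, i := a)) \<partial>PiM J (\<lambda>_. gamma_measure \<alpha>))) \<in> borel_measurable lborel"
          by measurable
      qed simp
      also have "\<dots> = (\<integral>\<^sup>+t. \<integral>\<^sup>+w. K a t w \<partial>PiM J (\<lambda>_. lborel) \<partial>lborel)"
      proof (intro nn_integral_cong)
        fix t :: real
        show "ennreal (gamma_density \<alpha> a) * (ennreal (a * gamma_density \<alpha> (a * t)) *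
           (\<integral>\<^sup>+z. F (z(j := a * t, i := a)) \<partial>PiM J (\<lambda>_. gamma_measure \<alpha>))) = (\<integral>\<^sup>+w. K a t w \<partial>PiM J (\<lambda>_. lborel))"
        proof (cases "t > 0")
          case False
          thus ?thesis using a by (simp add: gamma_density_def K_def zero_less_mult_iff)
        next
          case t: True
          have at: "a * t > 0" using a t by simp
          have [measurable]: "(\<lambda>w. F ((\<lambda>k\<in>J. a * t * w k)(j := a * t, i := a))) \<in> borel_measurable (PiM J (\<lambda>_. lborel))"
          proof -
            have "(\<lambda>w. (\<lambda>k\<in>J. a * t * w k)) \<in> PiM J (\<lambda>_. lborel) \<rightarrow>\<^sub>M PiM J (\<lambda>_. borel)" by measurable
            from measurable_compose[OF this m2] show ?thesis .
          qed
          have "(\<integral>\<^sup>+z. F (z(j := a * t, i := a)) \<partial>PiM J (\<lambda>_. gamma_measure \<alpha>)) =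
            (\<integral>\<^sup>+w. (\<Prod>k\<in>J. ennreal ((a * t) * gamma_density \<alpha> ((a * t) * w k))) *
               F ((\<lambda>k\<in>J. (a * t) * w k)(j := a * t, i := a)) \<partial>PiM J (\<lambda>_. lborel))"
            by (rule nn_integral_PiM_gamma_scale[OF fin m2 at \<alpha>])
          hence "ennreal (gamma_density \<alpha> a) * (ennreal (a * gamma_density \<alpha> (a * t)) *
           (\<integral>\<^sup>+z. F (z(j := a * t, i := a)) \<partial>PiM J (\<lambda>_. gamma_measure \<alpha>))) =
            (\<integral>\<^sup>+w. ennreal (gamma_density \<alpha> a) * (ennreal (a * gamma_density \<alpha> (a * t)) * ((\<Prod>k\<in>J. ennreal ((a * t) * gamma_density \<alpha> ((a * t) * w k))) *
               F ((\<lambda>k\<in>J. (a * t) * w k)(j := a * t, i := a)))) \<partial>PiM J (\<lambda>_. lborel))"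
            by (simp only:, subst nn_integral_cmult, measurable, subst nn_integral_cmult, measurable)
          also have "\<dots> = (\<integral>\<^sup>+w. K a t w \<partial>PiM J (\<lambda>_. lborel))"
            by (simp only: point[OF a t])
          finally show ?thesis .
        qed
      qed
      finally show ?thesis by simp
    qed
  qed
  (* Tonelli makes the integral over the scale a the innermost one, where it is Euler's integral. *)
  also have "\<dots> = (\<integral>\<^sup>+w. \<integral>\<^sup>+t. \<integral>\<^sup>+a. K a t w \<partial>lborel \<partial>lborel \<partial>PiM J (\<lambda>_. lborel))"
    by (rule nn_integral_rotate3[OF _ _ _ mK]) (auto intro: lborel.sigma_finite_measure_axioms L.sigma_finite fin)
  also have "\<dots> = (\<integral>\<^sup>+w. (\<Prod>k\<in>J. indicator {0<..<1} (w k) * ennreal (w k powr (\<alpha> - 1))) *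
       (\<integral>\<^sup>+t. indicator ({0<..<1} \<inter> T) t * \<phi> (sector_ratio (sum1 J w) (sumsq1 J w) t) *
          ennreal (Gamma p / Gamma \<alpha> ^ (card J + 2) * (t powr (\<beta> - 1) * (1 + t * sum1 J w) powr (- p))) \<partial>lborel)
      \<partial>PiM J (\<lambda>_. lborel))"
  proof (intro nn_integral_cong)
    fix w :: "'i \<Rightarrow> real"
    let ?W = "\<Prod>k\<in>J. indicator {0<..<1} (w k) * ennreal (w k powr (\<alpha> - 1))"
    show "(\<integral>\<^sup>+t. \<integral>\<^sup>+a. K a t w \<partial>lborel \<partial>lborel) = ?W *
       (\<integral>\<^sup>+t. indicator ({0<..<1} \<inter> T) t * \<phi> (sector_ratio (sum1 J w) (sumsq1 J w) t) *
          ennreal (Gamma p / Gamma \<alpha> ^ (card J + 2) * (t powr (\<beta> - 1) * (1 + t * sum1 J w) powr (- p))) \<partial>lborel)"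
    proof (cases "\<forall>k\<in>J. 0 < w k \<and> w k < 1")
      case False
      then obtain k where "k \<in> J" "\<not> (0 < w k \<and> w k < 1)" by blast
      hence W0: "?W = 0" using fin by (intro prod_zero[OF _ bexI[of _ k]]) auto
      show ?thesis unfolding K_def W0 by simp
    next
      case True
      have s1: "sum1 J w \<ge> 1" unfolding sum1_def using sum_nonneg[of J w] True by (simp add: less_imp_le)
      show ?thesis
      proof (subst nn_integral_cmult[symmetric])
        show "(\<integral>\<^sup>+t. \<integral>\<^sup>+a. K a t w \<partial>lborel \<partial>lborel) =
          (\<integral>\<^sup>+t. ?W * (indicator ({0<..<1} \<inter> T) t * \<phi> (sector_ratio (sum1 J w) (sumsq1 J w) t) *
          ennreal (Gamma p / Gamma \<alpha> ^ (card J + 2) * (t powr (\<beta> - 1) * (1 + t * sum1 J w) powr (- p)))) \<partial>lborel)"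
        proof (intro nn_integral_cong)
          fix t :: real
          let ?V = "indicator ({0<..<1} \<inter> T) t * \<phi> (sector_ratio (sum1 J w) (sumsq1 J w) t)"
          show "(\<integral>\<^sup>+a. K a t w \<partial>lborel) = ?W * (?V *
          ennreal (Gamma p / Gamma \<alpha> ^ (card J + 2) * (t powr (\<beta> - 1) * (1 + t * sum1 J w) powr (- p))))"
          proof (cases "t > 0")
            case False
            thus ?thesis by (simp add: K_def)
          next
            case t: True
            have s: "1 + t * sum1 J w > 0" using s1 t by (simp add: add_pos_nonneg)
            have "(\<integral>\<^sup>+a. K a t w \<partial>lborel) = ?W * (?V * ennreal (t powr (\<beta> - 1) / Gamma \<alpha> ^ (card J + 2))) *
              (\<integral>\<^sup>+a. indicator {0<..} a * ennreal (a powr (p - 1) * exp (- (a * (1 + t * sum1 J w)))) \<partial>lborel)"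
              unfolding K_def mult.assoc[symmetric]
              by (subst nn_integral_cmult[symmetric]) (auto simp: mult.assoc)
            also have "\<dots> = ?W * (?V * (ennreal (t powr (\<beta> - 1) / Gamma \<alpha> ^ (card J + 2)) * ennreal (Gamma p * (1 + t * sum1 J w) powr (- p))))"
              unfolding nn_integral_powr_exp[OF p s] by (simp add: mult.assoc)
            also have "ennreal (t powr (\<beta> - 1) / Gamma \<alpha> ^ (card J + 2)) * ennreal (Gamma p * (1 + t * sum1 J w) powr (- p)) =
               ennreal (Gamma p / Gamma \<alpha> ^ (card J + 2) * (t powr (\<beta> - 1) * (1 + t * sum1 J w) powr (- p)))"
              using p G0 by (subst ennreal_mult'[symmetric]) (auto simp: Gamma_real_pos less_imp_le)
            finally show ?thesis .
          qed
        qed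
      qed measurable
    qed
  qed
  finally show ?thesis by (simp add: F_def)
qed

section \<open>The speed of the ratio along a ray\<close>

lemma sector_ratio_deriv:
  assumes "N \<ge> 0"
  shows "(sector_ratio L N has_real_derivative (L - t * N) / ((1 + t\<^sup>2 * N) * sqrt (1 + t\<^sup>2 * N))) (at t)"
proof -
  have pos: "1 + t\<^sup>2 * N > 0" using assms by (simp add: add_pos_nonneg)
  have "((\<lambda>t. (1 + t * L) / sqrt (1 + t\<^sup>2 * N)) has_real_derivative
     (L * sqrt (1 + t\<^sup>2 * N) - (1 + t * L) * (t * N / sqrt (1 + t\<^sup>2 * N))) / (sqrt (1 + t\<^sup>2 * N) * sqrt (1 + t\<^sup>2 * N))) (at t)"
    using pos by (auto intro!: derivative_eq_intros simp: field_simps)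
  also have "(L * sqrt (1 + t\<^sup>2 * N) - (1 + t * L) * (t * N / sqrt (1 + t\<^sup>2 * N))) / (sqrt (1 + t\<^sup>2 * N) * sqrt (1 + t\<^sup>2 * N))
     = (L * (sqrt (1 + t\<^sup>2 * N) * sqrt (1 + t\<^sup>2 * N)) - (1 + t * L) * (t * N)) / (sqrt (1 + t\<^sup>2 * N) * (sqrt (1 + t\<^sup>2 * N) * sqrt (1 + t\<^sup>2 * N)))"
    using pos by (simp add: field_simps del: real_sqrt_mult_self)
  also have "\<dots> = (L - t * N) / ((1 + t\<^sup>2 * N) * sqrt (1 + t\<^sup>2 * N))"
    using pos by (simp add: mult_ac power2_eq_square) (simp add: algebra_simps)
  finally show ?thesis unfolding sector_ratio_def[abs_def] .
qed

definition sector_speed :: "real \<Rightarrow> real \<Rightarrow> real \<Rightarrow> real" where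
  "sector_speed L N t = (L - t * N) / ((1 + t\<^sup>2 * N) * sqrt (1 + t\<^sup>2 * N))"

lemma sector_speed_nonneg:
  assumes "0 \<le> N" "N \<le> L" "t \<le> 1"
  shows "sector_speed L N t \<ge> 0"
proof -
  have "t * N \<le> L" using assms mult_right_mono[of t 1 N] by simp
  thus ?thesis using assms by (simp add: sector_speed_def)
qed

lemma weighted_max_bound:
  fixes x y \<eta> :: real
  assumes "x > 0" "y > 0" "0 \<le> \<eta>" "\<eta> \<le> 1"
  shows "x powr \<eta> * y powr (1 - \<eta>) \<le> x + y"
proof -
  have "x powr \<eta> * y powr (1 - \<eta>) \<le> max x y powr \<eta> * max x y powr (1 - \<eta>)"
    using assms by (intro mult_mono powr_mono2) auto
  also have "\<dots> = max x y" using assms by (simp flip: powr_add)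
  also have "\<dots> \<le> x + y" using assms by auto
  finally show ?thesis .
qed

text \<open>The numerator of the speed is at least \<open>(L - N) + (1 - t)\<close>. The geometric interpolation between the two summands
  splits its reciprocal into a singularity in \<open>w\<close> and an integrable singularity at \<open>t = 1\<close>; with only one of them the
  bound would be \<open>1 / (1 - t)\<close>, or a reciprocal of \<open>w (1 - w)\<close>, neither of which can be afforded.\<close>

lemma inverse_sector_speed_le:
  assumes N: "1 \<le> N" "N \<le> B" and d: "0 < d" "d \<le> L - N" and t: "0 < t" "t < 1" and \<eta>: "0 < \<eta>" "\<eta> < 1"
  shows "sector_speed L N t > 0"
    and "1 / sector_speed L N t \<le> (1 + B)\<^sup>2 * (d powr (- \<eta>) * (1 - t) powr (\<eta> - 1))"
proof -
  have LtN: "L - t * N \<ge> d + (1 - t)"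
  proof -
    have "L - t * N = (L - N) + (1 - t) * N" by (simp add: algebra_simps)
    moreover have "(1 - t) * N \<ge> (1 - t) * 1" by (rule mult_left_mono) (use N t in auto)
    ultimately show ?thesis using d(2) by (simp add: algebra_simps)
  qed
  have "d powr \<eta> * (1 - t) powr (1 - \<eta>) \<le> d + (1 - t)"
    using d t \<eta> by (intro weighted_max_bound) auto
  hence low: "d powr \<eta> * (1 - t) powr (1 - \<eta>) \<le> L - t * N" using LtN by linarith
  have pos0: "d powr \<eta> * (1 - t) powr (1 - \<eta>) > 0" using d t by simp
  hence pos: "L - t * N > 0" using low by linarith
  have q: "1 + t\<^sup>2 * N \<ge> 1" using N by simp
  have q2: "1 + t\<^sup>2 * N \<le> 1 + B"
  proof -
    have "t\<^sup>2 \<le> 1" using t by (simp add: power_le_one)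
    hence "t\<^sup>2 * N \<le> 1 * B" using N by (intro mult_mono) auto
    thus ?thesis by simp
  qed
  show sp: "sector_speed L N t > 0"
    using pos q by (simp add: sector_speed_def)
  have "1 / sector_speed L N t = ((1 + t\<^sup>2 * N) * sqrt (1 + t\<^sup>2 * N)) / (L - t * N)"
    by (simp add: sector_speed_def)
  also have "\<dots> \<le> ((1 + B) * (1 + B)) / (d powr \<eta> * (1 - t) powr (1 - \<eta>))"
  proof (rule frac_le[OF _ _ pos0 low])
    have "sqrt (1 + t\<^sup>2 * N) \<le> 1 + t\<^sup>2 * N" using q by (intro real_le_lsqrt self_le_power) auto
    hence "sqrt (1 + t\<^sup>2 * N) \<le> 1 + B" using q2 by linarith
    thus "(1 + t\<^sup>2 * N) * sqrt (1 + t\<^sup>2 * N) \<le> (1 + B) * (1 + B)" using q q2 by (intro mult_mono) auto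
  qed (use q2 q in auto)
  also have "\<dots> = (1 + B)\<^sup>2 * (d powr (- \<eta>) * (1 - t) powr (\<eta> - 1))"
  proof -
    have "(1 - t) powr (\<eta> - 1) = 1 / (1 - t) powr (1 - \<eta>)"
      using powr_minus_divide[of "1 - t" "1 - \<eta>"] by simp
    thus ?thesis by (simp add: power2_eq_square powr_minus_divide)
  qed
  finally show "1 / sector_speed L N t \<le> (1 + B)\<^sup>2 * (d powr (- \<eta>) * (1 - t) powr (\<eta> - 1))" .
qed

section \<open>Square integrability of the law of the ratio\<close>

definition edges :: "real \<Rightarrow> real set" where
  "edges \<tau> = {t. t \<le> \<tau> \<or> 1 - \<tau> \<le> t}"

lemma edges_borel [measurable]: "edges \<tau> \<in> sets borel"
proof -
  have "edges \<tau> = {..\<tau>} \<union> {1 - \<tau>..}" by (auto simp: edges_def)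
  thus ?thesis by simp
qed

lemma nn_integral_powr_Icc0:
  assumes "a > 0" "x \<ge> 0"
  shows "(\<integral>\<^sup>+t. indicator {0..x} t * ennreal (t powr (a - 1)) \<partial>lborel) = ennreal (x powr a / a)"
proof -
  have "((\<lambda>t. t powr (a - 1)) has_integral (x powr (a - 1 + 1) / (a - 1 + 1))) {0..x}"
    using assms by (intro has_integral_powr_from_0) auto
  from nn_integral_has_integral_lebesgue'[OF _ this] show ?thesis
    by (simp add: mult.commute)
qed

text \<open>The integrand is \<open>t powr (2\<beta> - 2)\<close> near \<open>0\<close> and \<open>(1 - t) powr (\<eta> - 1)\<close> near \<open>1\<close>, up to a factor \<open>2\<close>. Integrability at \<open>0\<close>
  is the condition \<open>\<beta> > 1/2\<close>, which is \<open>n > 1 + 1 / (2\<alpha>)\<close>.\<close>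

lemma edge_integral_le:
  assumes \<beta>: "\<beta> > 1/2" and \<eta>: "0 < \<eta>" "\<eta> < 1" and \<tau>: "0 < \<tau>" "\<tau> \<le> 1/2"
  shows "(\<integral>\<^sup>+t. indicator ({0<..<1} \<inter> edges \<tau>) t * ennreal (t powr (2 * \<beta> - 2) * (1 - t) powr (\<eta> - 1)) \<partial>lborel)
     \<le> ennreal ((2 / (2 * \<beta> - 1) + 2 / \<eta>) * \<tau> powr (min (2 * \<beta> - 1) \<eta>))"
proof -
  let ?e = "min (2 * \<beta> - 1) \<eta>"
  have b1: "(1 - t) powr (\<eta> - 1) \<le> 2" if "0 < t" "t \<le> 1/2" for t :: real
  proof -
    have "(1 - t) powr (\<eta> - 1) \<le> (1/2) powr (\<eta> - 1)" using that \<eta> by (intro powr_mono2') auto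
    also have "\<dots> \<le> (1/2) powr (-1)" using \<eta> by (intro powr_mono') auto
    finally show ?thesis by (simp add: powr_minus)
  qed
  have b2: "t powr (2 * \<beta> - 2) \<le> 2" if "1/2 \<le> t" "t < 1" for t :: real
  proof -
    have "t powr (2 * \<beta> - 2) \<le> t powr (-1)" using that \<beta> by (intro powr_mono') auto
    also have "\<dots> \<le> 2" using that by (simp add: powr_minus divide_simps)
    finally show ?thesis .
  qed
  have "(\<integral>\<^sup>+t. indicator ({0<..<1} \<inter> edges \<tau>) t * ennreal (t powr (2 * \<beta> - 2) * (1 - t) powr (\<eta> - 1)) \<partial>lborel)
    \<le> (\<integral>\<^sup>+t. ennreal 2 * (indicator {0..\<tau>} t * ennreal (t powr ((2 * \<beta> - 1) - 1)))
          + ennreal 2 * (indicator {0..\<tau>} (1 - t) * ennreal ((1 - t) powr (\<eta> - 1))) \<partial>lborel)"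
  proof (rule nn_integral_mono)
    fix t :: real
    show "indicator ({0<..<1} \<inter> edges \<tau>) t * ennreal (t powr (2 * \<beta> - 2) * (1 - t) powr (\<eta> - 1)) \<le>
      ennreal 2 * (indicator {0..\<tau>} t * ennreal (t powr ((2 * \<beta> - 1) - 1)))
          + ennreal 2 * (indicator {0..\<tau>} (1 - t) * ennreal ((1 - t) powr (\<eta> - 1)))"
    proof (cases "t \<in> {0<..<1} \<inter> edges \<tau>")
      case True
      hence t: "0 < t" "t < 1" by auto
      show ?thesis
      proof (cases "t \<le> \<tau>")
        case tt: True
        have "t powr (2 * \<beta> - 2) * (1 - t) powr (\<eta> - 1) \<le> t powr (2 * \<beta> - 2) * 2"
          using t tt \<tau> b1[of t] by (intro mult_left_mono) auto
        hence "ennreal (t powr (2 * \<beta> - 2) * (1 - t) powr (\<eta> - 1)) \<le> ennreal 2 * ennreal (t powr ((2 * \<beta> - 1) - 1))"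
          by (subst ennreal_mult'[symmetric]) (auto intro!: ennreal_leI simp: mult.commute)
        thus ?thesis using True t tt by (simp add: add_increasing2)
      next
        case False
        hence t1: "1 - \<tau> \<le> t" using True by (auto simp: edges_def)
        have "t powr (2 * \<beta> - 2) * (1 - t) powr (\<eta> - 1) \<le> 2 * (1 - t) powr (\<eta> - 1)"
          using t t1 \<tau> b2[of t] by (intro mult_right_mono) auto
        hence "ennreal (t powr (2 * \<beta> - 2) * (1 - t) powr (\<eta> - 1)) \<le> ennreal 2 * ennreal ((1 - t) powr (\<eta> - 1))"
          by (subst ennreal_mult'[symmetric]) (auto intro!: ennreal_leI)
        thus ?thesis using True t t1 by (simp add: add_increasing)
      qed
    qed simp
  qed
  also have "\<dots> = ennreal 2 * (\<integral>\<^sup>+t. indicator {0..\<tau>} t * ennreal (t powr ((2 * \<beta> - 1) - 1)) \<partial>lborel)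
     + ennreal 2 * (\<integral>\<^sup>+t. indicator {0..\<tau>} (1 - t) * ennreal ((1 - t) powr (\<eta> - 1)) \<partial>lborel)"
    by (subst nn_integral_add) (auto simp: nn_integral_cmult)
  also have "(\<integral>\<^sup>+t. indicator {0..\<tau>} (1 - t) * ennreal ((1 - t) powr (\<eta> - 1)) \<partial>lborel) =
     (\<integral>\<^sup>+t. indicator {0..\<tau>} t * ennreal (t powr (\<eta> - 1)) \<partial>lborel)"
    by (subst nn_integral_real_affine[where c = "-1" and t = 1 and f = "\<lambda>t. indicator {0..\<tau>} t * ennreal (t powr (\<eta> - 1))"]) auto
  also have "(\<integral>\<^sup>+t. indicator {0..\<tau>} t * ennreal (t powr ((2 * \<beta> - 1) - 1)) \<partial>lborel) = ennreal (\<tau> powr (2 * \<beta> - 1) / (2 * \<beta> - 1))"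
    by (rule nn_integral_powr_Icc0) (use \<beta> \<tau> in auto)
  also have "(\<integral>\<^sup>+t. indicator {0..\<tau>} t * ennreal (t powr (\<eta> - 1)) \<partial>lborel) = ennreal (\<tau> powr \<eta> / \<eta>)"
    by (rule nn_integral_powr_Icc0) (use \<eta> \<tau> in auto)
  also have "ennreal 2 * ennreal (\<tau> powr (2 * \<beta> - 1) / (2 * \<beta> - 1)) + ennreal 2 * ennreal (\<tau> powr \<eta> / \<eta>)
     = ennreal (2 / (2 * \<beta> - 1) * \<tau> powr (2 * \<beta> - 1) + 2 / \<eta> * \<tau> powr \<eta>)"
  proof -
    have "ennreal (2 * x + 2 * y) = ennreal 2 * ennreal x + ennreal 2 * ennreal y" if "x \<ge> 0" "y \<ge> 0" for x y
      using that by (subst ennreal_plus) (auto simp: ennreal_mult)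
    from this[of "\<tau> powr (2 * \<beta> - 1) / (2 * \<beta> - 1)" "\<tau> powr \<eta> / \<eta>"] show ?thesis
      using \<beta> \<eta> by simp
  qed
  also have "\<dots> \<le> ennreal ((2 / (2 * \<beta> - 1) + 2 / \<eta>) * \<tau> powr ?e)"
  proof (rule ennreal_leI)
    have "\<tau> powr (2 * \<beta> - 1) \<le> \<tau> powr ?e" "\<tau> powr \<eta> \<le> \<tau> powr ?e"
      using \<tau> by (auto intro!: powr_mono')
    hence "2 / (2 * \<beta> - 1) * \<tau> powr (2 * \<beta> - 1) \<le> 2 / (2 * \<beta> - 1) * \<tau> powr ?e"
       "2 / \<eta> * \<tau> powr \<eta> \<le> 2 / \<eta> * \<tau> powr ?e"
      using \<beta> \<eta> by (intro mult_left_mono; simp)+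
    thus "2 / (2 * \<beta> - 1) * \<tau> powr (2 * \<beta> - 1) + 2 / \<eta> * \<tau> powr \<eta> \<le> (2 / (2 * \<beta> - 1) + 2 / \<eta>) * \<tau> powr ?e"
      unfolding distrib_right by linarith
  qed
  finally show ?thesis .
qed

text \<open>Here \<open>c\<close> will be the speed: \<open>\<phi>\<^sup>2\<close> times the speed is what the substitution rule integrates to \<open>\<integral>\<phi>\<^sup>2\<close>.\<close>

lemma young_inequality_speed:
  fixes a b c s :: real
  assumes "c > 0" "s > 0"
  shows "a * b \<le> s * (a\<^sup>2 * c) + 1 / s * (b\<^sup>2 / c)"
proof -
  have "0 \<le> (s * c * a - b)\<^sup>2 + s * c * a * b + 0 \<or> a * b < 0"
    using assms by (cases "a * b < 0") (auto simp: mult.assoc intro!: add_nonneg_nonneg mult_nonneg_nonneg)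
  moreover have "s * (a\<^sup>2 * c) + 1 / s * (b\<^sup>2 / c) - a * b = ((s * c * a - b)\<^sup>2 + s * c * a * b) / (s * c)"
    using assms by (simp add: field_simps power2_eq_square)
  moreover have "0 \<le> s * (a\<^sup>2 * c) + 1 / s * (b\<^sup>2 / c)" using assms by simp
  ultimately show ?thesis using assms by (smt (verit) divide_nonneg_pos mult_pos_pos)
qed

text \<open>Young's inequality separates the test function from the density. The first summand becomes \<open>\<integral>\<phi>\<^sup>2\<close> by the
  substitution \<open>x = sector_ratio L N t\<close>, the second is the integral of the squared density divided by the speed.
  The parameter \<open>s\<close> stays free, to be optimised much later; \<open>\<tau> = 1/2\<close> covers all of \<open>(0,1)\<close>, and a small \<open>\<tau>\<close> makes
  the second summand small.\<close>

lemma sector_inner_edge_bound: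
  fixes \<phi> :: "real \<Rightarrow> real"
  assumes N: "1 \<le> N" "N \<le> B" and d: "0 < d" "d \<le> L - N"
    and \<eta>: "0 < \<eta>" "\<eta> < 1" and \<beta>: "\<beta> > 1/2" and p: "p \<ge> 0"
    and \<tau>: "0 < \<tau>" "\<tau> \<le> 1/2" and s: "s > 0"
    and [measurable]: "\<phi> \<in> borel_measurable borel" and nn: "\<And>x. \<phi> x \<ge> 0"
  shows "(\<integral>\<^sup>+t. indicator ({0<..<1} \<inter> edges \<tau>) t * ennreal (\<phi> (sector_ratio L N t)) *
            ennreal (t powr (\<beta> - 1) * (1 + t * L) powr (- p)) \<partial>lborel)
     \<le> ennreal s * (\<integral>\<^sup>+x. ennreal ((\<phi> x)\<^sup>2) \<partial>lborel) +
       ennreal ((1 + B)\<^sup>2 * (2 / (2 * \<beta> - 1) + 2 / \<eta>) * (\<tau> powr (min (2 * \<beta> - 1) \<eta>) / s) * d powr (- \<eta>))"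
proof -
  let ?c = "sector_ratio L N" and ?v = "sector_speed L N"
  have L: "L \<ge> 1" "N \<le> L" using N d by auto
  have [measurable]: "?v \<in> borel_measurable borel" "?c \<in> borel_measurable borel"
    unfolding sector_speed_def[abs_def] by measurable
  let ?E = "(1 + B)\<^sup>2 * d powr (- \<eta>) / s"
  have E: "?E \<ge> 0" using s by simp
  have "(\<integral>\<^sup>+t. indicator ({0<..<1} \<inter> edges \<tau>) t * ennreal (\<phi> (?c t)) * ennreal (t powr (\<beta> - 1) * (1 + t * L) powr (- p)) \<partial>lborel)
    \<le> (\<integral>\<^sup>+t. ennreal s * ennreal ((\<phi> (?c t))\<^sup>2 * ?v t * indicator {0..1} t) +
         ennreal ?E * (indicator ({0<..<1} \<inter> edges \<tau>) t * ennreal (t powr (2 * \<beta> - 2) * (1 - t) powr (\<eta> - 1))) \<partial>lborel)"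
  proof (rule nn_integral_mono)
    fix t :: real
    show "indicator ({0<..<1} \<inter> edges \<tau>) t * ennreal (\<phi> (?c t)) * ennreal (t powr (\<beta> - 1) * (1 + t * L) powr (- p))
      \<le> ennreal s * ennreal ((\<phi> (?c t))\<^sup>2 * ?v t * indicator {0..1} t) +
         ennreal ?E * (indicator ({0<..<1} \<inter> edges \<tau>) t * ennreal (t powr (2 * \<beta> - 2) * (1 - t) powr (\<eta> - 1)))"
    proof (cases "t \<in> {0<..<1} \<inter> edges \<tau>")
      case True
      hence t: "0 < t" "t < 1" by auto
      note v = inverse_sector_speed_le[OF N d t \<eta>]
      have "(1 + t * L) powr (- p) \<le> (1 + t * L) powr 0" using t L p by (intro powr_mono) auto
      moreover have "1 + t * L > 0" using t L by (simp add: add_pos_nonneg)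
      ultimately have le1: "(1 + t * L) powr (- p) \<le> 1" by simp
      have "\<phi> (?c t) * (t powr (\<beta> - 1) * (1 + t * L) powr (- p)) \<le> \<phi> (?c t) * (t powr (\<beta> - 1) * 1)"
        using le1 nn by (intro mult_left_mono) auto
      also have "\<dots> = \<phi> (?c t) * t powr (\<beta> - 1)" by simp
      also have "\<dots> \<le> s * ((\<phi> (?c t))\<^sup>2 * ?v t) + 1 / s * ((t powr (\<beta> - 1))\<^sup>2 / ?v t)"
        by (rule young_inequality_speed[OF v(1) s])
      also have "(t powr (\<beta> - 1))\<^sup>2 = t powr (2 * \<beta> - 2)"
        by (simp add: power2_eq_square flip: powr_add)
      also have "1 / s * (t powr (2 * \<beta> - 2) / ?v t) = 1 / s * (t powr (2 * \<beta> - 2) * (1 / ?v t))" by simp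
      also have "\<dots> \<le> 1 / s * (t powr (2 * \<beta> - 2) * ((1 + B)\<^sup>2 * (d powr (- \<eta>) * (1 - t) powr (\<eta> - 1))))"
        using v(2) s by (intro mult_left_mono) auto
      also have "\<dots> = ?E * (t powr (2 * \<beta> - 2) * (1 - t) powr (\<eta> - 1))" by simp
      finally have "\<phi> (?c t) * (t powr (\<beta> - 1) * (1 + t * L) powr (- p)) \<le>
         s * ((\<phi> (?c t))\<^sup>2 * ?v t) + ?E * (t powr (2 * \<beta> - 2) * (1 - t) powr (\<eta> - 1))" by simp
      from ennreal_leI[OF this]
      have "ennreal (\<phi> (?c t)) * ennreal (t powr (\<beta> - 1) * (1 + t * L) powr (- p)) \<le>
         ennreal (s * ((\<phi> (?c t))\<^sup>2 * ?v t) + ?E * (t powr (2 * \<beta> - 2) * (1 - t) powr (\<eta> - 1)))"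
        using nn[of "?c t"] by (subst ennreal_mult'[symmetric]) auto
      also have "\<dots> = ennreal s * ennreal ((\<phi> (?c t))\<^sup>2 * ?v t) + ennreal ?E * ennreal (t powr (2 * \<beta> - 2) * (1 - t) powr (\<eta> - 1))"
      proof -
        have gen: "ennreal (s * x + e * y) = ennreal s * ennreal x + ennreal e * ennreal y"
          if "e \<ge> 0" "x \<ge> 0" "y \<ge> 0" for e x y
          using that s by (simp add: ennreal_mult)
        show ?thesis by (rule gen[OF E]) (use v(1) in simp_all)
      qed
      finally show ?thesis using True t by (simp del: ennreal_numeral)
    next
      case False
      thus ?thesis by simp
    qed
  qed
  also have "\<dots> = ennreal s * (\<integral>\<^sup>+t. ennreal ((\<phi> (?c t))\<^sup>2 * ?v t * indicator {0..1} t) \<partial>lborel) +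
      ennreal ?E * (\<integral>\<^sup>+t. indicator ({0<..<1} \<inter> edges \<tau>) t * ennreal (t powr (2 * \<beta> - 2) * (1 - t) powr (\<eta> - 1)) \<partial>lborel)"
    by (subst nn_integral_add) (auto simp: nn_integral_cmult)
  also have "\<dots> \<le> ennreal s * (\<integral>\<^sup>+x. ennreal ((\<phi> x)\<^sup>2) \<partial>lborel) +
      ennreal ?E * ennreal ((2 / (2 * \<beta> - 1) + 2 / \<eta>) * \<tau> powr (min (2 * \<beta> - 1) \<eta>))"
  proof (intro add_mono mult_left_mono edge_integral_le \<beta> \<eta> \<tau>)
    (* Substitution along the ray; the ray covers only part of the line, hence an inequality. *)
    have "(\<integral>\<^sup>+t. ennreal ((\<phi> (?c t))\<^sup>2 * ?v t * indicator {0..1} t) \<partial>lborel) =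
       (\<integral>\<^sup>+x. ennreal ((\<phi> x)\<^sup>2 * indicator {?c 0..?c 1} x) \<partial>lborel)"
    proof (rule nn_integral_substitution[symmetric])
      show "set_borel_measurable borel {?c 0..?c 1} (\<lambda>x. (\<phi> x)\<^sup>2)"
        unfolding set_borel_measurable_def by measurable
      show "(?c has_real_derivative ?v t) (at t)" if "t \<in> {0..1}" for t
        unfolding sector_speed_def by (rule sector_ratio_deriv) (use N in auto)
      have "1 + t\<^sup>2 * N \<noteq> 0" for t using N by (smt (verit) mult_nonneg_nonneg zero_le_power2)
      thus "continuous_on {0..1} ?v"
        unfolding sector_speed_def[abs_def] by (intro continuous_intros) auto
      show "0 \<le> ?v t" if "t \<in> {0..1}" for t
        by (rule sector_speed_nonneg) (use that N L in auto)
    qed simp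
    also have "\<dots> \<le> (\<integral>\<^sup>+x. ennreal ((\<phi> x)\<^sup>2) \<partial>lborel)"
      by (intro nn_integral_mono) (auto simp: indicator_def)
    finally show "(\<integral>\<^sup>+t. ennreal ((\<phi> (?c t))\<^sup>2 * ?v t * indicator {0..1} t) \<partial>lborel) \<le> (\<integral>\<^sup>+x. ennreal ((\<phi> x)\<^sup>2) \<partial>lborel)" .
  qed auto
  also have "ennreal ?E * ennreal ((2 / (2 * \<beta> - 1) + 2 / \<eta>) * \<tau> powr (min (2 * \<beta> - 1) \<eta>)) =
     ennreal ((1 + B)\<^sup>2 * (2 / (2 * \<beta> - 1) + 2 / \<eta>) * (\<tau> powr (min (2 * \<beta> - 1) \<eta>) / s) * d powr (- \<eta>))"
    using E by (subst ennreal_mult'[symmetric]) (auto simp: mult_ac)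
  finally show ?thesis .
qed

text \<open>The last bound is the reason to require a third observation: with \<open>J\<close> empty, \<open>L - N\<close> would vanish.\<close>

lemma sum1_bounds:
  assumes "finite J" "\<And>k. k \<in> J \<Longrightarrow> 0 < w k \<and> w k < 1"
  shows "1 \<le> sumsq1 J w" "sumsq1 J w \<le> sum1 J w" "sum1 J w \<le> real (card J) + 1"
    and "k \<in> J \<Longrightarrow> w k * (1 - w k) \<le> sum1 J w - sumsq1 J w"
proof -
  show "1 \<le> sumsq1 J w" by (simp add: sumsq1_def sum_nonneg)
  have diff: "sum1 J w - sumsq1 J w = (\<Sum>k\<in>J. w k * (1 - w k))"
    by (simp add: sum1_def sumsq1_def sum_subtractf[symmetric] algebra_simps power2_eq_square)
  have nn: "w k * (1 - w k) \<ge> 0" if "k \<in> J" for k using assms(2)[OF that] by simp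
  have "0 \<le> (\<Sum>k\<in>J. w k * (1 - w k))" by (intro sum_nonneg nn)
  thus "sumsq1 J w \<le> sum1 J w" using diff by linarith
  have "(\<Sum>k\<in>J. w k) \<le> (\<Sum>k\<in>J. 1)" using assms(2) by (intro sum_mono) (auto intro: less_imp_le)
  thus "sum1 J w \<le> real (card J) + 1" by (simp add: sum1_def)
  show "w k * (1 - w k) \<le> sum1 J w - sumsq1 J w" if "k \<in> J"
    unfolding diff using member_le_sum[OF that, of "\<lambda>k. w k * (1 - w k)"] nn assms(1) by auto
qed

lemma nn_integral_beta_finite:
  assumes "a > 0" "b > (0::real)"
  shows "(\<integral>\<^sup>+t. indicator {0<..<1} t * ennreal (t powr (a - 1) * (1 - t) powr (b - 1)) \<partial>lborel) < \<infinity>"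
proof -
  have "(\<integral>\<^sup>+t. indicator {0<..<1} t * ennreal (t powr (a - 1) * (1 - t) powr (b - 1)) \<partial>lborel)
    \<le> (\<integral>\<^sup>+t. ennreal (t powr (a - 1) * (1 - t) powr (b - 1)) * indicator {0..1} t \<partial>lborel)"
    by (intro nn_integral_mono) (auto simp: indicator_def)
  also have "\<dots> = ennreal (Beta a b)"
    by (rule nn_integral_has_integral_lebesgue'[OF _ has_integral_Beta_real]) (use assms in auto)
  also have "\<dots> < \<infinity>" by simp
  finally show ?thesis .
qed

text \<open>The density of the directions \<open>w\<close>, supported on the open unit cube.\<close>

definition sector_weight :: "real \<Rightarrow> 'i set \<Rightarrow> ('i \<Rightarrow> real) \<Rightarrow> ennreal" where
  "sector_weight \<alpha> J w = (\<Prod>k\<in>J. indicator {0<..<1} (w k) * ennreal (w k powr (\<alpha> - 1)))"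

lemma measurable_sector_weight [measurable]:
  "sector_weight \<alpha> J \<in> borel_measurable (PiM J (\<lambda>_. lborel))"
  unfolding sector_weight_def[abs_def] by measurable

lemma sector_weight_eq_0:
  assumes "finite J" "\<not> (\<forall>k\<in>J. 0 < w k \<and> w k < 1)"
  shows "sector_weight \<alpha> J w = 0"
proof -
  obtain k where "k \<in> J" "\<not> (0 < w k \<and> w k < 1)" using assms(2) by blast
  thus ?thesis unfolding sector_weight_def
    using assms(1) by (intro prod_zero[OF _ bexI[of _ k]]) auto
qed

text \<open>One coordinate carries the extra singularity \<open>(w (1 - w)) powr (- \<eta>)\<close>. The integral is a product of beta integrals,
  finite for \<open>\<eta> < min \<alpha> 1\<close>.\<close>

lemma nn_integral_sector_weight_edge_finite:
  assumes fin: "finite J" and k0: "k0 \<in> J" and \<alpha>: "\<alpha> > 0" and \<eta>: "0 \<le> \<eta>" "\<eta> < 1" "\<eta> < \<alpha>"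
  shows "(\<integral>\<^sup>+w. sector_weight \<alpha> J w * ennreal ((w k0 * (1 - w k0)) powr (- \<eta>)) \<partial>PiM J (\<lambda>_. lborel)) < \<infinity>"
proof -
  interpret L: product_sigma_finite "\<lambda>_. lborel :: real measure" ..
  define e where "e = (\<lambda>k. if k = k0 then \<eta> else 0)"
  define f :: "'a \<Rightarrow> real \<Rightarrow> ennreal" where
    "f = (\<lambda>k t. indicator {0<..<1} t * ennreal (t powr ((\<alpha> - e k) - 1) * (1 - t) powr ((1 - e k) - 1)))"
  have "(\<integral>\<^sup>+w. sector_weight \<alpha> J w * ennreal ((w k0 * (1 - w k0)) powr (- \<eta>)) \<partial>PiM J (\<lambda>_. lborel)) =
     (\<integral>\<^sup>+w. (\<Prod>k\<in>J. f k (w k)) \<partial>PiM J (\<lambda>_. lborel))"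
  proof (intro nn_integral_cong)
    fix w :: "'a \<Rightarrow> real"
    show "sector_weight \<alpha> J w * ennreal ((w k0 * (1 - w k0)) powr (- \<eta>)) = (\<Prod>k\<in>J. f k (w k))"
    proof (cases "\<forall>k\<in>J. 0 < w k \<and> w k < 1")
      case False
      then obtain k where "k \<in> J" "\<not> (0 < w k \<and> w k < 1)" by blast
      hence "(\<Prod>k\<in>J. f k (w k)) = 0"
        using fin by (intro prod_zero[OF _ bexI[of _ k]]) (auto simp: f_def)
      thus ?thesis using sector_weight_eq_0[OF fin False] by simp
    next
      case True
      define u where "u = (w k0 * (1 - w k0)) powr (- \<eta>)"
      have fk: "f k (w k) = indicator {0<..<1} (w k) * ennreal (w k powr (\<alpha> - 1)) * (if k = k0 then ennreal u else 1)"
        if "k \<in> J" for k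
      proof (cases "k = k0")
        case k: True
        have w: "0 < w k0" "w k0 < 1" using True that k by auto
        have "w k0 powr ((\<alpha> - \<eta>) - 1) * (1 - w k0) powr ((1 - \<eta>) - 1) = w k0 powr (\<alpha> - 1) * u"
        proof -
          have "w k0 powr ((\<alpha> - \<eta>) - 1) = w k0 powr (\<alpha> - 1) * w k0 powr (- \<eta>)"
            by (simp add: algebra_simps flip: powr_add)
          moreover have "u = w k0 powr (- \<eta>) * (1 - w k0) powr (- \<eta>)"
            using w by (simp add: u_def powr_mult)
          ultimately show ?thesis by simp
        qed
        hence "ennreal (w k0 powr ((\<alpha> - \<eta>) - 1) * (1 - w k0) powr ((1 - \<eta>) - 1)) = ennreal (w k0 powr (\<alpha> - 1)) * ennreal u"
          by (simp only: ennreal_mult powr_ge_zero u_def)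
        thus ?thesis using k by (simp add: f_def e_def mult.assoc)
      next
        case False
        thus ?thesis using bspec[OF True that] by (simp add: f_def e_def)
      qed
      have "(\<Prod>k\<in>J. f k (w k)) = sector_weight \<alpha> J w * (\<Prod>k\<in>J. if k = k0 then ennreal u else 1)"
        unfolding sector_weight_def prod.distrib[symmetric] by (rule prod.cong[OF refl fk])
      also have "(\<Prod>k\<in>J. if k = k0 then ennreal u else 1) = ennreal u"
        using fin k0 by simp
      finally show ?thesis by (simp add: u_def)
    qed
  qed
  also have "\<dots> = (\<Prod>k\<in>J. \<integral>\<^sup>+t. f k t \<partial>lborel)"
    by (rule L.product_nn_integral_prod[OF fin]) (simp add: f_def)
  also have "\<dots> < \<infinity>"
  proof -
    have "(\<integral>\<^sup>+t. f k t \<partial>lborel) < \<infinity>" for k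
      unfolding f_def by (rule nn_integral_beta_finite) (use \<alpha> \<eta> in \<open>auto simp: e_def\<close>)
    hence "(\<Prod>k\<in>J. \<integral>\<^sup>+t. f k t \<partial>lborel) \<noteq> \<infinity>"
      by (simp add: ennreal_prod_eq_top less_top)
    thus ?thesis by (simp add: less_top)
  qed
  finally show ?thesis .
qed

lemma nn_integral_sector_weight_finite:
  assumes "finite J" "\<alpha> > 0"
  shows "(\<integral>\<^sup>+w. sector_weight \<alpha> J w \<partial>PiM J (\<lambda>_. lborel)) < \<infinity>"
proof (cases "J = {}")
  case True
  thus ?thesis by (simp add: PiM_empty sector_weight_def)
next
  case False
  then obtain k where k: "k \<in> J" by blast
  have "sector_weight \<alpha> J w = sector_weight \<alpha> J w * ennreal ((w k * (1 - w k)) powr (- 0))" for w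
  proof (cases "\<forall>k\<in>J. 0 < w k \<and> w k < 1")
    case True
    hence "w k * (1 - w k) \<noteq> 0" using k by auto
    thus ?thesis by simp
  next
    case False
    thus ?thesis using sector_weight_eq_0[OF assms(1) False] by simp
  qed
  thus ?thesis using nn_integral_sector_weight_edge_finite[OF assms(1) k assms(2), of 0] assms(2) by simp
qed

text \<open>Integrate the bound on each ray against the density of the directions. For \<open>\<tau> = 1/2\<close> this is the square integrability of
  the part of the law that comes from the sector; for small \<open>\<tau>\<close> it says that the ends of the rays carry little.\<close>

theorem sector_edge_estimate:
  fixes J :: "'i set"
  assumes fin: "finite J" and ij: "i \<noteq> j" "i \<notin> J" "j \<notin> J" and \<alpha>: "\<alpha> > 0"
    and ne: "J \<noteq> {}" and \<beta>: "\<alpha> * real (card J + 1) > 1/2"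
  shows "\<exists>K\<ge>0. \<exists>\<epsilon>>0. \<forall>\<tau> s. \<forall>\<phi>\<in>borel_measurable borel. 0 < \<tau> \<longrightarrow> \<tau> \<le> 1/2 \<longrightarrow> s > 0 \<longrightarrow> (\<forall>x. \<phi> x \<ge> (0::real)) \<longrightarrow>
    (\<integral>\<^sup>+x. indicator (sector i j J) x * (indicator (edges \<tau>) (x j / x i) * ennreal (\<phi> (norm_ratio (insert i (insert j J)) x)))
            \<partial>PiM (insert i (insert j J)) (\<lambda>_. gamma_measure \<alpha>))
    \<le> ennreal K * (ennreal s * (\<integral>\<^sup>+x. ennreal ((\<phi> x)\<^sup>2) \<partial>lborel) + ennreal (\<tau> powr \<epsilon> / s))"
proof -
  obtain k0 where k0: "k0 \<in> J" using ne by blast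
  define \<beta>' where "\<beta>' = \<alpha> * real (card J + 1)"
  define p where "p = \<alpha> * real (card J + 2)"
  (* Any exponent strictly between 0 and min alpha 1 serves. *)
  define \<eta> where "\<eta> = min (\<alpha> / 2) (1 / 2)"
  have \<eta>: "0 < \<eta>" "\<eta> < 1" "\<eta> < \<alpha>" using \<alpha> by (auto simp: \<eta>_def)
  have p: "p > 0" using \<alpha> by (simp add: p_def)
  define \<epsilon> where "\<epsilon> = min (2 * \<beta>' - 1) \<eta>"
  have \<epsilon>: "\<epsilon> > 0" using \<beta> \<eta> by (simp add: \<epsilon>_def \<beta>'_def)
  define B where "B = real (card J) + 1"
  define Z where "Z = Gamma p / Gamma \<alpha> ^ (card J + 2)"
  have Z: "Z \<ge> 0" using p \<alpha> by (simp add: Z_def Gamma_real_pos less_imp_le)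
  define A where "A = (1 + B)\<^sup>2 * (2 / (2 * \<beta>' - 1) + 2 / \<eta>)"
  have A: "A \<ge> 0" using \<beta> \<eta> by (simp add: A_def \<beta>'_def)
  let ?W = "sector_weight \<alpha> J"
  obtain Q1 where Q1: "(\<integral>\<^sup>+w. ?W w \<partial>PiM J (\<lambda>_. lborel)) = ennreal Q1" "Q1 \<ge> 0"
    using nn_integral_sector_weight_finite[OF fin \<alpha>] by (cases "\<integral>\<^sup>+w. ?W w \<partial>PiM J (\<lambda>_. lborel)") auto
  obtain Q2 where Q2: "(\<integral>\<^sup>+w. ?W w * ennreal ((w k0 * (1 - w k0)) powr (- \<eta>)) \<partial>PiM J (\<lambda>_. lborel)) = ennreal Q2" "Q2 \<ge> 0"
    using nn_integral_sector_weight_edge_finite[OF fin k0 \<alpha>, of \<eta>] \<eta>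
    by (cases "\<integral>\<^sup>+w. ?W w * ennreal ((w k0 * (1 - w k0)) powr (- \<eta>)) \<partial>PiM J (\<lambda>_. lborel)") auto
  define K where "K = Z * Q1 + Z * A * Q2"
  have K: "K \<ge> 0" using Z A Q1 Q2 by (simp add: K_def)
  have "(\<integral>\<^sup>+x. indicator (sector i j J) x * (indicator (edges \<tau>) (x j / x i) * ennreal (\<phi> (norm_ratio (insert i (insert j J)) x)))
            \<partial>PiM (insert i (insert j J)) (\<lambda>_. gamma_measure \<alpha>))
    \<le> ennreal K * (ennreal s * (\<integral>\<^sup>+x. ennreal ((\<phi> x)\<^sup>2) \<partial>lborel) + ennreal (\<tau> powr \<epsilon> / s))"
    if \<phi>[measurable]: "\<phi> \<in> borel_measurable borel" and \<tau>: "0 < \<tau>" "\<tau> \<le> 1/2" and s: "s > 0" and nn: "\<And>x. \<phi> x \<ge> (0::real)"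
    for \<tau> s and \<phi> :: "real \<Rightarrow> real"
  proof -
    let ?I2 = "\<integral>\<^sup>+x. ennreal ((\<phi> x)\<^sup>2) \<partial>lborel"
    have "(\<integral>\<^sup>+x. indicator (sector i j J) x * (indicator (edges \<tau>) (x j / x i) * ennreal (\<phi> (norm_ratio (insert i (insert j J)) x)))
            \<partial>PiM (insert i (insert j J)) (\<lambda>_. gamma_measure \<alpha>)) =
      (\<integral>\<^sup>+w. ?W w * (\<integral>\<^sup>+t. indicator ({0<..<1} \<inter> edges \<tau>) t * ennreal (\<phi> (sector_ratio (sum1 J w) (sumsq1 J w) t)) *
          ennreal (Z * (t powr (\<beta>' - 1) * (1 + t * sum1 J w) powr (- p))) \<partial>lborel)
      \<partial>PiM J (\<lambda>_. lborel))"
      using nn_integral_sector[OF fin ij \<alpha>, of "\<lambda>x. ennreal (\<phi> x)" "edges \<tau>"]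
      by (simp add: sector_weight_def Z_def p_def \<beta>'_def)
    also have "\<dots> \<le> (\<integral>\<^sup>+w. (ennreal Z * (ennreal s * ?I2)) * ?W w +
        ennreal (Z * A * (\<tau> powr \<epsilon> / s)) * (?W w * ennreal ((w k0 * (1 - w k0)) powr (- \<eta>))) \<partial>PiM J (\<lambda>_. lborel))"
    proof (intro nn_integral_mono)
      fix w :: "'i \<Rightarrow> real"
      let ?L = "sum1 J w" and ?N = "sumsq1 J w"
      show "?W w * (\<integral>\<^sup>+t. indicator ({0<..<1} \<inter> edges \<tau>) t * ennreal (\<phi> (sector_ratio ?L ?N t)) *
          ennreal (Z * (t powr (\<beta>' - 1) * (1 + t * ?L) powr (- p))) \<partial>lborel) \<le>
        (ennreal Z * (ennreal s * ?I2)) * ?W w +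
        ennreal (Z * A * (\<tau> powr \<epsilon> / s)) * (?W w * ennreal ((w k0 * (1 - w k0)) powr (- \<eta>)))"
      proof (cases "\<forall>k\<in>J. 0 < w k \<and> w k < 1")
        case False
        show ?thesis unfolding sector_weight_eq_0[OF fin False] by simp
      next
        case True
        note b = sum1_bounds[OF fin, of w]
        have d: "0 < w k0 * (1 - w k0)" using True k0 by auto
        have "(\<integral>\<^sup>+t. indicator ({0<..<1} \<inter> edges \<tau>) t * ennreal (\<phi> (sector_ratio ?L ?N t)) *
          ennreal (Z * (t powr (\<beta>' - 1) * (1 + t * ?L) powr (- p))) \<partial>lborel) =
          ennreal Z * (\<integral>\<^sup>+t. indicator ({0<..<1} \<inter> edges \<tau>) t * ennreal (\<phi> (sector_ratio ?L ?N t)) *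
          ennreal (t powr (\<beta>' - 1) * (1 + t * ?L) powr (- p)) \<partial>lborel)"
          using Z by (subst nn_integral_cmult[symmetric]) (auto simp: ennreal_mult mult_ac)
        also have "\<dots> \<le> ennreal Z * (ennreal s * ?I2 +
          ennreal (A * (\<tau> powr \<epsilon> / s) * (w k0 * (1 - w k0)) powr (- \<eta>)))"
          unfolding A_def \<epsilon>_def by (intro mult_left_mono sector_inner_edge_bound)
             (use b True k0 d \<eta> \<beta> \<tau> s nn p in \<open>auto simp: B_def \<beta>'_def\<close>)
        also have "\<dots> = ennreal Z * (ennreal s * ?I2) + ennreal (Z * A * (\<tau> powr \<epsilon> / s)) * ennreal ((w k0 * (1 - w k0)) powr (- \<eta>))"
        proof -
          have "ennreal (A * (\<tau> powr \<epsilon> / s) * (w k0 * (1 - w k0)) powr (- \<eta>)) =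
             ennreal (A * (\<tau> powr \<epsilon> / s)) * ennreal ((w k0 * (1 - w k0)) powr (- \<eta>))"
            using A s by (intro ennreal_mult) auto
          moreover have "ennreal Z * ennreal (A * (\<tau> powr \<epsilon> / s)) = ennreal (Z * A * (\<tau> powr \<epsilon> / s))"
            using A s Z by (subst ennreal_mult[symmetric]) (auto simp: mult_ac)
          ultimately show ?thesis
            by (simp only: distrib_left mult.assoc[symmetric])
        qed
        finally have "?W w * (\<integral>\<^sup>+t. indicator ({0<..<1} \<inter> edges \<tau>) t * ennreal (\<phi> (sector_ratio ?L ?N t)) *
          ennreal (Z * (t powr (\<beta>' - 1) * (1 + t * ?L) powr (- p))) \<partial>lborel) \<le>
          ?W w * (ennreal Z * (ennreal s * ?I2) + ennreal (Z * A * (\<tau> powr \<epsilon> / s)) * ennreal ((w k0 * (1 - w k0)) powr (- \<eta>)))"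
          by (rule mult_left_mono) simp
        thus ?thesis by (simp only: distrib_left mult_ac)
      qed
    qed
    also have "\<dots> = (ennreal Z * (ennreal s * ?I2)) * (\<integral>\<^sup>+w. ?W w \<partial>PiM J (\<lambda>_. lborel)) +
        ennreal (Z * A * (\<tau> powr \<epsilon> / s)) * (\<integral>\<^sup>+w. ?W w * ennreal ((w k0 * (1 - w k0)) powr (- \<eta>)) \<partial>PiM J (\<lambda>_. lborel))"
    proof -
      have [measurable]: "(\<lambda>w. w k0) \<in> borel_measurable (PiM J (\<lambda>_. lborel :: real measure))"
        using k0 by measurable
      show ?thesis by (subst nn_integral_add) (auto simp: nn_integral_cmult)
    qed
    also have "\<dots> = ennreal (Z * Q1) * (ennreal s * ?I2) + ennreal (Z * A * Q2) * ennreal (\<tau> powr \<epsilon> / s)"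
    proof -
      have "ennreal (Z * A * (\<tau> powr \<epsilon> / s)) * ennreal Q2 = ennreal (Z * A * Q2) * ennreal (\<tau> powr \<epsilon> / s)"
        using Z A s Q2 by (subst (1 2) ennreal_mult[symmetric]) (auto simp: mult_ac)
      thus ?thesis unfolding Q1 Q2 using Z Q1 by (simp add: ennreal_mult mult_ac)
    qed
    also have "\<dots> \<le> ennreal K * (ennreal s * ?I2) + ennreal K * ennreal (\<tau> powr \<epsilon> / s)"
      using Z A Q1 Q2 by (intro add_mono mult_right_mono ennreal_leI) (auto simp: K_def)
    finally show ?thesis by (simp add: distrib_left)
  qed
  with K \<epsilon> show ?thesis by blast
qed

section \<open>Integration by parts along a ray\<close>

text \<open>The hypothesis \<open>L\<^sup>2 \<le> B N\<close> is Cauchy-Schwarz for \<open>B\<close> coordinates; adding the coordinate \<open>1\<close> gives the upper bound.\<close>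

lemma sector_ratio_bounds:
  assumes "0 \<le> t" "0 \<le> N" "N \<le> L" "t \<le> 1" "L\<^sup>2 \<le> B * N" "B \<ge> 0"
  shows "1 \<le> sector_ratio L N t" "sector_ratio L N t \<le> sqrt (B + 1)"
proof -
  have q: "1 + t\<^sup>2 * N > 0" using assms by (simp add: add_pos_nonneg)
  have "1 + t\<^sup>2 * N \<le> (1 + t * L)\<^sup>2"
  proof -
    have "t\<^sup>2 * N \<le> t * L"
    proof -
      have "t\<^sup>2 * N \<le> t * N" using assms by (simp add: power2_eq_square mult_left_le mult_right_mono)
      also have "\<dots> \<le> t * L" using assms by (intro mult_left_mono) auto
      finally show ?thesis .
    qed
    also have "t * L \<le> 2 * (t * L) + (t * L)\<^sup>2" using assms by simp
    finally show ?thesis by (simp add: power2_eq_square algebra_simps)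
  qed
  hence "sqrt (1 + t\<^sup>2 * N) \<le> 1 + t * L" using assms by (intro real_le_lsqrt) auto
  thus "1 \<le> sector_ratio L N t" using q by (simp add: sector_ratio_def)
  have "(1 + t * L)\<^sup>2 \<le> (B + 1) * (1 + t\<^sup>2 * N)"
  proof (cases "B = 0")
    case True
    hence "L = 0" using assms by simp
    thus ?thesis using True assms by simp
  next
    case False
    hence B: "B > 0" using assms by simp
    have "2 * (t * L) \<le> B + (t * L)\<^sup>2 / B"
    proof -
      have "0 \<le> (B - t * L)\<^sup>2 / B" using B by simp
      also have "\<dots> = B + (t * L)\<^sup>2 / B - 2 * (t * L)" using B by (simp add: power2_eq_square field_simps)
      finally show ?thesis by simp
    qed
    moreover have "(t * L)\<^sup>2 / B \<le> t\<^sup>2 * N"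
    proof -
      have "t\<^sup>2 * L\<^sup>2 \<le> t\<^sup>2 * (B * N)" using assms by (intro mult_left_mono) auto
      thus ?thesis using B by (simp add: power_mult_distrib field_simps)
    qed
    moreover have "(t * L)\<^sup>2 \<le> B * (t\<^sup>2 * N)"
    proof -
      have "t\<^sup>2 * L\<^sup>2 \<le> t\<^sup>2 * (B * N)" using assms by (intro mult_left_mono) auto
      thus ?thesis by (simp add: power_mult_distrib mult_ac)
    qed
    ultimately show ?thesis by (simp add: power2_eq_square algebra_simps)
  qed
  hence "1 + t * L \<le> sqrt ((B + 1) * (1 + t\<^sup>2 * N))" by (rule real_le_rsqrt)
  hence "1 + t * L \<le> sqrt (B + 1) * sqrt (1 + t\<^sup>2 * N)" by (simp only: real_sqrt_mult)
  thus "sector_ratio L N t \<le> sqrt (B + 1)" using q by (simp add: sector_ratio_def pos_divide_le_eq)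
qed

text \<open>Write the integrand as \<open>(D \<circ> c)' m\<close>, where \<open>c\<close> is the ratio along the ray and \<open>m\<close> collects the density, the power of the ratio
  and the reciprocal of the speed,
  and integrate by parts: only \<open>D\<close> remains, at the price of \<open>m\<close> and \<open>m'\<close>, which on \<open>[\<tau>, 1 - \<tau>]\<close> are bounded by a power
  of \<open>1/\<tau>\<close>. The constants depend on \<open>L\<close> and \<open>N\<close> only through the bound \<open>B\<close>.\<close>

lemma sector_inner_oscillation:
  fixes p \<beta> B :: real
  assumes B: "B \<ge> 1"
  shows "\<exists>K\<ge>0. \<exists>M\<ge>0. \<forall>L N \<tau> \<delta> D g. 1 \<le> N \<longrightarrow> N \<le> L \<longrightarrow> L \<le> B \<longrightarrow> 0 < \<tau> \<longrightarrow> \<tau> \<le> 1/2 \<longrightarrow>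
    (\<forall>y. (D has_real_derivative g y) (at y)) \<longrightarrow> continuous_on UNIV g \<longrightarrow>
    (\<forall>t\<in>{0..1}. \<bar>D (sector_ratio L N t)\<bar> \<le> \<delta>) \<longrightarrow>
    \<bar>integral {\<tau>..1-\<tau>} (\<lambda>t. sector_ratio L N t powr (p - 1) * g (sector_ratio L N t) * (t powr (\<beta> - 1) * (1 + t * L) powr (- p)))\<bar>
      \<le> K * \<delta> * \<tau> powr (- M)"
proof -
  (* The exponent of 1 + t^2 N in m: the ratio to the power p - 1 contributes - (p - 1) / 2, the reciprocal of the
     speed contributes 3 / 2. *)
  define e where "e = (4 - p) / 2"
  define M1 where "M1 = (1 + B) powr \<bar>e\<bar>"
  define M2 where "M2 = \<bar>\<beta> - 1\<bar> + 2 * B + 2 * \<bar>e\<bar> * B"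
  have M12: "M1 \<ge> 0" "M2 \<ge> 0" using B by (auto simp: M1_def M2_def)
  define K where "K = M1 * (2 + M2)"
  define M where "M = \<bar>\<beta> - 1\<bar> + 2"
  have "\<bar>integral {\<tau>..1-\<tau>} (\<lambda>t. sector_ratio L N t powr (p - 1) * g (sector_ratio L N t) * (t powr (\<beta> - 1) * (1 + t * L) powr (- p)))\<bar>
      \<le> K * \<delta> * \<tau> powr (- M)"
    if N: "1 \<le> N" and NL: "N \<le> L" and LB: "L \<le> B" and \<tau>: "0 < \<tau>" "\<tau> \<le> 1/2"
      and D: "\<And>y. (D has_real_derivative g y) (at y)" and g: "continuous_on UNIV g"
      and \<delta>: "\<And>t. t \<in> {0..1} \<Longrightarrow> \<bar>D (sector_ratio L N t)\<bar> \<le> \<delta>" for L N \<tau> \<delta> D g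
  proof -
    let ?c = "sector_ratio L N" and ?v = "sector_speed L N"
    define m where "m = (\<lambda>t. t powr (\<beta> - 1) * (1 / (1 + t * L)) * (1 + t\<^sup>2 * N) powr e * (1 / (L - t * N)))"
    (* The logarithmic derivative of m. *)
    define l where "l = (\<lambda>t. (\<beta> - 1) / t + - (L / (1 + t * L)) + e * (2 * t * N) / (1 + t\<^sup>2 * N) + N / (L - t * N))"
    have \<delta>0: "\<delta> \<ge> 0" using \<delta>[of 0] by (auto intro: order_trans[OF abs_ge_zero])
    have pos: "t > 0" "1 + t * L > 0" "1 + t\<^sup>2 * N > 0" "L - t * N \<ge> \<tau>" "L - t * N > 0" "t \<le> 1"
      if "t \<in> {\<tau>..1-\<tau>}" for t
    proof -
      show t: "t > 0" using that \<tau> by auto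
      show "t \<le> 1" using that \<tau> by auto
      show "1 + t * L > 0" "1 + t\<^sup>2 * N > 0" using t N NL by (auto intro!: add_pos_nonneg)
      have "t * N \<le> (1 - \<tau>) * N" using that N by (intro mult_right_mono) auto
      moreover have "\<tau> * 1 \<le> \<tau> * N" using \<tau> N by (intro mult_left_mono) auto
      ultimately show "L - t * N \<ge> \<tau>" using NL by (simp add: algebra_simps)
      thus "L - t * N > 0" using \<tau> by linarith
    qed
    have dm: "(m has_real_derivative m t * l t) (at t)" if t: "t \<in> {\<tau>..1-\<tau>}" for t
    proof -
      note p = pos[OF t]
      have d1: "((\<lambda>t. t powr (\<beta> - 1)) has_real_derivative t powr (\<beta> - 1) * ((\<beta> - 1) / t)) (at t)"
        by (rule DERIV_cong[OF has_real_derivative_powr[OF p(1)]]) (use p(1) in \<open>simp add: powr_diff field_simps power2_eq_square\<close>)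
      have d2: "((\<lambda>t. 1 / (1 + t * L)) has_real_derivative 1 / (1 + t * L) * (- (L / (1 + t * L)))) (at t)"
        using p by (auto intro!: derivative_eq_intros)
      have d3: "((\<lambda>t. (1 + t\<^sup>2 * N) powr e) has_real_derivative
          (1 + t\<^sup>2 * N) powr e * (e * (2 * t * N) / (1 + t\<^sup>2 * N))) (at t)"
      proof -
        have "((\<lambda>t. 1 + t\<^sup>2 * N) has_real_derivative 2 * t * N) (at t)"
          by (auto intro!: derivative_eq_intros)
        from DERIV_chain2[OF has_real_derivative_powr[OF p(3), of e] this] show ?thesis
          by (rule DERIV_cong) (use p(3) in \<open>simp add: powr_diff\<close>)
      qed
      have d4: "((\<lambda>t. 1 / (L - t * N)) has_real_derivative 1 / (L - t * N) * (N / (L - t * N))) (at t)"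
        using p by (auto intro!: derivative_eq_intros)
      have "(m has_real_derivative m t * l t) (at t)"
        unfolding m_def l_def
        by (rule DERIV_cong[OF DERIV_mult[OF DERIV_mult[OF DERIV_mult[OF d1 d2] d3] d4]]) (simp only: algebra_simps)
      thus ?thesis .
    qed
    have m_bound: "0 \<le> m t" "m t \<le> M1 * \<tau> powr (- (\<bar>\<beta> - 1\<bar> + 1))" if t: "t \<in> {\<tau>..1-\<tau>}" for t
    proof -
      note p = pos[OF t]
      show "0 \<le> m t" using p by (simp add: m_def)
      have 1: "t powr (\<beta> - 1) \<le> \<tau> powr (- \<bar>\<beta> - 1\<bar>)"
      proof -
        have "t powr (\<beta> - 1) \<le> t powr (- \<bar>\<beta> - 1\<bar>)" using p by (intro powr_mono') auto
        also have "\<dots> \<le> \<tau> powr (- \<bar>\<beta> - 1\<bar>)" using t \<tau> by (intro powr_mono2') auto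
        finally show ?thesis .
      qed
      have 2: "1 / (1 + t * L) \<le> 1" using p N NL by simp
      have 3: "(1 + t\<^sup>2 * N) powr e \<le> M1"
      proof -
        have "t\<^sup>2 * N \<le> 1 * B" using p N NL LB by (intro mult_mono) (auto simp: power_le_one)
        hence q: "1 + t\<^sup>2 * N \<le> 1 + B" by simp
        have "(1 + t\<^sup>2 * N) powr e \<le> (1 + t\<^sup>2 * N) powr \<bar>e\<bar>" using N by (intro powr_mono) auto
        also have "\<dots> \<le> (1 + B) powr \<bar>e\<bar>" using q p by (intro powr_mono2) auto
        finally show ?thesis by (simp add: M1_def)
      qed
      have 4: "1 / (L - t * N) \<le> 1 / \<tau>" using p \<tau> by (intro frac_le) auto
      have "m t = t powr (\<beta> - 1) * (1 / (1 + t * L)) * (1 + t\<^sup>2 * N) powr e * (1 / (L - t * N))"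
        by (simp add: m_def)
      also have "\<dots> \<le> \<tau> powr (- \<bar>\<beta> - 1\<bar>) * 1 * M1 * (1 / \<tau>)"
        using 1 2 3 4 p \<tau> M12 by (intro mult_mono) (auto intro!: mult_nonneg_nonneg)
      also have "\<dots> = M1 * \<tau> powr (- (\<bar>\<beta> - 1\<bar> + 1))"
        using \<tau> powr_minus_divide[of \<tau> 1] by (simp add: powr_add powr_diff)
      finally show "m t \<le> M1 * \<tau> powr (- (\<bar>\<beta> - 1\<bar> + 1))" .
    qed
    have l_bound: "\<bar>l t\<bar> \<le> M2 / \<tau>" if t: "t \<in> {\<tau>..1-\<tau>}" for t
    proof -
      note p = pos[OF t]
      have 1: "\<bar>(\<beta> - 1) / t\<bar> \<le> \<bar>\<beta> - 1\<bar> / \<tau>" using t \<tau> p by (simp add: abs_divide frac_le)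
      have BB: "B \<le> B / \<tau>" using B \<tau> by (simp add: field_simps mult_left_le)
      have 2: "\<bar>L / (1 + t * L)\<bar> \<le> B / \<tau>"
      proof -
        have "L / (1 + t * L) \<le> B / 1" using p N NL LB by (intro frac_le) auto
        moreover have "0 \<le> L / (1 + t * L)" using p N NL by simp
        ultimately show ?thesis using BB by linarith
      qed
      have 3: "\<bar>e * (2 * t * N) / (1 + t\<^sup>2 * N)\<bar> \<le> 2 * \<bar>e\<bar> * B / \<tau>"
      proof -
        have "(2 * t * N) / (1 + t\<^sup>2 * N) \<le> (2 * 1 * B) / 1"
          using p N NL LB by (intro frac_le mult_mono) auto
        moreover have "0 \<le> (2 * t * N) / (1 + t\<^sup>2 * N)" using p N by simp
        ultimately have "\<bar>(2 * t * N) / (1 + t\<^sup>2 * N)\<bar> \<le> 2 * B" by linarith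
        hence "\<bar>e\<bar> * \<bar>(2 * t * N) / (1 + t\<^sup>2 * N)\<bar> \<le> \<bar>e\<bar> * (2 * B)" by (rule mult_left_mono) simp
        also have "\<dots> \<le> \<bar>e\<bar> * (2 * (B / \<tau>))" using BB by (intro mult_left_mono) auto
        also have "\<bar>e\<bar> * (2 * (B / \<tau>)) = 2 * \<bar>e\<bar> * B / \<tau>" by simp
        also have "\<bar>e\<bar> * \<bar>(2 * t * N) / (1 + t\<^sup>2 * N)\<bar> = \<bar>e * (2 * t * N) / (1 + t\<^sup>2 * N)\<bar>"
          by (simp only: abs_mult[symmetric] times_divide_eq_right)
        finally show ?thesis .
      qed
      have 4: "\<bar>N / (L - t * N)\<bar> \<le> B / \<tau>" using p N NL LB \<tau> by (simp add: abs_divide frac_le)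
      have "\<bar>l t\<bar> \<le> \<bar>\<beta> - 1\<bar> / \<tau> + B / \<tau> + 2 * \<bar>e\<bar> * B / \<tau> + B / \<tau>"
      proof -
        have "\<bar>a + - b + c + d\<bar> \<le> a' + b' + c' + d'"
          if "\<bar>a\<bar> \<le> a'" "\<bar>b\<bar> \<le> b'" "\<bar>c\<bar> \<le> c'" "\<bar>d\<bar> \<le> d'" for a b c d a' b' c' d' :: real
          using that by linarith
        from this[OF 1 2 3 4] show ?thesis by (simp only: l_def)
      qed
      also have "\<dots> = M2 / \<tau>" by (simp add: M2_def add_divide_distrib algebra_simps)
      finally show ?thesis .
    qed
    let ?F = "\<lambda>t. D (?c t) * m t"
    let ?R = "\<lambda>t. D (?c t) * (m t * l t)"
    have dc: "(?c has_real_derivative ?v t) (at t)" for t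
      unfolding sector_speed_def by (rule sector_ratio_deriv) (use N in auto)
    have ab: "\<tau> \<le> 1 - \<tau>" using \<tau> by simp
    have I1: "((\<lambda>t. g (?c t) * ?v t * m t + ?R t) has_integral ?F (1 - \<tau>) - ?F \<tau>) {\<tau>..1-\<tau>}"
    proof (rule fundamental_theorem_of_calculus[OF ab])
      fix t assume t: "t \<in> {\<tau>..1-\<tau>}"
      have "((\<lambda>t. D (?c t)) has_real_derivative g (?c t) * ?v t) (at t)"
        by (rule DERIV_chain2[OF D dc])
      from DERIV_mult[OF this dm[OF t]]
      have "(?F has_real_derivative g (?c t) * ?v t * m t + ?R t) (at t)"
        by (simp add: mult_ac add_ac)
      thus "(?F has_vector_derivative g (?c t) * ?v t * m t + ?R t) (at t within {\<tau>..1-\<tau>})"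
        by (simp add: has_real_derivative_iff_has_vector_derivative has_vector_derivative_at_within)
    qed
    have cR: "continuous_on {\<tau>..1-\<tau>} ?R"
    proof -
      have "continuous_on {\<tau>..1-\<tau>} (\<lambda>t. D (?c t))"
        by (rule DERIV_continuous_on[where D = "\<lambda>t. g (?c t) * ?v t"])
           (rule has_field_derivative_at_within[OF DERIV_chain2[OF D dc]])
      moreover have "continuous_on {\<tau>..1-\<tau>} m"
        by (rule DERIV_continuous_on[where D = "\<lambda>t. m t * l t"])
           (rule has_field_derivative_at_within[OF dm])
      moreover have "continuous_on {\<tau>..1-\<tau>} l"
      proof -
        have nz: "t \<noteq> 0" "1 + t * L \<noteq> 0" "1 + t\<^sup>2 * N \<noteq> 0" "L - t * N \<noteq> 0" if "t \<in> {\<tau>..1-\<tau>}" for t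
          using pos(1,2,3,5)[OF that] by auto
        show ?thesis unfolding l_def by (intro continuous_intros ballI nz)
      qed
      ultimately show ?thesis by (intro continuous_intros)
    qed
    have I2: "(?R has_integral integral {\<tau>..1-\<tau>} ?R) {\<tau>..1-\<tau>}"
      by (rule integrable_integral, rule integrable_continuous_interval[OF cR])
    have I3: "((\<lambda>t. g (?c t) * ?v t * m t) has_integral (?F (1 - \<tau>) - ?F \<tau> - integral {\<tau>..1-\<tau>} ?R)) {\<tau>..1-\<tau>}"
      using has_integral_diff[OF I1 I2] by simp
    have eq: "sector_ratio L N t powr (p - 1) * g (?c t) * (t powr (\<beta> - 1) * (1 + t * L) powr (- p)) = g (?c t) * ?v t * m t"
      if t: "t \<in> {\<tau>..1-\<tau>}" for t
    proof -
      note ps = pos[OF t]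
      have sq: "sqrt (1 + t\<^sup>2 * N) = (1 + t\<^sup>2 * N) powr (1/2)" using ps by (simp add: powr_half_sqrt)
      have c: "?c t powr (p - 1) = (1 + t * L) powr (p - 1) * (1 + t\<^sup>2 * N) powr (- ((p - 1) / 2))"
      proof -
        have gen: "(x / y powr (1/2)) powr q = x powr q * y powr (- (q / 2))" if "x \<ge> 0" for x y q :: real
        proof -
          have "(x / y powr (1/2)) powr q = x powr q / (y powr (1/2)) powr q"
            by (rule powr_divide)
          also have "(y powr (1/2)) powr q = y powr (q / 2)" by (simp add: powr_powr)
          also have "x powr q / y powr (q / 2) = x powr q * y powr (- (q / 2))"
            by (simp only: powr_minus divide_inverse)
          finally show ?thesis .
        qed
        show ?thesis unfolding sector_ratio_def sq by (rule gen) (use ps in simp)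
      qed
      have v: "?v t = (L - t * N) * (1 + t\<^sup>2 * N) powr (- (3/2))"
      proof -
        have "(1 + t\<^sup>2 * N) * sqrt (1 + t\<^sup>2 * N) = (1 + t\<^sup>2 * N) powr 1 * (1 + t\<^sup>2 * N) powr (1/2)"
          using ps by (simp add: sq)
        also have "\<dots> = (1 + t\<^sup>2 * N) powr (3/2)" by (subst powr_add[symmetric]) simp
        finally show ?thesis unfolding sector_speed_def by (simp only: powr_minus divide_inverse)
      qed
      have r1: "(1 + t * L) powr (p - 1) * (1 + t * L) powr (- p) = 1 / (1 + t * L)"
        using ps powr_minus_divide[of "1 + t * L" 1] by (simp flip: powr_add)
      have r2: "(1 + t\<^sup>2 * N) powr (- (3/2)) * (1 + t\<^sup>2 * N) powr e = (1 + t\<^sup>2 * N) powr (- ((p - 1) / 2))"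
        unfolding powr_add[symmetric] by (rule arg_cong[of _ _ "\<lambda>x. (1 + t\<^sup>2 * N) powr x"]) (simp add: e_def field_simps)
      have "?c t powr (p - 1) * g (?c t) * (t powr (\<beta> - 1) * (1 + t * L) powr (- p)) =
         g (?c t) * t powr (\<beta> - 1) * ((1 + t * L) powr (p - 1) * (1 + t * L) powr (- p)) * (1 + t\<^sup>2 * N) powr (- ((p - 1) / 2))"
        unfolding c by simp
      also have "\<dots> = g (?c t) * ?v t * m t"
        unfolding r1 r2[symmetric] v m_def using ps by simp
      finally show ?thesis .
    qed
    have int: "integral {\<tau>..1-\<tau>} (\<lambda>t. sector_ratio L N t powr (p - 1) * g (sector_ratio L N t) * (t powr (\<beta> - 1) * (1 + t * L) powr (- p)))
       = ?F (1 - \<tau>) - ?F \<tau> - integral {\<tau>..1-\<tau>} ?R"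
      unfolding integral_unique[OF I3, symmetric]
      by (rule Henstock_Kurzweil_Integration.integral_cong) (rule eq)
    define T where "T = \<tau> powr (- (\<bar>\<beta> - 1\<bar> + 1))"
    have T: "T \<ge> 0" by (simp add: T_def)
    have TM: "T \<le> \<tau> powr (- M)" "T / \<tau> = \<tau> powr (- M)"
    proof -
      show "T \<le> \<tau> powr (- M)" unfolding T_def M_def using \<tau> by (intro powr_mono') auto
      have "\<tau> powr (- M) = \<tau> powr (- (\<bar>\<beta> - 1\<bar> + 1)) * \<tau> powr (- 1)"
        unfolding M_def powr_add[symmetric] by (rule arg_cong[of _ _ "\<lambda>x. \<tau> powr x"]) simp
      moreover have "\<tau> powr (- 1) = 1 / \<tau>" using \<tau> powr_minus_divide[of \<tau> 1] by simp
      ultimately show "T / \<tau> = \<tau> powr (- M)" unfolding T_def by simp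
    qed
    have Fb: "\<bar>?F t\<bar> \<le> \<delta> * (M1 * T)" if "t \<in> {\<tau>..1-\<tau>}" for t
      unfolding abs_mult using \<delta>[of t] m_bound[OF that] that \<tau> \<delta>0 by (intro mult_mono) (auto simp: T_def)
    have Rb: "norm (?R t) \<le> \<delta> * (M1 * T * (M2 / \<tau>))" if "t \<in> {\<tau>..1-\<tau>}" for t
      unfolding real_norm_def abs_mult using \<delta>[of t] m_bound[OF that] l_bound[OF that] that \<tau> \<delta>0 M12 T
      by (intro mult_mono) (auto simp: T_def)
    have "norm (integral {\<tau>..1-\<tau>} ?R) \<le> \<delta> * (M1 * T * (M2 / \<tau>)) * (1 - \<tau> - \<tau>)"
      by (rule integral_bound[OF ab cR]) (rule Rb)
    also have "\<dots> \<le> \<delta> * (M1 * T * (M2 / \<tau>)) * 1"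
      using \<tau> \<delta>0 M12 T by (intro mult_left_mono) auto
    finally have "\<bar>integral {\<tau>..1-\<tau>} ?R\<bar> \<le> \<delta> * (M1 * M2) * (T / \<tau>)" by (simp add: mult_ac)
    moreover have "\<bar>?F (1 - \<tau>)\<bar> \<le> \<delta> * (M1 * T)" "\<bar>?F \<tau>\<bar> \<le> \<delta> * (M1 * T)" using Fb ab by auto
    moreover have "\<delta> * (M1 * T) \<le> \<delta> * (M1 * \<tau> powr (- M))"
      using TM \<delta>0 M12 by (intro mult_left_mono) auto
    ultimately have "\<bar>?F (1 - \<tau>) - ?F \<tau> - integral {\<tau>..1-\<tau>} ?R\<bar> \<le> 2 * (\<delta> * (M1 * \<tau> powr (- M))) + \<delta> * (M1 * M2) * \<tau> powr (- M)"
      unfolding TM(2) by linarith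
    also have "\<dots> = K * \<delta> * \<tau> powr (- M)" by (simp add: K_def algebra_simps)
    finally show ?thesis unfolding int .
  qed
  moreover have "K \<ge> 0" using M12 by (simp add: K_def)
  moreover have "M \<ge> 0" by (simp add: M_def)
  ultimately show ?thesis by blast
qed

lemma sum1_square_le:
  assumes "finite J"
  shows "(sum1 J w)\<^sup>2 \<le> (real (card J) + 1) * sumsq1 J w"
proof -
  let ?S = "\<Sum>k\<in>J. w k" and ?Q = "\<Sum>k\<in>J. (w k)\<^sup>2" and ?m = "real (card J)"
  have 1: "?S\<^sup>2 \<le> ?Q * ?m" by (rule sum_squared_le_sum_of_squares)
  have "0 \<le> (\<Sum>k\<in>J. (1 - w k)\<^sup>2)" by (intro sum_nonneg) auto
  also have "\<dots> = ?m + ?Q - 2 * ?S"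
    by (simp add: power2_eq_square algebra_simps sum.distrib sum_subtractf sum_distrib_left sum_distrib_right)
  finally have 2: "0 \<le> ?m + ?Q - 2 * ?S" .
  have "(?m + 1) * (1 + ?Q) - (1 + ?S)\<^sup>2 = (?Q * ?m - ?S\<^sup>2) + (?m + ?Q - 2 * ?S)"
    by (simp add: power2_eq_square algebra_simps)
  with 1 2 show ?thesis unfolding sum1_def sumsq1_def by linarith
qed

text \<open>The signed estimate on the rays has to pass through the formula for the sector, which is about nonnegative integrands.
  Adding a constant \<open>c\<close> that dominates the integrand makes everything nonnegative, and its contribution appears on both
  sides.\<close>

theorem sector_oscillation_estimate:
  fixes J :: "'i set"
  assumes fin: "finite J" and ij: "i \<noteq> j" "i \<notin> J" "j \<notin> J" and \<alpha>: "\<alpha> > 0"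
  defines "p \<equiv> \<alpha> * real (card J + 2)"
  defines "P \<equiv> PiM (insert i (insert j J)) (\<lambda>_. gamma_measure \<alpha>)"
  defines "r \<equiv> norm_ratio (insert i (insert j J))"
  shows "\<exists>K\<ge>0. \<exists>M\<ge>0. \<forall>\<tau> \<delta> D g c. 0 < \<tau> \<longrightarrow> \<tau> \<le> 1/2 \<longrightarrow>
    (\<forall>y. (D has_real_derivative g y) (at y)) \<longrightarrow> continuous_on UNIV g \<longrightarrow>
    (\<forall>y\<in>{1..sqrt (card J + 2)}. \<bar>D y\<bar> \<le> \<delta>) \<longrightarrow> (\<forall>y\<in>{1..sqrt (card J + 2)}. \<bar>y powr (p - 1) * g y\<bar> \<le> c) \<longrightarrow>
    (\<integral>\<^sup>+x. indicator (sector i j J) x * (indicator {\<tau><..<1-\<tau>} (x j / x i) * ennreal (c + r x powr (p - 1) * g (r x))) \<partial>P)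
    \<le> (\<integral>\<^sup>+x. indicator (sector i j J) x * (indicator {\<tau><..<1-\<tau>} (x j / x i) * ennreal c) \<partial>P)
      + ennreal (K * \<delta> * \<tau> powr (- M))"
proof -
  define B where "B = real (card J) + 1"
  define \<beta> where "\<beta> = \<alpha> * real (card J + 1)"
  have B: "B \<ge> 1" by (simp add: B_def)
  have p: "p > 0" using \<alpha> by (simp add: p_def)
  define Z where "Z = Gamma p / Gamma \<alpha> ^ (card J + 2)"
  have Z: "Z \<ge> 0" using p \<alpha> by (simp add: Z_def Gamma_real_pos less_imp_le)
  let ?W = "sector_weight \<alpha> J"
  obtain Q1 where Q1: "(\<integral>\<^sup>+w. ?W w \<partial>PiM J (\<lambda>_. lborel)) = ennreal Q1" "Q1 \<ge> 0"
    using nn_integral_sector_weight_finite[OF fin \<alpha>] by (cases "\<integral>\<^sup>+w. ?W w \<partial>PiM J (\<lambda>_. lborel)") auto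
  obtain K M where KM: "K \<ge> 0" "M \<ge> 0" and osc: "\<And>L N \<tau> \<delta> D g. 1 \<le> N \<Longrightarrow> N \<le> L \<Longrightarrow> L \<le> B \<Longrightarrow> 0 < \<tau> \<Longrightarrow> \<tau> \<le> 1/2 \<Longrightarrow>
    (\<forall>y. (D has_real_derivative g y) (at y)) \<Longrightarrow> continuous_on UNIV g \<Longrightarrow>
    (\<forall>t\<in>{0..1}. \<bar>D (sector_ratio L N t)\<bar> \<le> \<delta>) \<Longrightarrow>
    \<bar>integral {\<tau>..1-\<tau>} (\<lambda>t. sector_ratio L N t powr (p - 1) * g (sector_ratio L N t) * (t powr (\<beta> - 1) * (1 + t * L) powr (- p)))\<bar>
      \<le> K * \<delta> * \<tau> powr (- M)"
    using sector_inner_oscillation[OF B, of p \<beta>] by blast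
  have "(\<integral>\<^sup>+x. indicator (sector i j J) x * (indicator {\<tau><..<1-\<tau>} (x j / x i) * ennreal (c + r x powr (p - 1) * g (r x))) \<partial>P)
    \<le> (\<integral>\<^sup>+x. indicator (sector i j J) x * (indicator {\<tau><..<1-\<tau>} (x j / x i) * ennreal c) \<partial>P)
      + ennreal (Z * K * Q1 * \<delta> * \<tau> powr (- M))"
    if \<tau>: "0 < \<tau>" "\<tau> \<le> 1/2" and D: "\<forall>y. (D has_real_derivative g y) (at y)" and g: "continuous_on UNIV g"
      and \<delta>: "\<forall>y\<in>{1..sqrt (card J + 2)}. \<bar>D y\<bar> \<le> \<delta>" and c: "\<forall>y\<in>{1..sqrt (card J + 2)}. \<bar>y powr (p - 1) * g y\<bar> \<le> c"
    for \<tau> \<delta> D g c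
  proof -
    have [measurable]: "g \<in> borel_measurable borel" using g by (intro borel_measurable_continuous_onI)
    have one: "1 \<in> {1..sqrt (card J + 2)}" by simp
    have c0: "c \<ge> 0" using bspec[OF c one] by (intro order_trans[OF abs_ge_zero])
    have \<delta>0: "\<delta> \<ge> 0" using bspec[OF \<delta> one] by (intro order_trans[OF abs_ge_zero])
    let ?T = "{\<tau><..<1-\<tau>}"
    have T: "{0<..<1} \<inter> ?T = ?T" using \<tau> by auto
    have formula: "(\<integral>\<^sup>+x. indicator (sector i j J) x * (indicator ?T (x j / x i) * \<phi> (r x)) \<partial>P) =
      (\<integral>\<^sup>+w. ?W w * (\<integral>\<^sup>+t. indicator ?T t * \<phi> (sector_ratio (sum1 J w) (sumsq1 J w) t) *
          ennreal (Z * (t powr (\<beta> - 1) * (1 + t * sum1 J w) powr (- p))) \<partial>lborel) \<partial>PiM J (\<lambda>_. lborel))"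
      if "\<phi> \<in> borel_measurable borel" for \<phi> :: "real \<Rightarrow> ennreal"
      using nn_integral_sector[OF fin ij \<alpha> that, of ?T] unfolding T
      by (simp add: sector_weight_def Z_def p_def \<beta>_def r_def P_def)
    have "(\<integral>\<^sup>+x. indicator (sector i j J) x * (indicator ?T (x j / x i) * ennreal (c + r x powr (p - 1) * g (r x))) \<partial>P)
      = (\<integral>\<^sup>+w. ?W w * (\<integral>\<^sup>+t. indicator ?T t * ennreal (c + sector_ratio (sum1 J w) (sumsq1 J w) t powr (p - 1) * g (sector_ratio (sum1 J w) (sumsq1 J w) t)) *
          ennreal (Z * (t powr (\<beta> - 1) * (1 + t * sum1 J w) powr (- p))) \<partial>lborel) \<partial>PiM J (\<lambda>_. lborel))"
      by (rule formula) measurable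
    also have "\<dots> \<le> (\<integral>\<^sup>+w. ?W w * (\<integral>\<^sup>+t. indicator ?T t * ennreal c *
          ennreal (Z * (t powr (\<beta> - 1) * (1 + t * sum1 J w) powr (- p))) \<partial>lborel) + ennreal (Z * (K * \<delta> * \<tau> powr (- M))) * ?W w \<partial>PiM J (\<lambda>_. lborel))"
    proof (intro nn_integral_mono)
      fix w :: "'i \<Rightarrow> real"
      let ?L = "sum1 J w" and ?N = "sumsq1 J w"
      let ?r = "sector_ratio ?L ?N"
      let ?a = "\<lambda>t. t powr (\<beta> - 1) * (1 + t * ?L) powr (- p)"
      let ?\<psi> = "\<lambda>t. ?r t powr (p - 1) * g (?r t)"
      show "?W w * (\<integral>\<^sup>+t. indicator ?T t * ennreal (c + ?\<psi> t) * ennreal (Z * ?a t) \<partial>lborel)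
         \<le> ?W w * (\<integral>\<^sup>+t. indicator ?T t * ennreal c * ennreal (Z * ?a t) \<partial>lborel) + ennreal (Z * (K * \<delta> * \<tau> powr (- M))) * ?W w"
      proof (cases "\<forall>k\<in>J. 0 < w k \<and> w k < 1")
        case False
        show ?thesis unfolding sector_weight_eq_0[OF fin False] by simp
      next
        case True
        note b = sum1_bounds[OF fin, of w]
        have N: "1 \<le> ?N" "?N \<le> ?L" "?L \<le> B" using b True by (auto simp: B_def)
        have r: "?r t \<in> {1..sqrt (card J + 2)}" if "t \<in> {0..1}" for t
          using sector_ratio_bounds[of t ?N ?L B] sum1_square_le[OF fin, of w] N that
          by (auto simp: B_def add_ac)
        have pos: "0 < t" "1 + t * ?L > 0" "1 + t\<^sup>2 * ?N > 0" "?r t > 0" "t \<in> {0..1}" if "t \<in> {\<tau>..1-\<tau>}" for t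
        proof -
          show "0 < t" "t \<in> {0..1}" using that \<tau> by auto
          thus "1 + t * ?L > 0" "1 + t\<^sup>2 * ?N > 0" "?r t > 0" using N r[of t] by (auto intro!: add_pos_nonneg)
        qed
        have ca: "continuous_on {\<tau>..1-\<tau>} ?a"
          using pos(1,2) by (intro continuous_intros) (auto simp: less_imp_neq[THEN not_sym])
        have cr: "continuous_on {\<tau>..1-\<tau>} ?r"
          unfolding sector_ratio_def using pos(3) by (intro continuous_intros) (auto simp: less_imp_neq[THEN not_sym])
        have cg: "continuous_on {\<tau>..1-\<tau>} (\<lambda>t. g (?r t))"
          by (rule continuous_on_compose2[OF g cr]) auto
        have c\<psi>: "continuous_on {\<tau>..1-\<tau>} ?\<psi>"
        proof -
          have nz: "?r t \<noteq> 0" if "t \<in> {\<tau>..1-\<tau>}" for t using pos(4)[OF that] by simp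
          show ?thesis by (intro continuous_intros cr cg ballI nz)
        qed
        define A where "A = integral {\<tau>..1-\<tau>} ?a"
        define S where "S = integral {\<tau>..1-\<tau>} (\<lambda>t. ?\<psi> t * ?a t)"
        have hA: "(?a has_integral A) {\<tau>..1-\<tau>}"
          unfolding A_def by (rule integrable_integral, rule integrable_continuous_interval[OF ca])
        have hS: "((\<lambda>t. ?\<psi> t * ?a t) has_integral S) {\<tau>..1-\<tau>}"
          unfolding S_def by (rule integrable_integral, rule integrable_continuous_interval, intro continuous_intros ca c\<psi>)
        have A0: "A \<ge> 0" by (rule has_integral_nonneg[OF hA]) auto
        have Sb: "\<bar>S\<bar> \<le> K * \<delta> * \<tau> powr (- M)"
          unfolding S_def by (rule osc[OF N \<tau> D g]) (use \<delta> r in blast)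
        have "((\<lambda>t. Z * (c * ?a t + ?\<psi> t * ?a t)) has_integral Z * (c * A + S)) {\<tau><..<1-\<tau>}"
          unfolding has_integral_Icc_iff_Ioo[symmetric]
          by (intro has_integral_mult_right has_integral_add hA hS)
        hence "((\<lambda>t. (c + ?\<psi> t) * (Z * ?a t)) has_integral Z * (c * A + S)) {\<tau><..<1-\<tau>}"
          by (simp add: algebra_simps)
        from nn_integral_has_integral_lebesgue'[OF _ this]
        have 1: "(\<integral>\<^sup>+t. ennreal ((c + ?\<psi> t) * (Z * ?a t)) * indicator ?T t \<partial>lborel) = ennreal (Z * (c * A + S))"
        proof
          fix t assume t: "t \<in> ?T"
          hence "\<bar>?\<psi> t\<bar> \<le> c" using c r[of t] \<tau> by auto
          thus "0 \<le> (c + ?\<psi> t) * (Z * ?a t)" using Z by (intro mult_nonneg_nonneg) auto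
        qed (rule refl)
        have 1: "(\<integral>\<^sup>+t. indicator ?T t * ennreal (c + ?\<psi> t) * ennreal (Z * ?a t) \<partial>lborel) = ennreal (Z * (c * A + S))"
          unfolding 1[symmetric]
        proof (intro nn_integral_cong)
          fix t :: real
          show "indicator ?T t * ennreal (c + ?\<psi> t) * ennreal (Z * ?a t) = ennreal ((c + ?\<psi> t) * (Z * ?a t)) * indicator ?T t"
            by (subst ennreal_mult'') (use Z in \<open>simp_all only: mult_ac mult_nonneg_nonneg powr_ge_zero\<close>)
        qed
        have "((\<lambda>t. c * (Z * ?a t)) has_integral c * (Z * A)) {\<tau><..<1-\<tau>}"
          unfolding has_integral_Icc_iff_Ioo[symmetric]
          by (intro has_integral_mult_right hA)
        from nn_integral_has_integral_lebesgue'[OF _ this]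
        have 2: "(\<integral>\<^sup>+t. ennreal (c * (Z * ?a t)) * indicator ?T t \<partial>lborel) = ennreal (c * (Z * A))"
          using Z c0 by simp
        have 2: "(\<integral>\<^sup>+t. indicator ?T t * ennreal c * ennreal (Z * ?a t) \<partial>lborel) = ennreal (c * (Z * A))"
          unfolding 2[symmetric]
        proof (intro nn_integral_cong)
          fix t :: real
          show "indicator ?T t * ennreal c * ennreal (Z * ?a t) = ennreal (c * (Z * ?a t)) * indicator ?T t"
            by (subst ennreal_mult'') (use Z in \<open>simp_all only: mult_ac mult_nonneg_nonneg powr_ge_zero\<close>)
        qed
        have "ennreal (Z * (c * A + S)) \<le> ennreal (c * (Z * A) + Z * (K * \<delta> * \<tau> powr (- M)))"
        proof (rule ennreal_leI)
          have "Z * S \<le> Z * (K * \<delta> * \<tau> powr (- M))" using Sb Z by (intro mult_left_mono) auto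
          thus "Z * (c * A + S) \<le> c * (Z * A) + Z * (K * \<delta> * \<tau> powr (- M))" by (simp add: algebra_simps)
        qed
        also have "\<dots> = ennreal (c * (Z * A)) + ennreal (Z * (K * \<delta> * \<tau> powr (- M)))"
          using Z A0 c0 KM \<delta>0 by (intro ennreal_plus) auto
        finally have "(\<integral>\<^sup>+t. indicator ?T t * ennreal (c + ?\<psi> t) * ennreal (Z * ?a t) \<partial>lborel) \<le>
           (\<integral>\<^sup>+t. indicator ?T t * ennreal c * ennreal (Z * ?a t) \<partial>lborel) + ennreal (Z * (K * \<delta> * \<tau> powr (- M)))"
          unfolding 1 2 .
        from mult_left_mono[OF this, of "?W w"] show ?thesis by (simp only: distrib_left mult.commute[of _ "?W w"] zero_le)
      qed
    qed
    also have "\<dots> = (\<integral>\<^sup>+w. ?W w * (\<integral>\<^sup>+t. indicator ?T t * ennreal c *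
          ennreal (Z * (t powr (\<beta> - 1) * (1 + t * sum1 J w) powr (- p))) \<partial>lborel) \<partial>PiM J (\<lambda>_. lborel)) +
          ennreal (Z * (K * \<delta> * \<tau> powr (- M))) * (\<integral>\<^sup>+w. ?W w \<partial>PiM J (\<lambda>_. lborel))"
    proof (subst nn_integral_add)
      have [measurable_cong]: "sets (PiM J (\<lambda>_. lborel :: real measure)) = sets (PiM J (\<lambda>_. borel))"
        by (intro sets_PiM_cong) auto
      show "(\<lambda>w. ?W w * (\<integral>\<^sup>+t. indicator ?T t * ennreal c *
          ennreal (Z * (t powr (\<beta> - 1) * (1 + t * sum1 J w) powr (- p))) \<partial>lborel)) \<in> borel_measurable (PiM J (\<lambda>_. lborel))"
        by measurable
    qed (simp_all add: nn_integral_cmult)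
    also have "ennreal (Z * (K * \<delta> * \<tau> powr (- M))) * (\<integral>\<^sup>+w. ?W w \<partial>PiM J (\<lambda>_. lborel)) = ennreal (Z * K * Q1 * \<delta> * \<tau> powr (- M))"
      unfolding Q1 using Z KM \<delta>0 Q1 by (subst ennreal_mult[symmetric]) (auto simp: mult_ac)
    also have "(\<integral>\<^sup>+w. ?W w * (\<integral>\<^sup>+t. indicator ?T t * ennreal c *
          ennreal (Z * (t powr (\<beta> - 1) * (1 + t * sum1 J w) powr (- p))) \<partial>lborel) \<partial>PiM J (\<lambda>_. lborel)) =
       (\<integral>\<^sup>+x. indicator (sector i j J) x * (indicator ?T (x j / x i) * ennreal c) \<partial>P)"
      by (rule formula[symmetric]) simp
    finally show ?thesis .
  qed
  moreover have "Z * K * Q1 \<ge> 0" using Z KM Q1 by simp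
  ultimately show ?thesis using KM(2) by blast
qed

section \<open>The law of the ratio\<close>

lemma prob_space_gamma_measure:
  assumes "\<alpha> > 0"
  shows "prob_space (gamma_measure \<alpha>)"
proof
  have G: "Gamma \<alpha> > 0" using assms by (simp add: Gamma_real_pos)
  have "emeasure (gamma_measure \<alpha>) (space (gamma_measure \<alpha>)) = (\<integral>\<^sup>+x. ennreal (gamma_density \<alpha> x) \<partial>lborel)"
    by (simp add: gamma_measure_def emeasure_density)
  also have "\<dots> = (\<integral>\<^sup>+x. ennreal (1 / Gamma \<alpha>) * (indicator {0<..} x * ennreal (x powr (\<alpha> - 1) * exp (- (x * 1)))) \<partial>lborel)"
    using G by (intro nn_integral_cong) (auto simp: gamma_density_def indicator_def ennreal_mult'[symmetric])
  also have "\<dots> = ennreal (1 / Gamma \<alpha>) * ennreal (Gamma \<alpha> * 1 powr (- \<alpha>))"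
    by (subst nn_integral_cmult, simp, subst nn_integral_powr_exp) (use assms in auto)
  also have "\<dots> = 1" using G by (simp add: ennreal_mult'[symmetric])
  finally show "emeasure (gamma_measure \<alpha>) (space (gamma_measure \<alpha>)) = 1" .
qed

text \<open>\<open>\<Sum> x\<^sub>k\<^sup>2 \<le> (\<Sum> x\<^sub>k)\<^sup>2 \<le> n \<Sum> x\<^sub>k\<^sup>2\<close>.\<close>

lemma norm_ratio_bounds:
  assumes fin: "finite I" and ne: "I \<noteq> {}" and pos: "\<And>k. k \<in> I \<Longrightarrow> x k > 0"
  shows "1 \<le> norm_ratio I x" "norm_ratio I x \<le> sqrt (card I)"
proof -
  have S: "(\<Sum>k\<in>I. x k) > 0" using assms by (intro sum_pos) auto
  have Q: "(\<Sum>k\<in>I. (x k)\<^sup>2) > 0"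
  proof (intro sum_pos fin ne)
    fix k assume "k \<in> I"
    from pos[OF this] show "0 < (x k)\<^sup>2" by simp
  qed
  have "(\<Sum>k\<in>I. (x k)\<^sup>2) \<le> (\<Sum>k\<in>I. x k * (\<Sum>k\<in>I. x k))"
  proof (intro sum_mono)
    fix k assume k: "k \<in> I"
    have "x k \<le> (\<Sum>k\<in>I. x k)" using fin k pos by (intro member_le_sum) (auto intro: less_imp_le)
    thus "(x k)\<^sup>2 \<le> x k * (\<Sum>k\<in>I. x k)" using pos[OF k] by (simp add: power2_eq_square)
  qed
  also have "\<dots> = (\<Sum>k\<in>I. x k)\<^sup>2" by (simp add: sum_distrib_right power2_eq_square)
  finally have "sqrt (\<Sum>k\<in>I. (x k)\<^sup>2) \<le> (\<Sum>k\<in>I. x k)" using S by (intro real_le_lsqrt) auto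
  thus "1 \<le> norm_ratio I x" using Q by (simp add: norm_ratio_def)
  have "(\<Sum>k\<in>I. x k)\<^sup>2 \<le> real (card I) * (\<Sum>k\<in>I. (x k)\<^sup>2)"
    using sum_squared_le_sum_of_squares[of x I] by (simp add: mult.commute)
  hence "(\<Sum>k\<in>I. x k) \<le> sqrt (real (card I) * (\<Sum>k\<in>I. (x k)\<^sup>2))" by (rule real_le_rsqrt)
  hence "(\<Sum>k\<in>I. x k) \<le> sqrt (real (card I)) * sqrt (\<Sum>k\<in>I. (x k)\<^sup>2)" by (simp only: real_sqrt_mult)
  thus "norm_ratio I x \<le> sqrt (card I)" using Q by (simp add: norm_ratio_def pos_divide_le_eq)
qed

lemma AE_gamma_measure_pos: "AE x in gamma_measure \<alpha>. x > 0"
  unfolding gamma_measure_def by (subst AE_density) (auto simp: gamma_density_def)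

lemma AE_gamma_measure_neq: "AE x in gamma_measure \<alpha>. x \<noteq> c"
proof -
  have "AE x in lborel. x \<noteq> c" by (rule AE_lborel_singleton)
  thus ?thesis unfolding gamma_measure_def by (subst AE_density) auto
qed

lemma AE_PiM_gamma_pos:
  assumes "finite I" "\<alpha> > 0"
  shows "AE x in PiM I (\<lambda>_. gamma_measure \<alpha>). \<forall>i\<in>I. x i > 0"
proof -
  have "AE x in PiM I (\<lambda>_. gamma_measure \<alpha>). x i > 0" if "i \<in> I" for i
    by (rule AE_PiM_component[OF _ that AE_gamma_measure_pos]) (rule prob_space_gamma_measure[OF assms(2)])
  thus ?thesis using assms(1) by (intro AE_finite_allI) auto
qed

text \<open>For fixed other coordinates, \<open>x\<^sub>i\<close> has a density.\<close>

lemma AE_PiM_gamma_neq: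
  assumes fin: "finite I" and \<alpha>: "\<alpha> > 0" and i: "i \<in> I" and k: "k \<in> I" "i \<noteq> k"
  shows "AE x in PiM I (\<lambda>_. gamma_measure \<alpha>). x i \<noteq> x k"
proof -
  interpret G: product_sigma_finite "\<lambda>_. gamma_measure \<alpha>"
    using sigma_finite_gamma_measure[OF \<alpha>] by (intro product_sigma_finite.intro)
  let ?J = "I - {i}"
  have I: "insert i ?J = I" using i by blast
  have sG: "sets (PiM I (\<lambda>_. gamma_measure \<alpha>)) = sets (PiM I (\<lambda>_. borel))" by (intro sets_PiM_cong) auto
  have [measurable]: "(\<lambda>x. x i) \<in> borel_measurable (PiM I (\<lambda>_. borel :: real measure))"
     "(\<lambda>x. x k) \<in> borel_measurable (PiM I (\<lambda>_. borel :: real measure))"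
    using i k(1) by measurable
  have m0: "(\<lambda>x. if x i = x k then 1 else 0 :: ennreal) \<in> borel_measurable (PiM I (\<lambda>_. borel :: real measure))"
    by measurable
  have ind: "(indicator {x. x i = x k} :: _ \<Rightarrow> ennreal) = (\<lambda>x. if x i = x k then 1 else 0)"
    by (auto simp: fun_eq_iff)
  have m: "(indicator {x. x i = x k} :: _ \<Rightarrow> ennreal) \<in> borel_measurable (PiM I (\<lambda>_. gamma_measure \<alpha>))"
    unfolding ind measurable_cong_sets[OF sG refl] by (rule m0)
  have "(\<integral>\<^sup>+x. indicator {x. x i = x k} x \<partial>PiM I (\<lambda>_. gamma_measure \<alpha>)) =
     (\<integral>\<^sup>+x. \<integral>\<^sup>+y. indicator {x. x i = x k} (x(i := y)) \<partial>gamma_measure \<alpha> \<partial>PiM ?J (\<lambda>_. gamma_measure \<alpha>))"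
    using G.product_nn_integral_insert[of ?J i "\<lambda>x. indicator {x. x i = x k} x"] m fin unfolding I by simp
  also have "\<dots> = (\<integral>\<^sup>+x. 0 \<partial>PiM ?J (\<lambda>_. gamma_measure \<alpha>))"
  proof (intro nn_integral_cong)
    fix x :: "'a \<Rightarrow> real"
    have "(\<integral>\<^sup>+y. indicator {x. x i = x k} (x(i := y)) \<partial>gamma_measure \<alpha>) = (\<integral>\<^sup>+y. 0 \<partial>gamma_measure \<alpha>)"
    proof (rule nn_integral_cong_AE)
      show "AE y in gamma_measure \<alpha>. indicator {x. x i = x k} (x(i := y)) = (0::ennreal)"
        using AE_gamma_measure_neq[where c = "x k"] by eventually_elim (use k in auto)
    qed
    thus "(\<integral>\<^sup>+y. indicator {x. x i = x k} (x(i := y)) \<partial>gamma_measure \<alpha>) = (0::ennreal)" by simp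
  qed
  finally have "(\<integral>\<^sup>+x. indicator {x. x i = x k} x \<partial>PiM I (\<lambda>_. gamma_measure \<alpha>)) = (0::ennreal)" by simp
  hence "AE x in PiM I (\<lambda>_. gamma_measure \<alpha>). indicator {x. x i = x k} x = (0::ennreal)"
    using m by (simp add: nn_integral_0_iff_AE)
  thus ?thesis by eventually_elim (auto simp: indicator_def split: if_splits)
qed

definition distinct_pairs :: "'i set \<Rightarrow> ('i \<times> 'i) set" where
  "distinct_pairs I = {(i, j). i \<in> I \<and> j \<in> I \<and> i \<noteq> j}"

lemma finite_distinct_pairs [simp]: "finite I \<Longrightarrow> finite (distinct_pairs I)"
  by (rule finite_subset[of _ "I \<times> I"]) (auto simp: distinct_pairs_def)

definition pair_sector :: "'i set \<Rightarrow> 'i \<times> 'i \<Rightarrow> ('i \<Rightarrow> real) set" where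
  "pair_sector I q = sector (fst q) (snd q) (I - {fst q, snd q})"

text \<open>Without ties, the largest and the second largest entry determine \<open>i\<close> and \<open>j\<close>.\<close>

lemma sum_indicator_pair_sector:
  fixes x :: "'i \<Rightarrow> real"
  assumes fin: "finite I" and card: "card I \<ge> 2" and pos: "\<And>i. i \<in> I \<Longrightarrow> x i > 0" and inj: "inj_on x I"
  shows "(\<Sum>q\<in>distinct_pairs I. indicator (pair_sector I q) x) = (1 :: 'b :: semiring_1)"
proof -
  have ne: "I \<noteq> {}" using card by auto
  have exmax: "\<exists>i\<in>A. \<forall>k\<in>A - {i}. x k < x i" if A: "A \<subseteq> I" "A \<noteq> {}" for A
  proof -
    have finA: "finite A" using A fin finite_subset by blast
    obtain i where i: "i \<in> A" "x i = Max (x ` A)"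
      using Max_in[of "x ` A"] finA A by fastforce
    have "x k < x i" if k: "k \<in> A - {i}" for k
    proof -
      have "x k \<le> x i" unfolding i(2) using k finA by (intro Max_ge) auto
      moreover have "x k \<noteq> x i" using inj_onD[OF inj, of k i] k i(1) A by blast
      ultimately show ?thesis by simp
    qed
    thus ?thesis using i by blast
  qed
  obtain i where i: "i \<in> I" "\<And>k. k \<in> I - {i} \<Longrightarrow> x k < x i" using exmax[of I] ne by blast
  have "card (I - {i}) \<ge> 1" using card i fin by simp
  hence "I - {i} \<noteq> {}" by (metis card.empty not_one_le_zero)
  then obtain j where j: "j \<in> I - {i}" "\<And>k. k \<in> I - {i} - {j} \<Longrightarrow> x k < x j" using exmax[of "I - {i}"] by blast
  have ij: "(i, j) \<in> distinct_pairs I" using i j by (auto simp: distinct_pairs_def)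
  have iff: "x \<in> pair_sector I q \<longleftrightarrow> q = (i, j)" if q: "q \<in> distinct_pairs I" for q
  proof
    assume "q = (i, j)"
    thus "x \<in> pair_sector I q" using i j pos by (auto simp: pair_sector_def sector_def)
  next
    obtain a b where ab: "q = (a, b)" by (cases q)
    assume "x \<in> pair_sector I q"
    hence ab2: "x b < x a" "\<And>k. k \<in> I - {a, b} \<Longrightarrow> x k < x b" by (auto simp: ab pair_sector_def sector_def)
    have abI: "a \<in> I" "b \<in> I" "a \<noteq> b" using q by (auto simp: ab distinct_pairs_def)
    have amax: "x k < x a" if "k \<in> I - {a}" for k
      using ab2 that by (cases "k = b") (auto intro: less_trans)
    have "a = i" using amax[of i] i(2)[of a] abI i(1) by (cases "a = i") auto
    moreover have "b = j"
    proof (rule ccontr)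
      assume nb: "b \<noteq> j"
      have "x j < x b" using ab2(2)[of j] j(1) nb \<open>a = i\<close> by auto
      moreover have "x b < x j" using j(2)[of b] abI nb \<open>a = i\<close> by auto
      ultimately show False by simp
    qed
    ultimately show "q = (i, j)" by (simp add: ab)
  qed
  have "(\<Sum>q\<in>distinct_pairs I. indicator (pair_sector I q) x) = (\<Sum>q\<in>distinct_pairs I. if q = (i, j) then 1 else (0::'b))"
    by (intro sum.cong refl) (simp add: indicator_def iff)
  also have "\<dots> = 1" using ij fin by simp
  finally show ?thesis .
qed

lemma AE_sum_indicator_pair_sector:
  assumes fin: "finite I" and card: "card I \<ge> 2" and \<alpha>: "\<alpha> > 0"
  shows "AE x in PiM I (\<lambda>_. gamma_measure \<alpha>).
           (\<Sum>q\<in>distinct_pairs I. indicator (pair_sector I q) x) = (1 :: 'b :: semiring_1)"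
proof -
  have "AE x in PiM I (\<lambda>_. gamma_measure \<alpha>). \<forall>i\<in>I. \<forall>k\<in>I. i \<noteq> k \<longrightarrow> x i \<noteq> x k"
    using AE_PiM_gamma_neq[OF fin \<alpha>] fin by (intro AE_finite_allI) auto
  with AE_PiM_gamma_pos[OF fin \<alpha>] show ?thesis
    by eventually_elim (intro sum_indicator_pair_sector fin card, auto simp: inj_on_def)
qed

lemma measurable_pair_sector [measurable]:
  assumes "finite I" "q \<in> distinct_pairs I"
  shows "Measurable.pred (PiM I (\<lambda>_. borel)) (\<lambda>x. x \<in> pair_sector I q)"
  unfolding pair_sector_def by (rule measurable_sector) (use assms in \<open>auto simp: distinct_pairs_def\<close>)

lemma pair_sector_pos:
  assumes "x \<in> pair_sector I q" "k \<in> I"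
  shows "x k > 0"
  using assms by (cases "k = fst q"; cases "k = snd q") (auto simp: pair_sector_def sector_def intro: less_trans)

lemma distinct_pairs_decompose:
  assumes "finite I" "q \<in> distinct_pairs I"
  obtains i j J where "q = (i, j)" "i \<noteq> j" "i \<notin> J" "j \<notin> J" "finite J" "I = insert i (insert j J)"
    "card I = card J + 2" "pair_sector I q = sector i j J"
proof -
  obtain i j where q: "q = (i, j)" by (cases q)
  define J where "J = I - {i, j}"
  have ij: "i \<in> I" "j \<in> I" "i \<noteq> j" using assms(2) by (auto simp: q distinct_pairs_def)
  have I: "I = insert i (insert j J)" using ij by (auto simp: J_def)
  have J: "i \<notin> J" "j \<notin> J" "finite J" using assms(1) by (auto simp: J_def)
  have c: "card I = card J + 2" using J ij(3) by (subst I) simp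
  have ps: "pair_sector I q = sector i j J" by (simp add: pair_sector_def q J_def)
  show ?thesis by (rule that[OF q ij(3) J I c ps])
qed

text \<open>Almost every sample lies in exactly one sector, so the bounds for the sectors add up. Taking the infimum over \<open>s\<close> turns the
  right-hand side into \<open>2K (\<integral>\<phi>\<^sup>2) powr (1/2)\<close>.\<close>

theorem norm_ratio_law_L2_bound:
  assumes fin: "finite I" and card: "card I \<ge> 3" and \<alpha>: "\<alpha> > 0" and \<beta>: "\<alpha> * (real (card I) - 1) > 1/2"
  shows "\<exists>K\<ge>0. \<forall>s>0. \<forall>\<phi>\<in>borel_measurable borel. (\<forall>x. \<phi> x \<ge> (0::real)) \<longrightarrow>
     (\<integral>\<^sup>+x. ennreal (\<phi> (norm_ratio I x)) \<partial>PiM I (\<lambda>_. gamma_measure \<alpha>)) \<le>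
     ennreal K * (ennreal s * (\<integral>\<^sup>+x. ennreal ((\<phi> x)\<^sup>2) \<partial>lborel) + ennreal (1 / s))"
proof -
  let ?P = "PiM I (\<lambda>_. gamma_measure \<alpha>)"
  have card2: "card I \<ge> 2" using card by simp
  have sG [measurable_cong]: "sets ?P = sets (PiM I (\<lambda>_. borel))" by (intro sets_PiM_cong) auto
  have "\<exists>K\<ge>0. \<forall>s>0. \<forall>\<phi>\<in>borel_measurable borel. (\<forall>x. \<phi> x \<ge> (0::real)) \<longrightarrow>
     (\<integral>\<^sup>+x. indicator (pair_sector I q) x * ennreal (\<phi> (norm_ratio I x)) \<partial>?P) \<le>
     ennreal K * (ennreal s * (\<integral>\<^sup>+x. ennreal ((\<phi> x)\<^sup>2) \<partial>lborel) + ennreal (1 / s))" if q: "q \<in> distinct_pairs I" for q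
  proof -
    obtain i j J where J: "q = (i, j)" "i \<noteq> j" "i \<notin> J" "j \<notin> J" "finite J" "I = insert i (insert j J)"
      "card I = card J + 2" "pair_sector I q = sector i j J" using distinct_pairs_decompose[OF fin q] .
    have ne: "J \<noteq> {}" using card J(7) by auto
    have b: "\<alpha> * real (card J + 1) > 1/2" using \<beta> J(7) by simp
    note est = sector_edge_estimate[OF J(5,2,3,4) \<alpha> ne b, folded J(6) J(8)]
    from est obtain K \<epsilon> where K: "K \<ge> 0" "\<epsilon> > 0" and
      *: "\<forall>\<tau> s. \<forall>\<phi>\<in>borel_measurable borel. 0 < \<tau> \<longrightarrow> \<tau> \<le> 1/2 \<longrightarrow> s > 0 \<longrightarrow> (\<forall>x. \<phi> x \<ge> (0::real)) \<longrightarrow>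
       (\<integral>\<^sup>+x. indicator (pair_sector I q) x * (indicator (edges \<tau>) (x j / x i) * ennreal (\<phi> (norm_ratio I x))) \<partial>?P)
        \<le> ennreal K * (ennreal s * (\<integral>\<^sup>+x. ennreal ((\<phi> x)\<^sup>2) \<partial>lborel) + ennreal (\<tau> powr \<epsilon> / s))"
      by (elim exE conjE) (rule that)
    (* At tau = 1/2 the two ends cover the whole ray. *)
    have e: "edges (1/2) = UNIV" by (auto simp: edges_def)
    have "(\<integral>\<^sup>+x. indicator (pair_sector I q) x * ennreal (\<phi> (norm_ratio I x)) \<partial>?P) \<le>
     ennreal K * (ennreal s * (\<integral>\<^sup>+x. ennreal ((\<phi> x)\<^sup>2) \<partial>lborel) + ennreal (1 / s))"
      if "\<phi> \<in> borel_measurable borel" "s > 0" "\<forall>x. \<phi> x \<ge> 0" for s \<phi>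
    proof -
      have "(1/2) powr \<epsilon> \<le> (1/2::real) powr 0" using K by (intro powr_mono') auto
      hence "(1/2) powr \<epsilon> / s \<le> 1 / s" using that by (intro divide_right_mono) auto
      hence "ennreal K * (ennreal s * (\<integral>\<^sup>+x. ennreal ((\<phi> x)\<^sup>2) \<partial>lborel) + ennreal ((1/2) powr \<epsilon> / s))
        \<le> ennreal K * (ennreal s * (\<integral>\<^sup>+x. ennreal ((\<phi> x)\<^sup>2) \<partial>lborel) + ennreal (1 / s))"
        by (intro mult_left_mono add_left_mono ennreal_leI) auto
      moreover have "(\<integral>\<^sup>+x. indicator (pair_sector I q) x * ennreal (\<phi> (norm_ratio I x)) \<partial>?P) \<le>
         ennreal K * (ennreal s * (\<integral>\<^sup>+x. ennreal ((\<phi> x)\<^sup>2) \<partial>lborel) + ennreal ((1/2) powr \<epsilon> / s))"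
        using *[rule_format, of \<phi> "1/2" s] that by (simp add: e)
      ultimately show ?thesis by (rule order_trans[rotated])
    qed
    thus ?thesis by (intro exI[of _ K] conjI K(1)) simp
  qed
  hence "\<forall>q\<in>distinct_pairs I. \<exists>K\<ge>0. \<forall>s>0. \<forall>\<phi>\<in>borel_measurable borel. (\<forall>x. \<phi> x \<ge> (0::real)) \<longrightarrow>
     (\<integral>\<^sup>+x. indicator (pair_sector I q) x * ennreal (\<phi> (norm_ratio I x)) \<partial>?P) \<le>
     ennreal K * (ennreal s * (\<integral>\<^sup>+x. ennreal ((\<phi> x)\<^sup>2) \<partial>lborel) + ennreal (1 / s))" by (rule ballI)
  from bchoice[OF this] obtain K where K': "\<forall>q\<in>distinct_pairs I. K q \<ge> 0 \<and> (\<forall>s>0. \<forall>\<phi>\<in>borel_measurable borel. (\<forall>x. \<phi> x \<ge> (0::real)) \<longrightarrow>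
     (\<integral>\<^sup>+x. indicator (pair_sector I q) x * ennreal (\<phi> (norm_ratio I x)) \<partial>?P) \<le>
     ennreal (K q) * (ennreal s * (\<integral>\<^sup>+x. ennreal ((\<phi> x)\<^sup>2) \<partial>lborel) + ennreal (1 / s)))"
    by (elim exE) (rule that)
  have K: "K q \<ge> 0" if "q \<in> distinct_pairs I" for q using bspec[OF K' that] by (rule conjunct1)
  have *: "(\<integral>\<^sup>+x. indicator (pair_sector I q) x * ennreal (\<phi> (norm_ratio I x)) \<partial>?P) \<le>
     ennreal (K q) * (ennreal s * (\<integral>\<^sup>+x. ennreal ((\<phi> x)\<^sup>2) \<partial>lborel) + ennreal (1 / s))"
    if "q \<in> distinct_pairs I" "s > 0" "\<phi> \<in> borel_measurable borel" "\<forall>x. \<phi> x \<ge> (0::real)" for q s \<phi>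
    using bspec[OF K' that(1), THEN conjunct2, rule_format, OF that(2,3)] that(4) by simp
  have "(\<integral>\<^sup>+x. ennreal (\<phi> (norm_ratio I x)) \<partial>?P) \<le>
     ennreal (\<Sum>q\<in>distinct_pairs I. K q) * (ennreal s * (\<integral>\<^sup>+x. ennreal ((\<phi> x)\<^sup>2) \<partial>lborel) + ennreal (1 / s))"
    if s: "s > 0" and \<phi>: "\<phi> \<in> borel_measurable borel" "\<forall>x. \<phi> x \<ge> 0" for s \<phi>
  proof -
    note [measurable] = \<phi>(1)
    have [measurable]: "(\<lambda>x. indicator (pair_sector I q) x :: ennreal) \<in> borel_measurable ?P" if "q \<in> distinct_pairs I" for q
    proof -
      have [measurable]: "Measurable.pred (PiM I (\<lambda>_. borel)) (\<lambda>x. x \<in> pair_sector I q)"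
        by (rule measurable_pair_sector[OF fin that])
      show ?thesis by measurable
    qed
    have "(\<integral>\<^sup>+x. ennreal (\<phi> (norm_ratio I x)) \<partial>?P) =
       (\<integral>\<^sup>+x. (\<Sum>q\<in>distinct_pairs I. indicator (pair_sector I q) x * ennreal (\<phi> (norm_ratio I x))) \<partial>?P)"
    proof (rule nn_integral_cong_AE)
      show "AE x in ?P. ennreal (\<phi> (norm_ratio I x)) = (\<Sum>q\<in>distinct_pairs I. indicator (pair_sector I q) x * ennreal (\<phi> (norm_ratio I x)))"
        using AE_sum_indicator_pair_sector[OF fin card2 \<alpha>, where ?'b = ennreal]
      proof eventually_elim
        case (elim x)
        show ?case unfolding sum_distrib_right[symmetric] elim by simp
      qed
    qed
    also have "\<dots> = (\<Sum>q\<in>distinct_pairs I. \<integral>\<^sup>+x. indicator (pair_sector I q) x * ennreal (\<phi> (norm_ratio I x)) \<partial>?P)"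
      by (intro nn_integral_sum) measurable
    also have "\<dots> \<le> (\<Sum>q\<in>distinct_pairs I. ennreal (K q) * (ennreal s * (\<integral>\<^sup>+x. ennreal ((\<phi> x)\<^sup>2) \<partial>lborel) + ennreal (1 / s)))"
      by (intro sum_mono *) (use s \<phi> in auto)
    also have "\<dots> = ennreal (\<Sum>q\<in>distinct_pairs I. K q) * (ennreal s * (\<integral>\<^sup>+x. ennreal ((\<phi> x)\<^sup>2) \<partial>lborel) + ennreal (1 / s))"
      using K unfolding sum_distrib_right[symmetric] by (subst sum_ennreal) auto
    finally show ?thesis .
  qed
  moreover have "(\<Sum>q\<in>distinct_pairs I. K q) \<ge> 0" using K by (intro sum_nonneg) auto
  ultimately show ?thesis by (intro exI[of _ "\<Sum>q\<in>distinct_pairs I. K q"]) simp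
qed

text \<open>Brings a comparison of shifted nonnegative integrals back to a signed function: all integrals are finite, so the
  constant cancels.\<close>

lemma (in prob_space) integral_le_of_shifted_nn_integral_le:
  fixes \<psi> :: "'a \<Rightarrow> real"
  assumes A [measurable]: "Measurable.pred M (\<lambda>x. x \<in> A)" and \<psi> [measurable]: "\<psi> \<in> borel_measurable M"
    and bd: "\<And>x. x \<in> space M \<Longrightarrow> x \<in> A \<Longrightarrow> \<bar>\<psi> x\<bar> \<le> c" and c: "c \<ge> 0" and e: "e \<ge> 0"
    and le: "(\<integral>\<^sup>+x. indicator A x * ennreal (c + \<psi> x) \<partial>M) \<le> (\<integral>\<^sup>+x. indicator A x * ennreal c \<partial>M) + ennreal e"
  shows "(\<integral>x. indicator A x * \<psi> x \<partial>M) \<le> e"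
proof -
  have i1: "integrable M (\<lambda>x. indicator A x * \<psi> x)"
    by (rule integrable_const_bound[where B = c]) (auto simp: indicator_def c bd)
  have i2: "integrable M (\<lambda>x. indicator A x * c)"
    by (rule integrable_const_bound[where B = c]) (auto simp: indicator_def c)
  have i3: "integrable M (\<lambda>x. indicator A x * (c + \<psi> x))"
    using Bochner_Integration.integrable_add[OF i2 i1] by (simp add: distrib_left)
  have "(\<integral>\<^sup>+x. indicator A x * ennreal (c + \<psi> x) \<partial>M) = (\<integral>\<^sup>+x. ennreal (indicator A x * (c + \<psi> x)) \<partial>M)"
    by (intro nn_integral_cong) (auto simp: indicator_def)
  also have "\<dots> = ennreal (\<integral>x. indicator A x * (c + \<psi> x) \<partial>M)"
  proof (rule nn_integral_eq_integral[OF i3], rule AE_I2)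
    fix x assume "x \<in> space M"
    thus "0 \<le> indicator A x * (c + \<psi> x)" using bd[of x] by (cases "x \<in> A") auto
  qed
  finally have 1: "(\<integral>\<^sup>+x. indicator A x * ennreal (c + \<psi> x) \<partial>M) = \<dots>" .
  have "(\<integral>\<^sup>+x. indicator A x * ennreal c \<partial>M) = (\<integral>\<^sup>+x. ennreal (indicator A x * c) \<partial>M)"
    by (intro nn_integral_cong) (auto simp: indicator_def)
  also have "\<dots> = ennreal (\<integral>x. indicator A x * c \<partial>M)"
    by (rule nn_integral_eq_integral[OF i2]) (use c in auto)
  finally have 2: "(\<integral>\<^sup>+x. indicator A x * ennreal c \<partial>M) = \<dots>" .
  have nn: "0 \<le> (\<integral>x. indicator A x * c \<partial>M)" using c by (intro integral_nonneg_AE) auto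
  have "ennreal (\<integral>x. indicator A x * (c + \<psi> x) \<partial>M) \<le> ennreal ((\<integral>x. indicator A x * c \<partial>M) + e)"
    using le unfolding 1 2 using nn e by simp
  hence "(\<integral>x. indicator A x * (c + \<psi> x) \<partial>M) \<le> (\<integral>x. indicator A x * c \<partial>M) + e"
    using nn e by (subst (asm) ennreal_le_iff) auto
  moreover have "(\<integral>x. indicator A x * (c + \<psi> x) \<partial>M) = (\<integral>x. indicator A x * c \<partial>M) + (\<integral>x. indicator A x * \<psi> x \<partial>M)"
    using Bochner_Integration.integral_add[OF i2 i1] by (simp add: distrib_left)
  ultimately show ?thesis by linarith
qed

text \<open>The case of interest is that of a primitive \<open>D\<close> much smaller than \<open>g\<close>, so that \<open>g\<close> oscillates. The interval \<open>[1, b]\<close>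
  is the range of the ratio.\<close>

definition oscillation_data :: "real \<Rightarrow> real \<Rightarrow> real \<Rightarrow> (real \<Rightarrow> real) \<Rightarrow> (real \<Rightarrow> real) \<Rightarrow> bool" where
  "oscillation_data b \<delta> \<Gamma> D g \<longleftrightarrow>
     (\<forall>y. (D has_real_derivative g y) (at y)) \<and> continuous_on UNIV g \<and>
     (\<forall>y\<in>{1..b}. \<bar>D y\<bar> \<le> \<delta>) \<and> \<Gamma> \<ge> 0 \<and>
     (\<integral>\<^sup>+y. indicator {1..b} y * ennreal ((g y)\<^sup>2) \<partial>lborel) \<le> ennreal \<Gamma>"

lemma nn_integral_cmult_indicator_square:
  fixes g :: "real \<Rightarrow> real"
  assumes [measurable]: "g \<in> borel_measurable borel"
  shows "(\<integral>\<^sup>+y. c * (indicator {a..b} y * ennreal ((g y)\<^sup>2)) \<partial>lborel) = c * (\<integral>\<^sup>+y. indicator {a..b} y * ennreal ((g y)\<^sup>2) \<partial>lborel)"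
  by (rule nn_integral_cmult) measurable

text \<open>On the middle part of the rays the integral is bounded by parts, in both directions because \<open>- g\<close> is as good as \<open>g\<close>; at their
  ends it is bounded by Young's inequality.\<close>

lemma pair_sector_oscillation:
  assumes fin: "finite I" and card: "card I \<ge> 3" and \<alpha>: "\<alpha> > 0" and \<beta>: "\<alpha> * (real (card I) - 1) > 1/2"
    and q: "q \<in> distinct_pairs I"
  defines "p \<equiv> \<alpha> * real (card I)"
  shows "\<exists>K\<ge>0. \<exists>\<epsilon>>0. \<exists>M\<ge>0. \<forall>\<tau> s \<delta> \<Gamma> D g. 0 < \<tau> \<longrightarrow> \<tau> \<le> 1/2 \<longrightarrow> s > 0 \<longrightarrow> oscillation_data (sqrt (card I)) \<delta> \<Gamma> D g \<longrightarrow>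
    \<bar>\<integral>x. indicator (pair_sector I q) x * (norm_ratio I x powr (p - 1) * g (norm_ratio I x)) \<partial>PiM I (\<lambda>_. gamma_measure \<alpha>)\<bar>
      \<le> K * (\<delta> * \<tau> powr (- M) + s * \<Gamma> + \<tau> powr \<epsilon> / s)"
proof -
  let ?P = "PiM I (\<lambda>_. gamma_measure \<alpha>)"
  let ?r = "norm_ratio I"
  let ?b = "sqrt (card I)"
  interpret P: prob_space ?P by (rule prob_space_PiM) (rule prob_space_gamma_measure[OF \<alpha>])
  have sG [measurable_cong]: "sets ?P = sets (PiM I (\<lambda>_. borel))" by (intro sets_PiM_cong) auto
  obtain i j J where J: "q = (i, j)" "i \<noteq> j" "i \<notin> J" "j \<notin> J" "finite J" "I = insert i (insert j J)"
      "card I = card J + 2" "pair_sector I q = sector i j J" using distinct_pairs_decompose[OF fin q] .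
  have Ine: "I \<noteq> {}" using card by auto
  have ijI: "i \<in> I" "j \<in> I" using q by (auto simp: J(1) distinct_pairs_def)
  have ne: "J \<noteq> {}" using card J(7) by auto
  have b: "\<alpha> * real (card J + 1) > 1/2" using \<beta> J(7) by simp
  have pJ: "\<alpha> * real (card J + 2) = p" by (simp add: p_def J(7))
  have bJ: "sqrt (real (card J + 2)) = ?b" by (simp add: J(7))
  note est = sector_edge_estimate[OF J(5,2,3,4) \<alpha> ne b, folded J(6) J(8)]
  from est obtain K2 \<epsilon> where K2: "K2 \<ge> 0" "\<epsilon> > 0" and
      edge: "\<forall>\<tau> s. \<forall>\<phi>\<in>borel_measurable borel. 0 < \<tau> \<longrightarrow> \<tau> \<le> 1/2 \<longrightarrow> s > 0 \<longrightarrow> (\<forall>x. \<phi> x \<ge> (0::real)) \<longrightarrow>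
       (\<integral>\<^sup>+x. indicator (pair_sector I q) x * (indicator (edges \<tau>) (x j / x i) * ennreal (\<phi> (?r x))) \<partial>?P)
        \<le> ennreal K2 * (ennreal s * (\<integral>\<^sup>+x. ennreal ((\<phi> x)\<^sup>2) \<partial>lborel) + ennreal (\<tau> powr \<epsilon> / s))"
    by (elim exE conjE) (rule that)
  note osc = sector_oscillation_estimate[OF J(5,2,3,4) \<alpha>, folded J(6) J(8), unfolded pJ bJ]
  from osc obtain K1 M where K1: "K1 \<ge> 0" "M \<ge> 0" and
    good: "\<forall>\<tau> \<delta> D g c. 0 < \<tau> \<longrightarrow> \<tau> \<le> 1/2 \<longrightarrow>
    (\<forall>y. (D has_real_derivative g y) (at y)) \<longrightarrow> continuous_on UNIV g \<longrightarrow>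
    (\<forall>y\<in>{1..?b}. \<bar>D y\<bar> \<le> \<delta>) \<longrightarrow> (\<forall>y\<in>{1..?b}. \<bar>y powr (p - 1) * g y\<bar> \<le> c) \<longrightarrow>
    (\<integral>\<^sup>+x. indicator (pair_sector I q) x * (indicator {\<tau><..<1-\<tau>} (x j / x i) * ennreal (c + ?r x powr (p - 1) * g (?r x))) \<partial>?P)
    \<le> (\<integral>\<^sup>+x. indicator (pair_sector I q) x * (indicator {\<tau><..<1-\<tau>} (x j / x i) * ennreal c) \<partial>?P)
      + ennreal (K1 * \<delta> * \<tau> powr (- M))"
    by (elim exE conjE) (rule that)
  (* A bound for y powr (2 (p - 1)) on the range of the ratio, for either sign of p - 1. *)
  define N1 where "N1 = ?b powr (2 * \<bar>p - 1\<bar>)"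
  have b1: "?b \<ge> 1" using card by simp
  have N1: "N1 \<ge> 1" using b1 by (auto simp: N1_def intro!: ge_one_powr_ge_zero)
  define K where "K = K1 + K2 * N1"
  have K: "K \<ge> 0" using K1 K2 N1 by (simp add: K_def)
  have mS [measurable]: "Measurable.pred (PiM I (\<lambda>_. borel)) (\<lambda>x. x \<in> pair_sector I q)"
    by (rule measurable_pair_sector[OF fin q])
  have [measurable]: "(\<lambda>x. x i) \<in> borel_measurable (PiM I (\<lambda>_. borel :: real measure))"
     "(\<lambda>x. x j) \<in> borel_measurable (PiM I (\<lambda>_. borel :: real measure))"
    using ijI by measurable
  have "\<bar>\<integral>x. indicator (pair_sector I q) x * (?r x powr (p - 1) * g (?r x)) \<partial>?P\<bar>
      \<le> K * (\<delta> * \<tau> powr (- M) + s * \<Gamma> + \<tau> powr \<epsilon> / s)"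
    if \<tau>: "0 < \<tau>" "\<tau> \<le> 1/2" and s: "s > 0" and data: "oscillation_data ?b \<delta> \<Gamma> D g" for \<tau> s \<delta> \<Gamma> D g
  proof -
    have D: "\<forall>y. (D has_real_derivative g y) (at y)" and g: "continuous_on UNIV g"
      and \<delta>: "\<forall>y\<in>{1..?b}. \<bar>D y\<bar> \<le> \<delta>" and \<Gamma>: "\<Gamma> \<ge> 0" "(\<integral>\<^sup>+y. indicator {1..?b} y * ennreal ((g y)\<^sup>2) \<partial>lborel) \<le> ennreal \<Gamma>"
      using data by (auto simp: oscillation_data_def)
    have [measurable]: "g \<in> borel_measurable borel" using g by (intro borel_measurable_continuous_onI)
    have \<delta>0: "\<delta> \<ge> 0" using \<delta> b1 by (intro order_trans[OF abs_ge_zero bspec[of _ _ 1]]) auto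
    let ?h = "\<lambda>y. y powr (p - 1) * g y"
    define \<psi> where "\<psi> = (\<lambda>x. ?h (?r x))"
    have [measurable]: "\<psi> \<in> borel_measurable ?P" unfolding \<psi>_def by measurable
    have "continuous_on {1..?b} ?h"
      by (intro continuous_intros continuous_on_subset[OF g]) auto
    hence "bounded (?h ` {1..?b})"
      by (intro compact_imp_bounded compact_continuous_image) auto
    then obtain c where c: "\<forall>y\<in>{1..?b}. \<bar>?h y\<bar> \<le> c" by (auto simp: bounded_iff)
    have c0: "c \<ge> 0" using c b1 by (intro order_trans[OF abs_ge_zero bspec[of _ _ 1]]) auto
    have rS: "?r x \<in> {1..?b}" if "x \<in> pair_sector I q" for x
      using norm_ratio_bounds[OF fin Ine pair_sector_pos[OF that]] by auto
    have \<psi>c: "\<bar>\<psi> x\<bar> \<le> c" if "x \<in> pair_sector I q" for x using c rS[OF that] by (auto simp: \<psi>_def)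
    define A where "A = {x. x \<in> pair_sector I q \<and> x j / x i \<in> {\<tau><..<1-\<tau>}}"
    define E where "E = {x. x \<in> pair_sector I q \<and> x j / x i \<in> edges \<tau>}"
    have [measurable]: "Measurable.pred ?P (\<lambda>x. x \<in> A)" "Measurable.pred ?P (\<lambda>x. x \<in> E)"
      unfolding A_def E_def mem_Collect_eq by measurable
    have indA: "indicator (pair_sector I q) x * (indicator {\<tau><..<1-\<tau>} (x j / x i) * z) = indicator A x * z" for x and z :: ennreal
      by (auto simp: A_def split: split_indicator)
    have indE: "indicator (pair_sector I q) x * (indicator (edges \<tau>) (x j / x i) * z) = indicator E x * z" for x and z :: ennreal
      by (auto simp: E_def split: split_indicator)
    have split: "indicator (pair_sector I q) x * z = indicator A x * z + indicator E x * z" for x and z :: real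
      by (auto simp: A_def E_def edges_def split: split_indicator)
    have e0: "K1 * \<delta> * \<tau> powr (- M) \<ge> 0" using K1 \<delta>0 by simp
    have up: "(\<integral>x. indicator A x * \<psi> x \<partial>?P) \<le> K1 * \<delta> * \<tau> powr (- M)"
    proof (rule P.integral_le_of_shifted_nn_integral_le[OF _ _ _ c0 e0])
      show "(\<integral>\<^sup>+x. indicator A x * ennreal (c + \<psi> x) \<partial>?P) \<le> (\<integral>\<^sup>+x. indicator A x * ennreal c \<partial>?P) + ennreal (K1 * \<delta> * \<tau> powr (- M))"
        using good[rule_format, OF \<tau> D[rule_format] g \<delta>[rule_format] c[rule_format]] unfolding indA \<psi>_def by simp
      show "\<bar>\<psi> x\<bar> \<le> c" if "x \<in> A" for x using \<psi>c that by (auto simp: A_def)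
    qed measurable
    have lo: "(\<integral>x. indicator A x * (- \<psi> x) \<partial>?P) \<le> K1 * \<delta> * \<tau> powr (- M)"
    proof (rule P.integral_le_of_shifted_nn_integral_le[OF _ _ _ c0 e0])
      have D': "((\<lambda>y. - D y) has_real_derivative - g y) (at y)" for y using D by (auto intro!: derivative_eq_intros)
      have g': "continuous_on UNIV (\<lambda>y. - g y)" using g by (intro continuous_intros)
      show "(\<integral>\<^sup>+x. indicator A x * ennreal (c + - \<psi> x) \<partial>?P) \<le> (\<integral>\<^sup>+x. indicator A x * ennreal c \<partial>?P) + ennreal (K1 * \<delta> * \<tau> powr (- M))"
        using good[rule_format, OF \<tau> D' g', of \<delta> c] \<delta> c unfolding indA \<psi>_def by simp
      show "\<bar>- \<psi> x\<bar> \<le> c" if "x \<in> A" for x using \<psi>c that by (auto simp: A_def)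
    qed measurable
    have iA: "integrable ?P (\<lambda>x. indicator A x * \<psi> x)"
      by (rule P.integrable_const_bound[where B = c]) (auto simp: indicator_def c0 \<psi>c A_def)
    have iE: "integrable ?P (\<lambda>x. indicator E x * \<psi> x)"
      by (rule P.integrable_const_bound[where B = c]) (auto simp: indicator_def c0 \<psi>c E_def)
    have lo': "- (\<integral>x. indicator A x * \<psi> x \<partial>?P) \<le> K1 * \<delta> * \<tau> powr (- M)" using lo by simp
    define \<phi> where "\<phi> = (\<lambda>y. indicator {1..?b} y * \<bar>?h y\<bar>)"
    have [measurable]: "\<phi> \<in> borel_measurable borel" unfolding \<phi>_def by measurable
    have \<phi>2: "(\<integral>\<^sup>+x. ennreal ((\<phi> x)\<^sup>2) \<partial>lborel) \<le> ennreal (N1 * \<Gamma>)"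
    proof -
      have "(\<integral>\<^sup>+x. ennreal ((\<phi> x)\<^sup>2) \<partial>lborel) \<le> (\<integral>\<^sup>+y. ennreal N1 * (indicator {1..?b} y * ennreal ((g y)\<^sup>2)) \<partial>lborel)"
      proof (intro nn_integral_mono)
        fix y :: real
        show "ennreal ((\<phi> y)\<^sup>2) \<le> ennreal N1 * (indicator {1..?b} y * ennreal ((g y)\<^sup>2))"
        proof (cases "y \<in> {1..?b}")
          case True
          have "(y powr (p - 1))\<^sup>2 = y powr (2 * (p - 1))" by (simp add: power2_eq_square flip: powr_add)
          also have "\<dots> \<le> y powr (2 * \<bar>p - 1\<bar>)"
            using True by (intro powr_mono mult_left_mono abs_ge_self) auto
          also have "\<dots> \<le> N1" unfolding N1_def using True by (intro powr_mono2) auto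
          finally have "(\<phi> y)\<^sup>2 \<le> N1 * (g y)\<^sup>2"
            using True by (simp add: \<phi>_def power_mult_distrib mult_right_mono)
          hence "ennreal ((\<phi> y)\<^sup>2) \<le> ennreal (N1 * (g y)\<^sup>2)" by (rule ennreal_leI)
          thus ?thesis using True N1 by (simp add: ennreal_mult)
        qed (simp add: \<phi>_def)
      qed
      also have "\<dots> = ennreal N1 * (\<integral>\<^sup>+y. indicator {1..?b} y * ennreal ((g y)\<^sup>2) \<partial>lborel)"
        by (rule nn_integral_cmult_indicator_square) fact
      also have "\<dots> \<le> ennreal N1 * ennreal \<Gamma>" by (intro mult_left_mono \<Gamma>) auto
      finally show ?thesis using N1 \<Gamma> by (simp add: ennreal_mult)
    qed
    have "\<bar>\<integral>x. indicator E x * \<psi> x \<partial>?P\<bar> \<le> (\<integral>x. indicator E x * \<bar>\<psi> x\<bar> \<partial>?P)"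
      using integral_abs_bound[of ?P "\<lambda>x. indicator E x * \<psi> x"] by (simp add: abs_mult)
    also have "\<dots> \<le> K2 * (s * (N1 * \<Gamma>) + \<tau> powr \<epsilon> / s)"
    proof -
      have "ennreal (\<integral>x. indicator E x * \<bar>\<psi> x\<bar> \<partial>?P) = (\<integral>\<^sup>+x. ennreal (indicator E x * \<bar>\<psi> x\<bar>) \<partial>?P)"
        using integrable_abs[OF iE] by (intro nn_integral_eq_integral[symmetric]) (auto simp: abs_mult)
      also have "\<dots> = (\<integral>\<^sup>+x. indicator E x * ennreal (\<phi> (?r x)) \<partial>?P)"
      proof (intro nn_integral_cong)
        fix x
        show "ennreal (indicator E x * \<bar>\<psi> x\<bar>) = indicator E x * ennreal (\<phi> (?r x))"
          using rS[of x] by (cases "x \<in> E") (auto simp: E_def \<phi>_def \<psi>_def)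
      qed
      also have "\<dots> \<le> ennreal K2 * (ennreal s * (\<integral>\<^sup>+x. ennreal ((\<phi> x)\<^sup>2) \<partial>lborel) + ennreal (\<tau> powr \<epsilon> / s))"
        using edge[rule_format, of \<phi> \<tau> s] \<tau> s unfolding indE by (simp add: \<phi>_def)
      also have "\<dots> \<le> ennreal K2 * (ennreal s * ennreal (N1 * \<Gamma>) + ennreal (\<tau> powr \<epsilon> / s))"
        by (intro mult_left_mono add_right_mono \<phi>2) auto
      also have "\<dots> = ennreal (K2 * (s * (N1 * \<Gamma>) + \<tau> powr \<epsilon> / s))"
      proof -
        have "ennreal (K2 * (s * a + b)) = ennreal K2 * (ennreal s * ennreal a + ennreal b)"
          if "a \<ge> 0" "b \<ge> 0" for a b
          using that K2 s by (simp add: ennreal_mult)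
        from this[of "N1 * \<Gamma>" "\<tau> powr \<epsilon> / s"] show ?thesis using N1 \<Gamma> s by simp
      qed
      finally show ?thesis using K2 s N1 \<Gamma> by (subst (asm) ennreal_le_iff) auto
    qed
    finally have ed: "\<bar>\<integral>x. indicator E x * \<psi> x \<partial>?P\<bar> \<le> K2 * (s * (N1 * \<Gamma>) + \<tau> powr \<epsilon> / s)" .
    have "(\<integral>x. indicator (pair_sector I q) x * \<psi> x \<partial>?P) = (\<integral>x. indicator A x * \<psi> x \<partial>?P) + (\<integral>x. indicator E x * \<psi> x \<partial>?P)"
      unfolding split by (rule Bochner_Integration.integral_add[OF iA iE])
    hence "\<bar>\<integral>x. indicator (pair_sector I q) x * \<psi> x \<partial>?P\<bar> \<le> K1 * \<delta> * \<tau> powr (- M) + K2 * (s * (N1 * \<Gamma>) + \<tau> powr \<epsilon> / s)"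
      using up lo' ed by linarith
    also have "\<dots> \<le> K * (\<delta> * \<tau> powr (- M)) + K * (s * \<Gamma> + \<tau> powr \<epsilon> / s)"
    proof (rule add_mono)
      have "K1 * (\<delta> * \<tau> powr (- M)) \<le> K * (\<delta> * \<tau> powr (- M))"
        using \<delta>0 K2 N1 by (intro mult_right_mono) (auto simp: K_def)
      thus "K1 * \<delta> * \<tau> powr (- M) \<le> K * (\<delta> * \<tau> powr (- M))" by (simp add: mult.assoc)
      have "\<tau> powr \<epsilon> / s \<le> N1 * (\<tau> powr \<epsilon> / s)" using N1 s by (intro mult_right_mono[of 1 N1, simplified]) auto
      hence "s * (N1 * \<Gamma>) + \<tau> powr \<epsilon> / s \<le> N1 * (s * \<Gamma> + \<tau> powr \<epsilon> / s)" by (simp add: algebra_simps)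
      hence "K2 * (s * (N1 * \<Gamma>) + \<tau> powr \<epsilon> / s) \<le> K2 * (N1 * (s * \<Gamma> + \<tau> powr \<epsilon> / s))"
        using K2 by (intro mult_left_mono) auto
      also have "\<dots> = (K2 * N1) * (s * \<Gamma> + \<tau> powr \<epsilon> / s)" by simp
      also have "\<dots> \<le> K * (s * \<Gamma> + \<tau> powr \<epsilon> / s)"
        using K1 s \<Gamma> by (intro mult_right_mono) (auto simp: K_def)
      finally show "K2 * (s * (N1 * \<Gamma>) + \<tau> powr \<epsilon> / s) \<le> K * (s * \<Gamma> + \<tau> powr \<epsilon> / s)" .
    qed
    finally show ?thesis by (simp add: \<psi>_def algebra_simps)
  qed
  with K K2(2) K1(2) show ?thesis by (intro exI[of _ K] exI[of _ \<epsilon>] exI[of _ M] conjI) simp_all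
qed

text \<open>Sum over the sectors; the exponents \<open>\<epsilon>\<close> and \<open>M\<close> are the worst ones that occur.\<close>

theorem norm_ratio_law_oscillation:
  assumes fin: "finite I" and card: "card I \<ge> 3" and \<alpha>: "\<alpha> > 0" and \<beta>: "\<alpha> * (real (card I) - 1) > 1/2"
  defines "p \<equiv> \<alpha> * real (card I)"
  shows "\<exists>K\<ge>0. \<exists>\<epsilon>>0. \<exists>M\<ge>0. \<forall>\<tau> s \<delta> \<Gamma> D g. 0 < \<tau> \<longrightarrow> \<tau> \<le> 1/2 \<longrightarrow> s > 0 \<longrightarrow> oscillation_data (sqrt (card I)) \<delta> \<Gamma> D g \<longrightarrow>
    \<bar>\<integral>x. norm_ratio I x powr (p - 1) * g (norm_ratio I x) \<partial>PiM I (\<lambda>_. gamma_measure \<alpha>)\<bar>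
      \<le> K * (\<delta> * \<tau> powr (- M) + s * \<Gamma> + \<tau> powr \<epsilon> / s)"
proof -
  let ?P = "PiM I (\<lambda>_. gamma_measure \<alpha>)"
  let ?r = "norm_ratio I"
  let ?b = "sqrt (card I)"
  let ?Q = "distinct_pairs I"
  interpret P: prob_space ?P by (rule prob_space_PiM) (rule prob_space_gamma_measure[OF \<alpha>])
  have sG [measurable_cong]: "sets ?P = sets (PiM I (\<lambda>_. borel))" by (intro sets_PiM_cong) auto
  have card2: "card I \<ge> 2" using card by simp
  have Ine: "I \<noteq> {}" using card by auto
  have finQ: "finite ?Q" using fin by simp
  define X where "X = (\<lambda>q g. \<bar>\<integral>x. indicator (pair_sector I q) x * (?r x powr (p - 1) * g (?r x)) \<partial>?P\<bar>)"
  have "\<exists>K\<ge>0. \<exists>\<epsilon>>0. \<exists>M\<ge>0. \<forall>\<tau> s \<delta> \<Gamma> D g. 0 < \<tau> \<longrightarrow> \<tau> \<le> 1/2 \<longrightarrow> s > 0 \<longrightarrow> oscillation_data ?b \<delta> \<Gamma> D g \<longrightarrow>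
    (\<Sum>q\<in>Q. X q g) \<le> K * (\<delta> * \<tau> powr (- M) + s * \<Gamma> + \<tau> powr \<epsilon> / s)" if "finite Q" "Q \<subseteq> ?Q" for Q
    using that
  proof (induction Q rule: finite_induct)
    case empty
    have "(0::real) \<le> 0" "(0::real) < 1" by auto
    thus ?case by (intro exI[of _ 0] exI[of _ 1] conjI) auto
  next
    case (insert q Q)
    hence q: "q \<in> ?Q" and Q: "Q \<subseteq> ?Q" by auto
    obtain K1 \<epsilon>1 M1 where 1: "K1 \<ge> 0" "\<epsilon>1 > 0" "M1 \<ge> 0" and
      X1: "\<And>\<tau> s \<delta> \<Gamma> D g. 0 < \<tau> \<Longrightarrow> \<tau> \<le> 1/2 \<Longrightarrow> s > 0 \<Longrightarrow> oscillation_data ?b \<delta> \<Gamma> D g \<Longrightarrow>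
        X q g \<le> K1 * (\<delta> * \<tau> powr (- M1) + s * \<Gamma> + \<tau> powr \<epsilon>1 / s)"
      using pair_sector_oscillation[OF fin card \<alpha> \<beta> q] unfolding X_def p_def by blast
    obtain K2 \<epsilon>2 M2 where 2: "K2 \<ge> 0" "\<epsilon>2 > 0" "M2 \<ge> 0" and
      X2: "\<And>\<tau> s \<delta> \<Gamma> D g. 0 < \<tau> \<Longrightarrow> \<tau> \<le> 1/2 \<Longrightarrow> s > 0 \<Longrightarrow> oscillation_data ?b \<delta> \<Gamma> D g \<Longrightarrow>
        (\<Sum>q\<in>Q. X q g) \<le> K2 * (\<delta> * \<tau> powr (- M2) + s * \<Gamma> + \<tau> powr \<epsilon>2 / s)"
      using insert.IH[OF Q] by blast
    define M where "M = max M1 M2"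
    define \<epsilon> where "\<epsilon> = min \<epsilon>1 \<epsilon>2"
    have "(\<Sum>q\<in>insert q Q. X q g) \<le> (K1 + K2) * (\<delta> * \<tau> powr (- M) + s * \<Gamma> + \<tau> powr \<epsilon> / s)"
      if \<tau>: "0 < \<tau>" "\<tau> \<le> 1/2" and s: "s > 0" and data: "oscillation_data ?b \<delta> \<Gamma> D g" for \<tau> s \<delta> \<Gamma> D g
    proof -
      have "1 \<in> {1..?b}" using card by simp
      hence \<delta>0: "\<delta> \<ge> 0" using data abs_ge_zero order_trans unfolding oscillation_data_def by blast
      have mono: "\<delta> * \<tau> powr (- M') + s * \<Gamma> + \<tau> powr \<epsilon>' / s \<le> \<delta> * \<tau> powr (- M) + s * \<Gamma> + \<tau> powr \<epsilon> / s"
        if "M' \<le> M" "\<epsilon> \<le> \<epsilon>'" for M' \<epsilon>'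
      proof -
        have "\<tau> powr (- M') \<le> \<tau> powr (- M)" "\<tau> powr \<epsilon>' \<le> \<tau> powr \<epsilon>"
          using \<tau> that by (auto intro!: powr_mono')
        thus ?thesis using \<delta>0 s by (intro add_mono mult_left_mono divide_right_mono) auto
      qed
      have "(\<Sum>q\<in>insert q Q. X q g) = X q g + (\<Sum>q\<in>Q. X q g)" using insert.hyps by simp
      also have "\<dots> \<le> K1 * (\<delta> * \<tau> powr (- M) + s * \<Gamma> + \<tau> powr \<epsilon> / s) + K2 * (\<delta> * \<tau> powr (- M) + s * \<Gamma> + \<tau> powr \<epsilon> / s)"
      proof (rule add_mono)
        show "X q g \<le> K1 * (\<delta> * \<tau> powr (- M) + s * \<Gamma> + \<tau> powr \<epsilon> / s)"
          by (rule order_trans[OF X1[OF \<tau> s data] mult_left_mono[OF mono 1(1)]]) (auto simp: M_def \<epsilon>_def)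
        show "(\<Sum>q\<in>Q. X q g) \<le> K2 * (\<delta> * \<tau> powr (- M) + s * \<Gamma> + \<tau> powr \<epsilon> / s)"
          by (rule order_trans[OF X2[OF \<tau> s data] mult_left_mono[OF mono 2(1)]]) (auto simp: M_def \<epsilon>_def)
      qed
      finally show ?thesis by (simp add: distrib_right)
    qed
    moreover have "K1 + K2 \<ge> 0" "\<epsilon> > 0" "M \<ge> 0" using 1 2 by (auto simp: \<epsilon>_def M_def)
    ultimately show ?case by blast
  qed
  from this[OF finQ subset_refl] obtain K \<epsilon> M where K: "K \<ge> 0" "\<epsilon> > 0" "M \<ge> 0" and
      main: "\<And>\<tau> s \<delta> \<Gamma> D g. 0 < \<tau> \<Longrightarrow> \<tau> \<le> 1/2 \<Longrightarrow> s > 0 \<Longrightarrow> oscillation_data ?b \<delta> \<Gamma> D g \<Longrightarrow>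
        (\<Sum>q\<in>?Q. X q g) \<le> K * (\<delta> * \<tau> powr (- M) + s * \<Gamma> + \<tau> powr \<epsilon> / s)" by blast
  have "\<bar>\<integral>x. ?r x powr (p - 1) * g (?r x) \<partial>?P\<bar> \<le> (\<Sum>q\<in>?Q. X q g)" if g: "continuous_on UNIV g" for g
  proof -
    have [measurable]: "g \<in> borel_measurable borel" using g by (intro borel_measurable_continuous_onI)
    let ?h = "\<lambda>y. y powr (p - 1) * g y"
    have "continuous_on {1..?b} ?h"
      by (intro continuous_intros continuous_on_subset[OF g]) auto
    hence "bounded (?h ` {1..?b})"
      by (intro compact_imp_bounded compact_continuous_image) auto
    then obtain c where c: "\<forall>y\<in>{1..?b}. \<bar>?h y\<bar> \<le> c" by (auto simp: bounded_iff)
    have c0: "c \<ge> 0" using bspec[OF c, of 1] card by (auto intro: order_trans[OF abs_ge_zero])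
    have int: "integrable ?P (\<lambda>x. indicator (pair_sector I q) x * ?h (?r x))" if q: "q \<in> ?Q" for q
    proof (rule P.integrable_const_bound[where B = c])
      show "AE x in ?P. norm (indicator (pair_sector I q) x * ?h (?r x)) \<le> c"
      proof (intro AE_I2)
        fix x
        show "norm (indicator (pair_sector I q) x * ?h (?r x)) \<le> c"
        proof (cases "x \<in> pair_sector I q")
          case True
          have "?r x \<in> {1..?b}" using norm_ratio_bounds[OF fin Ine pair_sector_pos[OF True]] by auto
          thus ?thesis using c True by simp
        qed (simp add: c0)
      qed
      have [measurable]: "Measurable.pred (PiM I (\<lambda>_. borel)) (\<lambda>x. x \<in> pair_sector I q)"
        by (rule measurable_pair_sector[OF fin q])
      show "(\<lambda>x. indicator (pair_sector I q) x * ?h (?r x)) \<in> borel_measurable ?P" by measurable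
    qed
    have "(\<integral>x. ?h (?r x) \<partial>?P) = (\<integral>x. (\<Sum>q\<in>?Q. indicator (pair_sector I q) x * ?h (?r x)) \<partial>?P)"
    proof (rule integral_cong_AE)
      show "AE x in ?P. ?h (?r x) = (\<Sum>q\<in>?Q. indicator (pair_sector I q) x * ?h (?r x))"
        using AE_sum_indicator_pair_sector[OF fin card2 \<alpha>, where ?'b = real]
      proof eventually_elim
        case (elim x)
        show ?case unfolding sum_distrib_right[symmetric] elim by simp
      qed
      show "(\<lambda>x. ?h (?r x)) \<in> borel_measurable ?P" by measurable
      show "(\<lambda>x. \<Sum>q\<in>?Q. indicator (pair_sector I q) x * ?h (?r x)) \<in> borel_measurable ?P"
        by (intro borel_measurable_sum borel_measurable_integrable int)
    qed
    also have "\<dots> = (\<Sum>q\<in>?Q. \<integral>x. indicator (pair_sector I q) x * ?h (?r x) \<partial>?P)"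
      by (intro Bochner_Integration.integral_sum int)
    finally show ?thesis unfolding X_def by (simp only: sum_abs)
  qed
  hence "\<bar>\<integral>x. ?r x powr (p - 1) * g (?r x) \<partial>?P\<bar> \<le> K * (\<delta> * \<tau> powr (- M) + s * \<Gamma> + \<tau> powr \<epsilon> / s)"
    if "0 < \<tau>" "\<tau> \<le> 1/2" "s > 0" "oscillation_data ?b \<delta> \<Gamma> D g" for \<tau> s \<delta> \<Gamma> D g
    using order_trans[OF _ main[OF that]] that(4) by (auto simp: oscillation_data_def)
  with K show ?thesis by blast
qed

section \<open>The Jacobi expansion of the tail function\<close>

text \<open>A law on \<open>[a\<^sub>0, 1]\<close> with a square integrable density. The assumption with a free parameter \<open>s\<close> is the form in which Young's
  inequality delivers it, and avoids speaking about the density.\<close>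

locale square_integrable_law = prob_space M for M :: "'a measure" +
  fixes C :: "'a \<Rightarrow> real" and a0 K0 :: real
  assumes C_measurable [measurable]: "C \<in> borel_measurable M"
    and a0: "0 < a0" "a0 < 1"
    and C_range: "AE \<omega> in M. a0 \<le> C \<omega> \<and> C \<omega> \<le> 1"
    and K0: "K0 \<ge> 0"
    and nn_bound: "\<And>s \<phi>. s > 0 \<Longrightarrow> \<phi> \<in> borel_measurable borel \<Longrightarrow> (\<And>x. \<phi> x \<ge> (0::real)) \<Longrightarrow>
       (\<integral>\<^sup>+\<omega>. ennreal (\<phi> (C \<omega>)) \<partial>M) \<le> ennreal K0 * (ennreal s * (\<integral>\<^sup>+x. ennreal ((\<phi> x)\<^sup>2) \<partial>lborel) + ennreal (1 / s))"
begin

text \<open>The optimal parameter is \<open>s = 1 / \<surd>\<Gamma>\<close>; for \<open>\<Gamma> = 0\<close> it tends to infinity.\<close>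

lemma expectation_bound:
  assumes [measurable]: "\<phi> \<in> borel_measurable borel" and \<Gamma>: "\<Gamma> \<ge> 0"
    and le: "(\<integral>\<^sup>+x. indicator {0..1} x * ennreal ((\<phi> x)\<^sup>2) \<partial>lborel) \<le> ennreal \<Gamma>"
  shows "\<bar>\<integral>\<omega>. \<phi> (C \<omega>) \<partial>M\<bar> \<le> 2 * K0 * sqrt \<Gamma>"
proof -
  have *: "\<bar>\<integral>\<omega>. \<phi> (C \<omega>) \<partial>M\<bar> \<le> K0 * (s * \<Gamma> + 1 / s)" if s: "s > 0" for s
  proof -
    define \<phi>' where "\<phi>' = (\<lambda>x. indicator {0..1} x * \<bar>\<phi> x\<bar>)"
    have [measurable]: "\<phi>' \<in> borel_measurable borel" unfolding \<phi>'_def by measurable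
    have "ennreal (\<bar>\<integral>\<omega>. \<phi> (C \<omega>) \<partial>M\<bar>) \<le> (\<integral>\<^sup>+\<omega>. ennreal (\<bar>\<phi> (C \<omega>)\<bar>) \<partial>M)"
    proof (cases "integrable M (\<lambda>\<omega>. \<phi> (C \<omega>))")
      case True
      from integral_norm_bound_ennreal[OF this] show ?thesis by simp
    next
      case False
      thus ?thesis by (simp add: not_integrable_integral_eq)
    qed
    also have "\<dots> = (\<integral>\<^sup>+\<omega>. ennreal (\<phi>' (C \<omega>)) \<partial>M)"
    proof (rule nn_integral_cong_AE)
      show "AE \<omega> in M. ennreal (\<bar>\<phi> (C \<omega>)\<bar>) = ennreal (\<phi>' (C \<omega>))"
        using C_range by eventually_elim (use a0 in \<open>auto simp: \<phi>'_def indicator_def\<close>)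
    qed
    also have "\<dots> \<le> ennreal K0 * (ennreal s * (\<integral>\<^sup>+x. ennreal ((\<phi>' x)\<^sup>2) \<partial>lborel) + ennreal (1 / s))"
      by (rule nn_bound[OF s]) (auto simp: \<phi>'_def)
    also have "(\<integral>\<^sup>+x. ennreal ((\<phi>' x)\<^sup>2) \<partial>lborel) = (\<integral>\<^sup>+x. indicator {0..1} x * ennreal ((\<phi> x)\<^sup>2) \<partial>lborel)"
      by (intro nn_integral_cong) (auto simp: \<phi>'_def split: split_indicator)
    also have "ennreal K0 * (ennreal s * \<dots> + ennreal (1 / s)) \<le> ennreal K0 * (ennreal s * ennreal \<Gamma> + ennreal (1 / s))"
      by (intro mult_left_mono add_right_mono le) auto
    also have "\<dots> = ennreal (K0 * (s * \<Gamma> + 1 / s))"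
    proof -
      have "ennreal (K0 * (s * a + b)) = ennreal K0 * (ennreal s * ennreal a + ennreal b)"
        if "a \<ge> 0" "b \<ge> 0" for a b
        using that K0 s by (simp add: ennreal_mult)
      from this[of \<Gamma> "1 / s"] show ?thesis using \<Gamma> s by simp
    qed
    finally show ?thesis using K0 s \<Gamma> by (subst (asm) ennreal_le_iff) auto
  qed
  show ?thesis
  proof (cases "\<Gamma> = 0")
    case True
    have "\<bar>\<integral>\<omega>. \<phi> (C \<omega>) \<partial>M\<bar> \<le> 0"
    proof (rule field_le_epsilon)
      fix e :: real assume e: "e > 0"
      have "\<bar>\<integral>\<omega>. \<phi> (C \<omega>) \<partial>M\<bar> \<le> K0 * (1 / ((K0 + 1) / e))" using *[of "(K0 + 1) / e"] True e K0 by simp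
      also have "\<dots> \<le> 0 + e" using e K0 by (simp add: field_simps)
      finally show "\<bar>\<integral>\<omega>. \<phi> (C \<omega>) \<partial>M\<bar> \<le> 0 + e" .
    qed
    thus ?thesis using True by simp
  next
    case False
    hence "\<Gamma> > 0" using \<Gamma> by simp
    hence "1 / sqrt \<Gamma> * \<Gamma> + 1 / (1 / sqrt \<Gamma>) = 2 * sqrt \<Gamma>" by (simp add: real_div_sqrt)
    with *[of "1 / sqrt \<Gamma>"] \<open>\<Gamma> > 0\<close> show ?thesis by simp
  qed
qed

text \<open>The inequality is not strict, so that \<open>U \<le> u\<close> is the event \<open>1 / (\<surd>n u) \<le> C\<close>.\<close>

definition tail :: "real \<Rightarrow> real" where
  "tail x = prob {\<omega> \<in> space M. x \<le> C \<omega>}"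

text \<open>An interval has probability at most a constant times the square root of its length.\<close>

lemma tail_holder:
  assumes "x \<le> y"
  shows "\<bar>tail x - tail y\<bar> \<le> 2 * K0 * sqrt (y - x)"
proof -
  let ?A = "{\<omega> \<in> space M. x \<le> C \<omega>}" and ?B = "{\<omega> \<in> space M. y \<le> C \<omega>}"
  have [measurable]: "?A \<in> events" "?B \<in> events" by measurable
  have "tail x - tail y = prob (?A - ?B)"
    unfolding tail_def by (rule finite_measure_Diff[symmetric]) (use assms in auto)
  also have "\<dots> = (\<integral>\<omega>. indicator {x..<y} (C \<omega>) \<partial>M)"
  proof -
    have "(\<integral>\<omega>. indicat_real {x..<y} (C \<omega>) \<partial>M) = (\<integral>\<omega>. indicator (?A - ?B) \<omega> \<partial>M)"
      by (intro Bochner_Integration.integral_cong) (auto simp: indicator_def)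
    thus ?thesis by simp
  qed
  finally have eq: "tail x - tail y = (\<integral>\<omega>. indicator {x..<y} (C \<omega>) \<partial>M)" .
  show ?thesis unfolding eq
  proof (rule expectation_bound)
    have "(\<integral>\<^sup>+t. indicator {0..1} t * ennreal ((indicator {x..<y} t)\<^sup>2) \<partial>lborel) \<le> (\<integral>\<^sup>+t. indicator {x..<y} t \<partial>lborel)"
      by (intro nn_integral_mono) (auto split: split_indicator)
    also have "\<dots> = ennreal (y - x)" using assms by simp
    finally show "(\<integral>\<^sup>+t. indicator {0..1} t * ennreal ((indicator {x..<y} t)\<^sup>2) \<partial>lborel) \<le> ennreal (y - x)" .
  qed (use assms in auto)
qed

lemma continuous_on_tail: "continuous_on A tail"
proof -
  have "isCont tail x" for x
    unfolding isCont_def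
  proof (rule LIM_imp_LIM[of "\<lambda>y. sqrt \<bar>y - x\<bar> * (2 * K0)" 0 x])
    have "((\<lambda>y. sqrt \<bar>y - x\<bar> * (2 * K0)) \<longlongrightarrow> sqrt \<bar>x - x\<bar> * (2 * K0)) (at x)"
      by (intro tendsto_intros)
    thus "((\<lambda>y. sqrt \<bar>y - x\<bar> * (2 * K0)) \<longlongrightarrow> 0) (at x)" by simp
    fix y
    show "norm (tail y - tail x) \<le> norm (sqrt \<bar>y - x\<bar> * (2 * K0) - 0)"
      using tail_holder[of x y] tail_holder[of y x] K0 by (cases "x \<le> y") (auto simp: mult_ac abs_minus_commute)
  qed
  thus ?thesis by (simp add: continuous_at_imp_continuous_on)
qed

text \<open>Fubini: the inner integral over \<open>x \<le> C \<omega>\<close> is \<open>C \<omega> powr q / q\<close>.\<close>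

lemma integral_powr_tail:
  assumes q: "q > 0"
  shows "has_bochner_integral lborel (\<lambda>x. indicator {0..1} x * (x powr (q - 1) * tail x)) (expectation (\<lambda>\<omega>. C \<omega> powr q) / q)"
proof -
  have [measurable]: "tail \<in> borel_measurable borel"
    by (intro borel_measurable_continuous_onI continuous_on_tail)
  have int: "integrable M (\<lambda>\<omega>. C \<omega> powr q / q)"
  proof (rule integrable_const_bound[where B = "1 / q"])
    show "AE \<omega> in M. norm (C \<omega> powr q / q) \<le> 1 / q"
      using C_range
    proof eventually_elim
      case (elim \<omega>)
      hence "C \<omega> powr q \<le> 1 powr q" using a0 q by (intro powr_mono2) auto
      thus ?case using q by (simp add: divide_right_mono)
    qed
  qed measurable
  interpret pair_sigma_finite lborel M ..
  have "(\<integral>\<^sup>+x. ennreal (indicator {0..1} x * (x powr (q - 1) * tail x)) \<partial>lborel) =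
     (\<integral>\<^sup>+x. (\<integral>\<^sup>+\<omega>. indicator {0..1} x * ennreal (x powr (q - 1)) * indicator {..C \<omega>} x \<partial>M) \<partial>lborel)"
  proof (intro nn_integral_cong)
    fix x :: real
    have [measurable]: "{\<omega> \<in> space M. x \<le> C \<omega>} \<in> events" by measurable
    have "(\<integral>\<^sup>+\<omega>. indicator {0..1} x * ennreal (x powr (q - 1)) * indicator {..C \<omega>} x \<partial>M) =
       (\<integral>\<^sup>+\<omega>. indicator {0..1} x * ennreal (x powr (q - 1)) * indicator {\<omega> \<in> space M. x \<le> C \<omega>} \<omega> \<partial>M)"
      by (intro nn_integral_cong) (auto split: split_indicator)
    also have "\<dots> = indicator {0..1} x * ennreal (x powr (q - 1)) * emeasure M {\<omega> \<in> space M. x \<le> C \<omega>}"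
      by (rule nn_integral_cmult_indicator) measurable
    also have "\<dots> = ennreal (indicator {0..1} x * (x powr (q - 1) * tail x))"
      by (auto simp: tail_def emeasure_eq_measure ennreal_mult split: split_indicator)
    finally show "ennreal (indicator {0..1} x * (x powr (q - 1) * tail x)) =
      (\<integral>\<^sup>+\<omega>. indicator {0..1} x * ennreal (x powr (q - 1)) * indicator {..C \<omega>} x \<partial>M)" ..
  qed
  also have "\<dots> = (\<integral>\<^sup>+\<omega>. (\<integral>\<^sup>+x. indicator {0..1} x * ennreal (x powr (q - 1)) * indicator {..C \<omega>} x \<partial>lborel) \<partial>M)"
  proof (rule Fubini'[symmetric])
    have "(\<lambda>z. indicator {0..1} (fst z) * ennreal (fst z powr (q - 1)) * (if fst z \<le> C (snd z) then 1 else 0 :: ennreal))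
       \<in> borel_measurable (lborel \<Otimes>\<^sub>M M)" by measurable
    thus "(\<lambda>(x, \<omega>). indicator {0..1} x * ennreal (x powr (q - 1)) * indicator {..C \<omega>} x) \<in> borel_measurable (lborel \<Otimes>\<^sub>M M)"
      by (simp add: case_prod_unfold indicator_def atMost_def cong: if_cong)
  qed
  also have "\<dots> = (\<integral>\<^sup>+\<omega>. ennreal (C \<omega> powr q / q) \<partial>M)"
  proof (rule nn_integral_cong_AE)
    show "AE \<omega> in M. (\<integral>\<^sup>+x. indicator {0..1} x * ennreal (x powr (q - 1)) * indicator {..C \<omega>} x \<partial>lborel) = ennreal (C \<omega> powr q / q)"
      using C_range
    proof eventually_elim
      case (elim \<omega>)
      have "(\<integral>\<^sup>+x. indicator {0..1} x * ennreal (x powr (q - 1)) * indicator {..C \<omega>} x \<partial>lborel) =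
        (\<integral>\<^sup>+x. indicator {0..C \<omega>} x * ennreal (x powr (q - 1)) \<partial>lborel)"
        using elim by (intro nn_integral_cong) (auto split: split_indicator)
      also have "\<dots> = ennreal (C \<omega> powr q / q)"
        by (rule nn_integral_powr_Icc0) (use q elim a0 in auto)
      finally show ?case .
    qed
  qed
  also have "\<dots> = ennreal (expectation (\<lambda>\<omega>. C \<omega> powr q / q))"
    by (rule nn_integral_eq_integral[OF int]) (use q in auto)
  finally have "(\<integral>\<^sup>+x. ennreal (indicator {0..1} x * (x powr (q - 1) * tail x)) \<partial>lborel) = ennreal (expectation (\<lambda>\<omega>. C \<omega> powr q) / q)"
    by simp
  thus ?thesis
    using q by (intro has_bochner_integral_nn_integral) (auto simp: tail_def intro!: divide_nonneg_pos integral_nonneg_AE)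
qed

lemma integral_powr_poly_tail:
  assumes p: "p > 0"
  shows "(\<integral>x. indicator {0..1} x * (x powr (p - 1) * (poly P x * tail x)) \<partial>lborel) =
     (\<Sum>j\<le>degree P. coeff P j * (expectation (\<lambda>\<omega>. C \<omega> powr (p + real j)) / (p + real j)))"
proof -
  have [measurable]: "tail \<in> borel_measurable borel"
    by (intro borel_measurable_continuous_onI continuous_on_tail)
  have "has_bochner_integral lborel (\<lambda>x. \<Sum>j\<le>degree P. coeff P j * (indicator {0..1} x * (x powr (p + real j - 1) * tail x)))
    (\<Sum>j\<le>degree P. coeff P j * (expectation (\<lambda>\<omega>. C \<omega> powr (p + real j)) / (p + real j)))"
    by (intro has_bochner_integral_sum has_bochner_integral_mult_right integral_powr_tail) (use p in simp)
  from has_bochner_integral_integral_eq[OF this]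
  have "(\<Sum>j\<le>degree P. coeff P j * (expectation (\<lambda>\<omega>. C \<omega> powr (p + real j)) / (p + real j))) =
    (\<integral>x. (\<Sum>j\<le>degree P. coeff P j * (indicator {0..1} x * (x powr (p + real j - 1) * tail x))) \<partial>lborel)" ..
  also have "\<dots> = (\<integral>x. indicator {0..1} x * (x powr (p - 1) * (poly P x * tail x)) \<partial>lborel)"
  proof (rule integral_cong_AE)
    show "AE x in lborel. (\<Sum>j\<le>degree P. coeff P j * (indicator {0..1} x * (x powr (p + real j - 1) * tail x))) =
        indicator {0..1} x * (x powr (p - 1) * (poly P x * tail x))"
      using AE_lborel_singleton[of 0]
    proof eventually_elim
      case (elim x)
      show ?case
      proof (cases "x > 0")
        case True
        hence "x powr (p + real j - 1) = x powr (p - 1) * x ^ j" for j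
          using powr_add[of x "p - 1" "real j"] by (simp add: powr_realpow algebra_simps)
        thus ?thesis by (simp add: poly_altdef sum_distrib_left sum_distrib_right mult_ac)
      next
        case False
        with elim show ?thesis by (auto simp: indicator_def)
      qed
    qed
  qed measurable
  finally show ?thesis ..
qed

definition jacobi_moment :: "real \<Rightarrow> nat \<Rightarrow> real" where
  "jacobi_moment p k = expectation (\<lambda>\<omega>. C \<omega> powr p * ((1 - C \<omega>) * poly (pderiv (jacobi_poly p k)) (C \<omega>)))"

lemma integrable_bounded_function:
  assumes "continuous_on {a0..1} \<phi>" "\<phi> \<in> borel_measurable borel"
  shows "integrable M (\<lambda>\<omega>. \<phi> (C \<omega>) :: real)"
proof -
  have [measurable]: "\<phi> \<in> borel_measurable borel" by fact
  have "bounded (\<phi> ` {a0..1})"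
    using assms(1) by (intro compact_imp_bounded compact_continuous_image) auto
  then obtain B where B: "\<forall>x\<in>{a0..1}. \<bar>\<phi> x\<bar> \<le> B" by (auto simp: bounded_iff)
  show ?thesis
  proof (rule integrable_const_bound[where B = B])
    show "AE \<omega> in M. norm (\<phi> (C \<omega>)) \<le> B" using C_range by eventually_elim (use B in auto)
  qed measurable
qed

text \<open>The scalar product of the tail function with \<open>R\<^sub>k\<close>, after one integration by parts.\<close>

lemma jacobi_coefficient_eq_moment:
  assumes p: "p > 0" and k: "k > 0"
  shows "(\<Sum>j\<le>k. coeff (jacobi_poly p k) j * (expectation (\<lambda>\<omega>. C \<omega> powr (p + real j)) / (p + real j)))
     = - jacobi_moment p k / jacobi_eigenvalue p k"
proof -
  let ?c = "coeff (jacobi_poly p k)"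
  have l: "jacobi_eigenvalue p k > 0" using jacobi_eigenvalue_pos[OF p k] .
  have i: "integrable M (\<lambda>\<omega>. C \<omega> powr q)" for q
    by (rule integrable_bounded_function) (use a0 in \<open>auto intro!: continuous_intros\<close>)
  have "(\<Sum>j\<le>k. ?c j * (expectation (\<lambda>\<omega>. C \<omega> powr (p + real j)) / (p + real j))) =
     expectation (\<lambda>\<omega>. \<Sum>j\<le>k. ?c j / (p + real j) * C \<omega> powr (p + real j))"
    by (subst Bochner_Integration.integral_sum) (auto intro!: i)
  also have "\<dots> = expectation (\<lambda>\<omega>. - (1 / jacobi_eigenvalue p k) * (C \<omega> powr p * ((1 - C \<omega>) * poly (pderiv (jacobi_poly p k)) (C \<omega>))))"
  proof (rule integral_cong_AE)
    show "AE \<omega> in M. (\<Sum>j\<le>k. ?c j / (p + real j) * C \<omega> powr (p + real j)) =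
       - (1 / jacobi_eigenvalue p k) * (C \<omega> powr p * ((1 - C \<omega>) * poly (pderiv (jacobi_poly p k)) (C \<omega>)))"
      using C_range
    proof eventually_elim
      case (elim \<omega>)
      hence c: "C \<omega> > 0" using a0 by simp
      have "(\<Sum>j\<le>k. ?c j / (p + real j) * C \<omega> powr (p + real j)) = C \<omega> powr p * (\<Sum>j\<le>k. ?c j * C \<omega> ^ j / (p + real j))"
        using c by (simp add: powr_add powr_realpow sum_distrib_left mult_ac)
      also have "(\<Sum>j\<le>k. ?c j * C \<omega> ^ j / (p + real j)) = - (1 - C \<omega>) * poly (pderiv (jacobi_poly p k)) (C \<omega>) / jacobi_eigenvalue p k"
        using jacobi_poly_primitive[OF p, of k "C \<omega>"] l by (simp add: field_simps)
      finally show ?case by (simp add: algebra_simps diff_divide_distrib)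
    qed
  qed measurable
  also have "\<dots> = - jacobi_moment p k / jacobi_eigenvalue p k"
    by (simp only: integral_mult_right_zero jacobi_moment_def) simp
  finally show ?thesis .
qed

text \<open>The functional \<open>\<phi> \<mapsto> E[C\<^sup>p (1 - C) \<phi>(C)]\<close> is bounded in the mean square norm for the weight \<open>x\<^sup>p (1 - x)\<close>, because the law is
  square integrable and the weight is at most \<open>1\<close>. For this weight the \<open>R\<^sub>k'\<close> are orthogonal with squared norm
  \<open>\<lambda>\<^sub>k / (p + 2k)\<close>. As in Bessel's inequality, the functional is tested on \<open>\<psi>\<close>, its own partial sum: both its value
  and the squared norm of \<open>\<psi>\<close> are equal to the sum \<open>B\<close>, whence \<open>B \<le> 2K\<^sub>0 \<surd>B\<close>.\<close>

lemma jacobi_moment_bessel: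
  assumes p: "p > 0"
  shows "(\<Sum>k=1..N. (p + 2 * real k) / jacobi_eigenvalue p k * (jacobi_moment p k)\<^sup>2) \<le> 4 * K0\<^sup>2"
proof -
  let ?w = "\<lambda>k. (p + 2 * real k) / jacobi_eigenvalue p k"
  let ?R' = "\<lambda>k. pderiv (jacobi_poly p k)"
  have l: "jacobi_eigenvalue p k > 0" if "k \<in> {1..N}" for k using that jacobi_eigenvalue_pos[OF p, of k] by simp
  define B where "B = (\<Sum>k=1..N. ?w k * (jacobi_moment p k)\<^sup>2)"
  define \<psi> where "\<psi> = (\<Sum>k=1..N. smult (?w k * jacobi_moment p k) (?R' k))"
  have B0: "B \<ge> 0" unfolding B_def using l p by (intro sum_nonneg mult_nonneg_nonneg divide_nonneg_nonneg) (auto intro: less_imp_le)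
  have e1: "expectation (\<lambda>\<omega>. C \<omega> powr p * ((1 - C \<omega>) * poly \<psi> (C \<omega>))) = B"
  proof -
    have i: "integrable M (\<lambda>\<omega>. C \<omega> powr p * ((1 - C \<omega>) * poly Q (C \<omega>)))" for Q
      by (rule integrable_bounded_function) (use a0 in \<open>auto intro!: continuous_intros\<close>)
    have "expectation (\<lambda>\<omega>. C \<omega> powr p * ((1 - C \<omega>) * poly \<psi> (C \<omega>))) =
       expectation (\<lambda>\<omega>. \<Sum>k=1..N. (?w k * jacobi_moment p k) * (C \<omega> powr p * ((1 - C \<omega>) * poly (?R' k) (C \<omega>))))"
      by (simp add: \<psi>_def poly_sum sum_distrib_left mult_ac)
    also have "\<dots> = (\<Sum>k=1..N. (?w k * jacobi_moment p k) * jacobi_moment p k)"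
      by (subst Bochner_Integration.integral_sum) (auto intro!: i simp: jacobi_moment_def)
    finally show ?thesis by (simp add: B_def power2_eq_square mult_ac)
  qed
  have jB: "jint p ([:0, 1, -1:] * \<psi> * \<psi>) = B"
  proof -
    have "jint p ([:0, 1, -1:] * \<psi> * \<psi>) = (\<Sum>k=1..N. (?w k * jacobi_moment p k)\<^sup>2 * (jacobi_eigenvalue p k / (p + 2 * real k)))"
      unfolding \<psi>_def by (rule jint_bilinear_diagonal) (simp_all only: finite_atLeastAtMost jint_jacobi_pderiv_mult[OF p])
    also have "\<dots> = B"
      unfolding B_def
    proof (intro sum.cong refl)
      fix k assume k: "k \<in> {1..N}"
      have "p + 2 * real k > 0" using p by simp
      thus "(?w k * jacobi_moment p k)\<^sup>2 * (jacobi_eigenvalue p k / (p + 2 * real k)) = ?w k * (jacobi_moment p k)\<^sup>2"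
        using l[OF k] by (simp add: power2_eq_square)
    qed
    finally show ?thesis .
  qed
  have "\<bar>expectation (\<lambda>\<omega>. C \<omega> powr p * ((1 - C \<omega>) * poly \<psi> (C \<omega>)))\<bar> \<le> 2 * K0 * sqrt B"
  proof (rule expectation_bound[OF _ B0])
    have "(\<integral>\<^sup>+x. indicator {0..1} x * ennreal ((x powr p * ((1 - x) * poly \<psi> x))\<^sup>2) \<partial>lborel) \<le>
      (\<integral>\<^sup>+x. ennreal (indicator {0..1} x * (x powr (p - 1) * poly ([:0, 1, -1:] * \<psi> * \<psi>) x)) \<partial>lborel)"
    proof (rule nn_integral_mono)
      fix x :: real
      show "indicator {0..1} x * ennreal ((x powr p * ((1 - x) * poly \<psi> x))\<^sup>2) \<le>
        ennreal (indicator {0..1} x * (x powr (p - 1) * poly ([:0, 1, -1:] * \<psi> * \<psi>) x))"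
      proof (cases "x \<in> {0..1}")
        case True
        have "(x powr p * ((1 - x) * poly \<psi> x))\<^sup>2 \<le> x powr (p - 1) * (x * (1 - x) * (poly \<psi> x)\<^sup>2)"
        proof (cases "x = 0")
          case False
          hence x: "x > 0" using True by simp
          have "x powr p \<le> 1" using True p by (intro powr_le1) auto
          hence a: "x powr p * (1 - x) \<le> 1 * 1" using True by (intro mult_mono) auto
          have "(x powr p * ((1 - x) * poly \<psi> x))\<^sup>2 = (x powr p * (1 - x)) * ((x powr p * (1 - x)) * (poly \<psi> x)\<^sup>2)"
            by (simp add: power2_eq_square mult_ac)
          also have "\<dots> \<le> 1 * ((x powr p * (1 - x)) * (poly \<psi> x)\<^sup>2)"
            using a True by (intro mult_right_mono) auto
          also have "\<dots> = x powr (p - 1) * (x * (1 - x) * (poly \<psi> x)\<^sup>2)"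
            using x by (simp add: powr_diff)
          finally show ?thesis .
        qed (use p in auto)
        also have "\<dots> = x powr (p - 1) * poly ([:0, 1, -1:] * \<psi> * \<psi>) x"
          by (simp add: power2_eq_square algebra_simps)
        finally show ?thesis using True by (simp add: ennreal_leI)
      qed simp
    qed
    also have "\<dots> = ennreal B"
    proof -
      note h = has_bochner_integral_jint[OF p, of "[:0, 1, -1:] * \<psi> * \<psi>"]
      have nn: "0 \<le> indicator {0..1} x * (x powr (p - 1) * poly ([:0, 1, -1:] * \<psi> * \<psi>) x)" for x :: real
      proof (cases "x \<in> {0..1}")
        case True
        have "poly ([:0, 1, -1:] * \<psi> * \<psi>) x = x * (1 - x) * (poly \<psi> x)\<^sup>2" by (simp add: power2_eq_square algebra_simps)
        moreover have "0 \<le> x * (1 - x) * (poly \<psi> x)\<^sup>2" using True by simp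
        ultimately show ?thesis by (simp only: mult_nonneg_nonneg powr_ge_zero) simp
      qed simp
      show ?thesis
        using nn_integral_eq_integral[OF integrable.intros[OF h]] has_bochner_integral_integral_eq[OF h] nn jB by simp
    qed
    finally show "(\<integral>\<^sup>+x. indicator {0..1} x * ennreal ((x powr p * ((1 - x) * poly \<psi> x))\<^sup>2) \<partial>lborel) \<le> ennreal B" .
  qed measurable
  hence "B \<le> 2 * K0 * sqrt B" unfolding e1 by simp
  hence "sqrt B * sqrt B \<le> 2 * K0 * sqrt B" using B0 by simp
  hence "sqrt B \<le> 2 * K0 \<or> sqrt B = 0" using B0 by (metis mult_right_le_imp_le order_le_less real_sqrt_ge_zero)
  hence "sqrt B \<le> 2 * K0" using K0 by auto
  hence "B \<le> (2 * K0)\<^sup>2" using B0 by (metis real_sqrt_le_iff real_sqrt_abs abs_of_nonneg K0 mult_nonneg_nonneg zero_le_numeral)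
  thus ?thesis by (simp add: B_def power_mult_distrib)
qed

end

section \<open>The classical normalisations\<close>

text \<open>Reverse the order of summation in the definition of the monic polynomial.\<close>

lemma jacobi_G_eq:
  assumes p: "p > 0"
  shows "jacobi_G k p p x = (-1) ^ k * fact k / pochhammer (p + real k) k * poly (jacobi_poly p k) x"
proof -
  have G: "Gamma (p + real j) > 0" for j using p by (intro Gamma_real_pos) (auto intro: add_pos_nonneg)
  have poch: "pochhammer (p + real j) k = Gamma (p + real j + real k) / Gamma (p + real j)" for j
  proof (rule pochhammer_Gamma)
    have "p + real j > 0" using p by (simp add: add_pos_nonneg)
    thus "p + real j \<notin> \<int>\<^sub>\<le>\<^sub>0" by (auto elim!: nonpos_Ints_cases)
  qed
  have "(\<Sum>m=0..k. (-1) ^ m * real (k choose m) * (Gamma (p + 2 * real k - real m) / Gamma (p + real k - real m)) * x ^ (k - m))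
     = (\<Sum>j=0..k. (-1) ^ (k - j) * real (k choose (k - j)) *
          (Gamma (p + 2 * real k - real (k - j)) / Gamma (p + real k - real (k - j))) * x ^ (k - (k - j)))"
    by (rule sum.reindex_bij_witness[where i = "\<lambda>j. k - j" and j = "\<lambda>j. k - j"]) auto
  also have "\<dots> = (\<Sum>j=0..k. (-1) ^ k * fact k * (coeff (jacobi_poly p k) j * x ^ j))"
  proof (intro sum.cong refl)
    fix j assume j: "j \<in> {0..k}"
    have s: "(-1::real) ^ (k - j) = (-1) ^ k * (-1) ^ j"
    proof -
      have "(-1::real) ^ k = (-1) ^ (k - j) * (-1) ^ j" using j by (simp flip: power_add)
      thus ?thesis by (simp add: mult.assoc flip: power_mult_distrib)
    qed
    have b: "real (k choose (k - j)) = fact k / (fact j * fact (k - j))"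
      using j by (subst binomial_symmetric[symmetric]) (auto simp: binomial_fact)
    have g: "Gamma (p + 2 * real k - real (k - j)) / Gamma (p + real k - real (k - j)) = pochhammer (p + real j) k"
      using j unfolding poch by (simp add: of_nat_diff algebra_simps)
    have "k - (k - j) = j" using j by simp
    thus "(-1) ^ (k - j) * real (k choose (k - j)) *
          (Gamma (p + 2 * real k - real (k - j)) / Gamma (p + real k - real (k - j))) * x ^ (k - (k - j)) =
       (-1) ^ k * fact k * (coeff (jacobi_poly p k) j * x ^ j)"
      unfolding s b g using j by (simp add: coeff_jacobi_poly)
  qed
  also have "\<dots> = (-1) ^ k * fact k * poly (jacobi_poly p k) x"
    by (simp add: sum_poly_jacobi sum_distrib_left atLeast0AtMost)
  finally have "jacobi_G k p p x = Gamma (p + real k) / Gamma (p + 2 * real k) * ((-1) ^ k * fact k * poly (jacobi_poly p k) x)"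
    by (simp add: jacobi_G_def)
  also have "Gamma (p + real k) / Gamma (p + 2 * real k) = 1 / pochhammer (p + real k) k"
    unfolding poch by (simp add: algebra_simps)
  finally show ?thesis by simp
qed

text \<open>The factor in front of the inner sum and the normalisation of \<open>G\<^sub>k\<close> combine to the reciprocal \<open>p + 2k\<close> of the
  squared norm of \<open>R\<^sub>k\<close>.\<close>

lemma jacobi_series_term:
  assumes p: "p > 0"
  shows "jacobi_coeff p g k * jacobi_G k p p x =
     (p + 2 * real k) * (\<Sum>j\<le>k. coeff (jacobi_poly p k) j * (g j / (p + real j))) * poly (jacobi_poly p k) x"
proof -
  let ?S = "\<Sum>j\<le>k. coeff (jacobi_poly p k) j * (g j / (p + real j))"
  have ph: "pochhammer (p + real k) k > 0" using p by (intro pochhammer_pos) simp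
  have S: "(\<Sum>j=0..k. (-1) ^ j * (pochhammer (p + real j) k / (fact j * fact (k - j))) * (g j / (p + real j))) = ?S"
    unfolding atLeast0AtMost by (intro sum.cong) (auto simp: coeff_jacobi_poly)
  have gb: "(p + 2 * real k) gchoose k = pochhammer (p + real k + 1) k / fact k"
    by (subst gbinomial_pochhammer') (simp add: algebra_simps)
  have sh: "pochhammer (p + real k + 1) k * (p + real k) = pochhammer (p + real k) k * (p + 2 * real k)"
    using pochhammer_shift[of "p + real k" k] by (simp add: algebra_simps)
  have "jacobi_coeff p g k * jacobi_G k p p x =
     ((-1) ^ k * (-1) ^ k) * ((pochhammer (p + real k + 1) k * (p + real k)) / pochhammer (p + real k) k) * ?S * poly (jacobi_poly p k) x"
    unfolding jacobi_coeff_def S jacobi_G_eq[OF p] gb by simp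
  also have "(-1::real) ^ k * (-1) ^ k = 1" by (simp flip: power_mult_distrib)
  also have "(pochhammer (p + real k + 1) k * (p + real k)) / pochhammer (p + real k) k = p + 2 * real k"
    unfolding sh using ph by simp
  finally show ?thesis by simp
qed

lemma higher_pderiv_pcompose_linear:
  "(pderiv ^^ k) (pcompose f [:b, c:]) = smult (c ^ k) (pcompose ((pderiv ^^ k) f) [:b, c :: real:])"
proof (induction k)
  case (Suc k)
  thus ?case by (simp add: pderiv_smult pderiv_pcompose pderiv_pCons mult.commute)
qed simp

lemma higher_pderiv_monom_add:
  "(pderiv ^^ k) (monom c (k + j)) = monom (c * (fact (k + j) / fact j :: real)) j"
proof (induction k arbitrary: c)
  case (Suc k)
  have "(pderiv ^^ Suc k) (monom c (Suc k + j)) = (pderiv ^^ k) (monom (real (Suc (k + j)) * c) (k + j))"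
    by (simp only: funpow_Suc_right o_def pderiv_monom) (simp add: pderiv_monom)
  also have "\<dots> = monom (c * (fact (Suc k + j) / fact j)) j"
    unfolding Suc.IH by (simp add: mult_ac)
  finally show ?case .
qed simp

lemma higher_pderiv_add: "(pderiv ^^ k) (P + Q) = (pderiv ^^ k) P + (pderiv ^^ k) Q"
  by (induction k arbitrary: P Q) (simp_all add: pderiv_add)

lemma higher_pderiv_0: "(pderiv ^^ k) 0 = 0"
  by (induction k) simp_all

lemma higher_pderiv_sum: "(pderiv ^^ k) (sum f A) = (\<Sum>a\<in>A. (pderiv ^^ k) (f a))"
  by (induction A rule: infinite_finite_induct) (simp_all add: higher_pderiv_add higher_pderiv_0)

lemma higher_pderiv_smult: "(pderiv ^^ k) (smult c P) = smult c ((pderiv ^^ k) P)"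
  by (induction k) (simp_all add: pderiv_smult)

lemma pcompose_power: "pcompose (f ^ n) g = pcompose f (g :: real poly) ^ n"
proof -
  have "pcompose 1 g = 1" by (metis one_pCons pcompose_const)
  thus ?thesis by (induction n) (simp_all add: pcompose_mult)
qed

text \<open>In Rodrigues' formula the substitution \<open>x \<mapsto> 2x - 1\<close> turns \<open>x\<^sup>2 - 1\<close> into \<open>4 (x\<^sup>2 - x)\<close>; then expand \<open>(x\<^sup>2 - x)\<^sup>k\<close> and
  differentiate term by term.\<close>

lemma shifted_legendre_eq: "shifted_legendre k x = (-1) ^ k * poly (jacobi_poly 1 k) x"
proof -
  let ?X = "[:0, -1, 1 :: real:]"
  have "pcompose ([:-1, 0, 1:] ^ k) [:-1, 2 :: real:] = (smult 4 ?X) ^ k"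
    by (simp add: pcompose_power pcompose_pCons)
  also have "\<dots> = smult (4 ^ k) (?X ^ k)" by (rule smult_power)
  finally have c: "pcompose ([:-1, 0, 1:] ^ k) [:-1, 2 :: real:] = smult (4 ^ k) (?X ^ k)" .
  have "smult (2 ^ k) (pcompose ((pderiv ^^ k) ([:-1, 0, 1:] ^ k)) [:-1, 2 :: real:]) = smult (4 ^ k) ((pderiv ^^ k) (?X ^ k))"
    unfolding higher_pderiv_pcompose_linear[symmetric] c higher_pderiv_smult ..
  hence "poly (smult (2 ^ k) (pcompose ((pderiv ^^ k) ([:-1, 0, 1:] ^ k)) [:-1, 2 :: real:])) x = poly (smult (4 ^ k) ((pderiv ^^ k) (?X ^ k))) x"
    by (rule arg_cong)
  hence "2 ^ k * poly ((pderiv ^^ k) ([:-1, 0, 1:] ^ k)) (2 * x - 1) = 4 ^ k * poly ((pderiv ^^ k) (?X ^ k)) x"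
    by (simp add: poly_pcompose algebra_simps)
  moreover have "(4::real) ^ k = 2 ^ k * 2 ^ k" by (simp flip: power_mult_distrib)
  ultimately have 1: "poly ((pderiv ^^ k) ([:-1, 0, 1:] ^ k)) (2 * x - 1) = 2 ^ k * poly ((pderiv ^^ k) (?X ^ k)) x"
    by simp
  have "?X = monom 1 1 * (monom 1 1 + [:-1:])"
    by (simp add: monom_altdef)
  hence "?X ^ k = monom 1 k * (monom 1 1 + [:-1:]) ^ k"
    by (simp add: power_mult_distrib monom_power)
  also have "(monom 1 1 + [:-1 :: real:]) ^ k = (\<Sum>j\<le>k. of_nat (k choose j) * monom 1 1 ^ j * [:-1:] ^ (k - j))"
    by (rule binomial_ring)
  also have "monom 1 k * \<dots> = (\<Sum>j\<le>k. monom (real (k choose j) * (-1) ^ (k - j)) (k + j))"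
    unfolding sum_distrib_left
  proof (intro sum.cong refl)
    fix j
    have "[:-1 :: real:] ^ (k - j) = [:(-1) ^ (k - j):]" by (induction "k - j") (simp_all add: poly_const_pow)
    thus "monom 1 k * (of_nat (k choose j) * monom 1 1 ^ j * [:-1:] ^ (k - j)) = monom (real (k choose j) * (-1) ^ (k - j)) (k + j)"
      by (simp add: monom_power mult_monom of_nat_poly smult_monom mult.commute)
  qed
  finally have "(pderiv ^^ k) (?X ^ k) = (\<Sum>j\<le>k. monom (real (k choose j) * (-1) ^ (k - j) * (fact (k + j) / fact j)) j)"
    by (simp only: higher_pderiv_sum higher_pderiv_monom_add)
  hence 2: "poly ((pderiv ^^ k) (?X ^ k)) x = (\<Sum>j\<le>k. real (k choose j) * (-1) ^ (k - j) * (fact (k + j) / fact j) * x ^ j)"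
    by (simp add: poly_sum poly_monom)
  have "shifted_legendre k x = 1 / (2 ^ k * fact k) * (2 ^ k * (\<Sum>j\<le>k. real (k choose j) * (-1) ^ (k - j) * (fact (k + j) / fact j) * x ^ j))"
    unfolding shifted_legendre_def legendre_poly_def by (simp add: 1 2)
  also have "\<dots> = (\<Sum>j\<le>k. 1 / fact k * (real (k choose j) * (-1) ^ (k - j) * (fact (k + j) / fact j) * x ^ j))"
    by (simp add: sum_distrib_left)
  also have "\<dots> = (\<Sum>j\<le>k. (-1) ^ k * (coeff (jacobi_poly 1 k) j * x ^ j))"
  proof (intro sum.cong refl)
    fix j assume j: "j \<in> {..k}"
    have s: "(-1::real) ^ (k - j) = (-1) ^ k * (-1) ^ j"
    proof -
      have "(-1::real) ^ k = (-1) ^ (k - j) * (-1) ^ j" using j by (simp flip: power_add)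
      thus ?thesis by (simp add: mult.assoc flip: power_mult_distrib)
    qed
    have ph: "pochhammer (1 + real j) k = fact (k + j) / fact j"
      using pochhammer_product'[of "1::real" j k] by (simp add: pochhammer_fact[symmetric] add.commute field_simps)
    show "1 / fact k * (real (k choose j) * (-1) ^ (k - j) * (fact (k + j) / fact j) * x ^ j) = (-1) ^ k * (coeff (jacobi_poly 1 k) j * x ^ j)"
      using j unfolding s by (simp add: coeff_jacobi_poly ph binomial_fact mult_ac)
  qed
  also have "\<dots> = (-1) ^ k * poly (jacobi_poly 1 k) x"
    by (simp add: sum_poly_jacobi sum_distrib_left)
  finally show ?thesis .
qed

lemma legendre_series_term:
  "legendre_coeff p g k * shifted_legendre k x =
     (1 + 2 * real k) * (\<Sum>j\<le>k. coeff (jacobi_poly 1 k) j * (g j / (p + real j))) * poly (jacobi_poly 1 k) x"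
proof -
  have S: "(\<Sum>j=0..k. (-1) ^ j * (pochhammer (real k - real j + 1) (2 * j) / (fact j * fact j)) * (g j / (p + real j))) =
     (\<Sum>j\<le>k. coeff (jacobi_poly 1 k) j * (g j / (p + real j)))"
    unfolding atLeast0AtMost
  proof (intro sum.cong refl)
    fix j assume j: "j \<in> {..k}"
    have 1: "pochhammer (1 + real j) k = fact (k + j) / fact j"
      using pochhammer_product'[of "1::real" j k] by (simp add: pochhammer_fact[symmetric] add.commute field_simps)
    have 2: "pochhammer (real k - real j + 1) (2 * j) = fact (k + j) / fact (k - j)"
    proof -
      have "(fact (k - j + 2 * j) :: real) = fact (k - j) * pochhammer (1 + real (k - j)) (2 * j)"
        using pochhammer_product'[of "1::real" "k - j" "2 * j"] by (simp add: pochhammer_fact[symmetric])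
      moreover have "k - j + 2 * j = k + j" using j by simp
      moreover have "1 + real (k - j) = real k - real j + 1" using j by (simp add: of_nat_diff)
      ultimately show ?thesis by (simp add: field_simps)
    qed
    show "(-1) ^ j * (pochhammer (real k - real j + 1) (2 * j) / (fact j * fact j)) * (g j / (p + real j)) =
      coeff (jacobi_poly 1 k) j * (g j / (p + real j))"
      using j unfolding 2 by (simp add: coeff_jacobi_poly 1)
  qed
  have "(-1::real) ^ k * (-1) ^ k = 1" by (simp flip: power_mult_distrib)
  moreover have "(-1) ^ k * (2 * real k + 1) * s * ((-1) ^ k * r) = ((-1) ^ k * (-1) ^ k) * ((1 + 2 * real k) * s * r)" for s r :: real
    by (simp only: mult_ac add_ac)
  ultimately show ?thesis unfolding legendre_coeff_def S shifted_legendre_eq by simp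
qed

context square_integrable_law
begin

lemma wint_jacobi_tail:
  assumes p: "p > 0"
  shows "wint p (\<lambda>y. poly (jacobi_poly p k) y * tail y) =
     (\<Sum>j\<le>k. coeff (jacobi_poly p k) j * (expectation (\<lambda>\<omega>. C \<omega> powr (p + real j)) / (p + real j)))"
  unfolding wint_def integral_powr_poly_tail[OF p]
  by (rule sum.mono_neutral_left) (use degree_jacobi_poly_le in \<open>auto simp: coeff_eq_0\<close>)

text \<open>The \<open>k\<close>-th term is \<open>(p + 2k) / \<lambda>\<^sub>k * \<bar>m\<^sub>k\<bar> * \<bar>R\<^sub>k x\<bar>\<close>. By \<open>uv \<le> u\<^sup>2 + v\<^sup>2\<close> it splits into a Bessel term and a term that the local
  bound on \<open>R\<^sub>k\<close> makes \<open>O(1 / \<lambda>\<^sub>k)\<close>.\<close>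

lemma jacobi_series_majorant:
  assumes p: "p > 0" and ab: "0 < a" "a < b" "b < 1"
  shows "\<exists>B. summable B \<and> (\<forall>k. \<forall>x\<in>{a..b}.
     \<bar>(p + 2 * real k) * wint p (\<lambda>y. poly (jacobi_poly p k) y * tail y) * poly (jacobi_poly p k) x\<bar> \<le> B k)"
proof -
  obtain K where K: "K \<ge> 0" "\<And>k x. x \<in> {a..b} \<Longrightarrow> (p + 2 * real k) * (poly (jacobi_poly p k) x)\<^sup>2 \<le> K"
    using jacobi_poly_locally_bounded[OF p ab] by blast
  let ?w = "\<lambda>k. (p + 2 * real k) / jacobi_eigenvalue p k"
  (* The eigenvalue vanishes for k = 0, so that this term is listed separately, in B0. *)
  define B1 where "B1 = (\<lambda>k. if k = 0 then 0 else ?w k * (jacobi_moment p k)\<^sup>2)"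
  define B2 where "B2 = (\<lambda>k. if k = 0 then 0 else K / jacobi_eigenvalue p k)"
  define B0 where "B0 = (\<lambda>k::nat. if k = 0 then \<bar>p * wint p (\<lambda>y. poly (jacobi_poly p 0) y * tail y)\<bar> else 0)"
  have l: "jacobi_eigenvalue p k > 0" if "k \<noteq> 0" for k using that jacobi_eigenvalue_pos[OF p, of k] by simp
  have w: "?w k > 0" if "k \<noteq> 0" for k using l[OF that] p by (simp add: add_pos_nonneg)
  have wm: "0 \<le> ?w k * (jacobi_moment p k)\<^sup>2" if "k \<noteq> 0" for k
    by (intro mult_nonneg_nonneg less_imp_le[OF w[OF that]]) simp
  have B1_nonneg: "0 \<le> B1 k" for k using wm[of k] by (auto simp: B1_def)
  have "summable B1"
  proof (rule summableI_nonneg_bounded[where x = "4 * K0\<^sup>2"])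
    show "0 \<le> B1 k" for k by (rule B1_nonneg)
    fix N
    have "(\<Sum>k<N. B1 k) \<le> (\<Sum>k\<in>{1..N}. B1 k)"
    proof -
      have "(\<Sum>k<N. B1 k) = (\<Sum>k\<in>{..<N} - {0}. B1 k)" by (intro sum.mono_neutral_right) (auto simp: B1_def)
      also have "\<dots> \<le> (\<Sum>k\<in>{1..N}. B1 k)"
        by (intro sum_mono2 B1_nonneg) auto
      finally show ?thesis .
    qed
    also have "\<dots> = (\<Sum>k=1..N. ?w k * (jacobi_moment p k)\<^sup>2)" by (intro sum.cong) (auto simp: B1_def)
    also have "\<dots> \<le> 4 * K0\<^sup>2" by (rule jacobi_moment_bessel[OF p])
    finally show "(\<Sum>k<N. B1 k) \<le> 4 * K0\<^sup>2" .
  qed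
  moreover have "summable B2"
  proof (rule summable_comparison_test')
    show "summable (\<lambda>k. K * inverse (real k ^ 2))"
      by (intro summable_mult inverse_power_summable) simp
    fix k :: nat assume "k \<ge> 0"
    show "norm (B2 k) \<le> K * inverse (real k ^ 2)"
    proof (cases "k = 0")
      case False
      have "real k ^ 2 \<le> jacobi_eigenvalue p k" using p by (simp add: jacobi_eigenvalue_def power2_eq_square algebra_simps)
      hence "K / jacobi_eigenvalue p k \<le> K / real k ^ 2" using K False by (intro divide_left_mono) (auto simp: l)
      thus ?thesis using False K l[OF False] by (simp add: B2_def divide_inverse)
    qed (simp add: B2_def)
  qed
  moreover have "summable B0" by (rule summable_finite[of "{0}"]) (auto simp: B0_def)
  ultimately have "summable (\<lambda>k. B0 k + (B1 k + B2 k))" by (intro summable_add)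
  moreover have "\<bar>(p + 2 * real k) * wint p (\<lambda>y. poly (jacobi_poly p k) y * tail y) * poly (jacobi_poly p k) x\<bar> \<le> B0 k + (B1 k + B2 k)"
    if x: "x \<in> {a..b}" for k x
  proof (cases "k = 0")
    case True
    thus ?thesis by (simp add: B0_def B1_def B2_def) (simp add: jacobi_poly_def)
  next
    case False
    let ?R = "poly (jacobi_poly p k) x" and ?m = "jacobi_moment p k"
    have "wint p (\<lambda>y. poly (jacobi_poly p k) y * tail y) = - ?m / jacobi_eigenvalue p k"
      unfolding wint_jacobi_tail[OF p] by (rule jacobi_coefficient_eq_moment[OF p]) (use False in simp)
    hence "\<bar>(p + 2 * real k) * wint p (\<lambda>y. poly (jacobi_poly p k) y * tail y) * ?R\<bar> = \<bar>?w k * (?m * ?R)\<bar>"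
      by (simp add: abs_mult)
    also have "\<dots> = ?w k * (\<bar>?m\<bar> * \<bar>?R\<bar>)" using w[OF False] by (simp only: abs_mult abs_of_pos)
    also have "\<dots> \<le> ?w k * (?m\<^sup>2 + ?R\<^sup>2)"
    proof (rule mult_left_mono)
      have "0 \<le> (\<bar>?m\<bar> - \<bar>?R\<bar>)\<^sup>2 + \<bar>?m\<bar> * \<bar>?R\<bar>" by simp
      thus "\<bar>?m\<bar> * \<bar>?R\<bar> \<le> ?m\<^sup>2 + ?R\<^sup>2" by (simp add: power2_eq_square algebra_simps)
    qed (use w[OF False] in simp)
    also have "\<dots> = ?w k * ?m\<^sup>2 + ((p + 2 * real k) * ?R\<^sup>2) / jacobi_eigenvalue p k"
      by (simp add: algebra_simps)
    also have "\<dots> \<le> B1 k + B2 k"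
      using False K(2)[OF x, of k] l[OF False] by (simp add: B1_def B2_def divide_right_mono)
    finally show ?thesis using False by (simp add: B0_def)
  qed
  ultimately show ?thesis by blast
qed

theorem jacobi_series_sums_tail:
  assumes p: "p > 0" and x: "0 < x" "x < 1"
  shows "(\<Sum>k. (p + 2 * real k) * wint p (\<lambda>y. poly (jacobi_poly p k) y * tail y) * poly (jacobi_poly p k) x) = tail x"
proof -
  let ?T = "\<lambda>k x. (p + 2 * real k) * wint p (\<lambda>y. poly (jacobi_poly p k) y * tail y) * poly (jacobi_poly p k) x"
  let ?a = "x / 2" and ?b = "(x + 1) / 2"
  have ab: "0 < ?a" "?a < ?b" "?b < 1" "?b \<le> 1" using x by auto
  obtain B where B: "summable B" "\<And>k x. x \<in> {?a..?b} \<Longrightarrow> \<bar>?T k x\<bar> \<le> B k"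
    using jacobi_series_majorant[OF p ab(1-3)] by blast
  have "uniform_limit {?a..?b} (\<lambda>N x. \<Sum>k<N. ?T k x) (\<lambda>x. \<Sum>k. ?T k x) sequentially"
    by (rule Weierstrass_m_test[OF _ B(1)]) (use B(2) in auto)
  hence "uniform_limit {?a..?b} (jacobi_partial_sum p tail) (\<lambda>x. \<Sum>k. ?T k x) sequentially"
    by (simp add: jacobi_partial_sum_def[abs_def])
  from jacobi_expansion_converges_to_function[OF p continuous_on_tail ab(1,2,4) this] show ?thesis
    using x by auto
qed

end

section \<open>Blocks of Legendre polynomials\<close>

text \<open>The primitive that vanishes at \<open>0\<close>.\<close>

definition pint :: "real poly \<Rightarrow> real poly" where
  "pint P = (\<Sum>i\<le>degree P. monom (coeff P i / (real i + 1)) (Suc i))"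

lemma pderiv_pint [simp]: "pderiv (pint P) = P"
proof (rule poly_eqI)
  fix j
  have "coeff (pint P) (Suc j) = (\<Sum>i\<le>degree P. if i = j then coeff P i / (real i + 1) else 0)"
    by (simp add: pint_def coeff_sum coeff_monom)
  also have "\<dots> = coeff P j / (real j + 1)" by (auto simp: coeff_eq_0)
  finally show "coeff (pderiv (pint P)) j = coeff P j" by (simp add: coeff_pderiv field_simps)
qed

lemma poly_pint_0 [simp]: "poly (pint P) 0 = 0"
  by (simp add: pint_def poly_sum poly_monom)

lemma poly_pint_1: "poly (pint P) 1 = jint 1 P"
  by (simp add: pint_def poly_sum poly_monom jint_def add.commute)

lemma has_integral_pint:
  assumes "0 \<le> x"
  shows "(poly P has_integral poly (pint P) x) {0..x}"
proof -
  have "(poly P has_integral poly (pint P) x - poly (pint P) 0) {0..x}"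
    by (rule fundamental_theorem_of_calculus[OF assms])
       (metis pderiv_pint poly_DERIV has_real_derivative_iff_has_vector_derivative has_vector_derivative_at_within)
  thus ?thesis by simp
qed

lemma poly_pint_mono:
  assumes "0 \<le> x" "\<And>y. y \<in> {0..x} \<Longrightarrow> poly P y \<le> poly Q y"
  shows "poly (pint P) x \<le> poly (pint Q) x"
  by (rule has_integral_le[OF has_integral_pint has_integral_pint]) (use assms in auto)

lemma jint_one_mono:
  assumes "\<And>y. y \<in> {0..1} \<Longrightarrow> poly P y \<le> poly Q y"
  shows "jint 1 P \<le> jint 1 Q"
  unfolding poly_pint_1[symmetric] by (rule poly_pint_mono) (use assms in auto)

lemma poly_pint_le_jint:
  assumes "x \<in> {0..1}" "\<And>y. y \<in> {0..1} \<Longrightarrow> 0 \<le> poly P y"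
  shows "poly (pint P) x \<le> jint 1 P"
  unfolding poly_pint_1[symmetric]
  by (rule DERIV_nonneg_imp_nondecreasing[of x 1 "poly (pint P)"])
     (use assms in \<open>auto intro!: exI[of _ "poly P _"] poly_DERIV[of "pint P", simplified]\<close>)

lemma jint_const: "jint p [:c:] = c / p"
  by (simp add: jint_def)

text \<open>For signs \<open>s\<close>, the kernel \<open>G\<close> is the primitive, vanishing at \<open>0\<close> and at \<open>1\<close>, of the signed Dirichlet kernel
  \<open>\<Sum> s\<^sub>k (2k + 1) R\<^sub>k\<close> over a dyadic block. By the Legendre equation \<open>(x (1 - x) R\<^sub>k')' = - \<lambda>\<^sub>k R\<^sub>k\<close> it has the form
  \<open>G = x (1 - x) V'\<close> with this polynomial \<open>V\<close>.\<close>

definition block_poly :: "(nat \<Rightarrow> real) \<Rightarrow> nat \<Rightarrow> real poly" where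
  "block_poly s K = (\<Sum>k\<in>{K..<2*K}. smult (- (s k * (1 + 2 * real k) / jacobi_eigenvalue 1 k)) (jacobi_poly 1 k))"

definition block_kernel :: "(nat \<Rightarrow> real) \<Rightarrow> nat \<Rightarrow> real poly" where
  "block_kernel s K = [:0, 1, -1:] * pderiv (block_poly s K)"

lemma pderiv_sum: "pderiv (sum f A) = (\<Sum>a\<in>A. pderiv (f a))"
  by (induction A rule: infinite_finite_induct) (auto simp: pderiv_add)

lemma pderiv_block_kernel:
  assumes "K \<ge> 1"
  shows "pderiv (block_kernel s K) = (\<Sum>k\<in>{K..<2*K}. smult (s k * (1 + 2 * real k)) (jacobi_poly 1 k))"
proof -
  have 1: "pderiv ([:0, 1, -1:] * pderiv (jacobi_poly 1 k)) = - smult (jacobi_eigenvalue 1 k) (jacobi_poly 1 k)" for k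
    using jacobi_poly_ode[of 1 k] unfolding pderiv_mult by (simp add: pderiv_pCons algebra_simps)
  have "block_kernel s K = (\<Sum>k\<in>{K..<2*K}. smult (- (s k * (1 + 2 * real k) / jacobi_eigenvalue 1 k)) ([:0, 1, -1:] * pderiv (jacobi_poly 1 k)))"
    unfolding block_kernel_def block_poly_def pderiv_sum sum_distrib_left pderiv_smult mult_smult_right ..
  hence "pderiv (block_kernel s K) = (\<Sum>k\<in>{K..<2*K}. smult (- (s k * (1 + 2 * real k) / jacobi_eigenvalue 1 k)) (- smult (jacobi_eigenvalue 1 k) (jacobi_poly 1 k)))"
    by (simp only: pderiv_sum pderiv_smult 1)
  also have "\<dots> = (\<Sum>k\<in>{K..<2*K}. smult (s k * (1 + 2 * real k)) (jacobi_poly 1 k))"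
  proof (intro sum.cong refl)
    fix k assume "k \<in> {K..<2*K}"
    hence "jacobi_eigenvalue 1 k \<noteq> 0" using assms by (simp add: jacobi_eigenvalue_def)
    thus "smult (- (s k * (1 + 2 * real k) / jacobi_eigenvalue 1 k)) (- smult (jacobi_eigenvalue 1 k) (jacobi_poly 1 k)) =
       smult (s k * (1 + 2 * real k)) (jacobi_poly 1 k)" by simp
  qed
  finally show ?thesis .
qed

text \<open>By orthogonality \<open>\<integral> x (1 - x) V'\<^sup>2 = \<Sum> s\<^sub>k\<^sup>2 (2k + 1) / \<lambda>\<^sub>k\<close> and \<open>\<integral> V\<^sup>2 = \<Sum> s\<^sub>k\<^sup>2 (2k + 1) / \<lambda>\<^sub>k\<^sup>2\<close>. A block has \<open>K\<close> terms, which are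
  at most \<open>2 / K\<close> and \<open>2 / K\<^sup>3\<close>.\<close>

lemma block_bounds:
  assumes K: "K \<ge> 1" and s: "\<And>k. \<bar>s k\<bar> \<le> 1"
  shows "jint 1 (block_kernel s K * block_kernel s K) \<le> 2"
    and "jint 1 (block_poly s K * block_poly s K) \<le> 2 / real K ^ 2"
proof -
  let ?S = "{K..<2*K}" and ?X = "[:0, 1, -1 :: real:]"
  let ?V = "block_poly s K"
  let ?v = "\<lambda>k. - (s k * (1 + 2 * real k) / jacobi_eigenvalue 1 k)"
  have l: "jacobi_eigenvalue 1 k = real k * (real k + 1)" for k by (simp add: jacobi_eigenvalue_def)
  have k1: "k \<ge> 1" if "k \<in> ?S" for k using that K by auto
  have s2: "(s k)\<^sup>2 \<le> 1" for k using s[of k] by (simp add: abs_square_le_1)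
  have V': "pderiv ?V = (\<Sum>k\<in>?S. smult (?v k) (pderiv (jacobi_poly 1 k)))"
    unfolding block_poly_def by (simp only: pderiv_sum pderiv_smult)
  have "jint 1 (?X * pderiv ?V * pderiv ?V) = (\<Sum>k\<in>?S. (?v k)\<^sup>2 * (jacobi_eigenvalue 1 k / (1 + 2 * real k)))"
    unfolding V' by (rule jint_bilinear_diagonal) (simp_all only: finite_atLeastLessThan jint_jacobi_pderiv_mult[OF zero_less_one])
  also have "\<dots> \<le> (\<Sum>k\<in>?S. 2 / real K)"
  proof (rule sum_mono)
    fix k assume k: "k \<in> ?S"
    hence kp: "real k > 0" using k1 by fastforce
    have "(?v k)\<^sup>2 * (jacobi_eigenvalue 1 k / (1 + 2 * real k)) = (s k)\<^sup>2 * ((1 + 2 * real k) / jacobi_eigenvalue 1 k)"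
    proof -
      have gen: "(- (a * b / c))\<^sup>2 * (c / b) = a\<^sup>2 * (b / c)" if "b \<noteq> 0" "c \<noteq> 0" for a b c :: real
        using that by (simp add: power2_eq_square)
      show ?thesis by (rule gen) (use kp in \<open>auto simp: l\<close>)
    qed
    also have "\<dots> \<le> 1 * ((1 + 2 * real k) / jacobi_eigenvalue 1 k)"
      using s2 kp by (intro mult_right_mono) (auto simp: l)
    also have "\<dots> \<le> (2 * (real k + 1)) / (real k * (real k + 1))"
      unfolding l mult_1 using kp by (intro divide_right_mono) auto
    also have "\<dots> = 2 / real k" by (rule mult_divide_mult_cancel_right) (use kp in simp)
    also have "\<dots> \<le> 2 / real K" using k K by (intro divide_left_mono) auto
    finally show "(?v k)\<^sup>2 * (jacobi_eigenvalue 1 k / (1 + 2 * real k)) \<le> 2 / real K" .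
  qed
  also have "\<dots> = 2" using K by simp
  finally have A: "jint 1 (?X * pderiv ?V * pderiv ?V) \<le> 2" .
  have "jint 1 (block_kernel s K * block_kernel s K) \<le> jint 1 (?X * pderiv ?V * pderiv ?V)"
  proof (rule jint_one_mono)
    fix y :: real assume y: "y \<in> {0..1}"
    have x: "0 \<le> y * (1 - y)" "y * (1 - y) \<le> 1" using y by (auto intro: mult_le_one)
    have "poly (block_kernel s K * block_kernel s K) y = (y * (1 - y)) * ((y * (1 - y)) * (poly (pderiv ?V) y)\<^sup>2)"
      by (simp add: block_kernel_def power2_eq_square algebra_simps)
    also have "\<dots> \<le> 1 * ((y * (1 - y)) * (poly (pderiv ?V) y)\<^sup>2)"
      using x by (intro mult_right_mono) auto
    also have "\<dots> = poly (?X * pderiv ?V * pderiv ?V) y" by (simp add: power2_eq_square algebra_simps)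
    finally show "poly (block_kernel s K * block_kernel s K) y \<le> poly (?X * pderiv ?V * pderiv ?V) y" .
  qed
  with A show "jint 1 (block_kernel s K * block_kernel s K) \<le> 2" by simp
  have "jint 1 (1 * ?V * ?V) = (\<Sum>k\<in>?S. (?v k)\<^sup>2 * (1 / (1 + 2 * real k)))"
    unfolding block_poly_def
    by (rule jint_bilinear_diagonal) (simp_all only: finite_atLeastLessThan mult_1_left jint_jacobi_poly_mult[OF zero_less_one])
  also have "\<dots> \<le> (\<Sum>k\<in>?S. 2 / real K ^ 3)"
  proof (rule sum_mono)
    fix k assume k: "k \<in> ?S"
    hence kp: "real k > 0" using k1 by fastforce
    have "(?v k)\<^sup>2 * (1 / (1 + 2 * real k)) = (s k)\<^sup>2 * ((1 + 2 * real k) / (jacobi_eigenvalue 1 k)\<^sup>2)"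
    proof -
      have gen: "(- (a * b / c))\<^sup>2 * (1 / b) = a\<^sup>2 * (b / c\<^sup>2)" if "b \<noteq> 0" "c \<noteq> 0" for a b c :: real
        using that by (simp add: power2_eq_square)
      show ?thesis by (rule gen) (use kp in \<open>auto simp: l\<close>)
    qed
    also have "\<dots> \<le> 1 * ((1 + 2 * real k) / (jacobi_eigenvalue 1 k)\<^sup>2)"
      using s2 kp by (intro mult_right_mono) (auto simp: l)
    also have "\<dots> \<le> 2 / real k ^ 3"
    proof -
      have "(1 + 2 * real k) / (jacobi_eigenvalue 1 k)\<^sup>2 \<le> (2 * (real k + 1)) / (jacobi_eigenvalue 1 k)\<^sup>2"
        by (intro divide_right_mono) auto
      also have "\<dots> = 2 / (real k ^ 2 * (real k + 1))"
      proof -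
        have gen: "(2 * c) / (a * c)\<^sup>2 = 2 / (a\<^sup>2 * c)" if "c \<noteq> 0" for a c :: real
          using that by (simp add: power2_eq_square)
        show ?thesis unfolding l by (rule gen) (use kp in simp)
      qed
      also have "\<dots> \<le> 2 / real k ^ 3"
      proof (rule frac_le)
        show "real k ^ 3 \<le> real k ^ 2 * (real k + 1)" by (simp add: power2_eq_square power3_eq_cube algebra_simps)
      qed (use kp in auto)
      finally show ?thesis by simp
    qed
    also have "\<dots> \<le> 2 / real K ^ 3" using k K by (intro divide_left_mono power_mono) auto
    finally show "(?v k)\<^sup>2 * (1 / (1 + 2 * real k)) \<le> 2 / real K ^ 3" .
  qed
  also have "\<dots> = 2 / real K ^ 2" using K by (simp add: power2_eq_square power3_eq_cube)
  finally show "jint 1 (?V * ?V) \<le> 2 / real K ^ 2" by simp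
qed

text \<open>Let \<open>D = \<integral>G\<close>. Integration by parts gives \<open>D = x (1 - x) V - \<integral> (1 - 2x) V\<close>, so that \<open>D\<close> is as small as \<open>V\<close> in the mean,
  \<open>\<integral>D\<^sup>2 = O(1 / K\<^sup>2)\<close>. A bound at every point follows from \<open>D\<^sup>2 = 2 \<integral> D G \<le> K \<integral>D\<^sup>2 + (1 / K) \<integral>G\<^sup>2\<close>.\<close>

lemma block_primitive_bound:
  assumes K: "K \<ge> 1" and s: "\<And>k. \<bar>s k\<bar> \<le> 1" and x: "x \<in> {0..1}"
  shows "(poly (pint (block_kernel s K)) x)\<^sup>2 \<le> 7 / real K"
proof -
  let ?G = "block_kernel s K" and ?V = "block_poly s K" and ?X = "[:0, 1, -1 :: real:]"
  let ?k = "real K"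
  have k: "?k \<ge> 1" using K by simp
  note G = block_bounds(1)[of K s, OF K s] and V = block_bounds(2)[of K s, OF K s]
  let ?E = "pint ([:1, -2:] * ?V)"
  have D: "pint ?G = ?X * ?V - ?E"
  proof -
    have "pderiv (pint ?G - (?X * ?V - ?E)) = 0"
      unfolding pderiv_diff pderiv_pint block_kernel_def pderiv_mult pderiv_pCons
      by (rule poly_eq_poly_eq_iff[THEN iffD1], rule ext) (simp add: algebra_simps)
    then obtain c where c: "pint ?G - (?X * ?V - ?E) = [:c:]"
      by (metis pderiv_eq_0_iff degree_eq_zeroE)
    have "poly (pint ?G - (?X * ?V - ?E)) 0 = 0" by simp
    hence "c = 0" unfolding c by simp
    thus ?thesis using c by simp
  qed
  (* Bounds the integral of |V| by Cauchy-Schwarz in the form |v| <= (K / 2) v^2 + 1 / (2 K). *)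
  have E: "\<bar>poly ?E y\<bar> \<le> 3 / (2 * ?k)" if y: "y \<in> {0..1}" for y
  proof -
    let ?Q = "smult (?k / 2) (?V * ?V) + [:1 / (2 * ?k):]"
    have Q0: "0 \<le> poly ?Q z" for z using k by simp
    have vb: "\<bar>v\<bar> \<le> ?k / 2 * (v * v) + 1 / (2 * ?k)" for v
    proof -
      have "0 \<le> (?k * \<bar>v\<bar> - 1)\<^sup>2 / (2 * ?k)" using k by simp
      also have "\<dots> = ?k / 2 * (\<bar>v\<bar> * \<bar>v\<bar>) + 1 / (2 * ?k) - \<bar>v\<bar>" using k by (simp add: power2_eq_square field_simps)
      finally show ?thesis by simp
    qed
    have ab: "\<bar>poly ([:1, -2:] * ?V) z\<bar> \<le> poly ?Q z" if "z \<in> {0..1}" for z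
    proof -
      have "\<bar>poly ([:1, -2:] * ?V) z\<bar> = \<bar>1 - 2 * z\<bar> * \<bar>poly ?V z\<bar>" by (simp add: abs_mult[symmetric] algebra_simps)
      also have "\<dots> \<le> 1 * \<bar>poly ?V z\<bar>" using that by (intro mult_right_mono) (auto simp: abs_if)
      also have "\<dots> \<le> poly ?Q z" using vb[of "poly ?V z"] by simp
      finally show ?thesis .
    qed
    have le: "poly (pint ?Q) y \<le> 3 / (2 * ?k)"
    proof -
      have "poly (pint ?Q) y \<le> jint 1 ?Q" by (rule poly_pint_le_jint[OF y]) (rule Q0)
      also have "\<dots> = ?k / 2 * jint 1 (?V * ?V) + 1 / (2 * ?k)" unfolding jint_add jint_smult jint_const by simp
      also have "\<dots> \<le> ?k / 2 * (2 / ?k ^ 2) + 1 / (2 * ?k)" using V k by (intro add_mono mult_left_mono) auto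
      also have "\<dots> = 3 / (2 * ?k)" using k by (simp add: power2_eq_square field_simps)
      finally show ?thesis .
    qed
    have "poly ?E y \<le> poly (pint ?Q) y"
    proof (rule poly_pint_mono)
      fix z assume "z \<in> {0..y}"
      hence "\<bar>poly ([:1, -2:] * ?V) z\<bar> \<le> poly ?Q z" using y by (intro ab) auto
      thus "poly ([:1, -2:] * ?V) z \<le> poly ?Q z" by linarith
    qed (use y in auto)
    moreover have "poly (pint (- ([:1, -2:] * ?V))) y \<le> poly (pint ?Q) y"
    proof (rule poly_pint_mono)
      fix z assume "z \<in> {0..y}"
      hence "\<bar>poly ([:1, -2:] * ?V) z\<bar> \<le> poly ?Q z" using y by (intro ab) auto
      thus "poly (- ([:1, -2:] * ?V)) z \<le> poly ?Q z" unfolding poly_minus by linarith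
    qed (use y in auto)
    moreover have "pint (- P) = - pint P" for P :: "real poly"
      by (simp add: pint_def minus_monom sum_negf[symmetric])
    ultimately show ?thesis using le by (simp only: poly_minus abs_le_iff) linarith
  qed
  have D2: "poly (pint ?G * pint ?G) y \<le> poly (smult (1/8) (?V * ?V) + [:9 / (2 * ?k ^ 2):]) y" if y: "y \<in> {0..1}" for y
  proof -
    have xy: "0 \<le> y * (1 - y)" "y * (1 - y) \<le> 1 / 4"
    proof -
      show "0 \<le> y * (1 - y)" using y by simp
      have "0 \<le> (y - 1/2)\<^sup>2" by simp
      thus "y * (1 - y) \<le> 1 / 4" by (simp add: power2_eq_square algebra_simps)
    qed
    define a where "a = y * (1 - y) * poly ?V y"
    define b where "b = poly ?E y"
    have N1: "poly (pint ?G) y = a - b" unfolding D a_def b_def by (simp add: algebra_simps)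
    have N2: "(a - b)\<^sup>2 \<le> 2 * a\<^sup>2 + 2 * b\<^sup>2"
    proof -
      have "0 \<le> (a + b)\<^sup>2" by simp
      thus ?thesis by (simp add: power2_eq_square algebra_simps)
    qed
    have N3: "a\<^sup>2 \<le> (1/16) * (poly ?V y)\<^sup>2"
    proof -
      have "(y * (1 - y))\<^sup>2 \<le> (1/4)\<^sup>2" using xy by (intro power_mono) auto
      hence "(y * (1 - y))\<^sup>2 * (poly ?V y)\<^sup>2 \<le> (1/16) * (poly ?V y)\<^sup>2" by (intro mult_right_mono) (auto simp: power2_eq_square)
      thus ?thesis by (simp add: a_def power_mult_distrib)
    qed
    have N4: "b\<^sup>2 \<le> 9 / (4 * ?k ^ 2)"
    proof -
      have "\<bar>b\<bar>\<^sup>2 \<le> (3 / (2 * ?k))\<^sup>2" unfolding b_def by (rule power_mono[OF E[OF y]]) simp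
      thus ?thesis by (simp add: power2_eq_square field_simps)
    qed
    have "2 * (9 / (4 * ?k ^ 2)) = 9 / (2 * ?k ^ 2)" by simp
    with N2 N3 N4 have "(poly (pint ?G) y)\<^sup>2 \<le> (1/8) * (poly ?V y)\<^sup>2 + 9 / (2 * ?k ^ 2)"
      unfolding N1 by linarith
    thus ?thesis by (simp add: power2_eq_square)
  qed
  have J: "jint 1 (pint ?G * pint ?G) \<le> 5 / ?k ^ 2"
  proof -
    have "jint 1 (pint ?G * pint ?G) \<le> jint 1 (smult (1/8) (?V * ?V) + [:9 / (2 * ?k ^ 2):])"
      by (rule jint_one_mono[OF D2])
    also have "\<dots> = 1/8 * jint 1 (?V * ?V) + 9 / (2 * ?k ^ 2)" unfolding jint_add jint_smult jint_const by simp
    also have "\<dots> \<le> 1/8 * (2 / ?k ^ 2) + 9 / (2 * ?k ^ 2)" using V by simp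
    also have "\<dots> \<le> 5 / ?k ^ 2" using k by (simp add: field_simps)
    finally show ?thesis .
  qed
  let ?D = "pint ?G"
  have dd: "?D * ?D = pint (smult 2 (?D * ?G))"
  proof -
    have "pderiv (?D * ?D - pint (smult 2 (?D * ?G))) = 0"
      unfolding pderiv_diff pderiv_pint pderiv_mult
      by (rule poly_eq_poly_eq_iff[THEN iffD1], rule ext) simp
    then obtain c where c: "?D * ?D - pint (smult 2 (?D * ?G)) = [:c:]"
      by (metis pderiv_eq_0_iff degree_eq_zeroE)
    have "poly (?D * ?D - pint (smult 2 (?D * ?G))) 0 = 0" by simp
    hence "c = 0" unfolding c by simp
    thus ?thesis using c by simp
  qed
  let ?Q = "smult ?k (?D * ?D) + smult (1 / ?k) (?G * ?G)"
  have "(poly ?D x)\<^sup>2 = poly (?D * ?D) x" by (simp add: power2_eq_square)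
  also have "\<dots> = poly (pint (smult 2 (?D * ?G))) x" by (rule arg_cong[OF dd])
  also have "\<dots> \<le> poly (pint ?Q) x"
  proof (rule poly_pint_mono)
    fix y assume "y \<in> {0..x}"
    have "0 \<le> (?k * poly ?D y - poly ?G y)\<^sup>2 / ?k" using k by simp
    also have "\<dots> = ?k * (poly ?D y * poly ?D y) + 1 / ?k * (poly ?G y * poly ?G y) - 2 * (poly ?D y * poly ?G y)"
      using k by (simp add: power2_eq_square field_simps)
    finally show "poly (smult 2 (?D * ?G)) y \<le> poly ?Q y" by simp
  qed (use x in auto)
  also have "\<dots> \<le> jint 1 ?Q" by (rule poly_pint_le_jint[OF x]) (use k in simp)
  also have "\<dots> = ?k * jint 1 (?D * ?D) + 1 / ?k * jint 1 (?G * ?G)" by (simp only: jint_add jint_smult)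
  also have "\<dots> \<le> ?k * (5 / ?k ^ 2) + 1 / ?k * 2" using J G k by (intro add_mono mult_left_mono) auto
  also have "\<dots> = 7 / ?k" using k by (simp add: power2_eq_square field_simps)
  finally show ?thesis .
qed

section \<open>Summability of the Legendre coefficients\<close>

text \<open>The value of \<open>\<integral>\<^sub>0\<^sup>c x powr (q - 1) * P x dx\<close>.\<close>

definition prim :: "real \<Rightarrow> real poly \<Rightarrow> real \<Rightarrow> real" where
  "prim q P c = (\<Sum>i\<le>degree P. coeff P i * (c powr (q + real i) / (q + real i)))"

lemma prim_altdef: "degree P \<le> n \<Longrightarrow> prim q P c = (\<Sum>i\<le>n. coeff P i * (c powr (q + real i) / (q + real i)))"
  unfolding prim_def by (rule sum.mono_neutral_left) (auto simp: coeff_eq_0)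

text \<open>The fundamental theorem of calculus for \<open>x powr (p - 1) * G x\<close>; the boundary term at \<open>0\<close> vanishes for \<open>p > 1\<close>.\<close>

lemma prim_by_parts:
  assumes p: "p > 1" and c: "c > 0"
  shows "prim p (pderiv G) c = c powr (p - 1) * poly G c - (p - 1) * prim (p - 1) G c"
proof -
  let ?n = "degree G"
  have nz: "p - 1 + real i \<noteq> 0" for i using p by (smt (verit) of_nat_0_le_iff)
  have pw: "c powr (p - 1 + real i) = c powr (p - 1) * c ^ i" for i
    using c by (simp add: powr_add powr_realpow)
  have dG: "degree (pderiv G) \<le> ?n" by (simp add: degree_pderiv)
  have "c powr (p - 1) * poly G c - (p - 1) * prim (p - 1) G c =
    (\<Sum>i\<le>?n. c powr (p - 1) * (coeff G i * c ^ i) - (p - 1) * (coeff G i * (c powr (p - 1 + real i) / (p - 1 + real i))))"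
    by (simp add: prim_def poly_altdef sum_distrib_left sum_subtractf)
  also have "\<dots> = (\<Sum>i\<le>?n. real i * coeff G i * (c powr (p - 1 + real i) / (p - 1 + real i)))"
  proof (intro sum.cong refl)
    fix i
    have gen: "w * (a * z) - (p - 1) * (a * ((w * z) / (p - 1 + r))) = r * a * ((w * z) / (p - 1 + r))"
      if "p - 1 + r \<noteq> 0" for w a z r :: real
      using that by (simp add: field_simps)
    show "c powr (p - 1) * (coeff G i * c ^ i) - (p - 1) * (coeff G i * (c powr (p - 1 + real i) / (p - 1 + real i))) =
      real i * coeff G i * (c powr (p - 1 + real i) / (p - 1 + real i))"
      unfolding pw by (rule gen[OF nz])
  qed
  also have "\<dots> = (\<Sum>i\<le>Suc ?n. real i * coeff G i * (c powr (p - 1 + real i) / (p - 1 + real i)))"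
    by (simp add: coeff_eq_0)
  also have "\<dots> = (\<Sum>i\<le>?n. real (Suc i) * coeff G (Suc i) * (c powr (p - 1 + real (Suc i)) / (p - 1 + real (Suc i))))"
    by (subst sum.atMost_Suc_shift) simp
  also have "\<dots> = prim p (pderiv G) c"
    unfolding prim_altdef[OF dG] by (intro sum.cong refl) (simp add: coeff_pderiv algebra_simps)
  finally show ?thesis ..
qed

lemma has_integral_prim:
  assumes q: "q > 0" and c: "c \<ge> 0"
  shows "((\<lambda>x. x powr (q - 1) * poly P x) has_integral prim q P c) {0..c}"
proof -
  have "((\<lambda>x. \<Sum>i\<le>degree P. coeff P i * x powr (q - 1 + real i)) has_integral
      (\<Sum>i\<le>degree P. coeff P i * (c powr (q - 1 + real i + 1) / (q - 1 + real i + 1)))) {0..c}"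
    by (intro has_integral_sum has_integral_mult_right has_integral_powr_from_0) (use q c in auto)
  also have "(\<Sum>i\<le>degree P. coeff P i * (c powr (q - 1 + real i + 1) / (q - 1 + real i + 1))) = prim q P c"
    by (simp add: prim_def algebra_simps)
  finally show ?thesis
  proof (rule has_integral_eq[rotated])
    fix x assume x: "x \<in> {0..c}"
    show "(\<Sum>i\<le>degree P. coeff P i * x powr (q - 1 + real i)) = x powr (q - 1) * poly P x"
    proof (cases "x = 0")
      case False
      thus ?thesis using x by (simp add: poly_altdef sum_distrib_left powr_add powr_realpow mult_ac)
    qed simp
  qed
qed

lemma prim_has_derivative:
  assumes q: "q > 0" and x: "x > 0"
  shows "(prim q P has_real_derivative x powr (q - 1) * poly P x) (at x)"
proof -
  have "((\<lambda>x. coeff P i * (x powr (q + real i) / (q + real i))) has_real_derivative x powr (q - 1) * (coeff P i * x ^ i)) (at x)" for i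
  proof -
    have nz: "q + real i \<noteq> 0" using q by (smt (verit) of_nat_0_le_iff)
    have "((\<lambda>x. coeff P i * (x powr (q + real i) / (q + real i))) has_real_derivative
       coeff P i * ((q + real i) * x powr (q + real i - 1) / (q + real i))) (at x)"
      by (intro DERIV_cmult DERIV_cdivide has_real_derivative_powr x)
    moreover have "x powr (q + real i - 1) = x powr (q - 1) * x ^ i"
      using x powr_add[of x "q - 1" "real i"] by (simp add: powr_realpow algebra_simps)
    ultimately show ?thesis using nz by (simp add: mult_ac)
  qed
  hence "((\<lambda>x. \<Sum>i\<le>degree P. coeff P i * (x powr (q + real i) / (q + real i))) has_real_derivative
     (\<Sum>i\<le>degree P. x powr (q - 1) * (coeff P i * x ^ i))) (at x)"
    by (intro DERIV_sum)
  thus ?thesis by (simp add: prim_def[abs_def] poly_altdef sum_distrib_left)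
qed

text \<open>Young's inequality; \<open>q > 1/2\<close> makes the square of the weight integrable at \<open>0\<close>.\<close>

lemma prim_near_zero:
  assumes q: "q > 1/2" and \<tau>: "0 < \<tau>" "\<tau> \<le> 1" and s: "s > 0"
  shows "\<bar>prim q G \<tau>\<bar> \<le> s * jint 1 (G * G) + \<tau> powr (2 * q - 1) / ((2 * q - 1) * s)"
proof -
  have I: "((\<lambda>x. x powr (2 * q - 2)) has_integral \<tau> powr (2 * q - 2 + 1) / (2 * q - 2 + 1)) {0..\<tau>}"
    using q \<tau> by (intro has_integral_powr_from_0) auto
  have J: "((\<lambda>x. s * poly (G * G) x + 1 / s * x powr (2 * q - 2)) has_integral
      s * poly (pint (G * G)) \<tau> + 1 / s * (\<tau> powr (2 * q - 2 + 1) / (2 * q - 2 + 1))) {0..\<tau>}"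
    by (intro has_integral_add has_integral_mult_right I has_integral_pint) (use \<tau> in simp)
  have H: "prim q P \<tau> \<le> s * poly (pint (G * G)) \<tau> + 1 / s * (\<tau> powr (2 * q - 2 + 1) / (2 * q - 2 + 1))"
    if P: "\<And>x. poly P x * poly P x = poly G x * poly G x" for P
  proof (rule has_integral_le[OF has_integral_prim J])
    fix x :: real
    have "0 \<le> (s * poly P x - x powr (q - 1))\<^sup>2 / s + x powr (q - 1) * poly P x \<or> x powr (q - 1) * poly P x < 0"
      using s by (cases "x powr (q - 1) * poly P x < 0") auto
    moreover have "s * (poly P x * poly P x) + 1 / s * (x powr (q - 1) * x powr (q - 1)) - x powr (q - 1) * poly P x
       = (s * poly P x - x powr (q - 1))\<^sup>2 / s + x powr (q - 1) * poly P x"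
      using s by (simp add: power2_eq_square field_simps)
    moreover have "0 \<le> s * (poly P x * poly P x) + 1 / s * (x powr (q - 1) * x powr (q - 1))" using s by simp
    ultimately have "x powr (q - 1) * poly P x \<le> s * (poly P x * poly P x) + 1 / s * (x powr (q - 1) * x powr (q - 1))"
      by linarith
    also have "x powr (q - 1) * x powr (q - 1) = x powr (2 * q - 2)" by (simp flip: powr_add)
    finally show "x powr (q - 1) * poly P x \<le> s * poly (G * G) x + 1 / s * x powr (2 * q - 2)" by (simp add: P)
  qed (use q \<tau> in auto)
  have neg: "prim q (- G) \<tau> = - prim q G \<tau>" by (simp add: prim_def sum_negf)
  have "\<bar>prim q G \<tau>\<bar> \<le> s * poly (pint (G * G)) \<tau> + 1 / s * (\<tau> powr (2 * q - 2 + 1) / (2 * q - 2 + 1))"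
    using H[of G] H[of "- G"] neg by simp
  also have "poly (pint (G * G)) \<tau> \<le> jint 1 (G * G)"
    by (rule poly_pint_le_jint) (use \<tau> in auto)
  finally show ?thesis using s by (simp add: mult_left_mono algebra_simps)
qed

lemma powr_le_powr_minus_abs:
  fixes x :: real
  assumes "0 < \<tau>" "\<tau> \<le> x" "x \<le> 1"
  shows "x powr a \<le> \<tau> powr (- \<bar>a\<bar>)"
proof -
  have "x powr a \<le> x powr (- \<bar>a\<bar>)" using assms by (intro powr_mono') auto
  also have "\<dots> \<le> \<tau> powr (- \<bar>a\<bar>)" using assms by (intro powr_mono2') auto
  finally show ?thesis .
qed

text \<open>Integration by parts: \<open>\<Phi>\<close> is the integral with the boundary term removed, and its derivative involves \<open>D\<close>, not \<open>G\<close>.\<close>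

lemma prim_away_from_zero:
  assumes q: "q > 0" and \<tau>: "0 < \<tau>" "\<tau> \<le> c" "c \<le> 1"
    and \<delta>: "\<And>x. x \<in> {0..1} \<Longrightarrow> \<bar>poly (pint G) x\<bar> \<le> \<delta>"
  shows "\<bar>prim q G c - prim q G \<tau>\<bar> \<le> \<delta> * (2 + \<bar>q - 1\<bar>) * \<tau> powr (- (\<bar>q - 1\<bar> + \<bar>q - 2\<bar>))"
proof -
  let ?D = "poly (pint G)"
  let ?t = "\<tau> powr (- (\<bar>q - 1\<bar> + \<bar>q - 2\<bar>))"
  have \<delta>0: "\<delta> \<ge> 0" using \<delta>[of 0] by simp
  have t1: "\<tau> powr (- \<bar>q - 1\<bar>) \<le> ?t" "\<tau> powr (- \<bar>q - 2\<bar>) \<le> ?t" using \<tau> by (auto intro!: powr_mono')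
  define \<Phi> where "\<Phi> = (\<lambda>x. prim q G x - x powr (q - 1) * ?D x)"
  have d: "(\<Phi> has_real_derivative - ((q - 1) * x powr (q - 2) * ?D x)) (at x)" if "x > 0" for x
  proof -
    have "(?D has_real_derivative poly G x) (at x)" using poly_DERIV[of "pint G" x] by simp
    from DERIV_diff[OF prim_has_derivative[OF q that] DERIV_mult[OF has_real_derivative_powr[OF that, of "q - 1"] this]]
    show ?thesis unfolding \<Phi>_def by (rule DERIV_cong) (simp add: algebra_simps)
  qed
  have bd: "\<bar>x powr (q - 1) * ?D x\<bar> \<le> \<delta> * ?t" if "\<tau> \<le> x" "x \<le> 1" for x
  proof -
    have "x powr (q - 1) \<le> ?t" using powr_le_powr_minus_abs[of \<tau> x "q - 1"] that \<tau> t1 by simp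
    hence "x powr (q - 1) * \<bar>?D x\<bar> \<le> ?t * \<delta>" using \<delta>[of x] that \<tau> by (intro mult_mono) auto
    thus ?thesis by (simp add: abs_mult mult.commute)
  qed
  have "norm (\<Phi> c - \<Phi> \<tau>) \<le> (\<delta> * \<bar>q - 1\<bar> * ?t) * norm (c - \<tau>)"
  proof (rule field_differentiable_bound[of "{\<tau>..c}"])
    fix x assume x: "x \<in> {\<tau>..c}"
    show "(\<Phi> has_field_derivative - ((q - 1) * x powr (q - 2) * ?D x)) (at x within {\<tau>..c})"
      by (rule has_field_derivative_at_within, rule d) (use x \<tau> in auto)
    have "x powr (q - 2) \<le> ?t" using powr_le_powr_minus_abs[of \<tau> x "q - 2"] x \<tau> t1 by simp
    hence "\<bar>q - 1\<bar> * x powr (q - 2) * \<bar>?D x\<bar> \<le> \<bar>q - 1\<bar> * ?t * \<delta>"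
      using \<delta>[of x] x \<tau> by (intro mult_mono) auto
    thus "norm (- ((q - 1) * x powr (q - 2) * ?D x)) \<le> \<delta> * \<bar>q - 1\<bar> * ?t"
      by (simp add: abs_mult mult_ac)
  qed (use \<tau> in auto)
  also have "\<dots> \<le> (\<delta> * \<bar>q - 1\<bar> * ?t) * 1" using \<tau> \<delta>0 by (intro mult_left_mono) auto
  finally have "\<bar>\<Phi> c - \<Phi> \<tau>\<bar> \<le> \<delta> * \<bar>q - 1\<bar> * ?t" by simp
  moreover have "\<bar>c powr (q - 1) * ?D c\<bar> \<le> \<delta> * ?t" "\<bar>\<tau> powr (q - 1) * ?D \<tau>\<bar> \<le> \<delta> * ?t"
    using bd \<tau> by auto
  ultimately have "\<bar>prim q G c - prim q G \<tau>\<bar> \<le> \<delta> * \<bar>q - 1\<bar> * ?t + \<delta> * ?t + \<delta> * ?t"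
    unfolding \<Phi>_def by linarith
  thus ?thesis by (simp add: algebra_simps)
qed

text \<open>The bounds for the blocks starting at powers of two form a geometric series.\<close>

lemma summable_of_dyadic_blocks:
  fixes a :: "nat \<Rightarrow> real"
  assumes nn: "\<And>k. a k \<ge> 0" and \<eta>: "\<eta> > 0" and A: "A \<ge> 0"
    and block: "\<And>K. K \<ge> 1 \<Longrightarrow> (\<Sum>k\<in>{K..<2*K}. a k) \<le> A * real K powr (- \<eta>)"
  shows "summable a"
proof (rule summableI_nonneg_bounded[OF nn])
  define r where "r = (2::real) powr (- \<eta>)"
  have r: "0 < r" "r < 1" using \<eta> by (auto simp: r_def powr_less_one)
  have dy: "(\<Sum>k<2 ^ n. a k) \<le> a 0 + A * (\<Sum>i<n. r ^ i)" for n
  proof (induction n)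
    case (Suc n)
    have "(\<Sum>k<2 ^ Suc n. a k) = (\<Sum>k<2 ^ n. a k) + (\<Sum>k\<in>{2^n..<2*2^n}. a k)"
      using sum.atLeastLessThan_concat[of 0 "2 ^ n" "2 * 2 ^ n" a] by (simp add: lessThan_atLeast0)
    also have "(\<Sum>k\<in>{2^n..<2*2^n}. a k) \<le> A * real (2 ^ n) powr (- \<eta>)" by (rule block) simp
    also have "real (2 ^ n) powr (- \<eta>) = r ^ n"
      by (simp add: r_def powr_realpow[symmetric] powr_powr mult.commute)
    finally show ?case using Suc.IH by (simp add: algebra_simps)
  qed simp
  fix N
  have "N < 2 ^ N" by (rule less_exp)
  hence "(\<Sum>k<N. a k) \<le> (\<Sum>k<2 ^ N. a k)" by (intro sum_mono2 nn) auto
  also have "\<dots> \<le> a 0 + A * (\<Sum>i<N. r ^ i)" by (rule dy)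
  also have "(\<Sum>i<N. r ^ i) \<le> (\<Sum>i. r ^ i)" by (rule sum_le_suminf) (use r in \<open>auto intro: summable_geometric\<close>)
  also have "\<dots> = 1 / (1 - r)" by (rule suminf_geometric) (use r in simp)
  finally show "(\<Sum>k<N. a k) \<le> a 0 + A * (1 / (1 - r))" using A by (simp add: mult_left_mono)
qed

text \<open>Take \<open>\<tau>\<close> proportional to \<open>K powr (- \<theta>)\<close> and \<open>s = \<tau> powr (e / 2)\<close>, which balances the last two summands.\<close>

lemma optimize_block_bound:
  fixes A e m t0 :: real
  assumes A: "A \<ge> 0" and e: "e > 0" and m: "m \<ge> 0" and t0: "0 < t0" "t0 \<le> 1/2"
  shows "\<exists>B\<ge>0. \<exists>\<eta>>0. \<forall>K x. K \<ge> (1::nat) \<longrightarrow>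
    (\<forall>\<tau> s. 0 < \<tau> \<longrightarrow> \<tau> \<le> t0 \<longrightarrow> s > 0 \<longrightarrow> x \<le> A * (real K powr (- 1/2) * \<tau> powr (- m) + s + \<tau> powr e / s)) \<longrightarrow>
    x \<le> B * real K powr (- \<eta>)"
proof -
  (* With this choice the factor tau powr (- m) costs at most K powr (1/4) of the gain K powr (- 1/2). *)
  define \<theta> where "\<theta> = 1 / (4 * (m + 1))"
  have \<theta>: "\<theta> > 0" "\<theta> * m \<le> 1/4" using m by (auto simp: \<theta>_def field_simps)
  define \<eta> where "\<eta> = min (1/4) (\<theta> * e / 2)"
  have \<eta>: "\<eta> > 0" using \<theta> e by (simp add: \<eta>_def)
  define B where "B = A * (t0 powr (- m) + 2)"
  have B: "B \<ge> 0" using A by (simp add: B_def)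
  have "x \<le> B * real K powr (- \<eta>)"
    if K: "K \<ge> (1::nat)" and x: "\<forall>\<tau> s. 0 < \<tau> \<longrightarrow> \<tau> \<le> t0 \<longrightarrow> s > 0 \<longrightarrow> x \<le> A * (real K powr (- 1/2) * \<tau> powr (- m) + s + \<tau> powr e / s)" for K x
  proof -
    have k: "real K \<ge> 1" using K by simp
    define \<tau> where "\<tau> = t0 * real K powr (- \<theta>)"
    have Kle: "real K powr (- \<theta>) \<le> 1" using powr_mono[of "- \<theta>" 0 "real K"] k \<theta> by simp
    have \<tau>: "\<tau> > 0" "\<tau> \<le> t0" using t0 k Kle by (auto simp: \<tau>_def mult_left_le)
    define s where "s = \<tau> powr (e / 2)"
    have s: "s > 0" using \<tau> by (simp add: s_def)
    have "\<tau> powr e / s = \<tau> powr (e - e / 2)" unfolding s_def by (rule powr_diff[symmetric])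
    hence se: "\<tau> powr e / s = s" by (simp add: s_def)
    have s_le: "s \<le> real K powr (- \<eta>)"
    proof -
      have "s = t0 powr (e / 2) * real K powr (- (\<theta> * e / 2))"
        unfolding s_def \<tau>_def using t0 k by (simp add: powr_mult powr_powr)
      also have "\<dots> \<le> 1 * real K powr (- \<eta>)"
        using t0 k e by (intro mult_mono powr_le1 powr_mono) (auto simp: \<eta>_def)
      finally show ?thesis by simp
    qed
    have first: "real K powr (- 1/2) * \<tau> powr (- m) \<le> t0 powr (- m) * real K powr (- \<eta>)"
    proof -
      have "real K powr (- 1/2) * \<tau> powr (- m) = t0 powr (- m) * (real K powr (- 1/2) * real K powr (\<theta> * m))"
        unfolding \<tau>_def using t0 k by (simp add: powr_mult powr_powr)
      also have "real K powr (- 1/2) * real K powr (\<theta> * m) = real K powr (- 1/2 + \<theta> * m)"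
        by (simp only: powr_add)
      also have "\<dots> \<le> real K powr (- \<eta>)"
      proof (rule powr_mono)
        have "\<eta> \<le> 1/4" by (simp add: \<eta>_def)
        thus "- 1/2 + \<theta> * m \<le> - \<eta>" using \<theta>(2) by linarith
      qed (use k in simp)
      finally show ?thesis by (simp add: mult_left_mono)
    qed
    have "x \<le> A * (real K powr (- 1/2) * \<tau> powr (- m) + s + \<tau> powr e / s)" using x \<tau> s by blast
    also have "\<dots> \<le> A * (t0 powr (- m) * real K powr (- \<eta>) + real K powr (- \<eta>) + real K powr (- \<eta>))"
      unfolding se using first s_le A by (intro mult_left_mono add_mono) auto
    also have "\<dots> = B * real K powr (- \<eta>)" by (simp add: B_def algebra_simps)
    finally show ?thesis .
  qed
  with B \<eta> show ?thesis by blast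
qed

text \<open>A law that, beyond square integrability, is regular enough to see cancellation: a function with small primitive \<open>D\<close> has a small
  expectation. The three summands come from the middle of the rays and, with Young's parameter \<open>s\<close>, from their
  ends.\<close>

locale oscillating_law = square_integrable_law M C a0 K0 for M :: "'a measure" and C a0 K0 +
  fixes p K1 \<epsilon> Mx :: real
  assumes p: "p > 3/2" and K1: "K1 \<ge> 0" and \<epsilon>: "\<epsilon> > 0" and Mx: "Mx \<ge> 0"
    and oscillation: "\<And>\<tau> s \<delta> \<Gamma> D g. 0 < \<tau> \<Longrightarrow> \<tau> \<le> 1/2 \<Longrightarrow> s > 0 \<Longrightarrow>
      (\<And>y. (D has_real_derivative g y) (at y)) \<Longrightarrow> continuous_on UNIV g \<Longrightarrow>
      (\<And>y. y \<in> {0..1} \<Longrightarrow> \<bar>D y\<bar> \<le> \<delta>) \<Longrightarrow> \<Gamma> \<ge> 0 \<Longrightarrow>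
      (\<integral>\<^sup>+y. indicator {0..1} y * ennreal ((g y)\<^sup>2) \<partial>lborel) \<le> ennreal \<Gamma> \<Longrightarrow>
      \<bar>\<integral>\<omega>. C \<omega> powr (p - 1) * g (C \<omega>) \<partial>M\<bar> \<le> K1 * (\<delta> * \<tau> powr (- Mx) + s * \<Gamma> + \<tau> powr \<epsilon> / s)"
begin

lemma p_pos: "p > 0" "p > 1" using p by auto

text \<open>The function of which the second series is the Legendre expansion.\<close>

definition wtail :: "real \<Rightarrow> real" where
  "wtail y = y powr (p - 1) * tail y"

lemma continuous_on_wtail: "continuous_on {0..1} wtail"
  unfolding wtail_def
  by (intro continuous_intros continuous_on_tail continuous_on_powr') (use p in auto)

lemma wint_one_wtail:
  "wint 1 (\<lambda>y. poly P y * wtail y) = (\<Sum>j\<le>degree P. coeff P j * (expectation (\<lambda>\<omega>. C \<omega> powr (p + real j)) / (p + real j)))"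
proof -
  have [measurable]: "tail \<in> borel_measurable borel"
    by (intro borel_measurable_continuous_onI continuous_on_tail)
  have "wint 1 (\<lambda>y. poly P y * wtail y) = (\<integral>x. indicator {0..1} x * (x powr (p - 1) * (poly P x * tail x)) \<partial>lborel)"
    unfolding wint_def wtail_def
  proof (rule integral_cong_AE)
    show "AE x in lborel. indicator {0..1} x * (x powr (1 - 1) * (poly P x * (x powr (p - 1) * tail x))) =
       indicator {0..1} x * (x powr (p - 1) * (poly P x * tail x))"
      using AE_lborel_singleton[of 0] by eventually_elim (auto simp: indicator_def)
  qed measurable
  thus ?thesis unfolding integral_powr_poly_tail[OF p_pos(1)] .
qed

lemma integrable_prim:
  assumes "q > 0"
  shows "integrable M (\<lambda>\<omega>. prim q P (C \<omega>))"
  unfolding prim_def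
proof (intro integrable_bounded_function)
  have "q + real i \<noteq> 0" for i using assms by (smt (verit) of_nat_0_le_iff)
  thus "continuous_on {a0..1} (\<lambda>c. \<Sum>i\<le>degree P. coeff P i * (c powr (q + real i) / (q + real i)))"
    using a0 by (intro continuous_intros) auto
qed measurable

text \<open>Fubini once more: integrating against the tail function is taking the expectation of the primitive at \<open>C\<close>.\<close>

lemma wint_one_wtail_prim:
  "wint 1 (\<lambda>y. poly P y * wtail y) = expectation (\<lambda>\<omega>. prim p P (C \<omega>))"
proof -
  have i: "integrable M (\<lambda>\<omega>. C \<omega> powr q)" for q
    by (rule integrable_bounded_function) (use a0 in \<open>auto intro!: continuous_intros\<close>)
  have "expectation (\<lambda>\<omega>. prim p P (C \<omega>)) = (\<Sum>j\<le>degree P. expectation (\<lambda>\<omega>. coeff P j * (C \<omega> powr (p + real j) / (p + real j))))"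
    unfolding prim_def by (intro Bochner_Integration.integral_sum integrable_mult_right) (auto intro!: i)
  also have "\<dots> = wint 1 (\<lambda>y. poly P y * wtail y)"
    unfolding wint_one_wtail by (intro sum.cong refl) simp
  finally show ?thesis ..
qed

text \<open>One more integration by parts, moving the derivative away from the signed Dirichlet kernel \<open>G'\<close>.\<close>

lemma block_sum_eq:
  assumes K: "K \<ge> 1"
  shows "(\<Sum>k\<in>{K..<2*K}. s k * ((1 + 2 * real k) * wint 1 (\<lambda>y. poly (jacobi_poly 1 k) y * wtail y))) =
    expectation (\<lambda>\<omega>. C \<omega> powr (p - 1) * poly (block_kernel s K) (C \<omega>)) - (p - 1) * expectation (\<lambda>\<omega>. prim (p - 1) (block_kernel s K) (C \<omega>))"
proof -
  let ?G = "block_kernel s K"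
  have c: "continuous_on {0..1} (\<lambda>y. poly P y * wtail y)" for P
    by (intro continuous_intros continuous_on_wtail)
  have "(\<Sum>k\<in>{K..<2*K}. s k * ((1 + 2 * real k) * wint 1 (\<lambda>y. poly (jacobi_poly 1 k) y * wtail y))) =
     wint 1 (\<lambda>y. \<Sum>k\<in>{K..<2*K}. (s k * (1 + 2 * real k)) * (poly (jacobi_poly 1 k) y * wtail y))"
    by (subst wint_sum) (auto intro!: continuous_intros c simp: wint_cmult mult.assoc)
  also have "\<dots> = wint 1 (\<lambda>y. poly (pderiv ?G) y * wtail y)"
    unfolding pderiv_block_kernel[OF K] by (simp add: poly_sum sum_distrib_right sum_distrib_left mult_ac)
  also have "\<dots> = expectation (\<lambda>\<omega>. prim p (pderiv ?G) (C \<omega>))" by (rule wint_one_wtail_prim)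
  also have "\<dots> = expectation (\<lambda>\<omega>. C \<omega> powr (p - 1) * poly ?G (C \<omega>) - (p - 1) * prim (p - 1) ?G (C \<omega>))"
  proof (rule integral_cong_AE)
    show "AE \<omega> in M. prim p (pderiv ?G) (C \<omega>) = C \<omega> powr (p - 1) * poly ?G (C \<omega>) - (p - 1) * prim (p - 1) ?G (C \<omega>)"
      using C_range by eventually_elim (rule prim_by_parts, use p_pos a0 in auto)
    show "(\<lambda>\<omega>. prim p (pderiv ?G) (C \<omega>)) \<in> borel_measurable M"
      by (rule borel_measurable_integrable[OF integrable_prim[OF p_pos(1)]])
    have "(\<lambda>\<omega>. prim (p - 1) ?G (C \<omega>)) \<in> borel_measurable M"
      by (rule borel_measurable_integrable[OF integrable_prim]) (use p in simp)
    thus "(\<lambda>\<omega>. C \<omega> powr (p - 1) * poly ?G (C \<omega>) - (p - 1) * prim (p - 1) ?G (C \<omega>)) \<in> borel_measurable M"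
      by measurable
  qed
  also have "\<dots> = expectation (\<lambda>\<omega>. C \<omega> powr (p - 1) * poly ?G (C \<omega>)) - (p - 1) * expectation (\<lambda>\<omega>. prim (p - 1) ?G (C \<omega>))"
  proof -
    have i1: "integrable M (\<lambda>\<omega>. C \<omega> powr (p - 1) * poly ?G (C \<omega>))"
      by (rule integrable_bounded_function) (use a0 in \<open>auto intro!: continuous_intros\<close>)
    have i2: "integrable M (\<lambda>\<omega>. prim (p - 1) ?G (C \<omega>))" by (rule integrable_prim) (use p in simp)
    show ?thesis using i1 i2 by simp
  qed
  finally show ?thesis .
qed

text \<open>With the signs of the coefficients, the sum of their absolute values is the linear expression of the preceding lemma. The first
  expectation is bounded by the cancellation in the law of \<open>C\<close>. The second integral is split at \<open>\<tau>\<close>: Young's inequality on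
  \<open>[0, \<tau>]\<close>, integration by parts on \<open>[\<tau>, C]\<close>.\<close>

lemma block_bound:
  "\<exists>A\<ge>0. \<exists>e>0. \<exists>m\<ge>0. \<forall>K\<ge>1. \<forall>\<tau> s. 0 < \<tau> \<longrightarrow> \<tau> \<le> min a0 (1/2) \<longrightarrow> s > 0 \<longrightarrow>
    (\<Sum>k\<in>{K..<2*K}. \<bar>(1 + 2 * real k) * wint 1 (\<lambda>y. poly (jacobi_poly 1 k) y * wtail y)\<bar>)
      \<le> A * (real K powr (- 1/2) * \<tau> powr (- m) + s + \<tau> powr e / s)"
proof -
  define q where "q = p - 1"
  have q: "q > 1/2" using p by (simp add: q_def)
  (* The weaker one of the two gains at the ends and the stronger one of the two losses. *)
  define e where "e = min \<epsilon> (2 * q - 1)"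
  define m where "m = max Mx (\<bar>q - 1\<bar> + \<bar>q - 2\<bar>)"
  have em: "e > 0" "m \<ge> 0" using q \<epsilon> Mx by (auto simp: e_def m_def le_max_iff_disj)
  define A where "A = K1 * 3 + q * (2 + 1 / (2 * q - 1) + 3 * (2 + \<bar>q - 1\<bar>))"
  have A: "A \<ge> 0" using K1 q by (auto simp: A_def intro!: add_nonneg_nonneg mult_nonneg_nonneg)
  have "(\<Sum>k\<in>{K..<2*K}. \<bar>(1 + 2 * real k) * wint 1 (\<lambda>y. poly (jacobi_poly 1 k) y * wtail y)\<bar>)
      \<le> A * (real K powr (- 1/2) * \<tau> powr (- m) + s + \<tau> powr e / s)"
    if K: "K \<ge> 1" and \<tau>: "0 < \<tau>" "\<tau> \<le> min a0 (1/2)" and s: "s > 0" for K \<tau> s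
  proof -
    define c where "c = (\<lambda>k. (1 + 2 * real k) * wint 1 (\<lambda>y. poly (jacobi_poly 1 k) y * wtail y))"
    define \<sigma> where "\<sigma> = (\<lambda>k. sgn (c k))"
    have \<sigma>: "\<bar>\<sigma> k\<bar> \<le> 1" for k by (simp add: \<sigma>_def sgn_if)
    let ?G = "block_kernel \<sigma> K"
    have k: "real K \<ge> 1" using K by simp
    define h where "h = real K powr (- 1/2)"
    define \<delta> where "\<delta> = 3 * h"
    have h: "h > 0" "h\<^sup>2 = 1 / real K"
    proof -
      show "h > 0" using k by (simp add: h_def)
      have "h\<^sup>2 = real K powr (- 1/2 + - 1/2)" by (simp only: h_def power2_eq_square powr_add)
      also have "\<dots> = 1 / real K" using k powr_minus_divide[of "real K" 1] by simp
      finally show "h\<^sup>2 = 1 / real K" .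
    qed
    have D: "\<bar>poly (pint ?G) x\<bar> \<le> \<delta>" if "x \<in> {0..1}" for x
    proof -
      have "(poly (pint ?G) x)\<^sup>2 \<le> 7 / real K" by (rule block_primitive_bound[OF K \<sigma> that])
      also have "\<dots> \<le> \<delta>\<^sup>2" using k by (simp add: \<delta>_def power_mult_distrib h(2) divide_right_mono)
      finally have "\<bar>poly (pint ?G) x\<bar>\<^sup>2 \<le> \<delta>\<^sup>2" by simp
      thus ?thesis by (rule power2_le_imp_le) (use h(1) in \<open>simp add: \<delta>_def\<close>)
    qed
    have G2: "jint 1 (?G * ?G) \<le> 2" by (rule block_bounds(1)[OF K \<sigma>])
    have L2: "(\<integral>\<^sup>+y. indicator {0..1} y * ennreal ((poly ?G y)\<^sup>2) \<partial>lborel) \<le> ennreal 2"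
    proof -
      have "(\<integral>\<^sup>+y. ennreal ((poly ?G y)\<^sup>2) * indicator {0..1} y \<partial>lborel) = ennreal (jint 1 (?G * ?G))"
      proof (rule nn_integral_has_integral_lebesgue')
        show "((\<lambda>y. (poly ?G y)\<^sup>2) has_integral jint 1 (?G * ?G)) {0..1}"
        proof -
          have "poly (?G * ?G) = (\<lambda>y. (poly ?G y)\<^sup>2)" by (simp add: fun_eq_iff power2_eq_square)
          thus ?thesis using has_integral_pint[of 1 "?G * ?G"] by (simp only: poly_pint_1 zero_le_one)
        qed
      qed simp
      thus ?thesis using ennreal_leI[OF G2] by (simp add: mult.commute)
    qed
    have o1: "\<bar>expectation (\<lambda>\<omega>. C \<omega> powr (p - 1) * poly ?G (C \<omega>))\<bar> \<le> K1 * (\<delta> * \<tau> powr (- Mx) + s * 2 + \<tau> powr \<epsilon> / s)"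
      by (rule oscillation[of \<tau> s "poly (pint ?G)"])
         (use \<tau> s D L2 poly_DERIV[of "pint ?G"] in \<open>auto intro!: continuous_intros\<close>)
    define b where "b = s * 2 + \<tau> powr (2 * q - 1) / ((2 * q - 1) * s) + \<delta> * (2 + \<bar>q - 1\<bar>) * \<tau> powr (- (\<bar>q - 1\<bar> + \<bar>q - 2\<bar>))"
    have pr: "\<bar>prim q ?G x\<bar> \<le> b" if x: "a0 \<le> x" "x \<le> 1" for x
    proof -
      have 1: "\<bar>prim q ?G x - prim q ?G \<tau>\<bar> \<le> \<delta> * (2 + \<bar>q - 1\<bar>) * \<tau> powr (- (\<bar>q - 1\<bar> + \<bar>q - 2\<bar>))"
        by (rule prim_away_from_zero) (use q \<tau> x D in auto)
      have 2: "\<bar>prim q ?G \<tau>\<bar> \<le> s * jint 1 (?G * ?G) + \<tau> powr (2 * q - 1) / ((2 * q - 1) * s)"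
        by (rule prim_near_zero) (use q \<tau> s in auto)
      have "s * jint 1 (?G * ?G) \<le> s * 2" using G2 s by (intro mult_left_mono) auto
      thus ?thesis using 1 2 unfolding b_def by linarith
    qed
    have o2: "\<bar>expectation (\<lambda>\<omega>. prim (p - 1) ?G (C \<omega>))\<bar> \<le> b"
    proof -
      have "\<bar>expectation (\<lambda>\<omega>. prim q ?G (C \<omega>))\<bar> \<le> expectation (\<lambda>\<omega>. \<bar>prim q ?G (C \<omega>)\<bar>)" by (rule integral_abs_bound)
      also have "\<dots> \<le> expectation (\<lambda>\<omega>. b)"
      proof (rule integral_mono_AE)
        show "integrable M (\<lambda>\<omega>. \<bar>prim q ?G (C \<omega>)\<bar>)" by (intro integrable_abs integrable_prim) (use q in simp)
        show "AE \<omega> in M. \<bar>prim q ?G (C \<omega>)\<bar> \<le> b" using C_range by eventually_elim (use pr in auto)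
      qed simp
      finally show ?thesis by (simp add: q_def prob_space)
    qed
    define T where "T = h * \<tau> powr (- m)"
    define E where "E = \<tau> powr e / s"
    have TE: "T \<ge> 0" "E \<ge> 0" using h s by (auto simp: T_def E_def)
    have t1: "\<tau> \<le> 1" using \<tau> by simp
    have TM: "\<delta> * \<tau> powr (- Mx) \<le> 3 * T" "\<delta> * \<tau> powr (- (\<bar>q - 1\<bar> + \<bar>q - 2\<bar>)) \<le> 3 * T"
    proof -
      have mm: "- m \<le> - Mx" "- m \<le> - (\<bar>q - 1\<bar> + \<bar>q - 2\<bar>)" unfolding m_def by linarith+
      have "\<tau> powr (- Mx) \<le> \<tau> powr (- m)" "\<tau> powr (- (\<bar>q - 1\<bar> + \<bar>q - 2\<bar>)) \<le> \<tau> powr (- m)"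
        using powr_mono'[OF mm(1), of \<tau>] powr_mono'[OF mm(2), of \<tau>] \<tau> t1 by simp_all
      thus "\<delta> * \<tau> powr (- Mx) \<le> 3 * T" "\<delta> * \<tau> powr (- (\<bar>q - 1\<bar> + \<bar>q - 2\<bar>)) \<le> 3 * T"
        using h by (auto simp: T_def \<delta>_def)
    qed
    have EM: "\<tau> powr \<epsilon> / s \<le> E" "\<tau> powr (2 * q - 1) / ((2 * q - 1) * s) \<le> 1 / (2 * q - 1) * E"
    proof -
      have a: "\<tau> powr \<epsilon> \<le> \<tau> powr e" "\<tau> powr (2 * q - 1) \<le> \<tau> powr e" using \<tau> t1 by (auto simp: e_def intro!: powr_mono')
      thus "\<tau> powr \<epsilon> / s \<le> E" using s by (simp add: E_def divide_right_mono)
      have "1 / (2 * q - 1) * (\<tau> powr (2 * q - 1) / s) \<le> 1 / (2 * q - 1) * E"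
        using a s q by (intro mult_left_mono) (auto simp: E_def divide_right_mono)
      thus "\<tau> powr (2 * q - 1) / ((2 * q - 1) * s) \<le> 1 / (2 * q - 1) * E" by simp
    qed
    define W where "W = T + s + E"
    have W: "T \<le> W" "s \<le> W" "E \<le> W" "W \<ge> 0" using TE s by (auto simp: W_def)
    have b1: "K1 * (\<delta> * \<tau> powr (- Mx) + s * 2 + \<tau> powr \<epsilon> / s) \<le> K1 * (3 * W)"
      using TM(1) EM(1) TE s K1 by (intro mult_left_mono) (auto simp: W_def)
    have b2: "b \<le> (2 + 1 / (2 * q - 1) + 3 * (2 + \<bar>q - 1\<bar>)) * W"
    proof -
      have "\<delta> * (2 + \<bar>q - 1\<bar>) * \<tau> powr (- (\<bar>q - 1\<bar> + \<bar>q - 2\<bar>)) = (2 + \<bar>q - 1\<bar>) * (\<delta> * \<tau> powr (- (\<bar>q - 1\<bar> + \<bar>q - 2\<bar>)))" by simp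
      also have "\<dots> \<le> (2 + \<bar>q - 1\<bar>) * (3 * W)" using TM(2) W by (intro mult_left_mono) auto
      also have "(2 + \<bar>q - 1\<bar>) * (3 * W) = (3 * (2 + \<bar>q - 1\<bar>)) * W" by (simp only: mult_ac)
      finally have x1: "\<delta> * (2 + \<bar>q - 1\<bar>) * \<tau> powr (- (\<bar>q - 1\<bar> + \<bar>q - 2\<bar>)) \<le> (3 * (2 + \<bar>q - 1\<bar>)) * W" .
      have x2: "1 / (2 * q - 1) * E \<le> 1 / (2 * q - 1) * W" using W q by (intro mult_left_mono) auto
      have "b \<le> 2 * W + 1 / (2 * q - 1) * W + (3 * (2 + \<bar>q - 1\<bar>)) * W"
        unfolding b_def using x1 x2 EM(2) W(2) by linarith
      thus ?thesis by (simp only: distrib_right)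
    qed
    have "(\<Sum>k\<in>{K..<2*K}. \<bar>c k\<bar>) = (\<Sum>k\<in>{K..<2*K}. \<sigma> k * c k)"
      by (intro sum.cong refl) (simp add: \<sigma>_def abs_sgn mult.commute)
    also have "\<dots> = expectation (\<lambda>\<omega>. C \<omega> powr (p - 1) * poly ?G (C \<omega>)) - q * expectation (\<lambda>\<omega>. prim (p - 1) ?G (C \<omega>))"
      unfolding c_def q_def by (rule block_sum_eq[OF K])
    also have "\<dots> \<le> K1 * (3 * W) + q * ((2 + 1 / (2 * q - 1) + 3 * (2 + \<bar>q - 1\<bar>)) * W)"
    proof -
      have "- (q * expectation (\<lambda>\<omega>. prim (p - 1) ?G (C \<omega>))) \<le> q * b"
      proof -
        have "q * (- expectation (\<lambda>\<omega>. prim (p - 1) ?G (C \<omega>))) \<le> q * b" using o2 q by (intro mult_left_mono) auto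
        thus ?thesis by simp
      qed
      also have "q * b \<le> q * ((2 + 1 / (2 * q - 1) + 3 * (2 + \<bar>q - 1\<bar>)) * W)" using b2 q by (intro mult_left_mono) auto
      finally show ?thesis using o1 b1 by linarith
    qed
    also have "\<dots> = A * W" by (simp add: A_def algebra_simps)
    finally show ?thesis unfolding W_def T_def E_def h_def c_def .
  qed
  with A em show ?thesis by blast
qed

lemma summable_legendre_coefficients:
  "summable (\<lambda>k. \<bar>(1 + 2 * real k) * wint 1 (\<lambda>y. poly (jacobi_poly 1 k) y * wtail y)\<bar>)"
proof -
  obtain A e m where A: "A \<ge> 0" "e > 0" "m \<ge> 0" and b: "\<And>K \<tau> s. K \<ge> 1 \<Longrightarrow> 0 < \<tau> \<Longrightarrow> \<tau> \<le> min a0 (1/2) \<Longrightarrow> s > 0 \<Longrightarrow>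
    (\<Sum>k\<in>{K..<2*K}. \<bar>(1 + 2 * real k) * wint 1 (\<lambda>y. poly (jacobi_poly 1 k) y * wtail y)\<bar>)
      \<le> A * (real K powr (- 1/2) * \<tau> powr (- m) + s + \<tau> powr e / s)"
    using block_bound by blast
  have t0: "0 < min a0 (1/2)" "min a0 (1/2) \<le> 1/2" using a0 by auto
  obtain B \<eta> where B: "B \<ge> 0" "\<eta> > 0" and *: "\<And>K x. K \<ge> (1::nat) \<Longrightarrow>
    (\<forall>\<tau> s. 0 < \<tau> \<longrightarrow> \<tau> \<le> min a0 (1/2) \<longrightarrow> s > 0 \<longrightarrow> x \<le> A * (real K powr (- 1/2) * \<tau> powr (- m) + s + \<tau> powr e / s)) \<Longrightarrow>
    x \<le> B * real K powr (- \<eta>)"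
    using optimize_block_bound[OF A t0] by blast
  show ?thesis
    by (rule summable_of_dyadic_blocks[OF _ B(2,1)], simp, rule *) (use b in auto)
qed

lemma legendre_series_majorant:
  assumes "x \<in> {0..1}"
  shows "\<bar>(1 + 2 * real k) * wint 1 (\<lambda>y. poly (jacobi_poly 1 k) y * wtail y) * poly (jacobi_poly 1 k) x\<bar>
     \<le> \<bar>(1 + 2 * real k) * wint 1 (\<lambda>y. poly (jacobi_poly 1 k) y * wtail y)\<bar>"
  unfolding abs_mult[of _ "poly (jacobi_poly 1 k) x"]
  by (rule mult_left_le[OF jacobi_poly_one_bounded[OF assms]]) simp

text \<open>In contrast to the Jacobi series, the majorant holds up to the endpoint \<open>1\<close>.\<close>

theorem legendre_series_sums_wtail:
  assumes x: "0 < x" "x \<le> 1"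
  shows "(\<Sum>k. (1 + 2 * real k) * wint 1 (\<lambda>y. poly (jacobi_poly 1 k) y * wtail y) * poly (jacobi_poly 1 k) x) = wtail x"
proof -
  let ?T = "\<lambda>k x. (1 + 2 * real k) * wint 1 (\<lambda>y. poly (jacobi_poly 1 k) y * wtail y) * poly (jacobi_poly 1 k) x"
  let ?a = "x / 2"
  have ab: "0 < ?a" "?a < 1" "(1::real) \<le> 1" using x by auto
  have "uniform_limit {?a..1} (\<lambda>N x. \<Sum>k<N. ?T k x) (\<lambda>x. \<Sum>k. ?T k x) sequentially"
    by (rule Weierstrass_m_test[OF _ summable_legendre_coefficients])
       (unfold real_norm_def, rule legendre_series_majorant, use x in auto)
  hence "uniform_limit {?a..1} (jacobi_partial_sum 1 wtail) (\<lambda>x. \<Sum>k. ?T k x) sequentially"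
    by (simp add: jacobi_partial_sum_def[abs_def])
  from jacobi_expansion_converges_to_function[OF zero_less_one continuous_on_wtail ab this] show ?thesis
    using x by auto
qed

end

section \<open>The ratio of a gamma sample\<close>

lemma series_unif_abs_convergent_onI:
  assumes B: "summable B" and le: "\<And>k u. u \<in> S \<Longrightarrow> \<bar>f k u\<bar> \<le> B k"
  shows "series_unif_abs_convergent_on S f"
proof -
  have "uniform_limit S (\<lambda>N u. \<Sum>k<N. f k u) (\<lambda>u. \<Sum>k. f k u) sequentially"
    by (rule Weierstrass_m_test[OF _ B]) (use le in auto)
  moreover have "summable (\<lambda>k. \<bar>f k u\<bar>)" if "u \<in> S" for u
    by (rule summable_comparison_test'[OF B, of 0]) (use le[OF that] in auto)
  ultimately show ?thesis
    unfolding series_unif_abs_convergent_on_def uniformly_convergent_on_def by blast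
qed

lemma nn_integral_scale_argument:
  fixes f :: "real \<Rightarrow> ennreal"
  assumes [measurable]: "f \<in> borel_measurable borel" and b: "b > 0"
  shows "(\<integral>\<^sup>+y. f (y / b) \<partial>lborel) = ennreal b * (\<integral>\<^sup>+x. f x \<partial>lborel)"
  using b by (subst nn_integral_real_affine[where c = b and t = 0]) auto

text \<open>The sizes \<open>n \<ge> 3\<close> and \<open>\<alpha> (n - 1) > 1/2\<close> are the two parts of the condition on \<open>n\<close>; the exponent \<open>\<beta> = \<alpha> (n - 1)\<close> is that of
  the density along the rays.\<close>

locale gamma_sample = prob_space M for M :: "'a measure" +
  fixes X :: "nat \<Rightarrow> 'a \<Rightarrow> real" and \<alpha> :: real and n :: nat and U C :: "'a \<Rightarrow> real"
  assumes \<alpha>: "\<alpha> > 0" and n3: "n \<ge> 3" and \<beta>: "\<alpha> * (real n - 1) > 1/2"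
    and indep: "indep_vars (\<lambda>_. borel) X {1..n}"
    and dist: "\<And>i. i \<in> {1..n} \<Longrightarrow> distributed M lborel (X i) (\<lambda>x. ennreal (gamma_density \<alpha> x))"
    and U: "\<And>\<omega>. U \<omega> = sqrt (\<Sum>i=1..n. (X i \<omega>)\<^sup>2) / (\<Sum>i=1..n. X i \<omega>)"
    and C: "\<And>\<omega>. C \<omega> = 1 / (sqrt (real n) * U \<omega>)"
begin

definition sample :: "'a \<Rightarrow> nat \<Rightarrow> real" where
  "sample \<omega> = (\<lambda>i\<in>{1..n}. X i \<omega>)"

lemma X_measurable: "i \<in> {1..n} \<Longrightarrow> X i \<in> borel_measurable M"
  using distributed_measurable[OF dist] by simp

lemma sample_measurable [measurable]: "sample \<in> M \<rightarrow>\<^sub>M PiM {1..n} (\<lambda>_. borel)"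
  unfolding sample_def[abs_def] by (rule measurable_restrict) (rule X_measurable)

lemma distr_sample: "distr M (PiM {1..n} (\<lambda>_. borel)) sample = PiM {1..n} (\<lambda>_. gamma_measure \<alpha>)"
proof -
  have ne: "{1..n} \<noteq> {}" using n3 by simp
  have "distr M (PiM {1..n} (\<lambda>_. borel)) (\<lambda>\<omega>. \<lambda>i\<in>{1..n}. X i \<omega>) = PiM {1..n} (\<lambda>i. distr M borel (X i))"
    using indep_vars_iff_distr_eq_PiM'[OF ne, where M' = "\<lambda>_. borel" and X = X] X_measurable indep by blast
  also have "\<dots> = PiM {1..n} (\<lambda>_. gamma_measure \<alpha>)"
  proof (rule PiM_cong[OF refl])
    fix i assume i: "i \<in> {1..n}"
    have "distr M borel (X i) = distr M lborel (X i)" by (rule distr_cong) auto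
    also have "\<dots> = gamma_measure \<alpha>" unfolding gamma_measure_def by (rule distributed_distr_eq_density[OF dist[OF i]])
    finally show "distr M borel (X i) = gamma_measure \<alpha>" .
  qed
  finally show ?thesis by (simp add: sample_def[abs_def])
qed

lemma AE_X_pos: "AE \<omega> in M. \<forall>i\<in>{1..n}. X i \<omega> > 0"
proof -
  have "AE x in distr M (PiM {1..n} (\<lambda>_. borel)) sample. \<forall>i\<in>{1..n}. x i > 0"
    unfolding distr_sample by (rule AE_PiM_gamma_pos[OF _ \<alpha>]) simp
  from AE_distrD[OF sample_measurable this] show ?thesis by (simp add: sample_def)
qed

abbreviation rn :: real where "rn \<equiv> sqrt (real n)"

lemma rn: "rn > 1" "rn > 0" using n3 by auto

lemma C_eq_norm_ratio: "C \<omega> = norm_ratio {1..n} (sample \<omega>) / rn"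
proof -
  have "norm_ratio {1..n} (sample \<omega>) = (\<Sum>i=1..n. X i \<omega>) / sqrt (\<Sum>i=1..n. (X i \<omega>)\<^sup>2)"
    unfolding norm_ratio_def sample_def by simp
  thus ?thesis by (simp add: C U)
qed

lemma C_measurable [measurable]: "C \<in> borel_measurable M"
  unfolding C_eq_norm_ratio[abs_def] by measurable

lemma U_measurable [measurable]: "U \<in> borel_measurable M"
  unfolding U[abs_def] using X_measurable by measurable

lemma AE_C_range: "AE \<omega> in M. 1 / rn \<le> C \<omega> \<and> C \<omega> \<le> 1"
  using AE_X_pos
proof eventually_elim
  case (elim \<omega>)
  have "1 \<le> norm_ratio {1..n} (sample \<omega>)" "norm_ratio {1..n} (sample \<omega>) \<le> sqrt (card {1..n})"
    using norm_ratio_bounds[of "{1..n}" "sample \<omega>"] elim n3 by (auto simp: sample_def)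
  thus ?case using rn by (simp add: C_eq_norm_ratio divide_simps)
qed

lemma nn_integral_C:
  assumes [measurable]: "\<phi> \<in> borel_measurable borel"
  shows "(\<integral>\<^sup>+\<omega>. \<phi> (C \<omega>) \<partial>M) = (\<integral>\<^sup>+x. \<phi> (norm_ratio {1..n} x / rn) \<partial>PiM {1..n} (\<lambda>_. gamma_measure \<alpha>))"
proof -
  have "(\<lambda>x. \<phi> (norm_ratio {1..n} x / rn)) \<in> borel_measurable (distr M (PiM {1..n} (\<lambda>_. borel)) sample)" by measurable
  from nn_integral_distr[OF sample_measurable this] show ?thesis
    unfolding distr_sample[symmetric] C_eq_norm_ratio by (rule sym)
qed

lemma integral_C:
  fixes \<phi> :: "real \<Rightarrow> real"
  assumes [measurable]: "\<phi> \<in> borel_measurable borel"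
  shows "(\<integral>\<omega>. \<phi> (C \<omega>) \<partial>M) = (\<integral>x. \<phi> (norm_ratio {1..n} x / rn) \<partial>PiM {1..n} (\<lambda>_. gamma_measure \<alpha>))"
proof -
  have "(\<lambda>x. \<phi> (norm_ratio {1..n} x / rn)) \<in> borel_measurable (PiM {1..n} (\<lambda>_. borel))" by measurable
  from integral_distr[OF sample_measurable this] show ?thesis
    unfolding distr_sample[symmetric] C_eq_norm_ratio by (rule sym)
qed

lemma square_integrable: "\<exists>K0. square_integrable_law M C (1 / rn) K0"
proof -
  have card: "card {1..n} \<ge> 3" "\<alpha> * (real (card {1..n}) - 1) > 1/2" using n3 \<beta> by auto
  obtain K where K: "K \<ge> 0" and *: "\<And>s \<phi>. s > 0 \<Longrightarrow> \<phi> \<in> borel_measurable borel \<Longrightarrow> (\<forall>x. \<phi> x \<ge> (0::real)) \<Longrightarrow>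
     (\<integral>\<^sup>+x. ennreal (\<phi> (norm_ratio {1..n} x)) \<partial>PiM {1..n} (\<lambda>_. gamma_measure \<alpha>)) \<le>
     ennreal K * (ennreal s * (\<integral>\<^sup>+x. ennreal ((\<phi> x)\<^sup>2) \<partial>lborel) + ennreal (1 / s))"
    using norm_ratio_law_L2_bound[OF _ card(1) \<alpha> card(2)] by auto
  have "square_integrable_law M C (1 / rn) (K * rn)"
  proof
    show "C \<in> borel_measurable M" by measurable
    show "0 < 1 / rn" "1 / rn < 1" using rn by auto
    show "AE \<omega> in M. 1 / rn \<le> C \<omega> \<and> C \<omega> \<le> 1" by (rule AE_C_range)
    show "K * rn \<ge> 0" using K rn by simp
    fix s :: real and \<phi> :: "real \<Rightarrow> real"
    assume s: "s > 0" and [measurable]: "\<phi> \<in> borel_measurable borel" and nn: "\<And>x. \<phi> x \<ge> 0"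
    let ?I = "\<integral>\<^sup>+x. ennreal ((\<phi> x)\<^sup>2) \<partial>lborel"
    have "(\<integral>\<^sup>+\<omega>. ennreal (\<phi> (C \<omega>)) \<partial>M) = (\<integral>\<^sup>+x. ennreal (\<phi> (norm_ratio {1..n} x / rn)) \<partial>PiM {1..n} (\<lambda>_. gamma_measure \<alpha>))"
      by (rule nn_integral_C) measurable
    also have "\<dots> \<le> ennreal K * (ennreal s * (\<integral>\<^sup>+y. ennreal ((\<phi> (y / rn))\<^sup>2) \<partial>lborel) + ennreal (1 / s))"
      by (rule *[of s "\<lambda>y. \<phi> (y / rn)"]) (use s nn in auto)
    also have "(\<integral>\<^sup>+y. ennreal ((\<phi> (y / rn))\<^sup>2) \<partial>lborel) = ennreal rn * ?I"
      by (rule nn_integral_scale_argument[OF _ rn(2)]) measurable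
    also have "ennreal K * (ennreal s * (ennreal rn * ?I) + ennreal (1 / s)) \<le> ennreal K * (ennreal s * (ennreal rn * ?I) + ennreal rn * ennreal (1 / s))"
    proof (intro mult_left_mono add_left_mono)
      have "1 * ennreal (1 / s) \<le> ennreal rn * ennreal (1 / s)"
        using rn(1) by (intro mult_right_mono) (auto simp: ennreal_1[symmetric] simp del: ennreal_1)
      thus "ennreal (1 / s) \<le> ennreal rn * ennreal (1 / s)" by simp
    qed auto
    also have "\<dots> = ennreal (K * rn) * (ennreal s * ?I + ennreal (1 / s))"
      using K rn by (simp add: ennreal_mult distrib_left mult_ac)
    finally show "(\<integral>\<^sup>+\<omega>. ennreal (\<phi> (C \<omega>)) \<partial>M) \<le> ennreal (K * rn) * (ennreal s * ?I + ennreal (1 / s))" .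
  qed
  thus ?thesis by blast
qed

text \<open>The estimate for the ratio, whose range is \<open>[1, \<surd>n]\<close>, is rescaled to \<open>C\<close>; the primitive of \<open>g (y / \<surd>n)\<close> is
  \<open>\<surd>n D (y / \<surd>n)\<close>.\<close>

lemma oscillating:
  assumes p: "\<alpha> * real n > 3/2" and K0: "square_integrable_law M C (1 / rn) K0"
  shows "\<exists>K1 \<epsilon> Mx. oscillating_law M C (1 / rn) K0 (\<alpha> * real n) K1 \<epsilon> Mx"
proof -
  let ?P = "PiM {1..n} (\<lambda>_. gamma_measure \<alpha>)"
  let ?r = "norm_ratio {1..n}"
  define p where "p = \<alpha> * real n"
  have card: "card {1..n} \<ge> 3" "\<alpha> * (real (card {1..n}) - 1) > 1/2" using n3 \<beta> by auto
  obtain K \<epsilon> Mx where K: "K \<ge> 0" "\<epsilon> > 0" "Mx \<ge> 0" and *: "\<And>\<tau> s \<delta> \<Gamma> D g. 0 < \<tau> \<Longrightarrow> \<tau> \<le> 1/2 \<Longrightarrow> s > 0 \<Longrightarrow> oscillation_data rn \<delta> \<Gamma> D g \<Longrightarrow>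
    \<bar>\<integral>x. ?r x powr (p - 1) * g (?r x) \<partial>?P\<bar> \<le> K * (\<delta> * \<tau> powr (- Mx) + s * \<Gamma> + \<tau> powr \<epsilon> / s)"
    using norm_ratio_law_oscillation[OF _ card(1) \<alpha> card(2)] unfolding p_def by auto
  define c where "c = (1 / rn) powr (p - 1)"
  have c: "c \<ge> 0" by (simp add: c_def)
  define K1 where "K1 = c * K * rn"
  have K1: "K1 \<ge> 0" using c K rn by (simp add: K1_def)
  interpret square_integrable_law M C "1 / rn" K0 by fact
  have "oscillating_law M C (1 / rn) K0 p K1 \<epsilon> Mx"
  proof
    show "p > 3/2" using p by (simp add: p_def)
    show "K1 \<ge> 0" "\<epsilon> > 0" "Mx \<ge> 0" using K1 K by auto
    fix \<tau> s \<delta> \<Gamma> :: real and D g :: "real \<Rightarrow> real"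
    assume \<tau>: "0 < \<tau>" "\<tau> \<le> 1/2" and s: "s > 0" and D: "\<And>y. (D has_real_derivative g y) (at y)"
      and g: "continuous_on UNIV g" and \<delta>: "\<And>y. y \<in> {0..1} \<Longrightarrow> \<bar>D y\<bar> \<le> \<delta>" and \<Gamma>: "\<Gamma> \<ge> 0"
      and g2: "(\<integral>\<^sup>+y. indicator {0..1} y * ennreal ((g y)\<^sup>2) \<partial>lborel) \<le> ennreal \<Gamma>"
    have [measurable]: "g \<in> borel_measurable borel" using g by (intro borel_measurable_continuous_onI)
    have \<delta>0: "\<delta> \<ge> 0" using \<delta>[of 0] by simp
    have data: "oscillation_data rn (rn * \<delta>) (rn * \<Gamma>) (\<lambda>y. rn * D (y / rn)) (\<lambda>y. g (y / rn))"
      unfolding oscillation_data_def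
    proof (intro conjI allI ballI)
      fix y
      have d: "((\<lambda>y. y / rn) has_real_derivative 1 / rn) (at y)" by (rule DERIV_cdivide[OF DERIV_ident])
      have cancel: "b * (z * (1 / b)) = z" if "b \<noteq> 0" for b z :: real using that by simp
      show "((\<lambda>y. rn * D (y / rn)) has_real_derivative g (y / rn)) (at y)"
        by (rule DERIV_cong[OF DERIV_cmult[OF DERIV_chain2[OF D d]] cancel]) (use rn in simp)
    next
      show "continuous_on UNIV (\<lambda>y. g (y / rn))"
        by (rule continuous_on_compose2[OF g]) (use rn in \<open>auto intro!: continuous_intros\<close>)
    next
      fix y assume "y \<in> {1..rn}"
      hence "\<bar>D (y / rn)\<bar> \<le> \<delta>" using rn by (intro \<delta>) (auto simp: divide_simps)
      thus "\<bar>rn * D (y / rn)\<bar> \<le> rn * \<delta>" using rn by (simp add: abs_mult)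
    next
      show "0 \<le> rn * \<Gamma>" using rn \<Gamma> by simp
    next
      have "(\<integral>\<^sup>+y. indicator {1..rn} y * ennreal ((g (y / rn))\<^sup>2) \<partial>lborel) \<le> (\<integral>\<^sup>+y. indicator {0..1} (y / rn) * ennreal ((g (y / rn))\<^sup>2) \<partial>lborel)"
        using rn by (intro nn_integral_mono mult_right_mono) (auto simp: indicator_def divide_simps)
      also have "\<dots> = ennreal rn * (\<integral>\<^sup>+y. indicator {0..1} y * ennreal ((g y)\<^sup>2) \<partial>lborel)"
        by (rule nn_integral_scale_argument[OF _ rn(2)]) measurable
      also have "\<dots> \<le> ennreal rn * ennreal \<Gamma>" by (intro mult_left_mono g2) auto
      finally show "(\<integral>\<^sup>+y. indicator {1..rn} y * ennreal ((g (y / rn))\<^sup>2) \<partial>lborel) \<le> ennreal (rn * \<Gamma>)"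
        using rn \<Gamma> by (simp add: ennreal_mult)
    qed
    have "(\<integral>\<omega>. C \<omega> powr (p - 1) * g (C \<omega>) \<partial>M) = (\<integral>x. (?r x / rn) powr (p - 1) * g (?r x / rn) \<partial>?P)"
      by (rule integral_C) measurable
    also have "\<dots> = (\<integral>x. c * (?r x powr (p - 1) * g (?r x / rn)) \<partial>?P)"
      unfolding c_def by (intro Bochner_Integration.integral_cong refl) (simp add: powr_divide)
    also have "\<dots> = c * (\<integral>x. ?r x powr (p - 1) * g (?r x / rn) \<partial>?P)"
      by (rule integral_mult_right_zero)
    finally have eq: "(\<integral>\<omega>. C \<omega> powr (p - 1) * g (C \<omega>) \<partial>M) = c * (\<integral>x. ?r x powr (p - 1) * g (?r x / rn) \<partial>?P)" .
    have "\<bar>\<integral>\<omega>. C \<omega> powr (p - 1) * g (C \<omega>) \<partial>M\<bar> = c * \<bar>\<integral>x. ?r x powr (p - 1) * g (?r x / rn) \<partial>?P\<bar>"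
      unfolding eq using c by (simp add: abs_mult)
    also have "\<dots> \<le> c * (K * (rn * \<delta> * \<tau> powr (- Mx) + s * (rn * \<Gamma>) + \<tau> powr \<epsilon> / s))"
      by (rule mult_left_mono[OF *[OF \<tau> s data] c])
    also have "\<dots> \<le> c * (K * (rn * (\<delta> * \<tau> powr (- Mx) + s * \<Gamma> + \<tau> powr \<epsilon> / s)))"
    proof (intro mult_left_mono c K)
      have "1 * (\<tau> powr \<epsilon> / s) \<le> rn * (\<tau> powr \<epsilon> / s)" using rn s by (intro mult_right_mono) auto
      thus "rn * \<delta> * \<tau> powr (- Mx) + s * (rn * \<Gamma>) + \<tau> powr \<epsilon> / s \<le> rn * (\<delta> * \<tau> powr (- Mx) + s * \<Gamma> + \<tau> powr \<epsilon> / s)"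
        by (simp add: algebra_simps)
    qed
    also have "\<dots> = K1 * (\<delta> * \<tau> powr (- Mx) + s * \<Gamma> + \<tau> powr \<epsilon> / s)" by (simp add: K1_def)
    finally show "\<bar>\<integral>\<omega>. C \<omega> powr (p - 1) * g (C \<omega>) \<partial>M\<bar> \<le> K1 * (\<delta> * \<tau> powr (- Mx) + s * \<Gamma> + \<tau> powr \<epsilon> / s)" .
  qed
  thus ?thesis unfolding p_def by blast
qed

text \<open>Solving the inequality for \<open>C\<close> requires \<open>U > 0\<close>, which holds almost surely.\<close>

lemma cdf_U_eq_tail:
  assumes u: "u > 0"
  shows "cdf (distr M borel U) u = prob {\<omega> \<in> space M. 1 / (rn * u) \<le> C \<omega>}"
proof -
  have "cdf (distr M borel U) u = prob (U -` {..u} \<inter> space M)"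
    unfolding cdf_def by (rule measure_distr) auto
  also have "\<dots> = prob {\<omega> \<in> space M. 1 / (rn * u) \<le> C \<omega>}"
  proof (rule measure_eq_AE)
    show "AE \<omega> in M. \<omega> \<in> U -` {..u} \<inter> space M \<longleftrightarrow> \<omega> \<in> {\<omega> \<in> space M. 1 / (rn * u) \<le> C \<omega>}"
      using AE_C_range AE_space
    proof eventually_elim
      case (elim \<omega>)
      hence "C \<omega> > 0" using rn by (meson divide_pos_pos less_le_trans zero_less_one)
      hence Upos: "U \<omega> > 0" using rn by (simp add: C zero_less_mult_iff)
      have "1 / (rn * u) \<le> C \<omega> \<longleftrightarrow> U \<omega> \<le> u"
        unfolding C using u Upos rn by (simp add: divide_simps)
      thus ?case using elim by auto
    qed
  qed measurable
  finally show ?thesis .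
qed

end

lemma sample_size_conditions:
  assumes \<alpha>: "\<alpha> > 0" and n: "real n > Max {2, 1 + 1 / (2 * \<alpha>)}"
  shows "n \<ge> 3" "\<alpha> * (real n - 1) > 1/2"
proof -
  have "real n > 2" "real n > 1 + 1 / (2 * \<alpha>)" using n by auto
  thus "n \<ge> 3" by simp
  have "\<alpha> * (1 / (2 * \<alpha>)) < \<alpha> * (real n - 1)" using \<open>real n > 1 + 1 / (2 * \<alpha>)\<close> \<alpha> by (intro mult_strict_left_mono) auto
  thus "\<alpha> * (real n - 1) > 1/2" using \<alpha> by simp
qed

theorem theorem1:
  fixes M :: "'a measure" and X :: "nat \<Rightarrow> 'a \<Rightarrow> real" and \<alpha> :: real and n :: nat
    and U C :: "'a \<Rightarrow> real" and F\<^sub>U :: "real \<Rightarrow> real" and \<gamma> :: "nat \<Rightarrow> real"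
  assumes "prob_space M"
    and "\<alpha> > 0"
    and "n \<ge> 2"
    and "prob_space.indep_vars M (\<lambda>_. borel) X {1..n}"
    and "\<And>i. i \<in> {1..n} \<Longrightarrow> distributed M lborel (X i) (\<lambda>x. ennreal (gamma_density \<alpha> x))"
    and "\<And>\<omega>. U \<omega> = sqrt (\<Sum>i=1..n. (X i \<omega>)\<^sup>2) / (\<Sum>i=1..n. X i \<omega>)"
    and "\<And>\<omega>. C \<omega> = 1 / (sqrt (real n) * U \<omega>)"
    and "F\<^sub>U = cdf (distr M borel U)"
    and "\<And>j. \<gamma> j = (\<integral>\<omega>. C \<omega> powr (\<alpha> * real n + real j) \<partial>M)"
  shows
    "(real n > Max {2, 1 + 1 / (2 * \<alpha>)} \<longrightarrow>
       (\<forall>u. 1 / sqrt (real n) < u \<and> u < 1 \<longrightarrow>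
          F\<^sub>U u = (\<Sum>k. jacobi_coeff (\<alpha> * real n) \<gamma> k *
                     jacobi_G k (\<alpha> * real n) (\<alpha> * real n) (1 / (sqrt (real n) * u)))) \<and>
       (\<forall>a b. 1 / sqrt (real n) < a \<and> a \<le> b \<and> b < 1 \<longrightarrow>
          series_unif_abs_convergent_on {a..b}
            (\<lambda>k u. jacobi_coeff (\<alpha> * real n) \<gamma> k *
               jacobi_G k (\<alpha> * real n) (\<alpha> * real n) (1 / (sqrt (real n) * u)))))
     \<and>
     (real n > Max {2, 1 + 1 / (2 * \<alpha>), 3 / (2 * \<alpha>)} \<longrightarrow>
       (\<forall>u. 1 / sqrt (real n) \<le> u \<and> u \<le> 1 \<longrightarrow>
          F\<^sub>U u = (sqrt (real n) * u) powr (\<alpha> * real n - 1) *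
                  (\<Sum>k. legendre_coeff (\<alpha> * real n) \<gamma> k *
                     shifted_legendre k (1 / (sqrt (real n) * u)))) \<and>
       series_unif_abs_convergent_on {1 / sqrt (real n)..1}
         (\<lambda>k u. legendre_coeff (\<alpha> * real n) \<gamma> k *
            shifted_legendre k (1 / (sqrt (real n) * u))))"
proof -
  interpret prob_space M by fact
  let ?p = "\<alpha> * real n"
  let ?x = "\<lambda>u. 1 / (sqrt (real n) * u)"
  have rn0: "sqrt (real n) > 1" using assms(3) by simp
  have p: "?p > 0" using assms(2,3) by simp
  have sample: "gamma_sample M X \<alpha> n U C" if "real n > Max {2, 1 + 1 / (2 * \<alpha>)}"
    by unfold_locales (use assms(2,4-7) sample_size_conditions[OF assms(2) that] in auto)
  show ?thesis
  proof (intro conjI impI allI)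
    fix u assume n: "real n > Max {2, 1 + 1 / (2 * \<alpha>)}" and u: "1 / sqrt (real n) < u \<and> u < 1"
    interpret gamma_sample M X \<alpha> n U C by (rule sample[OF n])
    obtain K0 where "square_integrable_law M C (1 / rn) K0" using square_integrable by blast
    then interpret L: square_integrable_law M C "1 / rn" K0 .
    have u0: "u > 0" using u rn0 by (meson divide_pos_pos less_trans zero_less_one)
    have x: "0 < ?x u" "?x u < 1" using u u0 rn0 by (auto simp: divide_simps mult.commute)
    have "F\<^sub>U u = L.tail (?x u)" unfolding assms(8) cdf_U_eq_tail[OF u0] L.tail_def ..
    also have "\<dots> = (\<Sum>k. (?p + 2 * real k) * wint ?p (\<lambda>y. poly (jacobi_poly ?p k) y * L.tail y) * poly (jacobi_poly ?p k) (?x u))"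
      by (rule L.jacobi_series_sums_tail[OF p x, symmetric])
    finally show "F\<^sub>U u = (\<Sum>k. jacobi_coeff ?p \<gamma> k * jacobi_G k ?p ?p (?x u))"
      unfolding jacobi_series_term[OF p] L.wint_jacobi_tail[OF p] assms(9) .
  next
    fix a b assume n: "real n > Max {2, 1 + 1 / (2 * \<alpha>)}" and ab: "1 / sqrt (real n) < a \<and> a \<le> b \<and> b < 1"
    interpret gamma_sample M X \<alpha> n U C by (rule sample[OF n])
    obtain K0 where "square_integrable_law M C (1 / rn) K0" using square_integrable by blast
    then interpret L: square_integrable_law M C "1 / rn" K0 .
    have a0: "a > 0" using ab rn0 by (meson divide_pos_pos less_trans zero_less_one)
    (* Half the smallest argument, so that the interval is nondegenerate even if a = b. *)
    define lo where "lo = ?x b / 2"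
    define hi where "hi = ?x a"
    have xb: "0 < ?x b" using ab a0 rn0 by auto
    have mono: "?x b \<le> ?x u" "?x u \<le> ?x a" if "u \<in> {a..b}" for u
      using that a0 ab rn0 by (auto intro!: divide_left_mono mult_pos_pos)
    have lohi: "0 < lo" "lo < hi" "hi < 1"
      using xb mono[of a] ab a0 rn0 by (auto simp: lo_def hi_def divide_simps mult.commute)
    obtain B where B: "summable B" "\<And>k x. x \<in> {lo..hi} \<Longrightarrow>
       \<bar>(?p + 2 * real k) * wint ?p (\<lambda>y. poly (jacobi_poly ?p k) y * L.tail y) * poly (jacobi_poly ?p k) x\<bar> \<le> B k"
      using L.jacobi_series_majorant[OF p lohi] by blast
    show "series_unif_abs_convergent_on {a..b} (\<lambda>k u. jacobi_coeff ?p \<gamma> k * jacobi_G k ?p ?p (?x u))"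
    proof (rule series_unif_abs_convergent_onI[OF B(1)])
      fix k u assume u: "u \<in> {a..b}"
      have half: "y / 2 \<le> x" if "y \<le> x" "0 < y" for x y :: real using that by linarith
      have "?x u \<in> {lo..hi}"
        unfolding lo_def hi_def atLeastAtMost_iff by (intro conjI half mono[OF u] xb)
      from B(2)[OF this] show "\<bar>jacobi_coeff ?p \<gamma> k * jacobi_G k ?p ?p (?x u)\<bar> \<le> B k"
        unfolding jacobi_series_term[OF p] L.wint_jacobi_tail[OF p] assms(9) .
    qed
  next
    assume n: "real n > Max {2, 1 + 1 / (2 * \<alpha>), 3 / (2 * \<alpha>)}"
    hence n1: "real n > Max {2, 1 + 1 / (2 * \<alpha>)}" by auto
    have p32: "?p > 3/2" using n assms(2) by (simp add: field_simps)
    interpret gamma_sample M X \<alpha> n U C by (rule sample[OF n1])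
    obtain K0 where K0: "square_integrable_law M C (1 / rn) K0" using square_integrable by blast
    obtain K1 \<epsilon> Mx where "oscillating_law M C (1 / rn) K0 ?p K1 \<epsilon> Mx" using oscillating[OF p32 K0] by blast
    then interpret L: oscillating_law M C "1 / rn" K0 ?p K1 \<epsilon> Mx .
    have coeff: "(\<Sum>j\<le>k. coeff (jacobi_poly 1 k) j * (\<gamma> j / (?p + real j))) = wint 1 (\<lambda>y. poly (jacobi_poly 1 k) y * L.wtail y)" for k
      unfolding L.wint_one_wtail assms(9)
      by (rule sum.mono_neutral_right) (use degree_jacobi_poly_le in \<open>auto simp: coeff_eq_0\<close>)
    have xr: "0 < ?x u" "?x u \<le> 1" "u > 0" if "1 / sqrt (real n) \<le> u" for u
    proof -
      show u: "u > 0" using that rn0 by (meson divide_pos_pos less_le_trans less_trans zero_less_one)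
      thus "0 < ?x u" "?x u \<le> 1" using that rn0 by (auto simp: divide_simps mult.commute)
    qed
    {
      fix u assume u: "1 / sqrt (real n) \<le> u \<and> u \<le> 1"
      note x = xr[OF u[THEN conjunct1]]
      have "(\<Sum>k. legendre_coeff ?p \<gamma> k * shifted_legendre k (?x u)) = L.wtail (?x u)"
        unfolding legendre_series_term coeff by (rule L.legendre_series_sums_wtail[OF x(1,2)])
      also have "\<dots> = ?x u powr (?p - 1) * F\<^sub>U u"
        unfolding assms(8) cdf_U_eq_tail[OF x(3)] L.wtail_def L.tail_def ..
      finally have "(sqrt (real n) * u) powr (?p - 1) * (\<Sum>k. legendre_coeff ?p \<gamma> k * shifted_legendre k (?x u)) =
         ((sqrt (real n) * u) powr (?p - 1) * ?x u powr (?p - 1)) * F\<^sub>U u" by (simp only: mult.assoc)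
      also have "(sqrt (real n) * u) powr (?p - 1) * ?x u powr (?p - 1) = ((sqrt (real n) * u) * ?x u) powr (?p - 1)"
        by (simp only: powr_mult)
      also have "(sqrt (real n) * u) * ?x u = 1" using x rn0 by simp
      finally show "F\<^sub>U u = (sqrt (real n) * u) powr (?p - 1) * (\<Sum>k. legendre_coeff ?p \<gamma> k * shifted_legendre k (?x u))"
        by simp
    }
    show "series_unif_abs_convergent_on {1 / sqrt (real n)..1} (\<lambda>k u. legendre_coeff ?p \<gamma> k * shifted_legendre k (?x u))"
    proof (rule series_unif_abs_convergent_onI[OF L.summable_legendre_coefficients])
      fix k u assume "u \<in> {1 / sqrt (real n)..1}"
      hence "?x u \<in> {0..1}" using xr[of u] by auto
      from L.legendre_series_majorant[OF this]
      show "\<bar>legendre_coeff ?p \<gamma> k * shifted_legendre k (?x u)\<bar> \<le> \<bar>(1 + 2 * real k) * wint 1 (\<lambda>y. poly (jacobi_poly 1 k) y * L.wtail y)\<bar>"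
        unfolding legendre_series_term coeff .
    qed
  qed
qed

end
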